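(* Let $G$ be a compact, connected, semisimple Lie group, let $\sigma$ be an involutive inner automorphism of $G$, and let $z\in G$ be such that $\sigma(a)=zaz^{-1}$ for all $a\in G$. Let $N=G\times G$ be endowed with $g=g_G\oplus g_G$ and $H=H_G\oplus H_G$, let $G\times G$ act on $N$ by $(g_1,g_2)\cdot(x_1,x_2)=(g_1x_1g_2^{-1},g_1x_2g_2^{-1})$, and let $M\subset N$ be the orbit through $p=(e,z)$, so that $M\cong (G\times G)/C_{\mathrm{diag}}$ with $C=G^\sigma$ the centralizer of $z$ in $G$ and $C_{\mathrm{diag}}=\{(a,a)\mid a\in C\}$. Let $\overline g$ and $\overline H$ be the pull-backs of $g$ and $H$ to $M$, and let $\overline\nabla$ be the Bismut connection on $M$ induced by $(\overline g,\overline H)$. Then the torsion $\overline H$ is not parallel with respect to $\overline\nabla$.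
   Context: An involutive automorphism is an automorphism $\sigma\ne\mathrm{Id}$ with $\sigma^2=\mathrm{Id}$. $B$ denotes the Cartan-Killing form of the Lie algebra $\mathfrak g$ of $G$, $g_G$ the bi-invariant metric on $G$ induced by $-B$, and $H_G$ the bi-invariant $3$-form with $H_G(X,Y,Z)=g_G([X,Y],Z)$ for left-invariant vector fields $X,Y,Z$. The Bismut connection induced by a pair $(g,H)$ of a Riemannian metric and a $3$-form is the metric connection $\nabla$ with $g(\nabla_XY,Z)=g(\nabla^g_XY,Z)+\frac12H(X,Y,Z)$, where $\nabla^g$ is the Levi-Civita connection of $g$. *)

theory Defs
  imports
    "HOL-Analysis.Analysis"
    "HOL-Algebra.Group_Action"
    "HOL-Library.Function_Algebras"
begin

section \<open>Real-valued functions and fields as real vector spaces\<close>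

instantiation "fun" :: (type, scaleR) scaleR
begin
definition scaleR_fun_def: "r *\<^sub>R f = (\<lambda>x. r *\<^sub>R f x)"
instance ..
end

instance "fun" :: (type, real_vector) real_vector
  by standard (simp_all add: scaleR_fun_def plus_fun_def fun_eq_iff scaleR_add_right scaleR_add_left)

text \<open>
  The trace of an endomorphism of a finite-dimensional subspace \<open>V\<close>; it does not depend on the
  chosen basis.
\<close>
definition trace_on :: "'v::real_vector set \<Rightarrow> ('v \<Rightarrow> 'v) \<Rightarrow> real" where
  "trace_on V L =
     (let b = (SOME b. independent b \<and> span b = V) in \<Sum>x\<in>b. representation b (L x) x)"


section \<open>Smooth manifolds\<close>

text \<open>These two notions are meant for open sets \<open>S\<close>.\<close>
primrec Ck_on :: "nat \<Rightarrow> ('a::real_normed_vector \<Rightarrow> 'b::real_normed_vector) \<Rightarrow> 'a set \<Rightarrow> bool" where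
  "Ck_on 0 f S \<longleftrightarrow> continuous_on S f"
| "Ck_on (Suc k) f S \<longleftrightarrow>
     f differentiable_on S \<and> (\<forall>v. Ck_on k (\<lambda>x. frechet_derivative f (at x) v) S)"

definition smooth_on :: "('a::real_normed_vector \<Rightarrow> 'b::real_normed_vector) \<Rightarrow> 'a set \<Rightarrow> bool" where
  "smooth_on f S \<longleftrightarrow> (\<forall>k. Ck_on k f S)"

text \<open>
  A chart is a pair \<open>(U, \<phi>)\<close> of an open set and a homeomorphism of it onto an open subset of the
  model space \<open>'e\<close>; the values of \<open>\<phi>\<close> outside \<open>U\<close> are irrelevant.
\<close>
type_synonym ('a, 'e) atlas = "('a set \<times> ('a \<Rightarrow> 'e)) set"

definition smooth_manifold :: "'a topology \<Rightarrow> ('a, 'e::euclidean_space) atlas \<Rightarrow> bool" where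
  "smooth_manifold T A \<longleftrightarrow>
     Hausdorff_space T \<and> second_countable T \<and>
     (\<forall>(U, \<phi>)\<in>A. openin T U \<and> open (\<phi> ` U) \<and>
        homeomorphic_map (subtopology T U) (top_of_set (\<phi> ` U)) \<phi>) \<and>
     (\<Union>(U, \<phi>)\<in>A. U) = topspace T \<and>
     (\<forall>(U, \<phi>)\<in>A. \<forall>(V, \<psi>)\<in>A. smooth_on (\<psi> \<circ> inv_into U \<phi>) (\<phi> ` (U \<inter> V)))"

definition prod_atlas ::
  "('a, 'e::euclidean_space) atlas \<Rightarrow> ('b, 'f::euclidean_space) atlas \<Rightarrow> ('a \<times> 'b, 'e \<times> 'f) atlas" where
  "prod_atlas A B = {(U \<times> V, map_prod \<phi> \<psi>) | U \<phi> V \<psi>. (U, \<phi>) \<in> A \<and> (V, \<psi>) \<in> B}"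

definition smooth_map ::
  "'a topology \<Rightarrow> ('a, 'e::euclidean_space) atlas \<Rightarrow> 'b topology \<Rightarrow> ('b, 'f::euclidean_space) atlas \<Rightarrow>
   ('a \<Rightarrow> 'b) \<Rightarrow> bool" where
  "smooth_map T A T' A' F \<longleftrightarrow>
     continuous_map T T' F \<and>
     (\<forall>(U, \<phi>)\<in>A. \<forall>(V, \<psi>)\<in>A'. smooth_on (\<psi> \<circ> F \<circ> inv_into U \<phi>) (\<phi> ` (U \<inter> F -` V)))"

text \<open>
  The algebra of smooth functions. Functions on a set \<open>M\<close> are represented by their extensions
  by \<open>0\<close>, so that equality of functions on \<open>M\<close> is equality in HOL.
\<close>
definition smooth_functions :: "'a topology \<Rightarrow> ('a, 'e::euclidean_space) atlas \<Rightarrow> ('a \<Rightarrow> real) set" where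
  "smooth_functions T A =
     {f. (\<forall>x. x \<notin> topspace T \<longrightarrow> f x = 0) \<and>
         (\<forall>(U, \<phi>)\<in>A. smooth_on (f \<circ> inv_into U \<phi>) (\<phi> ` U))}"

text \<open>
  The smooth functions on an embedded submanifold \<open>M\<close> of a manifold with topology \<open>T\<close> and algebra
  of smooth functions \<open>C\<close>: those functions that locally extend to smooth functions on the ambient
  manifold.
\<close>
definition submanifold_functions :: "'a topology \<Rightarrow> ('a \<Rightarrow> real) set \<Rightarrow> 'a set \<Rightarrow> ('a \<Rightarrow> real) set" where
  "submanifold_functions T C M =
     {f. (\<forall>x. x \<notin> M \<longrightarrow> f x = 0) \<and>
         (\<forall>p\<in>M. \<exists>U F. openin T U \<and> p \<in> U \<and> F \<in> C \<and> (\<forall>q\<in>U \<inter> M. f q = F q))}"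


section \<open>Tangent vectors, vector fields and tensor fields\<close>

text \<open>
  From here on a manifold enters through its set of points \<open>M\<close> and its algebra \<open>C\<close> of smooth
  functions. Tangent vectors at \<open>p\<close> are the derivations of \<open>C\<close> at \<open>p\<close>; they are set to \<open>0\<close> on
  functions outside \<open>C\<close>, and vector fields are set to \<open>0\<close> at points outside \<open>M\<close>.
\<close>
type_synonym 'a tvec = "('a \<Rightarrow> real) \<Rightarrow> real"
type_synonym 'a vfield = "'a \<Rightarrow> 'a tvec"
type_synonym 'a form2 = "'a \<Rightarrow> 'a tvec \<Rightarrow> 'a tvec \<Rightarrow> real"
type_synonym 'a form3 = "'a \<Rightarrow> 'a tvec \<Rightarrow> 'a tvec \<Rightarrow> 'a tvec \<Rightarrow> real"

definition tangent_space :: "('a \<Rightarrow> real) set \<Rightarrow> 'a \<Rightarrow> 'a tvec set" where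
  "tangent_space C p =
     {v. (\<forall>f\<in>C. \<forall>h\<in>C. \<forall>a b. v (\<lambda>x. a * f x + b * h x) = a * v f + b * v h) \<and>
         (\<forall>f\<in>C. \<forall>h\<in>C. v (\<lambda>x. f x * h x) = v f * h p + f p * v h) \<and>
         (\<forall>f. f \<notin> C \<longrightarrow> v f = 0)}"

definition vector_fields :: "'a set \<Rightarrow> ('a \<Rightarrow> real) set \<Rightarrow> 'a vfield set" where
  "vector_fields M C =
     {X. (\<forall>p\<in>M. X p \<in> tangent_space C p) \<and> (\<forall>p. p \<notin> M \<longrightarrow> X p = 0) \<and>
         (\<forall>f\<in>C. (\<lambda>p. X p f) \<in> C)}"

definition lie_bracket :: "'a vfield \<Rightarrow> 'a vfield \<Rightarrow> 'a vfield" where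
  "lie_bracket X Y = (\<lambda>p f. X p (\<lambda>q. Y q f) - Y p (\<lambda>q. X q f))"

text \<open>
  The differential of a map \<open>F\<close> from \<open>M\<close> to a manifold with algebra of smooth functions \<open>C'\<close>.
\<close>
definition tangent_map :: "'a set \<Rightarrow> ('b \<Rightarrow> real) set \<Rightarrow> ('a \<Rightarrow> 'b) \<Rightarrow> 'a tvec \<Rightarrow> 'b tvec" where
  "tangent_map M C' F v = (\<lambda>f. if f \<in> C' then v (\<lambda>x. if x \<in> M then f (F x) else 0) else 0)"

definition pullback2 :: "'a set \<Rightarrow> ('b \<Rightarrow> real) set \<Rightarrow> ('a \<Rightarrow> 'b) \<Rightarrow> 'b form2 \<Rightarrow> 'a form2" where
  "pullback2 M C' F h = (\<lambda>p u v. h (F p) (tangent_map M C' F u) (tangent_map M C' F v))"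

definition pullback3 :: "'a set \<Rightarrow> ('b \<Rightarrow> real) set \<Rightarrow> ('a \<Rightarrow> 'b) \<Rightarrow> 'b form3 \<Rightarrow> 'a form3" where
  "pullback3 M C' F h =
     (\<lambda>p u v w. h (F p) (tangent_map M C' F u) (tangent_map M C' F v) (tangent_map M C' F w))"

text \<open>The functions \<open>g(Y, Z)\<close> and \<open>H(Y, Z, W)\<close> on \<open>M\<close>.\<close>
definition eval2 :: "'a set \<Rightarrow> 'a form2 \<Rightarrow> 'a vfield \<Rightarrow> 'a vfield \<Rightarrow> 'a \<Rightarrow> real" where
  "eval2 M g Y Z = (\<lambda>p. if p \<in> M then g p (Y p) (Z p) else 0)"

definition eval3 :: "'a set \<Rightarrow> 'a form3 \<Rightarrow> 'a vfield \<Rightarrow> 'a vfield \<Rightarrow> 'a vfield \<Rightarrow> 'a \<Rightarrow> real" where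
  "eval3 M H Y Z W = (\<lambda>p. if p \<in> M then H p (Y p) (Z p) (W p) else 0)"


section \<open>Connections\<close>

text \<open>A connection is a map \<open>D\<close> with \<open>D X Y\<close> standing for \<open>\<nabla>\<^sub>X Y\<close>.\<close>
type_synonym 'a connection = "'a vfield \<Rightarrow> 'a vfield \<Rightarrow> 'a vfield"

definition affine_connection :: "'a set \<Rightarrow> ('a \<Rightarrow> real) set \<Rightarrow> 'a connection \<Rightarrow> bool" where
  "affine_connection M C D \<longleftrightarrow>
     (\<forall>X\<in>vector_fields M C. \<forall>Y\<in>vector_fields M C.
        D X Y \<in> vector_fields M C \<and>
        (\<forall>X'\<in>vector_fields M C. D (X + X') Y = D X Y + D X' Y) \<and>
        (\<forall>Y'\<in>vector_fields M C. D X (Y + Y') = D X Y + D X Y') \<and>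
        (\<forall>f\<in>C. D (\<lambda>p. f p *\<^sub>R X p) Y = (\<lambda>p. f p *\<^sub>R D X Y p)) \<and>
        (\<forall>f\<in>C. D X (\<lambda>p. f p *\<^sub>R Y p) = (\<lambda>p. X p f *\<^sub>R Y p + f p *\<^sub>R D X Y p)))"

definition metric_connection ::
  "'a set \<Rightarrow> ('a \<Rightarrow> real) set \<Rightarrow> 'a form2 \<Rightarrow> 'a connection \<Rightarrow> bool" where
  "metric_connection M C g D \<longleftrightarrow>
     affine_connection M C D \<and>
     (\<forall>X\<in>vector_fields M C. \<forall>Y\<in>vector_fields M C. \<forall>Z\<in>vector_fields M C. \<forall>p\<in>M.
        X p (eval2 M g Y Z) = eval2 M g (D X Y) Z p + eval2 M g Y (D X Z) p)"

definition levi_civita_connection ::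
  "'a set \<Rightarrow> ('a \<Rightarrow> real) set \<Rightarrow> 'a form2 \<Rightarrow> 'a connection \<Rightarrow> bool" where
  "levi_civita_connection M C g D \<longleftrightarrow>
     metric_connection M C g D \<and>
     (\<forall>X\<in>vector_fields M C. \<forall>Y\<in>vector_fields M C. D X Y - D Y X = lie_bracket X Y)"

definition bismut_connection ::
  "'a set \<Rightarrow> ('a \<Rightarrow> real) set \<Rightarrow> 'a form2 \<Rightarrow> 'a form3 \<Rightarrow> 'a connection \<Rightarrow> bool" where
  "bismut_connection M C g H D \<longleftrightarrow>
     metric_connection M C g D \<and>
     (\<exists>L. levi_civita_connection M C g L \<and>
        (\<forall>X\<in>vector_fields M C. \<forall>Y\<in>vector_fields M C. \<forall>Z\<in>vector_fields M C. \<forall>p\<in>M.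
           eval2 M g (D X Y) Z p = eval2 M g (L X Y) Z p + 1 / 2 * eval3 M H X Y Z p))"

definition covariant_derivative3 ::
  "'a set \<Rightarrow> 'a connection \<Rightarrow> 'a form3 \<Rightarrow> 'a vfield \<Rightarrow> 'a vfield \<Rightarrow> 'a vfield \<Rightarrow> 'a vfield \<Rightarrow> 'a \<Rightarrow> real" where
  "covariant_derivative3 M D H X Y Z W =
     (\<lambda>p. X p (eval3 M H Y Z W)
            - eval3 M H (D X Y) Z W p - eval3 M H Y (D X Z) W p - eval3 M H Y Z (D X W) p)"

definition parallel3 :: "'a set \<Rightarrow> ('a \<Rightarrow> real) set \<Rightarrow> 'a connection \<Rightarrow> 'a form3 \<Rightarrow> bool" where
  "parallel3 M C D H \<longleftrightarrow>
     (\<forall>X\<in>vector_fields M C. \<forall>Y\<in>vector_fields M C. \<forall>Z\<in>vector_fields M C. \<forall>W\<in>vector_fields M C.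
        \<forall>p\<in>M. covariant_derivative3 M D H X Y Z W p = 0)"


section \<open>Lie groups\<close>

definition lie_group :: "('a, 'm) monoid_scheme \<Rightarrow> 'a topology \<Rightarrow> ('a, 'e::euclidean_space) atlas \<Rightarrow> bool" where
  "lie_group G T A \<longleftrightarrow>
     group G \<and> carrier G = topspace T \<and> smooth_manifold T A \<and>
     smooth_map (prod_topology T T) (prod_atlas A A) T A (\<lambda>(x, y). x \<otimes>\<^bsub>G\<^esub> y) \<and>
     smooth_map T A T A (\<lambda>x. inv\<^bsub>G\<^esub> x)"

definition involutive_automorphism ::
  "('a, 'm) monoid_scheme \<Rightarrow> 'a topology \<Rightarrow> ('a, 'e::euclidean_space) atlas \<Rightarrow> ('a \<Rightarrow> 'a) \<Rightarrow> bool" where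
  "involutive_automorphism G T A \<sigma> \<longleftrightarrow>
     \<sigma> \<in> iso G G \<and> smooth_map T A T A \<sigma> \<and>
     (\<exists>a\<in>carrier G. \<sigma> a \<noteq> a) \<and> (\<forall>a\<in>carrier G. \<sigma> (\<sigma> a) = a)"

text \<open>The Lie algebra of left-invariant vector fields, where \<open>C\<close> is the algebra of smooth functions on \<open>G\<close>.\<close>
definition lie_algebra :: "('a, 'm) monoid_scheme \<Rightarrow> ('a \<Rightarrow> real) set \<Rightarrow> 'a vfield set" where
  "lie_algebra G C =
     {X \<in> vector_fields (carrier G) C.
        \<forall>a\<in>carrier G. \<forall>x\<in>carrier G.
          tangent_map (carrier G) C (\<lambda>y. a \<otimes>\<^bsub>G\<^esub> y) (X x) = X (a \<otimes>\<^bsub>G\<^esub> x)}"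

primrec derived_series :: "'a vfield set \<Rightarrow> nat \<Rightarrow> 'a vfield set" where
  "derived_series I 0 = I"
| "derived_series I (Suc k) =
     span {lie_bracket X Y | X Y. X \<in> derived_series I k \<and> Y \<in> derived_series I k}"

definition semisimple_lie_group :: "('a, 'm) monoid_scheme \<Rightarrow> ('a \<Rightarrow> real) set \<Rightarrow> bool" where
  "semisimple_lie_group G C \<longleftrightarrow>
     (\<forall>I. subspace I \<and> I \<subseteq> lie_algebra G C \<and>
          (\<forall>X\<in>lie_algebra G C. \<forall>Y\<in>I. lie_bracket X Y \<in> I) \<and>
          (\<exists>k. derived_series I k = {0})
        \<longrightarrow> I = {0})"

definition killing_form :: "('a, 'm) monoid_scheme \<Rightarrow> ('a \<Rightarrow> real) set \<Rightarrow> 'a vfield \<Rightarrow> 'a vfield \<Rightarrow> real" where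
  "killing_form G C X Y = trace_on (lie_algebra G C) (\<lambda>Z. lie_bracket X (lie_bracket Y Z))"

definition left_invariant_extension ::
  "('a, 'm) monoid_scheme \<Rightarrow> ('a \<Rightarrow> real) set \<Rightarrow> 'a \<Rightarrow> 'a tvec \<Rightarrow> 'a vfield" where
  "left_invariant_extension G C x u = (THE X. X \<in> lie_algebra G C \<and> X x = u)"

definition killing_metric :: "('a, 'm) monoid_scheme \<Rightarrow> ('a \<Rightarrow> real) set \<Rightarrow> 'a form2" where
  "killing_metric G C =
     (\<lambda>x u v. - killing_form G C (left_invariant_extension G C x u) (left_invariant_extension G C x v))"

definition cartan_3form :: "('a, 'm) monoid_scheme \<Rightarrow> ('a \<Rightarrow> real) set \<Rightarrow> 'a form3" where
  "cartan_3form G C =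
     (\<lambda>x u v w. killing_metric G C x
        (lie_bracket (left_invariant_extension G C x u) (left_invariant_extension G C x v) x) w)"

definition two_sided_action :: "('a, 'm) monoid_scheme \<Rightarrow> 'a \<times> 'a \<Rightarrow> 'a \<times> 'a \<Rightarrow> 'a \<times> 'a" where
  "two_sided_action G =
     (\<lambda>(g1, g2) (x1, x2). (g1 \<otimes>\<^bsub>G\<^esub> x1 \<otimes>\<^bsub>G\<^esub> inv\<^bsub>G\<^esub> g2, g1 \<otimes>\<^bsub>G\<^esub> x2 \<otimes>\<^bsub>G\<^esub> inv\<^bsub>G\<^esub> g2))"

end

theory Submission
  imports Defs
begin

text \<open>
  In the right trivialisation the Bismut connection of the bi-invariant pair on \<open>G \<times> G\<close> is flat with
  right-invariant fields parallel, and the Bismut connection of \<open>M\<close> is its tangential projection.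
  The failure of the torsion to be parallel is therefore measured by the second fundamental form.
  Write \<open>\<pp>\<close> for the \<open>-1\<close>-eigenspace of \<open>Ad z\<close> on the Lie algebra. Differentiating along the field
  \<open>R\<^sub>X\<close> generated by left translations, with \<open>X \<in> \<pp>\<close>, and evaluating on the fields \<open>L\<^bsub>Y\<^esub>\<close>, \<open>L\<^bsub>Y'\<^esub>\<close>
  generated by right translations and on \<open>R\<^sub>S\<close>, with \<open>Y, Y', S \<in> \<pp>\<close>, all terms with a covariant
  derivative of an argument vanish at \<open>(1, z)\<close>, by the Koszul formula. What remains is a multiple of
  \<open>B([Y, Y'], [X, S])\<close>. If the torsion were parallel, then \<open>[\<pp>, \<pp>] = 0\<close> since \<open>B\<close> is negative
  definite; hence \<open>\<pp>\<close> would be an abelian ideal, so \<open>\<pp> = 0\<close>, \<open>Ad z = 1\<close>, and \<open>\<sigma> = Id\<close> as \<open>G\<close> is connected.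

  Derivations of the function algebras are identified with directional derivatives in charts through
  Hadamard's lemma. The tangent space of \<open>M\<close> at \<open>(1, z)\<close> is controlled by the equation
  \<open>(y x\<^sup>-\<^sup>1)\<^sup>2 = z\<^sup>2\<close>, which holds on \<open>M\<close> because \<open>z\<^sup>2\<close> is central, so no implicit function theorem is needed.
\<close>

section \<open>Calculus of \<open>C\<^sup>k\<close> functions\<close>

text \<open>The test fields are dictated by constancy: inner products of two \<open>LL\<close>
  fields or of two \<open>RR\<close> fields are constant on \<open>M\<close>, so every derivative in
  the Koszul formula falls on a function \<open>mixed\<close>. At \<open>p\<^sub>0\<close> this
  function pairs its arguments through 1 + Ad z, hence vanishes as soon as one of them is
  anti-invariant. The obstacle is that \<open>M\<close> is known only through its function algebra.
  The only candidates are (U, -U) with Ad z U = U, and the linearised equation of \<open>M\<close>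
  excludes them. Curves, flows and the exponential map never occur. Derivatives of translations,
  inversion and conjugation come from two facts about functions of two variables: the diagonal rule
  and the interchange of derivations. Semisimplicity is given as the absence of solvable ideals, so
  the negativity of \<open>B\<close> has to be proved. It follows from an Ad-invariant inner
  product, which is found by a minimisation rather than by averaging over Haar measure.\<close>

lemma Ck_on_cong:
  assumes "open S" "\<And>x. x \<in> S \<Longrightarrow> f x = g x" "Ck_on k f S"
  shows "Ck_on k g S"
  using assms(2,3)
proof (induction k arbitrary: f g)
  case 0
  have "continuous_on S f \<longleftrightarrow> continuous_on S g"
    by (rule continuous_on_cong[OF refl 0(1)])
  then show ?case using 0(2) by simp
next
  case (Suc k)
  have d: "f differentiable (at x)" if x: "x \<in> S" for x
  proof -
    have "f differentiable_on S" using Suc.prems(2) by simp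
    then show ?thesis using x \<open>open S\<close> by (metis differentiable_on_def at_within_open)
  qed
  have e: "frechet_derivative f (at x) = frechet_derivative g (at x)" if "x \<in> S" for x
    by (rule frechet_derivative_transform_within_open[OF d[OF that] \<open>open S\<close> that Suc.prems(1)])
  have "g differentiable_on S"
    unfolding differentiable_on_def
    by (metis Suc.prems(1) \<open>open S\<close> d has_derivative_transform_within_open differentiable_def
        at_within_open)
  moreover have "Ck_on k (\<lambda>x. frechet_derivative g (at x) v) S" for v
  proof (rule Suc.IH)
    show "frechet_derivative f (at x) v = frechet_derivative g (at x) v" if "x \<in> S" for x
      by (simp only: e[OF that])
    show "Ck_on k (\<lambda>x. frechet_derivative f (at x) v) S"
      using Suc.prems(2) by simp
  qed
  ultimately show ?case by simp
qed

lemma Ck_on_subset: "Ck_on k f S \<Longrightarrow> U \<subseteq> S \<Longrightarrow> Ck_on k f U"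
  by (induction k arbitrary: f) (auto intro: continuous_on_subset differentiable_on_subset)

lemma Ck_on_local:
  assumes "open S" "\<And>x. x \<in> S \<Longrightarrow> \<exists>U. open U \<and> x \<in> U \<and> Ck_on k f (U \<inter> S)"
  shows "Ck_on k f S"
  using assms(2)
proof (induction k arbitrary: f)
  case 0
  have "continuous (at x) f" if x: "x \<in> S" for x
  proof -
    obtain U where U: "open U" "x \<in> U" "continuous_on (U \<inter> S) f"
      using 0[OF x] by auto
    then show ?thesis
      using \<open>open S\<close> x by (meson IntI continuous_on_eq_continuous_at open_Int)
  qed
  then show ?case by (simp add: continuous_at_imp_continuous_on)
next
  case (Suc k)
  have "f differentiable (at x)" if x: "x \<in> S" for x
  proof -
    obtain U where U: "open U" "x \<in> U" "f differentiable_on (U \<inter> S)"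
      using Suc.prems[OF x] by auto
    then show ?thesis
      using \<open>open S\<close> x by (metis IntI differentiable_on_def at_within_open open_Int)
  qed
  then have "f differentiable_on S"
    by (simp add: differentiable_at_imp_differentiable_on)
  moreover have "Ck_on k (\<lambda>x. frechet_derivative f (at x) v) S" for v
    by (rule Suc.IH) (metis Suc.prems Ck_on.simps(2))
  ultimately show ?case by simp
qed

lemma Ck_on_SucI:
  assumes "open S" "\<And>x. x \<in> S \<Longrightarrow> (f has_derivative f' x) (at x)"
    and "\<And>v. Ck_on k (\<lambda>x. f' x v) S"
  shows "Ck_on (Suc k) f S"
proof -
  have "f differentiable_on S"
    using assms(2) by (meson differentiable_at_imp_differentiable_on differentiable_def)
  moreover have "Ck_on k (\<lambda>x. frechet_derivative f (at x) v) S" for v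
    by (rule Ck_on_cong[OF \<open>open S\<close> _ assms(3)[of v]]) (metis assms(2) frechet_derivative_at)
  ultimately show ?thesis by simp
qed

lemma Ck_on_SucD:
  assumes "open S" "Ck_on (Suc k) f S" "x \<in> S"
  shows "(f has_derivative frechet_derivative f (at x)) (at x)"
proof -
  have "f differentiable (at x)"
    using assms by (metis Ck_on.simps(2) differentiable_on_def at_within_open)
  then show ?thesis by (simp add: frechet_derivative_works)
qed

lemma Ck_on_Suc_imp: "Ck_on (Suc k) f S \<Longrightarrow> Ck_on k f S"
proof (induction k arbitrary: f)
  case 0
  then show ?case by (auto simp: differentiable_imp_continuous_on)
next
  case (Suc k)
  then show ?case by (metis Ck_on.simps(2))
qed

lemma Ck_on_const: "open S \<Longrightarrow> Ck_on k (\<lambda>x. c) S"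
proof (induction k arbitrary: c)
  case (Suc k)
  show ?case by (rule Ck_on_SucI[where f' = "\<lambda>_ _. 0"]) (use Suc in auto)
qed simp

lemma Ck_on_bounded_linear:
  assumes "open S" "bounded_linear f"
  shows "Ck_on k f S"
proof (cases k)
  case 0
  then show ?thesis
    using assms by (simp add: linear_continuous_on)
next
  case (Suc m)
  show ?thesis unfolding Suc
    by (rule Ck_on_SucI[where f' = "\<lambda>_. f"])
       (use assms Ck_on_const in \<open>auto intro: bounded_linear_imp_has_derivative\<close>)
qed

lemma Ck_on_add:
  assumes "open S" "Ck_on k f S" "Ck_on k g S"
  shows "Ck_on k (\<lambda>x. f x + g x) S"
  using assms(2,3)
proof (induction k arbitrary: f g)
  case 0
  then show ?case by (simp add: continuous_on_add)
next
  case (Suc k)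
  note d = Ck_on_SucD[OF \<open>open S\<close> Suc.prems(1)] Ck_on_SucD[OF \<open>open S\<close> Suc.prems(2)]
  show ?case
    by (rule Ck_on_SucI[OF \<open>open S\<close> has_derivative_add[OF d]], assumption, assumption)
       (use Suc in auto)
qed

text \<open>The product rule writes the derivative as a sum of two bilinear terms of one order less.
  This single induction serves products of reals, scalings and inner products alike.\<close>

lemma Ck_on_bilinear:
  assumes "open S" "bounded_bilinear b" "Ck_on k f S" "Ck_on k g S"
  shows "Ck_on k (\<lambda>x. b (f x) (g x)) S"
  using assms(3,4)
proof (induction k arbitrary: f g)
  case 0
  then show ?case
    using bounded_bilinear.continuous_on[OF assms(2)] by auto
next
  case (Suc k)
  note d = Ck_on_SucD[OF \<open>open S\<close> Suc.prems(1)] Ck_on_SucD[OF \<open>open S\<close> Suc.prems(2)]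
  note c = Ck_on_Suc_imp[OF Suc.prems(1)] Ck_on_Suc_imp[OF Suc.prems(2)]
  show ?case
    by (rule Ck_on_SucI[OF \<open>open S\<close> bounded_bilinear.FDERIV[OF assms(2) d]], assumption, assumption)
       (rule Ck_on_add[OF \<open>open S\<close> Suc.IH[OF c(1)] Suc.IH[OF _ c(2)]]; use Suc.prems in simp)
qed

lemma Ck_on_linear_image:
  assumes "open S" "bounded_linear L" "Ck_on k f S"
  shows "Ck_on k (\<lambda>x. L (f x)) S"
  using assms(3)
proof (induction k arbitrary: f)
  case 0
  then show ?case
    using assms(2) by (auto simp: bounded_linear.continuous_on)
next
  case (Suc k)
  note d = Ck_on_SucD[OF \<open>open S\<close> Suc.prems(1)]
  show ?case
    by (rule Ck_on_SucI[OF \<open>open S\<close> bounded_linear.has_derivative[OF assms(2) d]], assumption)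
       (use Suc in auto)
qed

lemma Ck_on_sum:
  assumes "open S" "\<And>i. i \<in> I \<Longrightarrow> Ck_on k (f i) S"
  shows "Ck_on k (\<lambda>x. \<Sum>i\<in>I. f i x) S"
  using assms(2)
  by (induction I rule: infinite_finite_induct)
     (auto simp: Ck_on_const Ck_on_add assms(1))

lemma Ck_on_Pair:
  assumes "open S" "Ck_on k f S" "Ck_on k g S"
  shows "Ck_on k (\<lambda>x. (f x, g x)) S"
proof -
  have "Ck_on k (\<lambda>x. (f x, 0) + (0, g x)) S"
    using assms
    by (intro Ck_on_add[OF assms(1)] Ck_on_linear_image[of S "\<lambda>x. (x, 0)" k f]
         Ck_on_linear_image[of S "\<lambda>x. (0, x)" k g] bounded_linear_Pair bounded_linear_ident bounded_linear_zero)
  then show ?thesis by simp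
qed

text \<open>\<open>Ck_on\<close> differentiates only in fixed directions, whereas the chain rule
  applies the derivative of \<open>g\<close> to a direction that moves with \<open>x\<close>.
  Expanding that direction in \<open>Basis\<close> restores fixed directions, with coefficients of
  the right order; this is why the intermediate space is Euclidean.\<close>

lemma Ck_on_compose:
  fixes f :: "'a::real_normed_vector \<Rightarrow> 'b::euclidean_space"
  assumes "open S" "open U" "f ` S \<subseteq> U" "Ck_on k f S" "Ck_on k g U"
  shows "Ck_on k (\<lambda>x. g (f x)) S"
  using assms(4,5)
proof (induction k arbitrary: g)
  case 0
  then show ?case
    using assms(3) by (auto intro: continuous_on_compose2)
next
  case (Suc k)
  note df = Ck_on_SucD[OF \<open>open S\<close> Suc.prems(1)] and dg = Ck_on_SucD[OF \<open>open U\<close> Suc.prems(2)]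
  have eq: "frechet_derivative g (at (f x)) (frechet_derivative f (at x) v) =
      (\<Sum>i\<in>Basis. (frechet_derivative f (at x) v \<bullet> i) *\<^sub>R frechet_derivative g (at (f x)) i)"
    if "x \<in> S" for x v
  proof -
    let ?w = "frechet_derivative f (at x) v"
    have "f x \<in> U" using that assms(3) by blast
    then have lin: "linear (frechet_derivative g (at (f x)))"
      using dg has_derivative_linear by blast
    have "frechet_derivative g (at (f x)) ?w =
        frechet_derivative g (at (f x)) (\<Sum>i\<in>Basis. (?w \<bullet> i) *\<^sub>R i)"
      by (simp only: euclidean_representation)
    also have "\<dots> = (\<Sum>i\<in>Basis. (?w \<bullet> i) *\<^sub>R frechet_derivative g (at (f x)) i)"
      by (simp only: linear_sum[OF lin] linear_scale[OF lin])
    finally show ?thesis .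
  qed
  show ?case
  proof (rule Ck_on_SucI[OF \<open>open S\<close>])
    fix x assume "x \<in> S"
    then have "((g \<circ> f) has_derivative
        frechet_derivative g (at (f x)) \<circ> frechet_derivative f (at x)) (at x)"
      using df dg assms(3) by (intro diff_chain_at) auto
    then show "((\<lambda>x. g (f x)) has_derivative
        (\<lambda>v. frechet_derivative g (at (f x)) (frechet_derivative f (at x) v))) (at x)"
      by (simp add: o_def)
  next
    fix v
    have "Ck_on k (\<lambda>x. (\<Sum>i\<in>Basis. (frechet_derivative f (at x) v \<bullet> i) *\<^sub>R
        frechet_derivative g (at (f x)) i)) S"
    proof (rule Ck_on_sum[OF \<open>open S\<close>], rule Ck_on_bilinear[OF \<open>open S\<close> bounded_bilinear_scaleR])
      fix i :: 'b
      show "Ck_on k (\<lambda>x. frechet_derivative f (at x) v \<bullet> i) S"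
        by (rule Ck_on_linear_image[OF \<open>open S\<close> bounded_linear_inner_left]) (use Suc.prems in simp)
      show "Ck_on k (\<lambda>x. frechet_derivative g (at (f x)) i) S"
        by (rule Suc.IH) (use Ck_on_Suc_imp[OF Suc.prems(1)] Suc.prems(2) in auto)
    qed
    then show "Ck_on k (\<lambda>x. frechet_derivative g (at (f x)) (frechet_derivative f (at x) v)) S"
      by (rule Ck_on_cong[OF \<open>open S\<close>, rotated]) (simp only: eq)
  qed
qed

section \<open>Closure properties of smooth functions on open sets\<close>

lemma smooth_on_cong:
  assumes "open S" "\<And>x. x \<in> S \<Longrightarrow> f x = g x" "smooth_on f S"
  shows "smooth_on g S"
  using assms Ck_on_cong unfolding smooth_on_def by blast

lemma smooth_on_subset: "smooth_on f S \<Longrightarrow> U \<subseteq> S \<Longrightarrow> smooth_on f U"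
  using Ck_on_subset unfolding smooth_on_def by blast

lemma smooth_on_local:
  assumes "open S" "\<And>x. x \<in> S \<Longrightarrow> \<exists>U. open U \<and> x \<in> U \<and> smooth_on f (U \<inter> S)"
  shows "smooth_on f S"
  unfolding smooth_on_def
  by (intro allI Ck_on_local[OF assms(1)]) (metis assms(2) smooth_on_def)

lemma smooth_on_imp_continuous_on: "smooth_on f S \<Longrightarrow> continuous_on S f"
  unfolding smooth_on_def by (metis Ck_on.simps(1))

lemma smooth_on_has_derivative:
  "open S \<Longrightarrow> smooth_on f S \<Longrightarrow> x \<in> S \<Longrightarrow> (f has_derivative frechet_derivative f (at x)) (at x)"
  unfolding smooth_on_def using Ck_on_SucD by blast

lemma smooth_on_frechet: "smooth_on f S \<Longrightarrow> smooth_on (\<lambda>x. frechet_derivative f (at x) v) S"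
  unfolding smooth_on_def by (metis Ck_on.simps(2))

lemma smooth_on_const: "open S \<Longrightarrow> smooth_on (\<lambda>x. c) S"
  and smooth_on_bounded_linear: "open S \<Longrightarrow> bounded_linear f \<Longrightarrow> smooth_on f S"
  and smooth_on_add: "open S \<Longrightarrow> smooth_on f S \<Longrightarrow> smooth_on g S \<Longrightarrow> smooth_on (\<lambda>x. f x + g x) S"
  and smooth_on_bilinear: "open S \<Longrightarrow> bounded_bilinear b \<Longrightarrow> smooth_on f1 S \<Longrightarrow> smooth_on g1 S
        \<Longrightarrow> smooth_on (\<lambda>x. b (f1 x) (g1 x)) S"
  and smooth_on_linear_image: "open S \<Longrightarrow> bounded_linear L \<Longrightarrow> smooth_on f2 S
        \<Longrightarrow> smooth_on (\<lambda>x. L (f2 x)) S"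
  and smooth_on_Pair: "open S \<Longrightarrow> smooth_on f3 S \<Longrightarrow> smooth_on g3 S \<Longrightarrow> smooth_on (\<lambda>x. (f3 x, g3 x)) S"
  unfolding smooth_on_def
  by (simp_all add: Ck_on_const Ck_on_bounded_linear Ck_on_add Ck_on_bilinear
        Ck_on_linear_image Ck_on_Pair)

lemma smooth_on_compose:
  fixes f :: "'a::real_normed_vector \<Rightarrow> 'b::euclidean_space"
  assumes "open S" "open U" "f ` S \<subseteq> U" "smooth_on f S" "smooth_on g U"
  shows "smooth_on (\<lambda>x. g (f x)) S"
  using assms Ck_on_compose unfolding smooth_on_def by blast

lemma smooth_on_mult:
  fixes f g :: "'a::real_normed_vector \<Rightarrow> real"
  shows "open S \<Longrightarrow> smooth_on f S \<Longrightarrow> smooth_on g S \<Longrightarrow> smooth_on (\<lambda>x. f x * g x) S"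
  by (rule smooth_on_bilinear[OF _ bounded_bilinear_mult])

subsection \<open>Bump functions\<close>

text \<open>The powers of 1/t are carried along because differentiating exp(-1/t) produces them: the
  derivative of each member is a combination of two later members, so the whole family is smooth by
  one induction. Bump functions are built from \<open>flat_exp 0\<close>.\<close>

definition flat_exp :: "nat \<Rightarrow> real \<Rightarrow> real" where
  "flat_exp n t = (if t > 0 then (1 / t) ^ n * exp (- (1 / t)) else 0)"

lemma flat_exp_tendsto_0: "((\<lambda>t. flat_exp n t) \<longlongrightarrow> 0) (at 0)"
proof -
  have "((\<lambda>t. (1 / t) ^ n / exp (1 / t)) \<longlongrightarrow> (0::real)) (at_right 0)"
    using filterlim_compose[OF tendsto_power_div_exp_0 filterlim_inverse_at_top_right]
    by (simp add: inverse_eq_divide)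
  then have r: "((\<lambda>t. flat_exp n t) \<longlongrightarrow> 0) (at_right 0)"
    by (rule Lim_transform_eventually)
       (auto simp: eventually_at_filter flat_exp_def exp_minus divide_inverse)
  have l: "((\<lambda>t. flat_exp n t) \<longlongrightarrow> 0) (at_left 0)"
    by (rule Lim_transform_eventually[OF tendsto_const])
       (auto simp: eventually_at_filter flat_exp_def)
  show ?thesis using l r by (simp add: filterlim_split_at)
qed

lemma flat_exp_DERIV: "DERIV (flat_exp n) t :> flat_exp (n + 2) t - of_nat n * flat_exp (n + 1) t"
proof (cases t "0::real" rule: linorder_cases)
  case less
  have "DERIV (\<lambda>t. 0::real) t :> 0" by simp
  moreover have "eventually (\<lambda>t. t < (0::real)) (nhds t)"
    using less by (intro eventually_nhds_in_open[of "{..<0}", simplified]) auto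
  then have "eventually (\<lambda>t. flat_exp n t = 0) (nhds t)"
    by eventually_elim (simp add: flat_exp_def)
  ultimately have "DERIV (flat_exp n) t :> 0"
    by (subst DERIV_cong_ev[OF refl _ refl]) auto
  then show ?thesis using less by (simp add: flat_exp_def)
next
  case equal
  \<comment> \<open>Off 0, the difference quotient of \<open>flat_exp n\<close> at 0 is
    \<open>flat_exp (n + 1)\<close> itself.\<close>
  have "((\<lambda>h. flat_exp (n + 1) h) \<longlongrightarrow> 0) (at 0)" by (rule flat_exp_tendsto_0)
  then have "((\<lambda>h. (flat_exp n (0 + h) - flat_exp n 0) / h) \<longlongrightarrow> 0) (at 0)"
    by (rule Lim_transform_eventually) (auto simp: eventually_at_filter flat_exp_def divide_simps)
  then show ?thesis using equal by (simp add: DERIV_def flat_exp_def)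
next
  case greater
  have "eventually (\<lambda>t. t > (0::real)) (nhds t)"
    using greater by (intro eventually_nhds_in_open[of "{0<..}", simplified]) auto
  then have ev: "eventually (\<lambda>t. flat_exp n t = (1 / t) ^ n * exp (- (1 / t))) (nhds t)"
    by eventually_elim (simp add: flat_exp_def)
  have "DERIV (\<lambda>t. (1 / t) ^ n * exp (- (1 / t))) t :>
     flat_exp (n + 2) t - of_nat n * flat_exp (n + 1) t"
    using greater
    by (cases n)
       (auto intro!: derivative_eq_intros simp: flat_exp_def field_simps power2_eq_square,
        metis One_nat_def Suc_pred neq0_conv power_Suc)
  then show ?thesis
    by (subst DERIV_cong_ev[OF refl ev refl])
qed

lemma smooth_on_flat_exp: "smooth_on (flat_exp n) UNIV"
proof -
  have "Ck_on k (flat_exp n) UNIV" for k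
  proof (induction k arbitrary: n)
    case 0
    show ?case by (simp, rule DERIV_continuous_on[OF flat_exp_DERIV])
  next
    case (Suc k)
    show ?case
    proof (rule Ck_on_SucI)
      show "(flat_exp n has_derivative
           (\<lambda>v. (flat_exp (n + 2) t + (- of_nat n) * flat_exp (n + 1) t) * v)) (at t)" for t
        using flat_exp_DERIV[of n t] by (simp add: has_field_derivative_def)
      show "Ck_on k (\<lambda>t. (flat_exp (n + 2) t + (- of_nat n) * flat_exp (n + 1) t) * v) UNIV" for v
        by (rule Ck_on_bilinear[OF open_UNIV bounded_bilinear_mult Ck_on_add[OF open_UNIV Suc.IH
              Ck_on_bilinear[OF open_UNIV bounded_bilinear_mult Ck_on_const[OF open_UNIV] Suc.IH]]
              Ck_on_const[OF open_UNIV]])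
    qed simp
  qed
  then show ?thesis by (simp add: smooth_on_def)
qed

lemma exists_bump:
  fixes a :: "'a::euclidean_space"
  assumes "r > 0"
  obtains \<beta> :: "'a \<Rightarrow> real" where "smooth_on \<beta> UNIV" "\<beta> a = 1" "\<And>x. x \<notin> ball a r \<Longrightarrow> \<beta> x = 0"
proof
  let ?c = "flat_exp 0 (r\<^sup>2)"
  \<comment> \<open>The squared distance keeps the argument polynomial, hence smooth at the centre
    too; \<open>?c\<close> normalises the value there.\<close>
  let ?u = "\<lambda>x. r\<^sup>2 - (x - a) \<bullet> (x - a)"
  have c: "?c > 0" using assms by (simp add: flat_exp_def)
  have sub: "smooth_on (\<lambda>x::'a. x - a) UNIV"
    using smooth_on_add[OF open_UNIV smooth_on_bounded_linear[OF open_UNIV bounded_linear_ident]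
        smooth_on_const[OF open_UNIV, of "-a"]] by simp
  have u: "smooth_on ?u UNIV"
    using smooth_on_add[OF open_UNIV smooth_on_const[OF open_UNIV, of "r\<^sup>2"]
      smooth_on_linear_image[OF open_UNIV bounded_linear_minus[OF bounded_linear_ident]
        smooth_on_bilinear[OF open_UNIV bounded_bilinear_inner sub sub]]] by simp
  show "smooth_on (\<lambda>x. flat_exp 0 (?u x) * (1 / ?c)) UNIV"
    by (rule smooth_on_mult[OF open_UNIV smooth_on_compose[OF open_UNIV open_UNIV _ u smooth_on_flat_exp]
          smooth_on_const[OF open_UNIV]]) simp
  show "flat_exp 0 (?u a) * (1 / ?c) = 1" using c by simp
  show "flat_exp 0 (?u x) * (1 / ?c) = 0" if "x \<notin> ball a r" for x
  proof -
    have "r \<le> norm (x - a)" using that by (simp add: dist_norm norm_minus_commute)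
    then have "r\<^sup>2 \<le> (x - a) \<bullet> (x - a)"
      using assms by (simp add: dot_square_norm power_mono)
    then show ?thesis by (simp add: flat_exp_def)
  qed
qed

subsection \<open>Symmetry of second derivatives and Hadamard's lemma\<close>

text \<open>Two applications of the mean value theorem turn the second difference, divided by the
  square of \<open>t\<close>, into the mixed derivative at some point of a small parallelogram. The
  quotient itself is symmetric in \<open>u\<close> and \<open>v\<close>, so the limits for both
  orders must agree.\<close>

lemma frechet_derivative_symmetric_aux:
  fixes f :: "'a::real_normed_vector \<Rightarrow> real"
  assumes "open S" "smooth_on f S" "a \<in> S" "\<epsilon> > 0"
  shows "\<exists>\<delta>>0. \<forall>t. 0 < t \<and> t < \<delta> \<longrightarrow>
    \<bar>(f (a + t *\<^sub>R u + t *\<^sub>R v) - f (a + t *\<^sub>R u) - f (a + t *\<^sub>R v) + f a) / t\<^sup>2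
      - frechet_derivative (\<lambda>x. frechet_derivative f (at x) u) (at a) v\<bar> < \<epsilon>"
proof -
  let ?fu = "\<lambda>x. frechet_derivative f (at x) u"
  let ?fuv = "\<lambda>x. frechet_derivative ?fu (at x) v"
  have "smooth_on ?fu S" by (rule smooth_on_frechet[OF assms(2)])
  note dfu = smooth_on_has_derivative[OF assms(1) this]
  have "continuous_on S ?fuv"
    by (intro smooth_on_imp_continuous_on smooth_on_frechet assms(2))
  then have "isCont ?fuv a"
    using assms(1,3) by (simp add: continuous_on_eq_continuous_at)
  then obtain d where d: "d > 0" "\<And>x. dist x a < d \<Longrightarrow> dist (?fuv x) (?fuv a) < \<epsilon>"
    using \<open>\<epsilon> > 0\<close> unfolding continuous_at_eps_delta by (metis dist_commute)
  obtain r where r: "r > 0" "ball a r \<subseteq> S"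
    using assms(1,3) open_contains_ball by blast
  let ?m = "norm u + norm v + 1"
  have m: "?m > 0" by (smt (verit) norm_ge_zero)
  \<comment> \<open>The divisor bounds how far the unit parallelogram on \<open>u\<close> and
    \<open>v\<close> reaches, so the scaled one stays within both radii \<open>r\<close> and
    \<open>d\<close>; the summand 1 in \<open>?m\<close> keeps it positive.\<close>
  define \<delta> where "\<delta> = min r d / ?m"
  have "\<delta> > 0" using r d m by (simp add: \<delta>_def)
  moreover have "\<bar>(f (a + t *\<^sub>R u + t *\<^sub>R v) - f (a + t *\<^sub>R u) - f (a + t *\<^sub>R v) + f a) / t\<^sup>2 - ?fuv a\<bar> < \<epsilon>"
    if t: "0 < t" "t < \<delta>" for t
  proof -
    have near: "a + x *\<^sub>R u + y *\<^sub>R v \<in> S \<and> dist (a + x *\<^sub>R u + y *\<^sub>R v) a < d"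
      if "0 \<le> x" "x \<le> t" "0 \<le> y" "y \<le> t" for x y
    proof -
      have "norm (x *\<^sub>R u + y *\<^sub>R v) \<le> x * norm u + y * norm v"
        by (rule order_trans[OF norm_triangle_ineq]) (use that in simp)
      also have "\<dots> \<le> t * norm u + t * norm v"
        using that by (intro add_mono mult_right_mono) auto
      also have "\<dots> < t * ?m" using t by (simp add: algebra_simps)
      also have "\<dots> < min r d"
        using t m by (simp add: \<delta>_def pos_less_divide_eq)
      finally have "norm (x *\<^sub>R u + y *\<^sub>R v) < min r d" .
      moreover have "dist (a + x *\<^sub>R u + y *\<^sub>R v) a = norm (x *\<^sub>R u + y *\<^sub>R v)"
        by (simp add: dist_norm algebra_simps)
      ultimately show ?thesis
        using r(2) by (auto simp: subset_iff dist_commute)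
    qed
    let ?\<phi> = "\<lambda>x. f (a + x *\<^sub>R u + t *\<^sub>R v) - f (a + x *\<^sub>R u)"
    have "\<exists>x>0. x < t \<and> ?\<phi> t - ?\<phi> 0 = (t - 0) * (?fu (a + x *\<^sub>R u + t *\<^sub>R v) - ?fu (a + x *\<^sub>R u))"
    proof (rule MVT2[OF t(1)])
      fix x assume x: "0 \<le> x" "x \<le> t"
      have *: "((\<lambda>x. f (a + x *\<^sub>R u + y *\<^sub>R v)) has_real_derivative ?fu (a + x *\<^sub>R u + y *\<^sub>R v)) (at x)"
        if "0 \<le> y" "y \<le> t" for y
      proof -
        have df: "(f has_derivative frechet_derivative f (at (a + x *\<^sub>R u + y *\<^sub>R v))) (at (a + x *\<^sub>R u + y *\<^sub>R v))"
          using near[of x y] x that by (intro smooth_on_has_derivative[OF assms(1,2)]) auto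
        have "((\<lambda>x. a + x *\<^sub>R u + y *\<^sub>R v) has_derivative (\<lambda>h. h *\<^sub>R u)) (at x)"
          by (auto intro!: derivative_eq_intros)
        from diff_chain_at[OF this df] show ?thesis
          by (simp add: has_field_derivative_def o_def
              linear_scale[OF has_derivative_linear[OF df]] mult_commute_abs)
      qed
      show "(?\<phi> has_real_derivative ?fu (a + x *\<^sub>R u + t *\<^sub>R v) - ?fu (a + x *\<^sub>R u)) (at x)"
        using DERIV_diff[OF *[of t] *[of 0]] t by simp
    qed
    then obtain x where x: "0 < x" "x < t"
      "?\<phi> t - ?\<phi> 0 = t * (?fu (a + x *\<^sub>R u + t *\<^sub>R v) - ?fu (a + x *\<^sub>R u))" by auto
    have "\<exists>y>0. y < t \<and> ?fu (a + x *\<^sub>R u + t *\<^sub>R v) - ?fu (a + x *\<^sub>R u + 0 *\<^sub>R v) = (t - 0) * ?fuv (a + x *\<^sub>R u + y *\<^sub>R v)"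
    proof (rule MVT2[OF t(1)])
      fix y assume y: "0 \<le> y" "y \<le> t"
      have df: "(?fu has_derivative frechet_derivative ?fu (at (a + x *\<^sub>R u + y *\<^sub>R v))) (at (a + x *\<^sub>R u + y *\<^sub>R v))"
        using near[of x y] x y by (intro dfu) auto
      have "((\<lambda>y. a + x *\<^sub>R u + y *\<^sub>R v) has_derivative (\<lambda>h. h *\<^sub>R v)) (at y)"
        by (auto intro!: derivative_eq_intros)
      from diff_chain_at[OF this df]
      show "((\<lambda>y. ?fu (a + x *\<^sub>R u + y *\<^sub>R v)) has_real_derivative ?fuv (a + x *\<^sub>R u + y *\<^sub>R v)) (at y)"
        by (simp add: has_field_derivative_def o_def linear_scale[OF has_derivative_linear[OF df]]
              mult_commute_abs)
    qed
    then obtain y where y: "0 < y" "y < t"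
      "?fu (a + x *\<^sub>R u + t *\<^sub>R v) - ?fu (a + x *\<^sub>R u) = t * ?fuv (a + x *\<^sub>R u + y *\<^sub>R v)" by auto
    have "f (a + t *\<^sub>R u + t *\<^sub>R v) - f (a + t *\<^sub>R u) - f (a + t *\<^sub>R v) + f a = t\<^sup>2 * ?fuv (a + x *\<^sub>R u + y *\<^sub>R v)"
      using x(3) y(3) by (simp add: power2_eq_square)
    then show ?thesis
      using near[of x y] x y d(2)[of "a + x *\<^sub>R u + y *\<^sub>R v"] t by (simp add: dist_real_def)
  qed
  ultimately show ?thesis by blast
qed

lemma frechet_derivative_symmetric:
  fixes f :: "'a::real_normed_vector \<Rightarrow> real"
  assumes "open S" "smooth_on f S" "a \<in> S"
  shows "frechet_derivative (\<lambda>x. frechet_derivative f (at x) u) (at a) v =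
         frechet_derivative (\<lambda>x. frechet_derivative f (at x) v) (at a) u" (is "?l = ?r")
proof (rule ccontr)
  assume "?l \<noteq> ?r"
  then have e: "\<bar>?l - ?r\<bar> / 2 > 0" by simp
  let ?q = "\<lambda>t. (f (a + t *\<^sub>R u + t *\<^sub>R v) - f (a + t *\<^sub>R u) - f (a + t *\<^sub>R v) + f a) / t\<^sup>2"
  obtain d1 where d1: "d1 > 0" "\<And>t. 0 < t \<Longrightarrow> t < d1 \<Longrightarrow> \<bar>?q t - ?l\<bar> < \<bar>?l - ?r\<bar> / 2"
    using frechet_derivative_symmetric_aux[OF assms e, of u v] by blast
  obtain d2 where d2: "d2 > 0" "\<And>t. 0 < t \<Longrightarrow> t < d2 \<Longrightarrow>
      \<bar>(f (a + t *\<^sub>R v + t *\<^sub>R u) - f (a + t *\<^sub>R v) - f (a + t *\<^sub>R u) + f a) / t\<^sup>2 - ?r\<bar> < \<bar>?l - ?r\<bar> / 2"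
    using frechet_derivative_symmetric_aux[OF assms e, of v u] by blast
  have eq: "(f (a + t *\<^sub>R v + t *\<^sub>R u) - f (a + t *\<^sub>R v) - f (a + t *\<^sub>R u) + f a) / t\<^sup>2 = ?q t" for t
    by (simp add: add.commute add.left_commute algebra_simps)
  let ?t = "min d1 d2 / 2"
  have "\<bar>?q ?t - ?l\<bar> < \<bar>?l - ?r\<bar> / 2" "\<bar>?q ?t - ?r\<bar> < \<bar>?l - ?r\<bar> / 2"
    using d1(1) d2(1) d1(2)[of ?t] d2(2)[of ?t] unfolding eq by auto
  moreover have False if "\<bar>q - l\<bar> < \<bar>l - r\<bar> / 2" "\<bar>q - r\<bar> < \<bar>l - r\<bar> / 2" for q l r :: real
    using that by (auto simp: abs_if split: if_splits)
  ultimately show False by blast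
qed

text \<open>Differentiating under the integral brings down a factor \<open>t\<close> from the inner
  scaling, so the induction on the order of differentiability has to run over all weights
  \<open>t ^ m\<close> at once.\<close>

lemma Ck_on_ray_integral:
  fixes g :: "'a::euclidean_space \<Rightarrow> real"
  assumes "smooth_on g (ball a r)"
  shows "Ck_on k (\<lambda>x. integral {0..1} (\<lambda>t. t ^ m * g (a + t *\<^sub>R (x - a)))) (ball a r)"
  using assms
proof (induction k arbitrary: g m)
  let ?B = "ball a r"
  have ray: "a + t *\<^sub>R (x - a) \<in> ?B" if "x \<in> ?B" "t \<in> {0..1}" for x t
  proof -
    have "norm (t *\<^sub>R (x - a)) \<le> 1 * norm (x - a)"
      using that by (simp add: mult_left_le_one_le)
    then show ?thesis using that by (simp add: dist_norm norm_minus_commute)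
  qed
  have D: "((\<lambda>x. integral {0..1} (\<lambda>t. t ^ m * g (a + t *\<^sub>R (x - a)))) has_derivative
      (\<lambda>v. integral {0..1} (\<lambda>t. t ^ Suc m * frechet_derivative g (at (a + t *\<^sub>R (x - a))) v))) (at x)"
    if g: "smooth_on g ?B" and x: "x \<in> ?B" for g :: "'a \<Rightarrow> real" and m x
  proof -
    have dg: "(g has_derivative frechet_derivative g (at y)) (at y)" if "y \<in> ?B" for y
      by (rule smooth_on_has_derivative[OF open_ball g that])
    \<comment> \<open>\<open>leibniz_rule\<close> asks for a derivative that is jointly continuous
      as an operator-valued function, hence the wrapping into \<open>Blinfun\<close>. In finite
      dimension this continuity can be tested on basis directions.\<close>
    define F where "F y t = t ^ Suc m *\<^sub>R Blinfun (frechet_derivative g (at (a + t *\<^sub>R (y - a))))" for y t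
    have Fv: "blinfun_apply (F y t) v = t ^ Suc m * frechet_derivative g (at (a + t *\<^sub>R (y - a))) v"
      if "y \<in> ?B" "t \<in> {0..1}" for y t v
      using dg[OF ray[OF that]]
      by (simp add: F_def scaleR_blinfun.rep_eq bounded_linear_Blinfun_apply has_derivative_bounded_linear)
    have contray: "continuous_on (?B \<times> {0..1}) (\<lambda>(y, t). a + t *\<^sub>R (y - a))"
      by (auto intro!: continuous_intros simp: case_prod_unfold)
    have contF: "continuous_on (?B \<times> cbox 0 1) (\<lambda>(y, t). F y t)"
    proof (rule continuous_on_blinfun_componentwise)
      fix i :: 'a
      have "continuous_on ?B (\<lambda>y. frechet_derivative g (at y) i)"
        by (intro smooth_on_imp_continuous_on smooth_on_frechet g)
      then have "continuous_on (?B \<times> {0..1}) (\<lambda>p. frechet_derivative g (at ((\<lambda>(y, t). a + t *\<^sub>R (y - a)) p)) i)"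
        by (rule continuous_on_compose2[OF _ contray]) (use ray in auto)
      then have "continuous_on (?B \<times> {0..1})
         (\<lambda>p. snd p ^ Suc m * frechet_derivative g (at (a + snd p *\<^sub>R (fst p - a))) i)"
        by (intro continuous_intros) (simp add: case_prod_unfold)
      then show "continuous_on (?B \<times> cbox 0 1) (\<lambda>p. blinfun_apply (case p of (y, t) \<Rightarrow> F y t) i)"
        unfolding cbox_interval by (rule continuous_on_eq) (auto simp: Fv)
    qed
    have intF: "F x integrable_on cbox 0 1"
    proof (rule integrable_continuous)
      have "continuous_on (cbox 0 1) (\<lambda>t. (\<lambda>(y, t). F y t) (x, t))"
        by (rule continuous_on_compose2[OF contF]) (use x in \<open>auto intro!: continuous_intros\<close>)
      then show "continuous_on (cbox 0 1) (F x)" by simp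
    qed
    have A: "((\<lambda>x. integral (cbox 0 1) (\<lambda>t. t ^ m * g (a + t *\<^sub>R (x - a)))) has_derivative
        blinfun_apply (integral (cbox 0 1) (F x))) (at x within ?B)"
    proof (rule leibniz_rule[OF _ _ contF x convex_ball])
      fix y t assume yt: "y \<in> ?B" "t \<in> cbox (0::real) 1"
      then have t: "t \<in> {0..1}" by simp
      have "((\<lambda>y. a + t *\<^sub>R (y - a)) has_derivative (\<lambda>h. t *\<^sub>R h)) (at y)"
        by (auto intro!: derivative_eq_intros)
      from diff_chain_at[OF this dg[OF ray[OF yt(1) t]]]
      have "((\<lambda>y. g (a + t *\<^sub>R (y - a))) has_derivative
           (\<lambda>h. t * frechet_derivative g (at (a + t *\<^sub>R (y - a))) h)) (at y)"
        by (simp add: o_def linear_scale[OF has_derivative_linear[OF dg[OF ray[OF yt(1) t]]]])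
      then have "((\<lambda>y. t ^ m * g (a + t *\<^sub>R (y - a))) has_derivative
           (\<lambda>h. t ^ m * (t * frechet_derivative g (at (a + t *\<^sub>R (y - a))) h))) (at y)"
        by (rule has_derivative_mult_right)
      moreover have "(\<lambda>h. t ^ m * (t * frechet_derivative g (at (a + t *\<^sub>R (y - a))) h)) = blinfun_apply (F y t)"
        by (simp add: fun_eq_iff Fv[OF yt(1) t])
      ultimately show "((\<lambda>y. t ^ m * g (a + t *\<^sub>R (y - a))) has_derivative blinfun_apply (F y t)) (at y within ?B)"
        by (simp add: has_derivative_at_withinI)
    next
      fix y assume y: "y \<in> ?B"
      have "continuous_on {0..1} (\<lambda>t. g (a + t *\<^sub>R (y - a)))"
        by (rule continuous_on_compose2[OF smooth_on_imp_continuous_on[OF g]])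
           (use ray[OF y] in \<open>auto intro!: continuous_intros\<close>)
      then show "(\<lambda>t. t ^ m * g (a + t *\<^sub>R (y - a))) integrable_on cbox 0 1"
        by (intro integrable_continuous) (auto intro!: continuous_intros)
    qed
    have E: "blinfun_apply (integral (cbox 0 1) (F x)) v =
       integral {0..1} (\<lambda>t. t ^ Suc m * frechet_derivative g (at (a + t *\<^sub>R (x - a))) v)" for v
    proof -
      have "blinfun_apply (integral (cbox 0 1) (F x)) v = integral (cbox 0 1) (\<lambda>t. blinfun_apply (F x t) v)"
        by (rule blinfun_apply_integral[OF intF])
      also have "\<dots> = integral {0..1} (\<lambda>t. t ^ Suc m * frechet_derivative g (at (a + t *\<^sub>R (x - a))) v)"
        unfolding cbox_interval by (rule integral_cong) (use Fv[OF x] in auto)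
      finally show ?thesis .
    qed
    show ?thesis
      using A unfolding ext[of "blinfun_apply (integral (cbox 0 1) (F x))", OF E]
        at_within_open[OF x open_ball] unfolding cbox_interval .
  qed
  case 0
  show ?case
    using D[OF 0] by (auto intro!: continuous_at_imp_continuous_on has_derivative_continuous)
  case (Suc k)
  show ?case
    by (rule Ck_on_SucI[OF open_ball D[OF Suc.prems]], assumption)
       (rule Suc.IH[OF smooth_on_frechet[OF Suc.prems]])
qed

text \<open>The remainders are averages of the partial derivatives over the segment from
  \<open>a\<close> to \<open>x\<close>, by the fundamental theorem of calculus. As a consequence a
  derivation at \<open>a\<close> sees \<open>f\<close> only through its first partials.\<close>

lemma hadamard:
  fixes f :: "'a::euclidean_space \<Rightarrow> real"
  assumes "smooth_on f (ball a r)"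
  obtains h where "\<And>i. smooth_on (h i) (ball a r)"
    "\<And>x. x \<in> ball a r \<Longrightarrow> f x = f a + (\<Sum>i\<in>Basis. ((x - a) \<bullet> i) * h i x)"
    "\<And>i. r > 0 \<Longrightarrow> h i a = frechet_derivative f (at a) i"
proof
  let ?B = "ball a r"
  let ?h = "\<lambda>i x. integral {0..1} (\<lambda>t. t ^ 0 * frechet_derivative f (at (a + t *\<^sub>R (x - a))) i)"
  show "smooth_on (?h i) ?B" for i
    unfolding smooth_on_def using Ck_on_ray_integral[OF smooth_on_frechet[OF assms]] by blast
  show "?h i a = frechet_derivative f (at a) i" if "r > 0" for i by simp
  fix x assume x: "x \<in> ?B"
  have ray: "a + t *\<^sub>R (x - a) \<in> ?B" if "t \<in> {0..1}" for t
  proof -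
    have "norm (t *\<^sub>R (x - a)) \<le> 1 * norm (x - a)"
      using that by (simp add: mult_left_le_one_le)
    then show ?thesis using x by (simp add: dist_norm norm_minus_commute)
  qed
  note df = smooth_on_has_derivative[OF open_ball assms ray]
  let ?d = "\<lambda>i t. frechet_derivative f (at (a + t *\<^sub>R (x - a))) i"
  have "((\<lambda>t. f (a + t *\<^sub>R (x - a))) has_vector_derivative ?d (x - a) t) (at t within {0..1})"
    if "t \<in> {0..1}" for t
  proof -
    have "((\<lambda>t. a + t *\<^sub>R (x - a)) has_derivative (\<lambda>h. h *\<^sub>R (x - a))) (at t)"
      by (auto intro!: derivative_eq_intros)
    from diff_chain_at[OF this df[OF that]]
    have "((\<lambda>t. f (a + t *\<^sub>R (x - a))) has_vector_derivative ?d (x - a) t) (at t)"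
      by (simp add: has_vector_derivative_def o_def linear_scale[OF has_derivative_linear[OF df[OF that]]])
    then show ?thesis by (rule has_vector_derivative_at_within)
  qed
  then have "((\<lambda>t. ?d (x - a) t) has_integral
      (f (a + 1 *\<^sub>R (x - a)) - f (a + 0 *\<^sub>R (x - a)))) {0..1}"
    by (intro fundamental_theorem_of_calculus) auto
  then have "f x - f a = integral {0..1} (\<lambda>t. ?d (x - a) t)"
    by (simp add: integral_unique)
  also have "\<dots> = integral {0..1} (\<lambda>t. \<Sum>i\<in>Basis. ((x - a) \<bullet> i) * ?d i t)"
  proof (rule integral_cong)
    fix t :: real assume t: "t \<in> {0..1}"
    note lin = has_derivative_linear[OF df[OF t]]
    have "?d (x - a) t = ?d (\<Sum>i\<in>Basis. ((x - a) \<bullet> i) *\<^sub>R i) t"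
      by (simp only: euclidean_representation)
    then show "?d (x - a) t = (\<Sum>i\<in>Basis. ((x - a) \<bullet> i) * ?d i t)"
      by (simp only: linear_sum[OF lin] linear_scale[OF lin] real_scaleR_def)
  qed
  also have "\<dots> = (\<Sum>i\<in>Basis. integral {0..1} (\<lambda>t. ((x - a) \<bullet> i) * ?d i t))"
  proof (rule integral_sum)
    fix i :: 'a
    have "continuous_on {0..1} (\<lambda>t. ?d i t)"
      by (rule continuous_on_compose2[OF smooth_on_imp_continuous_on[OF smooth_on_frechet[OF assms]]])
         (use ray in \<open>auto intro!: continuous_intros\<close>)
    then show "(\<lambda>t. ((x - a) \<bullet> i) * ?d i t) integrable_on {0..1}"
      by (intro integrable_continuous_interval) (auto intro!: continuous_intros)
  qed simp
  finally show "f x = f a + (\<Sum>i\<in>Basis. ((x - a) \<bullet> i) * ?h i x)" by simp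
qed

section \<open>Smooth functions and tangent vectors on a manifold\<close>

text \<open>Charts are recorded through injectivity and the exchange of open sets, a form that can
  be verified for product atlases point by point.\<close>

locale smooth_atlas =
  fixes T :: "'a topology" and A :: "('a, 'e::euclidean_space) atlas"
  assumes hausdorff: "Hausdorff_space T"
    and chart_open: "(U, \<phi>) \<in> A \<Longrightarrow> openin T U"
    and chart_inj: "(U, \<phi>) \<in> A \<Longrightarrow> inj_on \<phi> U"
    and chart_openin_iff: "(U, \<phi>) \<in> A \<Longrightarrow> W \<subseteq> U \<Longrightarrow> openin T W \<longleftrightarrow> open (\<phi> ` W)"
    and chart_cover: "x \<in> topspace T \<Longrightarrow> \<exists>U \<phi>. (U, \<phi>) \<in> A \<and> x \<in> U"
    and chart_transition: "(U, \<phi>) \<in> A \<Longrightarrow> (V, \<psi>) \<in> A \<Longrightarrow>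
          smooth_on (\<psi> \<circ> inv_into U \<phi>) (\<phi> ` (U \<inter> V))"

lemma smooth_manifold_smooth_atlas:
  assumes "smooth_manifold T A"
  shows "smooth_atlas T A"
proof
  show "Hausdorff_space T" using assms by (simp add: smooth_manifold_def)
  fix U \<phi> assume c: "(U, \<phi>) \<in> A"
  have h: "homeomorphic_map (subtopology T U) (top_of_set (\<phi> ` U)) \<phi>" and o: "openin T U" "open (\<phi> ` U)"
    using c assms by (auto simp: smooth_manifold_def)
  then have top: "topspace (subtopology T U) = U"
    using openin_subset[OF o(1)] by auto
  show "openin T U" by fact
  show inj: "inj_on \<phi> U"
    using h top by (simp add: homeomorphic_eq_everything_map)
  show "openin T W \<longleftrightarrow> open (\<phi> ` W)" if "W \<subseteq> U" for W
  proof -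
    have "openin T W \<longleftrightarrow> openin (subtopology T U) W"
      using o(1) that by (simp add: openin_open_subtopology)
    also have "\<dots> \<longleftrightarrow> openin (top_of_set (\<phi> ` U)) (\<phi> ` W)"
      using homeomorphic_map_openness[OF h, of W] top that by auto
    also have "\<dots> \<longleftrightarrow> open (\<phi> ` W)"
      using o(2) that openin_open_eq[of "\<phi> ` U" "\<phi> ` W"] by auto
    finally show ?thesis .
  qed
  fix V \<psi> assume d: "(V, \<psi>) \<in> A"
  have "\<forall>(U, \<phi>)\<in>A. \<forall>(V, \<psi>)\<in>A. smooth_on (\<psi> \<circ> inv_into U \<phi>) (\<phi> ` (U \<inter> V))"
    using assms by (simp add: smooth_manifold_def)
  from bspec[OF this c] have "\<forall>(V, \<psi>)\<in>A. smooth_on (\<psi> \<circ> inv_into U \<phi>) (\<phi> ` (U \<inter> V))"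
    by simp
  from bspec[OF this d] show "smooth_on (\<psi> \<circ> inv_into U \<phi>) (\<phi> ` (U \<inter> V))"
    by simp
next
  fix x assume "x \<in> topspace T"
  then have "x \<in> (\<Union>(U, \<phi>)\<in>A. U)" using assms by (simp add: smooth_manifold_def)
  then show "\<exists>U \<phi>. (U, \<phi>) \<in> A \<and> x \<in> U" by auto
qed

context smooth_atlas
begin

abbreviation "C \<equiv> smooth_functions T A"

lemma chart_image_open: "(U, \<phi>) \<in> A \<Longrightarrow> open (\<phi> ` U)"
  using chart_open chart_openin_iff by blast

lemma chart_image_Int_open: "(U, \<phi>) \<in> A \<Longrightarrow> openin T W \<Longrightarrow> open (\<phi> ` (U \<inter> W))"
  using chart_open chart_openin_iff[of U \<phi> "U \<inter> W"] by blast

lemma chart_preimage_open: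
  assumes "(U, \<phi>) \<in> A" "open S"
  shows "openin T {x \<in> U. \<phi> x \<in> S}"
proof -
  have "\<phi> ` {x \<in> U. \<phi> x \<in> S} = \<phi> ` U \<inter> S" by auto
  then show ?thesis
    using assms chart_image_open chart_openin_iff[of U \<phi> "{x \<in> U. \<phi> x \<in> S}"] by auto
qed

lemma chart_subset: "(U, \<phi>) \<in> A \<Longrightarrow> x \<in> U \<Longrightarrow> x \<in> topspace T"
  using chart_open openin_subset by blast

lemma chart_inv [simp]: "(U, \<phi>) \<in> A \<Longrightarrow> x \<in> U \<Longrightarrow> inv_into U \<phi> (\<phi> x) = x"
  by (simp add: chart_inj)

lemma smooth_functions_outside: "f \<in> C \<Longrightarrow> x \<notin> topspace T \<Longrightarrow> f x = 0"
  by (simp add: smooth_functions_def)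

lemma smooth_functions_chart:
  "f \<in> C \<Longrightarrow> (U, \<phi>) \<in> A \<Longrightarrow> smooth_on (f \<circ> inv_into U \<phi>) (\<phi> ` U)"
  by (auto simp: smooth_functions_def)

text \<open>Transition maps carry smoothness from one chart to every other, so one suitable chart
  around each point suffices.\<close>

lemma smooth_functions_localI:
  assumes out: "\<And>x. x \<notin> topspace T \<Longrightarrow> f x = 0"
    and loc: "\<And>p. p \<in> topspace T \<Longrightarrow> \<exists>U \<phi> W. (U, \<phi>) \<in> A \<and> openin T W \<and> p \<in> W \<and> W \<subseteq> U \<and>
        smooth_on (f \<circ> inv_into U \<phi>) (\<phi> ` W)"
  shows "f \<in> C"
proof -
  have "smooth_on (f \<circ> inv_into V \<psi>) (\<psi> ` V)" if V: "(V, \<psi>) \<in> A" for V \<psi>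
  proof (rule smooth_on_local[OF chart_image_open[OF V]])
    fix s assume "s \<in> \<psi> ` V"
    then obtain p where p: "p \<in> V" "s = \<psi> p" by blast
    obtain U \<phi> W where W: "(U, \<phi>) \<in> A" "openin T W" "p \<in> W" "W \<subseteq> U"
        "smooth_on (f \<circ> inv_into U \<phi>) (\<phi> ` W)"
      using loc chart_subset[OF V p(1)] by blast
    have o: "open (\<psi> ` (V \<inter> W))" by (rule chart_image_Int_open[OF V W(2)])
    have oW: "open (\<phi> ` W)" using W chart_openin_iff by blast
    have "smooth_on (\<phi> \<circ> inv_into V \<psi>) (\<psi> ` (V \<inter> W))"
      by (rule smooth_on_subset[OF chart_transition[OF V W(1)]]) (use W(4) in auto)
    moreover have "(\<phi> \<circ> inv_into V \<psi>) ` \<psi> ` (V \<inter> W) \<subseteq> \<phi> ` W" using V by auto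
    ultimately have "smooth_on (\<lambda>s. (f \<circ> inv_into U \<phi>) ((\<phi> \<circ> inv_into V \<psi>) s)) (\<psi> ` (V \<inter> W))"
      using smooth_on_compose[OF o oW _ _ W(5)] by blast
    then have "smooth_on (f \<circ> inv_into V \<psi>) (\<psi> ` (V \<inter> W))"
      by (rule smooth_on_cong[OF o, rotated]) (use V W(1,4) in auto)
    then have "smooth_on (f \<circ> inv_into V \<psi>) (\<psi> ` (V \<inter> W) \<inter> \<psi> ` V)"
      by (rule smooth_on_subset) auto
    then show "\<exists>S. open S \<and> s \<in> S \<and> smooth_on (f \<circ> inv_into V \<psi>) (S \<inter> \<psi> ` V)"
      using o p W(3) by blast
  qed
  then show ?thesis using out by (auto simp: smooth_functions_def)
qed

lemma smooth_functions_eq_localI: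
  assumes out: "\<And>x. x \<notin> topspace T \<Longrightarrow> f x = 0"
    and loc: "\<And>p. p \<in> topspace T \<Longrightarrow> \<exists>W F. openin T W \<and> p \<in> W \<and> F \<in> C \<and> (\<forall>x\<in>W. f x = F x)"
  shows "f \<in> C"
proof (rule smooth_functions_localI[OF out])
  fix p assume "p \<in> topspace T"
  then obtain W F U \<phi> where *: "openin T W" "p \<in> W" "F \<in> C" "\<forall>x\<in>W. f x = F x" "(U, \<phi>) \<in> A" "p \<in> U"
    using loc chart_cover by metis
  have o: "open (\<phi> ` (U \<inter> W))" by (rule chart_image_Int_open[OF *(5,1)])
  have "smooth_on (F \<circ> inv_into U \<phi>) (\<phi> ` (U \<inter> W))"
    by (rule smooth_on_subset[OF smooth_functions_chart[OF *(3,5)]]) auto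
  then have "smooth_on (f \<circ> inv_into U \<phi>) (\<phi> ` (U \<inter> W))"
    by (rule smooth_on_cong[OF o, rotated]) (use * in auto)
  then show "\<exists>U \<phi> W. (U, \<phi>) \<in> A \<and> openin T W \<and> p \<in> W \<and> W \<subseteq> U \<and> smooth_on (f \<circ> inv_into U \<phi>) (\<phi> ` W)"
    using * chart_open by (intro exI[of _ U] exI[of _ \<phi>] exI[of _ "U \<inter> W"]) auto
qed auto

lemma smooth_functions_const: "(\<lambda>x. if x \<in> topspace T then c else 0) \<in> C"
proof (rule smooth_functions_localI)
  fix p assume "p \<in> topspace T"
  then obtain U \<phi> where U: "(U, \<phi>) \<in> A" "p \<in> U" using chart_cover by blast
  have "smooth_on (\<lambda>s. c) (\<phi> ` U)" by (rule smooth_on_const[OF chart_image_open[OF U(1)]])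
  then have "smooth_on ((\<lambda>x. if x \<in> topspace T then c else 0) \<circ> inv_into U \<phi>) (\<phi> ` U)"
    by (rule smooth_on_cong[OF chart_image_open[OF U(1)], rotated]) (use U chart_subset in auto)
  then show "\<exists>U \<phi> W. (U, \<phi>) \<in> A \<and> openin T W \<and> p \<in> W \<and> W \<subseteq> U \<and>
      smooth_on ((\<lambda>x. if x \<in> topspace T then c else 0) \<circ> inv_into U \<phi>) (\<phi> ` W)"
    using U chart_open by blast
qed auto

lemma smooth_functions_0: "(\<lambda>x. 0) \<in> C"
  using smooth_functions_const[of 0] by simp

lemma smooth_functionsI:
  assumes "\<And>x. x \<notin> topspace T \<Longrightarrow> f x = 0"
    and "\<And>U \<phi>. (U, \<phi>) \<in> A \<Longrightarrow> smooth_on (f \<circ> inv_into U \<phi>) (\<phi> ` U)"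
  shows "f \<in> C"
  using assms by (auto simp: smooth_functions_def)

lemma smooth_functions_add:
  assumes "f \<in> C" "h \<in> C"
  shows "(\<lambda>x. f x + h x) \<in> C"
proof (rule smooth_functionsI)
  fix U \<phi> assume U: "(U, \<phi>) \<in> A"
  show "smooth_on ((\<lambda>x. f x + h x) \<circ> inv_into U \<phi>) (\<phi> ` U)"
    using smooth_on_add[OF chart_image_open[OF U] smooth_functions_chart[OF assms(1) U]
        smooth_functions_chart[OF assms(2) U]] by (simp add: o_def)
qed (simp add: assms smooth_functions_outside)

lemma smooth_functions_mult:
  assumes "f \<in> C" "h \<in> C"
  shows "(\<lambda>x. f x * h x) \<in> C"
proof (rule smooth_functionsI)
  fix U \<phi> assume U: "(U, \<phi>) \<in> A"
  show "smooth_on ((\<lambda>x. f x * h x) \<circ> inv_into U \<phi>) (\<phi> ` U)"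
    using smooth_on_mult[OF chart_image_open[OF U] smooth_functions_chart[OF assms(1) U]
        smooth_functions_chart[OF assms(2) U]] by (simp add: o_def)
qed (simp add: assms smooth_functions_outside)

lemma smooth_functions_scale:
  assumes "f \<in> C"
  shows "(\<lambda>x. c * f x) \<in> C"
proof -
  have "(\<lambda>x. (if x \<in> topspace T then c else 0) * f x) \<in> C"
    by (rule smooth_functions_mult[OF smooth_functions_const assms])
  moreover have "(\<lambda>x. (if x \<in> topspace T then c else 0) * f x) = (\<lambda>x. c * f x)"
    using smooth_functions_outside[OF assms] by auto
  ultimately show ?thesis by simp
qed

lemma smooth_functions_diff: "f \<in> C \<Longrightarrow> h \<in> C \<Longrightarrow> (\<lambda>x. f x - h x) \<in> C"
  using smooth_functions_add[of f "\<lambda>x. (-1) * h x"] smooth_functions_scale[of h "-1"] by simp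

lemma smooth_functions_sum: "(\<And>i. i \<in> I \<Longrightarrow> F i \<in> C) \<Longrightarrow> (\<lambda>x. \<Sum>i\<in>I. F i x) \<in> C"
  by (induction I rule: infinite_finite_induct) (auto intro: smooth_functions_0 smooth_functions_add)

text \<open>The issue is smoothness outside the chart ball. The closed ball that contains the
  support of \<open>b\<close> has compact preimage, which is closed because the space is Hausdorff,
  so the extension vanishes near every remaining point.\<close>

lemma chart_extension:
  assumes U: "(U, \<phi>) \<in> A" and r: "r > 0" "ball a r \<subseteq> \<phi> ` U"
    and b: "smooth_on b (ball a r)" "\<And>s. s \<notin> ball a (r / 2) \<Longrightarrow> b s = 0"
  shows "(\<lambda>x. if x \<in> U then b (\<phi> x) else 0) \<in> C" (is "?f \<in> C")
proof (rule smooth_functions_localI)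
  show "?f x = 0" if "x \<notin> topspace T" for x using that chart_subset[OF U] by auto
  fix p assume p: "p \<in> topspace T"
  let ?i = "inv_into U \<phi>"
  let ?K = "?i ` cball a (r / 2)"
  have sub: "cball a (r / 2) \<subseteq> \<phi> ` U" using r by (auto simp: subset_iff)
  have ci: "continuous_map (top_of_set (\<phi> ` U)) T ?i"
    unfolding continuous_map_def
  proof (intro conjI allI impI)
    show "?i \<in> topspace (top_of_set (\<phi> ` U)) \<rightarrow> topspace T"
      using U chart_subset by auto
    fix W assume "openin T W"
    have "{s \<in> \<phi> ` U. ?i s \<in> W} = \<phi> ` (U \<inter> W)" using U by auto
    then show "openin (top_of_set (\<phi> ` U)) {x \<in> topspace (top_of_set (\<phi> ` U)). ?i x \<in> W}"
      using chart_image_Int_open[OF U \<open>openin T W\<close>] chart_image_open[OF U]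
      by (auto simp: openin_open_eq)
  qed
  have "compactin (top_of_set (\<phi> ` U)) (cball a (r / 2))"
    using sub by (simp add: compactin_subtopology)
  then have "closedin T ?K"
    using ci hausdorff by (intro compactin_imp_closedin image_compactin)
  then have oK: "openin T (topspace T - ?K)" by blast
  show "\<exists>U \<phi> W. (U, \<phi>) \<in> A \<and> openin T W \<and> p \<in> W \<and> W \<subseteq> U \<and> smooth_on (?f \<circ> inv_into U \<phi>) (\<phi> ` W)"
  proof (cases "p \<in> U \<and> \<phi> p \<in> ball a r")
    case True
    let ?W = "{x \<in> U. \<phi> x \<in> ball a r}"
    have im: "\<phi> ` ?W = ball a r" using r(2) by auto
    have "b s = (?f \<circ> ?i) s" if "s \<in> ball a r" for s
    proof -
      have "s \<in> \<phi> ` U" using that r(2) by blast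
      then show ?thesis by (simp add: f_inv_into_f inv_into_into)
    qed
    then have "smooth_on (?f \<circ> ?i) (\<phi> ` ?W)"
      unfolding im by (rule smooth_on_cong[OF open_ball _ b(1)])
    then show ?thesis
      using U True chart_preimage_open[OF U open_ball, of a r] by blast
  next
    case False
    obtain V \<psi> where V: "(V, \<psi>) \<in> A" "p \<in> V" using p chart_cover by blast
    have "p \<notin> ?K"
      using False sub r(1) by (auto simp: f_inv_into_f inv_into_into subset_iff)
    let ?W = "V \<inter> (topspace T - ?K)"
    have "?f x = 0" if "x \<in> ?W" for x
    proof (cases "x \<in> U")
      case True
      then have "\<phi> x \<notin> cball a (r / 2)"
        using that U by (metis DiffD2 IntD2 chart_inv image_eqI)
      then show ?thesis using b(2)[of "\<phi> x"] by auto
    qed auto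
    then have z: "?f x = 0" if "x \<in> V" "x \<in> topspace T - ?K" for x using that by blast
    have "smooth_on (\<lambda>_. 0::real) (\<psi> ` ?W)"
      by (rule smooth_on_const[OF chart_image_Int_open[OF V(1) oK]])
    then have "smooth_on (?f \<circ> inv_into V \<psi>) (\<psi> ` ?W)"
      by (rule smooth_on_cong[OF chart_image_Int_open[OF V(1) oK], rotated]) (use V z in force)
    moreover have "openin T ?W" using oK V chart_open by blast
    ultimately show ?thesis using V \<open>p \<notin> ?K\<close> p by blast
  qed
qed

lemma exists_smooth_bump:
  assumes "openin T W" "p \<in> W"
  obtains \<beta> where "\<beta> \<in> C" "\<beta> p = 1" "\<And>x. x \<notin> W \<Longrightarrow> \<beta> x = 0"
proof -
  obtain U \<phi> where U: "(U, \<phi>) \<in> A" "p \<in> U"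
    using assms chart_cover openin_subset by blast
  obtain r where r: "r > 0" "ball (\<phi> p) r \<subseteq> \<phi> ` (U \<inter> W)"
    using chart_image_Int_open[OF U(1) assms(1)] U(2) assms(2) open_contains_ball by blast
  obtain b :: "'e \<Rightarrow> real" where b: "smooth_on b UNIV" "b (\<phi> p) = 1" "\<And>s. s \<notin> ball (\<phi> p) (r / 2) \<Longrightarrow> b s = 0"
    using exists_bump[of "r / 2" "\<phi> p"] r by auto
  show thesis
  proof
    show "(\<lambda>x. if x \<in> U then b (\<phi> x) else 0) \<in> C"
      by (rule chart_extension[OF U(1) r(1)]) (use r b in \<open>auto intro: smooth_on_subset\<close>)
    show "(if p \<in> U then b (\<phi> p) else 0) = 1" using U b by simp
    show "(if x \<in> U then b (\<phi> x) else 0) = 0" if "x \<notin> W" for x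
    proof (cases "x \<in> U")
      case True
      have "\<phi> x \<notin> ball (\<phi> p) r"
      proof
        assume "\<phi> x \<in> ball (\<phi> p) r"
        then obtain y where "y \<in> U \<inter> W" "\<phi> x = \<phi> y" using r(2) by blast
        then show False using True that chart_inj[OF U(1)] by (auto dest: inj_onD)
      qed
      then have "\<phi> x \<notin> ball (\<phi> p) (r / 2)" using r(1) by auto
      then show ?thesis using b(3) by auto
    qed auto
  qed
qed

end

subsection \<open>Derivations\<close>

lemma tangent_lincomb:
  "v \<in> tangent_space C p \<Longrightarrow> f \<in> C \<Longrightarrow> h \<in> C \<Longrightarrow> v (\<lambda>x. a * f x + b * h x) = a * v f + b * v h"
  and tangent_mult: "v \<in> tangent_space C p \<Longrightarrow> f \<in> C \<Longrightarrow> h \<in> C \<Longrightarrow> v (\<lambda>x. f x * h x) = v f * h p + f p * v h"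
  and tangent_outside: "v \<in> tangent_space C p \<Longrightarrow> f \<notin> C \<Longrightarrow> v f = 0"
  by (simp_all add: tangent_space_def)

lemma tangent_add: "v \<in> tangent_space C p \<Longrightarrow> f \<in> C \<Longrightarrow> h \<in> C \<Longrightarrow> v (\<lambda>x. f x + h x) = v f + v h"
  using tangent_lincomb[of v C p f h 1 1] by simp

lemma tangent_diff: "v \<in> tangent_space C p \<Longrightarrow> f \<in> C \<Longrightarrow> h \<in> C \<Longrightarrow> v (\<lambda>x. f x - h x) = v f - v h"
  using tangent_lincomb[of v C p f h 1 "-1"] by simp

lemma tangent_scale: "v \<in> tangent_space C p \<Longrightarrow> f \<in> C \<Longrightarrow> v (\<lambda>x. a * f x) = a * v f"
  using tangent_lincomb[of v C p f f a 0] by simp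

lemma tangent_eqI:
  assumes "u \<in> tangent_space C p" "v \<in> tangent_space C p" "\<And>f. f \<in> C \<Longrightarrow> u f = v f"
  shows "u = v"
  using assms tangent_outside by (metis ext)

lemma subspace_tangent_space: "subspace (tangent_space C p)"
  unfolding subspace_def tangent_space_def
  by (auto simp: scaleR_fun_def algebra_simps)

context smooth_atlas
begin

lemma tangent_0: "v \<in> tangent_space C p \<Longrightarrow> v (\<lambda>x. 0) = 0"
  using tangent_scale[of v C p "\<lambda>x. 0" 0] smooth_functions_0 by simp

lemma tangent_sum:
  assumes "v \<in> tangent_space C p" "\<And>i. i \<in> I \<Longrightarrow> F i \<in> C"
  shows "v (\<lambda>x. \<Sum>i\<in>I. F i x) = (\<Sum>i\<in>I. v (F i))"
  using assms(2)
  by (induction I rule: infinite_finite_induct)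
     (auto simp: tangent_0[OF assms(1)] tangent_add[OF assms(1) _ smooth_functions_sum])

lemma tangent_const:
  assumes "v \<in> tangent_space C p" "p \<in> topspace T"
  shows "v (\<lambda>x. if x \<in> topspace T then c else 0) = 0"
proof -
  let ?k = "\<lambda>c x. if x \<in> topspace T then c else (0::real)"
  \<comment> \<open>The unit of the algebra is idempotent, so the Leibniz rule makes its derivative
    equal to twice itself.\<close>
  have "v (?k 1) = v (\<lambda>x. ?k 1 x * ?k 1 x)" by (rule arg_cong[where f = v]) auto
  also have "\<dots> = v (?k 1) + v (?k 1)"
    using tangent_mult[OF assms(1) smooth_functions_const smooth_functions_const, of 1 1] assms(2) by simp
  finally have "v (?k 1) = 0" by simp
  moreover have "?k c = (\<lambda>x. c * ?k 1 x)" by auto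
  ultimately show ?thesis
    using tangent_scale[OF assms(1) smooth_functions_const[of 1], of c] by simp
qed

text \<open>A bump \<open>\<beta>\<close> that vanishes off \<open>W\<close> annihilates f - h. The
  Leibniz rule then isolates v (f - h), since f - h vanishes at \<open>p\<close> and
  \<open>\<beta>\<close> is 1 there.\<close>

lemma tangent_local:
  assumes v: "v \<in> tangent_space C p" and W: "openin T W" "p \<in> W"
    and f: "f \<in> C" "h \<in> C" "\<And>x. x \<in> W \<Longrightarrow> f x = h x"
  shows "v f = v h"
proof -
  obtain \<beta> where b: "\<beta> \<in> C" "\<beta> p = 1" "\<And>x. x \<notin> W \<Longrightarrow> \<beta> x = 0"
    using exists_smooth_bump[OF W] by blast
  let ?d = "\<lambda>x. f x - h x"
  have d: "?d \<in> C" by (rule smooth_functions_diff[OF f(1,2)])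
  have "(\<lambda>x. \<beta> x * ?d x) = (\<lambda>x. 0)" using b(3) f(3) by (metis diff_self mult_eq_0_iff)
  then have "0 = v \<beta> * ?d p + \<beta> p * v ?d"
    using tangent_mult[OF v b(1) d] tangent_0[OF v] by simp
  then have "v ?d = 0" using f(3)[OF W(2)] b(2) by simp
  then show ?thesis using tangent_diff[OF v f(1,2)] by simp
qed

lemma coordinate_derivation:
  assumes U: "(U, \<phi>) \<in> A" "p \<in> U"
  shows "(\<lambda>f. if f \<in> C then frechet_derivative (f \<circ> inv_into U \<phi>) (at (\<phi> p)) c else 0) \<in> tangent_space C p"
proof -
  have D: "((f \<circ> inv_into U \<phi>) has_derivative frechet_derivative (f \<circ> inv_into U \<phi>) (at (\<phi> p))) (at (\<phi> p))"
    if "f \<in> C" for f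
    by (rule smooth_on_has_derivative[OF chart_image_open[OF U(1)] smooth_functions_chart[OF that U(1)]])
       (use U in auto)
  have l: "frechet_derivative ((\<lambda>x. a * f x + b * h x) \<circ> inv_into U \<phi>) (at (\<phi> p)) c =
     a * frechet_derivative (f \<circ> inv_into U \<phi>) (at (\<phi> p)) c
     + b * frechet_derivative (h \<circ> inv_into U \<phi>) (at (\<phi> p)) c" if "f \<in> C" "h \<in> C" for f h a b
  proof -
    have "((\<lambda>x. a * (f \<circ> inv_into U \<phi>) x + b * (h \<circ> inv_into U \<phi>) x) has_derivative
       (\<lambda>c. a * frechet_derivative (f \<circ> inv_into U \<phi>) (at (\<phi> p)) c
     + b * frechet_derivative (h \<circ> inv_into U \<phi>) (at (\<phi> p)) c)) (at (\<phi> p))"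
      by (intro has_derivative_add has_derivative_mult_right D that)
    from frechet_derivative_at[OF this] show ?thesis by (simp add: o_def fun_eq_iff)
  qed
  have m: "frechet_derivative ((\<lambda>x. f x * h x) \<circ> inv_into U \<phi>) (at (\<phi> p)) c =
     frechet_derivative (f \<circ> inv_into U \<phi>) (at (\<phi> p)) c * h p
     + f p * frechet_derivative (h \<circ> inv_into U \<phi>) (at (\<phi> p)) c" if "f \<in> C" "h \<in> C" for f h
    using frechet_derivative_at[OF has_derivative_mult[OF D[OF that(1)] D[OF that(2)]]] U
    by (simp add: o_def fun_eq_iff add.commute)
  show ?thesis
    unfolding tangent_space_def mem_Collect_eq
  proof (intro conjI ballI allI impI)
    fix f h a b assume fh: "f \<in> C" "h \<in> C"
    have "(\<lambda>x. a * f x + b * h x) \<in> C"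
      by (intro smooth_functions_add smooth_functions_scale fh)
    then show "(if (\<lambda>x. a * f x + b * h x) \<in> C then frechet_derivative ((\<lambda>x. a * f x + b * h x) \<circ> inv_into U \<phi>) (at (\<phi> p)) c else 0) =
       a * (if f \<in> C then frechet_derivative (f \<circ> inv_into U \<phi>) (at (\<phi> p)) c else 0)
       + b * (if h \<in> C then frechet_derivative (h \<circ> inv_into U \<phi>) (at (\<phi> p)) c else 0)"
      using fh l[OF fh] by simp
  next
    fix f h assume fh: "f \<in> C" "h \<in> C"
    show "(if (\<lambda>x. f x * h x) \<in> C then frechet_derivative ((\<lambda>x. f x * h x) \<circ> inv_into U \<phi>) (at (\<phi> p)) c else 0) =
       (if f \<in> C then frechet_derivative (f \<circ> inv_into U \<phi>) (at (\<phi> p)) c else 0) * h p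
       + f p * (if h \<in> C then frechet_derivative (h \<circ> inv_into U \<phi>) (at (\<phi> p)) c else 0)"
      using fh m[OF fh] smooth_functions_mult[OF fh] by simp
  qed simp
qed

text \<open>Hadamard's remainders exist only near \<open>p\<close>; their cut-off versions live in
  the global algebra. With them every derivation is determined by its values on the finitely many
  functions \<open>X i\<close> with \<open>i\<close> in \<open>Basis\<close>, hence is a directional
  derivative in the chart.\<close>

lemma coordinate_functions:
  assumes U: "(U, \<phi>) \<in> A" "p \<in> U"
  obtains X where "\<And>i. X i \<in> C"
    "\<And>i c. frechet_derivative (X i \<circ> inv_into U \<phi>) (at (\<phi> p)) c = c \<bullet> i"
    "\<And>v f. v \<in> tangent_space C p \<Longrightarrow> f \<in> C \<Longrightarrow>
       v f = (\<Sum>i\<in>Basis. v (X i) * frechet_derivative (f \<circ> inv_into U \<phi>) (at (\<phi> p)) i)"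
proof -
  let ?a = "\<phi> p"
  obtain r where r: "r > 0" "ball ?a r \<subseteq> \<phi> ` U"
    using chart_image_open[OF U(1)] U(2) open_contains_ball by blast
  obtain b :: "'e \<Rightarrow> real" where b: "smooth_on b UNIV" "b ?a = 1" "\<And>s. s \<notin> ball ?a (r / 2) \<Longrightarrow> b s = 0"
    using exists_bump[of "r / 2" ?a] r by auto
  have sub: "smooth_on (\<lambda>s. (s - ?a) \<bullet> i) S" if "open S" for i S
    using smooth_on_linear_image[OF that bounded_linear_inner_left[of i] smooth_on_add[OF that
       smooth_on_bounded_linear[OF that bounded_linear_ident] smooth_on_const[OF that, of "- ?a"]]]
    by simp
  have bB: "smooth_on b (ball ?a r)" by (rule smooth_on_subset[OF b(1)]) auto
  define X where "X i x = (if x \<in> U then b (\<phi> x) * ((\<phi> x - ?a) \<bullet> i) else 0)" for i x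
  have X: "X i \<in> C" for i
    unfolding X_def
    by (rule chart_extension[OF U(1) r smooth_on_mult[OF open_ball bB sub[OF open_ball]]])
       (use b(3) in auto)
  have DX: "frechet_derivative (X i \<circ> inv_into U \<phi>) (at ?a) c = c \<bullet> i" for i c
  proof -
    have db: "(b has_derivative frechet_derivative b (at ?a)) (at ?a)"
      by (rule smooth_on_has_derivative[OF open_UNIV b(1)]) simp
    have dl: "((\<lambda>s. (s - ?a) \<bullet> i) has_derivative (\<lambda>c. c \<bullet> i)) (at ?a)"
      by (auto intro!: derivative_eq_intros)
    have "((\<lambda>s. b s * ((s - ?a) \<bullet> i)) has_derivative (\<lambda>c. c \<bullet> i)) (at ?a)"
      using has_derivative_mult[OF db dl] b(2) by simp
    moreover have "b s * ((s - ?a) \<bullet> i) = (X i \<circ> inv_into U \<phi>) s" if "s \<in> \<phi> ` U" for s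
      using that U(1) by (auto simp: X_def)
    ultimately have "((X i \<circ> inv_into U \<phi>) has_derivative (\<lambda>c. c \<bullet> i)) (at ?a)"
      using has_derivative_transform_within_open chart_image_open[OF U(1)] U(2) by blast
    from frechet_derivative_at[OF this] show ?thesis by metis
  qed
  define B where "B x = (if x \<in> U then b (\<phi> x) else 0)" for x
  have B: "B \<in> C"
    unfolding B_def by (rule chart_extension[OF U(1) r bB b(3)])
  have Bp: "B p = 1" using U b(2) by (simp add: B_def)
  have main: "v f = (\<Sum>i\<in>Basis. v (X i) * frechet_derivative (f \<circ> inv_into U \<phi>) (at ?a) i)"
    if v: "v \<in> tangent_space C p" and f: "f \<in> C" for v f
  proof -
    let ?F = "f \<circ> inv_into U \<phi>"
    have sm: "smooth_on ?F (ball ?a r)"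
      by (rule smooth_on_subset[OF smooth_functions_chart[OF f U(1)] r(2)])
    obtain h where h: "\<And>i. smooth_on (h i) (ball ?a r)"
      "\<And>x. x \<in> ball ?a r \<Longrightarrow> ?F x = ?F ?a + (\<Sum>i\<in>Basis. ((x - ?a) \<bullet> i) * h i x)"
      "\<And>i. r > 0 \<Longrightarrow> h i ?a = frechet_derivative ?F (at ?a) i"
    proof (rule hadamard[OF sm], goal_cases)
      case (1 h)
      from 1(2-4) show ?case by (rule that)
    qed
    define Y where "Y i x = (if x \<in> U then b (\<phi> x) * h i (\<phi> x) else 0)" for i x
    have Y: "Y i \<in> C" for i
      unfolding Y_def
      by (rule chart_extension[OF U(1) r smooth_on_mult[OF open_ball bB h(1)]]) (use b(3) in auto)
    have Yp: "Y i p = frechet_derivative ?F (at ?a) i" for i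
      using U b(2) h(3) r(1) by (simp add: Y_def)
    have Xp: "X i p = 0" for i by (simp add: X_def)
    have BB: "(\<lambda>x. B x * B x) \<in> C" by (rule smooth_functions_mult[OF B B])
    have XY: "(\<lambda>x. X i x * Y i x) \<in> C" for i by (rule smooth_functions_mult[OF X Y])
    \<comment> \<open>\<open>B\<close> enters squared because each \<open>X i\<close> and each
      \<open>Y i\<close> carries one factor \<open>b\<close>. When \<open>v\<close> is applied, the
      derivatives of the square of \<open>B\<close> cancel and \<open>v f\<close> remains.\<close>
    have eq: "B x * B x * f x = f p * (B x * B x) + (\<Sum>i\<in>Basis. X i x * Y i x)" for x
    proof (cases "x \<in> U \<and> \<phi> x \<in> ball ?a r")
      case True
      then have "f x = f p + (\<Sum>i\<in>Basis. ((\<phi> x - ?a) \<bullet> i) * h i (\<phi> x))"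
        using h(2)[of "\<phi> x"] U by simp
      then show ?thesis
        using True by (simp add: B_def X_def Y_def sum_distrib_left algebra_simps)
    next
      case False
      then have "B x = 0" "X i x = 0" for i
        using b(3)[of "\<phi> x"] r(1) by (auto simp: B_def X_def)
      then show ?thesis by simp
    qed
    have "v (\<lambda>x. B x * B x * f x) = v (\<lambda>x. B x * B x) * f p + v f"
      using tangent_mult[OF v BB f] Bp by simp
    moreover have "v (\<lambda>x. B x * B x * f x) = f p * v (\<lambda>x. B x * B x) + (\<Sum>i\<in>Basis. v (\<lambda>x. X i x * Y i x))"
      unfolding eq
      by (simp add: tangent_add[OF v smooth_functions_scale[OF BB] smooth_functions_sum[OF XY]]
           tangent_scale[OF v BB] tangent_sum[OF v XY])
    moreover have "v (\<lambda>x. X i x * Y i x) = v (X i) * frechet_derivative ?F (at ?a) i" for i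
      using tangent_mult[OF v X Y] Xp Yp by simp
    ultimately show ?thesis by simp
  qed
  show thesis using that[OF X DX main] .
qed

lemma tangent_eq_frechet_derivative:
  assumes U: "(U, \<phi>) \<in> A" "p \<in> U" and v: "v \<in> tangent_space C p"
  shows "\<exists>c. \<forall>f\<in>C. v f = frechet_derivative (f \<circ> inv_into U \<phi>) (at (\<phi> p)) c"
proof -
  obtain X where "\<And>i. X i \<in> C"
    "\<And>i c. frechet_derivative (X i \<circ> inv_into U \<phi>) (at (\<phi> p)) c = c \<bullet> i"
    and X: "\<And>v f. v \<in> tangent_space C p \<Longrightarrow> f \<in> C \<Longrightarrow>
       v f = (\<Sum>i\<in>Basis. v (X i) * frechet_derivative (f \<circ> inv_into U \<phi>) (at (\<phi> p)) i)"
  proof (rule coordinate_functions[OF U], goal_cases)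
    case (1 X)
    from 1(2-4) show ?case by (rule that)
  qed
  show ?thesis
  proof (intro exI ballI)
    fix f assume f: "f \<in> C"
    have "((f \<circ> inv_into U \<phi>) has_derivative frechet_derivative (f \<circ> inv_into U \<phi>) (at (\<phi> p))) (at (\<phi> p))"
      by (rule smooth_on_has_derivative[OF chart_image_open[OF U(1)] smooth_functions_chart[OF f U(1)]])
         (use U in auto)
    note lin = has_derivative_linear[OF this]
    show "v f = frechet_derivative (f \<circ> inv_into U \<phi>) (at (\<phi> p)) (\<Sum>i\<in>Basis. v (X i) *\<^sub>R i)"
      by (simp only: X[OF v f] linear_sum[OF lin] linear_scale[OF lin] real_scaleR_def)
  qed
qed

lemma tangent_basis:
  assumes "p \<in> topspace T"
  obtains x e where "\<And>i. i \<in> Basis \<Longrightarrow> x i \<in> C" "\<And>i. i \<in> Basis \<Longrightarrow> e i \<in> tangent_space C p"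
    "\<And>i j. i \<in> (Basis :: 'e set) \<Longrightarrow> j \<in> Basis \<Longrightarrow> e i (x j) = (if i = j then 1 else 0)"
    "\<And>v. v \<in> tangent_space C p \<Longrightarrow> v = (\<Sum>i\<in>Basis. v (x i) *\<^sub>R e i)"
proof -
  obtain U \<phi> where U: "(U, \<phi>) \<in> A" "p \<in> U" using assms chart_cover by blast
  obtain X where X: "\<And>i. X i \<in> C"
    "\<And>i c. frechet_derivative (X i \<circ> inv_into U \<phi>) (at (\<phi> p)) c = c \<bullet> i"
    "\<And>v f. v \<in> tangent_space C p \<Longrightarrow> f \<in> C \<Longrightarrow>
       v f = (\<Sum>i\<in>Basis. v (X i) * frechet_derivative (f \<circ> inv_into U \<phi>) (at (\<phi> p)) i)"
  proof (rule coordinate_functions[OF U], goal_cases)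
    case (1 X)
    from 1(2-4) show ?case by (rule that)
  qed
  define d where "d i = (\<lambda>f. if f \<in> C then frechet_derivative (f \<circ> inv_into U \<phi>) (at (\<phi> p)) i else 0)" for i
  have d: "d i \<in> tangent_space C p" for i
    unfolding d_def by (rule coordinate_derivation[OF U])
  show thesis
  proof
    show "X i \<in> C" "d i \<in> tangent_space C p" for i using X d by auto
    show "d i (X j) = (if i = j then 1 else 0)" if "i \<in> Basis" "j \<in> Basis" for i j
      using X(1,2) that by (simp add: d_def inner_Basis)
    fix v assume v: "v \<in> tangent_space C p"
    have s: "(\<Sum>i\<in>Basis. v (X i) *\<^sub>R d i) \<in> tangent_space C p"
      by (intro subspace_sum subspace_scale subspace_tangent_space d)
    show "v = (\<Sum>i\<in>Basis. v (X i) *\<^sub>R d i)"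
    proof (rule tangent_eqI[OF v s])
      fix f assume f: "f \<in> C"
      have "(\<Sum>i\<in>I. v (X i) *\<^sub>R d i) f = (\<Sum>i\<in>I. v (X i) * d i f)" for I
        by (induction I rule: infinite_finite_induct) (auto simp: scaleR_fun_def)
      then show "v f = (\<Sum>i\<in>Basis. v (X i) *\<^sub>R d i) f"
        using X(3)[OF v f] f by (simp add: d_def)
    qed
  qed
qed

end

section \<open>Smooth maps and products\<close>

lemma smooth_map_continuous: "smooth_map T A T' A' F \<Longrightarrow> continuous_map T T' F"
  by (simp add: smooth_map_def)

lemma smooth_map_chart:
  assumes "smooth_map T A T' A' F" "(U, \<phi>) \<in> A" "(V, \<psi>) \<in> A'"
  shows "smooth_on (\<psi> \<circ> F \<circ> inv_into U \<phi>) (\<phi> ` (U \<inter> F -` V))"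
proof -
  have "\<forall>(U, \<phi>)\<in>A. \<forall>(V, \<psi>)\<in>A'. smooth_on (\<psi> \<circ> F \<circ> inv_into U \<phi>) (\<phi> ` (U \<inter> F -` V))"
    using assms(1) by (simp add: smooth_map_def)
  from bspec[OF this assms(2)]
  have "\<forall>(V, \<psi>)\<in>A'. smooth_on (\<psi> \<circ> F \<circ> inv_into U \<phi>) (\<phi> ` (U \<inter> F -` V))" by simp
  from bspec[OF this assms(3)] show ?thesis by simp
qed

lemma smooth_map_in: "smooth_map T A T' A' F \<Longrightarrow> x \<in> topspace T \<Longrightarrow> F x \<in> topspace T'"
  using smooth_map_continuous continuous_map_image_subset_topspace by blast

lemma smooth_map_chart_open:
  assumes "smooth_atlas T A" "smooth_atlas T' A'" "smooth_map T A T' A' F" "(U, \<phi>) \<in> A" "(V, \<psi>) \<in> A'"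
  shows "openin T (U \<inter> F -` V)" "open (\<phi> ` (U \<inter> F -` V))"
proof -
  interpret M: smooth_atlas T A by fact
  interpret M': smooth_atlas T' A' by fact
  have "openin T {x \<in> topspace T. F x \<in> V}"
    using openin_continuous_map_preimage[OF smooth_map_continuous[OF assms(3)] M'.chart_open[OF assms(5)]] .
  then have "openin T (U \<inter> {x \<in> topspace T. F x \<in> V})"
    using M.chart_open[OF assms(4)] by blast
  moreover have "U \<inter> {x \<in> topspace T. F x \<in> V} = U \<inter> F -` V"
    using M.chart_subset[OF assms(4)] by auto
  ultimately show "openin T (U \<inter> F -` V)" by simp
  then show "open (\<phi> ` (U \<inter> F -` V))"
    using M.chart_openin_iff[OF assms(4), of "U \<inter> F -` V"] by simp
qed

lemma smooth_map_pullback_function: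
  assumes "smooth_atlas T A" "smooth_atlas T' A'" "smooth_map T A T' A' F" "f \<in> smooth_functions T' A'"
  shows "(\<lambda>x. if x \<in> topspace T then f (F x) else 0) \<in> smooth_functions T A" (is "?f \<in> _")
proof -
  interpret M: smooth_atlas T A by fact
  interpret M': smooth_atlas T' A' by fact
  show ?thesis
  proof (rule M.smooth_functions_localI)
    fix p assume p: "p \<in> topspace T"
    obtain U \<phi> where U: "(U, \<phi>) \<in> A" "p \<in> U" using M.chart_cover[OF p] by blast
    obtain V \<psi> where V: "(V, \<psi>) \<in> A'" "F p \<in> V"
      using M'.chart_cover smooth_map_in[OF assms(3) p] by blast
    note o = smooth_map_chart_open[OF assms(1-3) U(1) V(1)]
    have "(\<psi> \<circ> F \<circ> inv_into U \<phi>) ` \<phi> ` (U \<inter> F -` V) \<subseteq> \<psi> ` V" using U by auto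
    from smooth_on_compose[OF o(2) M'.chart_image_open[OF V(1)] this smooth_map_chart[OF assms(3) U(1) V(1)]
        M'.smooth_functions_chart[OF assms(4) V(1)]]
    have "smooth_on (\<lambda>s. (f \<circ> inv_into V \<psi>) ((\<psi> \<circ> F \<circ> inv_into U \<phi>) s)) (\<phi> ` (U \<inter> F -` V))" .
    then have "smooth_on (?f \<circ> inv_into U \<phi>) (\<phi> ` (U \<inter> F -` V))"
      by (rule smooth_on_cong[OF o(2), rotated]) (use U V M.chart_subset in auto)
    then show "\<exists>U \<phi> W. (U, \<phi>) \<in> A \<and> openin T W \<and> p \<in> W \<and> W \<subseteq> U \<and> smooth_on (?f \<circ> inv_into U \<phi>) (\<phi> ` W)"
      using U V o(1) by (intro exI[of _ U] exI[of _ \<phi>] exI[of _ "U \<inter> F -` V"]) auto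
  qed auto
qed

lemma smooth_mapI_local:
  assumes "smooth_atlas T A" "smooth_atlas T' A'" and cont: "continuous_map T T' F"
    and loc: "\<And>p. p \<in> topspace T \<Longrightarrow> \<exists>U \<phi> V \<psi> W. (U, \<phi>) \<in> A \<and> (V, \<psi>) \<in> A' \<and> openin T W \<and> p \<in> W \<and>
       W \<subseteq> U \<inter> F -` V \<and> smooth_on (\<psi> \<circ> F \<circ> inv_into U \<phi>) (\<phi> ` W)"
  shows "smooth_map T A T' A' F"
proof -
  interpret M: smooth_atlas T A by fact
  interpret M': smooth_atlas T' A' by fact
  have "smooth_on (\<psi>' \<circ> F \<circ> inv_into U' \<phi>') (\<phi>' ` (U' \<inter> F -` V'))" (is "smooth_on ?h ?S")
    if U': "(U', \<phi>') \<in> A" and V': "(V', \<psi>') \<in> A'" for U' \<phi>' V' \<psi>'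
  proof -
    have "openin T {x \<in> topspace T. F x \<in> V'}"
      using openin_continuous_map_preimage[OF cont M'.chart_open[OF V']] .
    then have "openin T (U' \<inter> {x \<in> topspace T. F x \<in> V'})"
      using M.chart_open[OF U'] by blast
    moreover have "U' \<inter> {x \<in> topspace T. F x \<in> V'} = U' \<inter> F -` V'"
      using M.chart_subset[OF U'] by auto
    ultimately have oU': "openin T (U' \<inter> F -` V')" by simp
    have oS: "open ?S" using M.chart_openin_iff[OF U', of "U' \<inter> F -` V'"] oU' by simp
    show ?thesis
    proof (rule smooth_on_local[OF oS])
      fix s assume "s \<in> ?S"
      then obtain p where p: "p \<in> U'" "F p \<in> V'" "s = \<phi>' p" by blast
      obtain U \<phi> V \<psi> W where W: "(U, \<phi>) \<in> A" "(V, \<psi>) \<in> A'" "openin T W" "p \<in> W" "W \<subseteq> U \<inter> F -` V"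
         "smooth_on (\<psi> \<circ> F \<circ> inv_into U \<phi>) (\<phi> ` W)"
        using loc[OF M.chart_subset[OF U' p(1)]] by blast
      let ?W = "W \<inter> (U' \<inter> F -` V')"
      have oW: "openin T ?W" using W(3) oU' by blast
      have o1: "open (\<phi>' ` ?W)" using M.chart_openin_iff[OF U', of ?W] oW by auto
      have o2: "open (\<phi> ` ?W)" using M.chart_openin_iff[OF W(1), of ?W] oW W(5) by auto
      have o3: "open (\<psi> ` (V \<inter> V'))" by (rule M'.chart_image_Int_open[OF W(2) M'.chart_open[OF V']])
      have s1: "smooth_on (\<phi> \<circ> inv_into U' \<phi>') (\<phi>' ` ?W)"
        by (rule smooth_on_subset[OF M.chart_transition[OF U' W(1)]]) (use W(5) in auto)
      have s2: "smooth_on (\<psi> \<circ> F \<circ> inv_into U \<phi>) (\<phi> ` ?W)"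
        by (rule smooth_on_subset[OF W(6)]) auto
      have i1: "(\<phi> \<circ> inv_into U' \<phi>') ` \<phi>' ` ?W \<subseteq> \<phi> ` ?W"
        using U' by auto
      have s12: "smooth_on (\<lambda>s. (\<psi> \<circ> F \<circ> inv_into U \<phi>) ((\<phi> \<circ> inv_into U' \<phi>') s)) (\<phi>' ` ?W)"
        by (rule smooth_on_compose[OF o1 o2 i1 s1 s2])
      have s3: "smooth_on (\<psi>' \<circ> inv_into V \<psi>) (\<psi> ` (V \<inter> V'))"
        by (rule M'.chart_transition[OF W(2) V'])
      have i2: "(\<lambda>s. (\<psi> \<circ> F \<circ> inv_into U \<phi>) ((\<phi> \<circ> inv_into U' \<phi>') s)) ` \<phi>' ` ?W \<subseteq> \<psi> ` (V \<inter> V')"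
        using U' W(1,5) by fastforce
      have "smooth_on (\<lambda>s. (\<psi>' \<circ> inv_into V \<psi>) ((\<psi> \<circ> F \<circ> inv_into U \<phi>) ((\<phi> \<circ> inv_into U' \<phi>') s))) (\<phi>' ` ?W)"
        by (rule smooth_on_compose[OF o1 o3 i2 s12 s3])
      then have "smooth_on ?h (\<phi>' ` ?W)"
      proof (rule smooth_on_cong[OF o1, rotated])
        fix s assume "s \<in> \<phi>' ` ?W"
        then obtain x where x: "x \<in> ?W" "s = \<phi>' x" by blast
        then have "x \<in> U" "F x \<in> V" "x \<in> U'" using W(5) by auto
        then show "(\<psi>' \<circ> inv_into V \<psi>) ((\<psi> \<circ> F \<circ> inv_into U \<phi>) ((\<phi> \<circ> inv_into U' \<phi>') s)) = ?h s"
          using x(2) U' W(1,2) by simp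
      qed
      then have "smooth_on ?h (\<phi>' ` ?W \<inter> ?S)" by (rule smooth_on_subset) auto
      then show "\<exists>S. open S \<and> s \<in> S \<and> smooth_on ?h (S \<inter> ?S)"
        using o1 p W(4) by blast
    qed
  qed
  then show ?thesis using cont by (auto simp: smooth_map_def)
qed

lemma smooth_map_compose:
  assumes "smooth_atlas T A" "smooth_atlas T' A'" "smooth_atlas T'' A''"
    and F: "smooth_map T A T' A' F" and K: "smooth_map T' A' T'' A'' K"
  shows "smooth_map T A T'' A'' (\<lambda>x. K (F x))"
proof (rule smooth_mapI_local[OF assms(1,3)])
  interpret M: smooth_atlas T A by fact
  interpret M': smooth_atlas T' A' by fact
  interpret M'': smooth_atlas T'' A'' by fact
  show "continuous_map T T'' (\<lambda>x. K (F x))"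
    using continuous_map_compose[OF smooth_map_continuous[OF F] smooth_map_continuous[OF K]] by (simp add: o_def)
  fix p assume p: "p \<in> topspace T"
  obtain U \<phi> where U: "(U, \<phi>) \<in> A" "p \<in> U" using M.chart_cover[OF p] by blast
  obtain V \<psi> where V: "(V, \<psi>) \<in> A'" "F p \<in> V"
    using M'.chart_cover smooth_map_in[OF F p] by blast
  obtain X \<xi> where X: "(X, \<xi>) \<in> A''" "K (F p) \<in> X"
    using M''.chart_cover smooth_map_in[OF K smooth_map_in[OF F p]] by blast
  note o = smooth_map_chart_open[OF assms(2,3) K V(1) X(1)]
  let ?W = "U \<inter> F -` V \<inter> (U \<inter> {x \<in> topspace T. F x \<in> V \<inter> K -` X})"
  have "openin T {x \<in> topspace T. F x \<in> V \<inter> K -` X}"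
    using openin_continuous_map_preimage[OF smooth_map_continuous[OF F] o(1)] .
  then have oW: "openin T ?W"
    using smooth_map_chart_open(1)[OF assms(1,2) F U(1) V(1)] M.chart_open[OF U(1)] by blast
  have o1: "open (\<phi> ` ?W)" using M.chart_openin_iff[OF U(1), of ?W] oW by auto
  have s1: "smooth_on (\<psi> \<circ> F \<circ> inv_into U \<phi>) (\<phi> ` ?W)"
    by (rule smooth_on_subset[OF smooth_map_chart[OF F U(1) V(1)]]) auto
  have i: "(\<psi> \<circ> F \<circ> inv_into U \<phi>) ` \<phi> ` ?W \<subseteq> \<psi> ` (V \<inter> K -` X)" using U by auto
  have "smooth_on (\<lambda>s. (\<xi> \<circ> K \<circ> inv_into V \<psi>) ((\<psi> \<circ> F \<circ> inv_into U \<phi>) s)) (\<phi> ` ?W)"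
    by (rule smooth_on_compose[OF o1 o(2) i s1 smooth_map_chart[OF K V(1) X(1)]])
  then have "smooth_on (\<xi> \<circ> (\<lambda>x. K (F x)) \<circ> inv_into U \<phi>) (\<phi> ` ?W)"
    by (rule smooth_on_cong[OF o1, rotated]) (use U V in auto)
  then show "\<exists>U \<phi> V \<psi> W. (U, \<phi>) \<in> A \<and> (V, \<psi>) \<in> A'' \<and> openin T W \<and> p \<in> W \<and>
       W \<subseteq> U \<inter> (\<lambda>x. K (F x)) -` V \<and> smooth_on (\<psi> \<circ> (\<lambda>x. K (F x)) \<circ> inv_into U \<phi>) (\<phi> ` W)"
    using U V X oW p
    by (intro exI[of _ U] exI[of _ \<phi>] exI[of _ X] exI[of _ \<xi>] exI[of _ ?W]) auto
qed

lemma smooth_map_id: "smooth_atlas T A \<Longrightarrow> smooth_map T A T A (\<lambda>x. x)"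
  by (auto simp: smooth_map_def o_def dest: smooth_atlas.chart_transition)

lemma smooth_map_const:
  assumes "smooth_atlas T A" "smooth_atlas T' A'" "c \<in> topspace T'"
  shows "smooth_map T A T' A' (\<lambda>x. c)"
proof (rule smooth_mapI_local[OF assms(1,2)])
  interpret M: smooth_atlas T A by fact
  interpret M': smooth_atlas T' A' by fact
  show "continuous_map T T' (\<lambda>x. c)" using assms(3) by simp
  fix p assume p: "p \<in> topspace T"
  obtain U \<phi> where U: "(U, \<phi>) \<in> A" "p \<in> U" using M.chart_cover[OF p] by blast
  obtain V \<psi> where V: "(V, \<psi>) \<in> A'" "c \<in> V" using M'.chart_cover[OF assms(3)] by blast
  have "smooth_on (\<psi> \<circ> (\<lambda>x. c) \<circ> inv_into U \<phi>) (\<phi> ` U)"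
    using smooth_on_const[OF M.chart_image_open[OF U(1)], of "\<psi> c"] by (simp add: o_def)
  then show "\<exists>U \<phi> V \<psi> W. (U, \<phi>) \<in> A \<and> (V, \<psi>) \<in> A' \<and> openin T W \<and> p \<in> W \<and>
       W \<subseteq> U \<inter> (\<lambda>x. c) -` V \<and> smooth_on (\<psi> \<circ> (\<lambda>x. c) \<circ> inv_into U \<phi>) (\<phi> ` W)"
    using U V M.chart_open[OF U(1)]
    by (intro exI[of _ U] exI[of _ \<phi>] exI[of _ V] exI[of _ \<psi>] exI[of _ U]) auto
qed

section \<open>Product atlases, and smooth maps into and out of products\<close>

lemma prod_atlasE:
  assumes "(W, \<theta>) \<in> prod_atlas A A'"
  obtains U \<phi> V \<psi> where "W = U \<times> V" "\<theta> = map_prod \<phi> \<psi>" "(U, \<phi>) \<in> A" "(V, \<psi>) \<in> A'"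
  using assms by (auto simp: prod_atlas_def)

lemma prod_atlasI: "(U, \<phi>) \<in> A \<Longrightarrow> (V, \<psi>) \<in> A' \<Longrightarrow> (U \<times> V, map_prod \<phi> \<psi>) \<in> prod_atlas A A'"
  by (auto simp: prod_atlas_def)

lemma map_prod_image: "map_prod \<phi> \<psi> ` (U \<times> V) = \<phi> ` U \<times> \<psi> ` V"
  by auto

lemma inv_into_map_prod:
  assumes "inj_on \<phi> U" "inj_on \<psi> V" "s \<in> \<phi> ` U" "t \<in> \<psi> ` V"
  shows "inv_into (U \<times> V) (map_prod \<phi> \<psi>) (s, t) = (inv_into U \<phi> s, inv_into V \<psi> t)"
proof (rule inv_into_f_eq)
  show "inj_on (map_prod \<phi> \<psi>) (U \<times> V)" using assms by (simp add: map_prod_inj_on)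
qed (use assms in \<open>auto simp: f_inv_into_f inv_into_into\<close>)

lemma smooth_on_fst_compose:
  fixes f :: "'a::euclidean_space \<Rightarrow> 'c::real_normed_vector"
  assumes "open S" "open R" "smooth_on f S"
  shows "smooth_on (\<lambda>x. f (fst x)) (S \<times> (R :: 'b::euclidean_space set))"
  by (rule smooth_on_compose[OF open_Times[OF assms(1,2)] assms(1) _
      smooth_on_bounded_linear[OF open_Times[OF assms(1,2)] bounded_linear_fst] assms(3)]) auto

lemma smooth_on_snd_compose:
  fixes f :: "'b::euclidean_space \<Rightarrow> 'c::real_normed_vector"
  assumes "open S" "open R" "smooth_on f R"
  shows "smooth_on (\<lambda>x. f (snd x)) ((S :: 'a::euclidean_space set) \<times> R)"
  by (rule smooth_on_compose[OF open_Times[OF assms(1,2)] assms(2) _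
      smooth_on_bounded_linear[OF open_Times[OF assms(1,2)] bounded_linear_snd] assms(3)]) auto

lemma smooth_atlas_prod:
  assumes "smooth_atlas T A" "smooth_atlas T' A'"
  shows "smooth_atlas (prod_topology T T') (prod_atlas A A')"
proof
  interpret M: smooth_atlas T A by fact
  interpret M': smooth_atlas T' A' by fact
  show "Hausdorff_space (prod_topology T T')"
    using M.hausdorff M'.hausdorff by (simp add: Hausdorff_space_prod_topology)
  show "\<exists>W \<theta>. (W, \<theta>) \<in> prod_atlas A A' \<and> p \<in> W" if top: "p \<in> topspace (prod_topology T T')" for p
  proof -
    obtain x y where p: "p = (x, y)" "x \<in> topspace T" "y \<in> topspace T'" using top by (cases p) auto
    then show ?thesis
      using M.chart_cover[OF p(2)] M'.chart_cover[OF p(3)] by (metis mem_Sigma_iff prod_atlasI)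
  qed
  fix W \<theta> assume "(W, \<theta>) \<in> prod_atlas A A'"
  then obtain U \<phi> V \<psi> where W: "W = U \<times> V" "\<theta> = map_prod \<phi> \<psi>" and U: "(U, \<phi>) \<in> A" and V: "(V, \<psi>) \<in> A'"
    by (rule prod_atlasE)
  show "openin (prod_topology T T') W"
    using M.chart_open[OF U] M'.chart_open[OF V] by (simp add: W openin_prod_Times_iff)
  show "inj_on \<theta> W"
    using M.chart_inj[OF U] M'.chart_inj[OF V] by (simp add: W map_prod_inj_on)
  show "openin (prod_topology T T') Y \<longleftrightarrow> open (\<theta> ` Y)" if Y: "Y \<subseteq> W" for Y
  proof
    assume o: "openin (prod_topology T T') Y"
    show "open (\<theta> ` Y)"
    proof (subst open_subopen, intro ballI)
      fix q assume "q \<in> \<theta> ` Y"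
      then obtain x y where q: "(x, y) \<in> Y" "q = (\<phi> x, \<psi> y)" by (auto simp: W)
      obtain X X' where X: "openin T X" "openin T' X'" "x \<in> X" "y \<in> X'" "X \<times> X' \<subseteq> Y"
        using o[unfolded openin_prod_topology_alt, rule_format, OF q(1)] by blast
      have "x \<in> U" "y \<in> V" using q Y W by auto
      then have "q \<in> \<phi> ` (U \<inter> X) \<times> \<psi> ` (V \<inter> X')" using q X by auto
      moreover have "open (\<phi> ` (U \<inter> X) \<times> \<psi> ` (V \<inter> X'))"
        by (intro open_Times M.chart_image_Int_open M'.chart_image_Int_open U V X)
      moreover have "\<phi> ` (U \<inter> X) \<times> \<psi> ` (V \<inter> X') \<subseteq> \<theta> ` Y"
        using X(5) by (force simp: W)
      ultimately show "\<exists>S. open S \<and> q \<in> S \<and> S \<subseteq> \<theta> ` Y" by blast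
    qed
  next
    assume o: "open (\<theta> ` Y)"
    show "openin (prod_topology T T') Y"
      unfolding openin_prod_topology_alt
    proof (intro allI impI)
      fix x y assume xy: "(x, y) \<in> Y"
      then have "(\<phi> x, \<psi> y) \<in> \<theta> ` Y" by (force simp: W)
      then obtain S R where S: "open S" "open R" "(\<phi> x, \<psi> y) \<in> S \<times> R" "S \<times> R \<subseteq> \<theta> ` Y"
        using open_prod_elim[OF o] by metis
      let ?X = "{x \<in> U. \<phi> x \<in> S}" and ?X' = "{y \<in> V. \<psi> y \<in> R}"
      have "?X \<times> ?X' \<subseteq> Y"
      proof
        fix q assume q: "q \<in> ?X \<times> ?X'"
        then have "\<theta> q \<in> \<theta> ` Y" using S(4) by (auto simp: W)
        then obtain q' where "q' \<in> Y" "\<theta> q = \<theta> q'" by blast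
        moreover have "q \<in> W" using q W by auto
        ultimately have "q = q'" using \<open>inj_on \<theta> W\<close> Y by (auto dest: inj_onD)
        then show "q \<in> Y" using \<open>q' \<in> Y\<close> by simp
      qed
      moreover have "x \<in> ?X" "y \<in> ?X'" using xy Y S(3) W by auto
      ultimately show "\<exists>X X'. openin T X \<and> openin T' X' \<and> x \<in> X \<and> y \<in> X' \<and> X \<times> X' \<subseteq> Y"
        using M.chart_preimage_open[OF U S(1)] M'.chart_preimage_open[OF V S(2)] by blast
    qed
  qed
  fix W' \<theta>' assume "(W', \<theta>') \<in> prod_atlas A A'"
  then obtain U' \<phi>' V' \<psi>' where W': "W' = U' \<times> V'" "\<theta>' = map_prod \<phi>' \<psi>'" and U': "(U', \<phi>') \<in> A" and V': "(V', \<psi>') \<in> A'"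
    by (rule prod_atlasE)
  have o: "open (\<phi> ` (U \<inter> U'))" "open (\<psi> ` (V \<inter> V'))"
    by (rule M.chart_image_Int_open[OF U M.chart_open[OF U']] M'.chart_image_Int_open[OF V M'.chart_open[OF V']])+
  have im: "\<theta> ` (W \<inter> W') = \<phi> ` (U \<inter> U') \<times> \<psi> ` (V \<inter> V')"
    by (auto simp: W W')
  have "smooth_on (\<lambda>s. ((\<phi>' \<circ> inv_into U \<phi>) (fst s), (\<psi>' \<circ> inv_into V \<psi>) (snd s)))
     (\<phi> ` (U \<inter> U') \<times> \<psi> ` (V \<inter> V'))"
    by (rule smooth_on_Pair[OF open_Times[OF o] smooth_on_fst_compose[OF o M.chart_transition[OF U U']]
          smooth_on_snd_compose[OF o M'.chart_transition[OF V V']]])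
  then show "smooth_on (\<theta>' \<circ> inv_into W \<theta>) (\<theta> ` (W \<inter> W'))"
    unfolding im
  proof (rule smooth_on_cong[OF open_Times[OF o], rotated])
    fix s assume "s \<in> \<phi> ` (U \<inter> U') \<times> \<psi> ` (V \<inter> V')"
    then have "fst s \<in> \<phi> ` U" "snd s \<in> \<psi> ` V" by auto
    from inv_into_map_prod[OF M.chart_inj[OF U] M'.chart_inj[OF V] this]
    show "((\<phi>' \<circ> inv_into U \<phi>) (fst s), (\<psi>' \<circ> inv_into V \<psi>) (snd s)) = (\<theta>' \<circ> inv_into W \<theta>) s"
      by (simp add: W W')
  qed
qed

lemma smooth_map_Pair:
  assumes "smooth_atlas T A" "smooth_atlas T1 A1" "smooth_atlas T2 A2"
    and F: "smooth_map T A T1 A1 F" and K: "smooth_map T A T2 A2 K"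
  shows "smooth_map T A (prod_topology T1 T2) (prod_atlas A1 A2) (\<lambda>x. (F x, K x))"
proof -
  interpret M: smooth_atlas T A by fact
  have "smooth_on (\<theta> \<circ> (\<lambda>x. (F x, K x)) \<circ> inv_into U \<phi>) (\<phi> ` (U \<inter> (\<lambda>x. (F x, K x)) -` W))"
    if U: "(U, \<phi>) \<in> A" and W: "(W, \<theta>) \<in> prod_atlas A1 A2" for U \<phi> W \<theta>
  proof -
    obtain U1 \<phi>1 U2 \<phi>2 where W': "W = U1 \<times> U2" "\<theta> = map_prod \<phi>1 \<phi>2" "(U1, \<phi>1) \<in> A1" "(U2, \<phi>2) \<in> A2"
      using W by (rule prod_atlasE)
    let ?S = "\<phi> ` (U \<inter> (\<lambda>x. (F x, K x)) -` W)"
    have "openin T ((U \<inter> F -` U1) \<inter> (U \<inter> K -` U2))"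
      using smooth_map_chart_open(1)[OF assms(1,2) F U W'(3)] smooth_map_chart_open(1)[OF assms(1,3) K U W'(4)]
      by blast
    moreover have "(U \<inter> F -` U1) \<inter> (U \<inter> K -` U2) = U \<inter> (\<lambda>x. (F x, K x)) -` W" by (auto simp: W')
    ultimately have o: "open ?S"
      using M.chart_openin_iff[OF U, of "U \<inter> (\<lambda>x. (F x, K x)) -` W"] by auto
    have s: "smooth_on (\<phi>1 \<circ> F \<circ> inv_into U \<phi>) ?S" "smooth_on (\<phi>2 \<circ> K \<circ> inv_into U \<phi>) ?S"
      by (rule smooth_on_subset[OF smooth_map_chart[OF F U W'(3)]], force simp: W')
         (rule smooth_on_subset[OF smooth_map_chart[OF K U W'(4)]], force simp: W')
    show ?thesis
      using smooth_on_Pair[OF o s] by (simp add: W' o_def)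
  qed
  moreover have "continuous_map T (prod_topology T1 T2) (\<lambda>x. (F x, K x))"
    by (intro continuous_map_pairedI smooth_map_continuous[OF F] smooth_map_continuous[OF K])
  ultimately show ?thesis by (auto simp: smooth_map_def)
qed

lemma smooth_map_fst:
  assumes "smooth_atlas T A" "smooth_atlas T' A'"
  shows "smooth_map (prod_topology T T') (prod_atlas A A') T A fst"
proof (rule smooth_mapI_local[OF smooth_atlas_prod[OF assms] assms(1) continuous_map_fst])
  interpret M: smooth_atlas T A by fact
  interpret M': smooth_atlas T' A' by fact
  interpret P: smooth_atlas "prod_topology T T'" "prod_atlas A A'" by (rule smooth_atlas_prod[OF assms])
  fix p assume "p \<in> topspace (prod_topology T T')"
  then obtain x y where p: "p = (x, y)" "x \<in> topspace T" "y \<in> topspace T'" by auto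
  obtain U \<phi> where U: "(U, \<phi>) \<in> A" "x \<in> U" using M.chart_cover[OF p(2)] by blast
  obtain V \<psi> where V: "(V, \<psi>) \<in> A'" "y \<in> V" using M'.chart_cover[OF p(3)] by blast
  note W = prod_atlasI[OF U(1) V(1)]
  have o: "open (map_prod \<phi> \<psi> ` (U \<times> V))" by (rule P.chart_image_open[OF W])
  have "smooth_on (\<phi> \<circ> fst \<circ> inv_into (U \<times> V) (map_prod \<phi> \<psi>)) (map_prod \<phi> \<psi> ` (U \<times> V))"
    by (rule smooth_on_cong[OF o _ smooth_on_bounded_linear[OF o bounded_linear_fst]])
       (use M.chart_inj[OF U(1)] M'.chart_inj[OF V(1)] in \<open>auto simp: inv_into_map_prod\<close>)
  then show "\<exists>U \<phi> V \<psi> W. (U, \<phi>) \<in> prod_atlas A A' \<and> (V, \<psi>) \<in> A \<and> openin (prod_topology T T') W \<and> p \<in> W \<and>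
       W \<subseteq> U \<inter> fst -` V \<and> smooth_on (\<psi> \<circ> fst \<circ> inv_into U \<phi>) (\<phi> ` W)"
    using W U V p P.chart_open[OF W]
    by (intro exI[of _ "U \<times> V"] exI[of _ "map_prod \<phi> \<psi>"] exI[of _ U] exI[of _ \<phi>]) auto
qed

lemma smooth_map_snd:
  assumes "smooth_atlas T A" "smooth_atlas T' A'"
  shows "smooth_map (prod_topology T T') (prod_atlas A A') T' A' snd"
proof (rule smooth_mapI_local[OF smooth_atlas_prod[OF assms] assms(2) continuous_map_snd])
  interpret M: smooth_atlas T A by fact
  interpret M': smooth_atlas T' A' by fact
  interpret P: smooth_atlas "prod_topology T T'" "prod_atlas A A'" by (rule smooth_atlas_prod[OF assms])
  fix p assume "p \<in> topspace (prod_topology T T')"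
  then obtain x y where p: "p = (x, y)" "x \<in> topspace T" "y \<in> topspace T'" by auto
  obtain U \<phi> where U: "(U, \<phi>) \<in> A" "x \<in> U" using M.chart_cover[OF p(2)] by blast
  obtain V \<psi> where V: "(V, \<psi>) \<in> A'" "y \<in> V" using M'.chart_cover[OF p(3)] by blast
  note W = prod_atlasI[OF U(1) V(1)]
  have o: "open (map_prod \<phi> \<psi> ` (U \<times> V))" by (rule P.chart_image_open[OF W])
  have "smooth_on (\<psi> \<circ> snd \<circ> inv_into (U \<times> V) (map_prod \<phi> \<psi>)) (map_prod \<phi> \<psi> ` (U \<times> V))"
    by (rule smooth_on_cong[OF o _ smooth_on_bounded_linear[OF o bounded_linear_snd]])
       (use M.chart_inj[OF U(1)] M'.chart_inj[OF V(1)] in \<open>auto simp: inv_into_map_prod\<close>)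
  then show "\<exists>U \<phi> V \<psi> W. (U, \<phi>) \<in> prod_atlas A A' \<and> (V, \<psi>) \<in> A' \<and> openin (prod_topology T T') W \<and> p \<in> W \<and>
       W \<subseteq> U \<inter> snd -` V \<and> smooth_on (\<psi> \<circ> snd \<circ> inv_into U \<phi>) (\<phi> ` W)"
    using W U V p P.chart_open[OF W]
    by (intro exI[of _ "U \<times> V"] exI[of _ "map_prod \<phi> \<psi>"] exI[of _ V] exI[of _ \<psi>]) auto
qed

lemma tangent_map_in:
  assumes "smooth_atlas T A" "smooth_atlas T' A'" "smooth_map T A T' A' F" "p \<in> topspace T"
    and v: "v \<in> tangent_space (smooth_functions T A) p"
  shows "tangent_map (topspace T) (smooth_functions T' A') F v \<in> tangent_space (smooth_functions T' A') (F p)"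
proof -
  interpret M: smooth_atlas T A by fact
  interpret M': smooth_atlas T' A' by fact
  let ?r = "\<lambda>f x. if x \<in> topspace T then f (F x) else (0::real)"
  note r = smooth_map_pullback_function[OF assms(1-3)]
  have e: "?r (\<lambda>x. a * f x + b * h x) = (\<lambda>x. a * ?r f x + b * ?r h x)"
    "?r (\<lambda>x. f x * h x) = (\<lambda>x. ?r f x * ?r h x)" for f h a b by auto
  show ?thesis
    unfolding tangent_space_def mem_Collect_eq tangent_map_def
  proof (intro conjI ballI allI impI)
    fix f h a b assume fh: "f \<in> M'.C" "h \<in> M'.C"
    have "(\<lambda>x. a * f x + b * h x) \<in> M'.C"
      by (intro M'.smooth_functions_add M'.smooth_functions_scale fh)
    then show "(if (\<lambda>x. a * f x + b * h x) \<in> M'.C then v (?r (\<lambda>x. a * f x + b * h x)) else 0) =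
       a * (if f \<in> M'.C then v (?r f) else 0) + b * (if h \<in> M'.C then v (?r h) else 0)"
      using fh by (simp add: e(1) tangent_lincomb[OF v r[OF fh(1)] r[OF fh(2)]])
  next
    fix f h assume fh: "f \<in> M'.C" "h \<in> M'.C"
    then show "(if (\<lambda>x. f x * h x) \<in> M'.C then v (?r (\<lambda>x. f x * h x)) else 0) =
       (if f \<in> M'.C then v (?r f) else 0) * h (F p) + f (F p) * (if h \<in> M'.C then v (?r h) else 0)"
      using assms(4) M'.smooth_functions_mult[OF fh]
      by (simp add: e(2) tangent_mult[OF v r[OF fh(1)] r[OF fh(2)]])
  qed simp
qed

subsection \<open>Partial derivatives on a product\<close>

lemma frechet_derivative_slice:
  fixes F :: "'a::euclidean_space \<times> 'b::euclidean_space \<Rightarrow> real"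
  assumes "open S" "smooth_on F S" "(a, b) \<in> S"
  shows "frechet_derivative (\<lambda>s. F (s, b)) (at a) c = frechet_derivative F (at (a, b)) (c, 0)"
    "frechet_derivative (\<lambda>t. F (a, t)) (at b) d = frechet_derivative F (at (a, b)) (0, d)"
proof -
  note D = smooth_on_has_derivative[OF assms]
  have "((\<lambda>s. (s, b)) has_derivative (\<lambda>c. (c, 0))) (at a)"
    by (auto intro!: derivative_eq_intros)
  from diff_chain_at[OF this D]
  have "((\<lambda>s. F (s, b)) has_derivative (\<lambda>c. frechet_derivative F (at (a, b)) (c, 0))) (at a)"
    by (simp add: o_def)
  from frechet_derivative_at[OF this]
  show "frechet_derivative (\<lambda>s. F (s, b)) (at a) c = frechet_derivative F (at (a, b)) (c, 0)" by metis
  have "((\<lambda>t. (a, t)) has_derivative (\<lambda>c. (0, c))) (at b)"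
    by (auto intro!: derivative_eq_intros)
  from diff_chain_at[OF this D]
  have "((\<lambda>t. F (a, t)) has_derivative (\<lambda>d. frechet_derivative F (at (a, b)) (0, d))) (at b)"
    by (simp add: o_def)
  from frechet_derivative_at[OF this]
  show "frechet_derivative (\<lambda>t. F (a, t)) (at b) d = frechet_derivative F (at (a, b)) (0, d)" by metis
qed

locale smooth_atlas_pair = M: smooth_atlas T A + M': smooth_atlas T' A'
  for T :: "'a topology" and A :: "('a, 'e::euclidean_space) atlas"
  and T' :: "'b topology" and A' :: "('b, 'f::euclidean_space) atlas"
begin

sublocale P: smooth_atlas "prod_topology T T'" "prod_atlas A A'"
  by (rule smooth_atlas_prod) unfold_locales

lemma slice_fst:
  assumes "F \<in> P.C"
  shows "(\<lambda>x. F (x, y)) \<in> M.C"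
proof (cases "y \<in> topspace T'")
  case True
  have "smooth_map T A (prod_topology T T') (prod_atlas A A') (\<lambda>x. (x, y))"
    by (intro smooth_map_Pair smooth_map_id smooth_map_const True) unfold_locales
  from smooth_map_pullback_function[OF _ _ this assms]
  have "(\<lambda>x. if x \<in> topspace T then F (x, y) else 0) \<in> M.C"
    using M.smooth_atlas_axioms P.smooth_atlas_axioms by blast
  moreover have "(\<lambda>x. if x \<in> topspace T then F (x, y) else 0) = (\<lambda>x. F (x, y))"
    using P.smooth_functions_outside[OF assms] by auto
  ultimately show ?thesis by simp
next
  case False
  then have "(\<lambda>x. F (x, y)) = (\<lambda>x. 0)" using P.smooth_functions_outside[OF assms] by auto
  then show ?thesis using M.smooth_functions_0 by simp
qed

lemma slice_snd:
  assumes "F \<in> P.C"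
  shows "(\<lambda>y. F (x, y)) \<in> M'.C"
proof (cases "x \<in> topspace T")
  case True
  have "smooth_map T' A' (prod_topology T T') (prod_atlas A A') (\<lambda>y. (x, y))"
    by (intro smooth_map_Pair smooth_map_id smooth_map_const True) unfold_locales
  from smooth_map_pullback_function[OF _ _ this assms]
  have "(\<lambda>y. if y \<in> topspace T' then F (x, y) else 0) \<in> M'.C"
    using M'.smooth_atlas_axioms P.smooth_atlas_axioms by blast
  moreover have "(\<lambda>y. if y \<in> topspace T' then F (x, y) else 0) = (\<lambda>y. F (x, y))"
    using P.smooth_functions_outside[OF assms] by auto
  ultimately show ?thesis by simp
next
  case False
  then have "(\<lambda>y. F (x, y)) = (\<lambda>y. 0)" using P.smooth_functions_outside[OF assms] by auto
  then show ?thesis using M'.smooth_functions_0 by simp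
qed

lemma chart_expression:
  assumes F: "F \<in> P.C" and U: "(U, \<phi>) \<in> A" and V: "(V, \<psi>) \<in> A'"
  defines "E \<equiv> F \<circ> inv_into (U \<times> V) (map_prod \<phi> \<psi>)"
  shows "open (\<phi> ` U \<times> \<psi> ` V)" "smooth_on E (\<phi> ` U \<times> \<psi> ` V)"
    "\<And>s t. s \<in> \<phi> ` U \<Longrightarrow> t \<in> \<psi> ` V \<Longrightarrow> E (s, t) = F (inv_into U \<phi> s, inv_into V \<psi> t)"
proof -
  show "open (\<phi> ` U \<times> \<psi> ` V)"
    by (intro open_Times M.chart_image_open[OF U] M'.chart_image_open[OF V])
  show "smooth_on E (\<phi> ` U \<times> \<psi> ` V)"
    using P.smooth_functions_chart[OF F prod_atlasI[OF U V]] by (simp add: E_def map_prod_image)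
  show "E (s, t) = F (inv_into U \<phi> s, inv_into V \<psi> t)" if "s \<in> \<phi> ` U" "t \<in> \<psi> ` V" for s t
    using inv_into_map_prod[OF M.chart_inj[OF U] M'.chart_inj[OF V] that] by (simp add: E_def)
qed

lemma frechet_derivative_chart_slice:
  assumes F: "F \<in> P.C" and U: "(U, \<phi>) \<in> A" and V: "(V, \<psi>) \<in> A'" and xy: "x \<in> U" "y \<in> V"
  defines "E \<equiv> F \<circ> inv_into (U \<times> V) (map_prod \<phi> \<psi>)"
  shows "frechet_derivative ((\<lambda>x. F (x, y)) \<circ> inv_into U \<phi>) (at (\<phi> x)) c =
           frechet_derivative E (at (\<phi> x, \<psi> y)) (c, 0)"
    "frechet_derivative ((\<lambda>y. F (x, y)) \<circ> inv_into V \<psi>) (at (\<psi> y)) d =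
           frechet_derivative E (at (\<phi> x, \<psi> y)) (0, d)"
proof -
  note E = chart_expression[OF F U V, folded E_def]
  have "frechet_derivative ((\<lambda>x. F (x, y)) \<circ> inv_into U \<phi>) (at (\<phi> x)) =
      frechet_derivative (\<lambda>s. E (s, \<psi> y)) (at (\<phi> x))"
  proof (rule frechet_derivative_transform_within_open[OF _ M.chart_image_open[OF U]])
    show "(\<lambda>x. F (x, y)) \<circ> inv_into U \<phi> differentiable at (\<phi> x)"
      using smooth_on_has_derivative[OF M.chart_image_open[OF U] M.smooth_functions_chart[OF slice_fst[OF F] U]] xy
      by (auto simp: differentiable_def)
  qed (use xy E(3) V in auto)
  then show "frechet_derivative ((\<lambda>x. F (x, y)) \<circ> inv_into U \<phi>) (at (\<phi> x)) c =
           frechet_derivative E (at (\<phi> x, \<psi> y)) (c, 0)"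
    using frechet_derivative_slice(1)[OF E(1,2)] xy by auto
  have "frechet_derivative ((\<lambda>y. F (x, y)) \<circ> inv_into V \<psi>) (at (\<psi> y)) =
      frechet_derivative (\<lambda>t. E (\<phi> x, t)) (at (\<psi> y))"
  proof (rule frechet_derivative_transform_within_open[OF _ M'.chart_image_open[OF V]])
    show "(\<lambda>y. F (x, y)) \<circ> inv_into V \<psi> differentiable at (\<psi> y)"
      using smooth_on_has_derivative[OF M'.chart_image_open[OF V] M'.smooth_functions_chart[OF slice_snd[OF F] V]] xy
      by (auto simp: differentiable_def)
  qed (use xy E(3) U in auto)
  then show "frechet_derivative ((\<lambda>y. F (x, y)) \<circ> inv_into V \<psi>) (at (\<psi> y)) d =
           frechet_derivative E (at (\<phi> x, \<psi> y)) (0, d)"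
    using frechet_derivative_slice(2)[OF E(1,2)] xy by auto
qed

text \<open>In a chart \<open>v\<close> is the derivative in a fixed direction \<open>c\<close>, so
  the result is a slice of the derivative of the chart expression of \<open>F\<close> in the
  direction (c, 0). This supplies the smoothness of fields obtained by differentiating a group
  operation.\<close>

lemma tangent_parameter_fst:
  assumes F: "F \<in> P.C" and v: "v \<in> tangent_space M.C x" and x: "x \<in> topspace T"
  shows "(\<lambda>y. v (\<lambda>x. F (x, y))) \<in> M'.C"
proof (rule M'.smooth_functionsI)
  fix y assume "y \<notin> topspace T'"
  then have "(\<lambda>x. F (x, y)) = (\<lambda>x. 0)" using P.smooth_functions_outside[OF F] by auto
  then show "v (\<lambda>x. F (x, y)) = 0" using M.tangent_0[OF v] by simp
next
  fix V \<psi> assume V: "(V, \<psi>) \<in> A'"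
  obtain U \<phi> where U: "(U, \<phi>) \<in> A" "x \<in> U" using M.chart_cover[OF x] by blast
  obtain c where "\<forall>f\<in>M.C. v f = frechet_derivative (f \<circ> inv_into U \<phi>) (at (\<phi> x)) c"
    using M.tangent_eq_frechet_derivative[OF U v] by blast
  note c = this[rule_format]
  define E where "E = F \<circ> inv_into (U \<times> V) (map_prod \<phi> \<psi>)"
  note E = chart_expression[OF F U(1) V, folded E_def]
  have o: "open (\<psi> ` V)" by (rule M'.chart_image_open[OF V])
  have a: "smooth_on (\<lambda>t. (\<phi> x, t)) (\<psi> ` V)"
    by (rule smooth_on_Pair[OF o smooth_on_const[OF o] smooth_on_bounded_linear[OF o bounded_linear_ident]])
  have "smooth_on (\<lambda>t. frechet_derivative E (at (\<phi> x, t)) (c, 0)) (\<psi> ` V)"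
    by (rule smooth_on_compose[OF o E(1) _ a smooth_on_frechet[OF E(2)]]) (use U in auto)
  then show "smooth_on ((\<lambda>y. v (\<lambda>x. F (x, y))) \<circ> inv_into V \<psi>) (\<psi> ` V)"
  proof (rule smooth_on_cong[OF o, rotated])
    fix t assume "t \<in> \<psi> ` V"
    then obtain y where y: "y \<in> V" "t = \<psi> y" by blast
    show "frechet_derivative E (at (\<phi> x, t)) (c, 0) = ((\<lambda>y. v (\<lambda>x. F (x, y))) \<circ> inv_into V \<psi>) t"
      using frechet_derivative_chart_slice(1)[OF F U(1) V U(2) y(1), folded E_def] c[OF slice_fst[OF F]] V y
      by simp
  qed
qed

lemma tangent_parameter_snd:
  assumes F: "F \<in> P.C" and v: "v \<in> tangent_space M'.C y" and y: "y \<in> topspace T'"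
  shows "(\<lambda>x. v (\<lambda>y. F (x, y))) \<in> M.C"
proof (rule M.smooth_functionsI)
  fix x assume "x \<notin> topspace T"
  then have "(\<lambda>y. F (x, y)) = (\<lambda>y. 0)" using P.smooth_functions_outside[OF F] by auto
  then show "v (\<lambda>y. F (x, y)) = 0" using M'.tangent_0[OF v] by simp
next
  fix U \<phi> assume U: "(U, \<phi>) \<in> A"
  obtain V \<psi> where V: "(V, \<psi>) \<in> A'" "y \<in> V" using M'.chart_cover[OF y] by blast
  obtain c where "\<forall>f\<in>M'.C. v f = frechet_derivative (f \<circ> inv_into V \<psi>) (at (\<psi> y)) c"
    using M'.tangent_eq_frechet_derivative[OF V v] by blast
  note c = this[rule_format]
  define E where "E = F \<circ> inv_into (U \<times> V) (map_prod \<phi> \<psi>)"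
  note E = chart_expression[OF F U V(1), folded E_def]
  have o: "open (\<phi> ` U)" by (rule M.chart_image_open[OF U])
  have a: "smooth_on (\<lambda>s. (s, \<psi> y)) (\<phi> ` U)"
    by (rule smooth_on_Pair[OF o smooth_on_bounded_linear[OF o bounded_linear_ident] smooth_on_const[OF o]])
  have "smooth_on (\<lambda>s. frechet_derivative E (at (s, \<psi> y)) (0, c)) (\<phi> ` U)"
    by (rule smooth_on_compose[OF o E(1) _ a smooth_on_frechet[OF E(2)]]) (use V in auto)
  then show "smooth_on ((\<lambda>x. v (\<lambda>y. F (x, y))) \<circ> inv_into U \<phi>) (\<phi> ` U)"
  proof (rule smooth_on_cong[OF o, rotated])
    fix s assume "s \<in> \<phi> ` U"
    then obtain x where x: "x \<in> U" "s = \<phi> x" by blast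
    show "frechet_derivative E (at (s, \<psi> y)) (0, c) = ((\<lambda>x. v (\<lambda>y. F (x, y))) \<circ> inv_into U \<phi>) s"
      using frechet_derivative_chart_slice(2)[OF F U V(1) x(1) V(2), folded E_def] c[OF slice_snd[OF F]] U x
      by simp
  qed
qed

text \<open>This is the symmetry of second derivatives in a product chart. It stands in for
  commuting flows wherever two derivatives have to change places.\<close>

lemma tangent_interchange:
  assumes F: "F \<in> P.C" and x: "x \<in> topspace T" and y: "y \<in> topspace T'"
    and u: "u \<in> tangent_space M.C x" and v: "v \<in> tangent_space M'.C y"
  shows "u (\<lambda>x. v (\<lambda>y. F (x, y))) = v (\<lambda>y. u (\<lambda>x. F (x, y)))"
proof -
  obtain U \<phi> where U: "(U, \<phi>) \<in> A" "x \<in> U" using M.chart_cover[OF x] by blast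
  obtain V \<psi> where V: "(V, \<psi>) \<in> A'" "y \<in> V" using M'.chart_cover[OF y] by blast
  obtain c where "\<forall>f\<in>M.C. u f = frechet_derivative (f \<circ> inv_into U \<phi>) (at (\<phi> x)) c"
    using M.tangent_eq_frechet_derivative[OF U u] by blast
  note c = this[rule_format]
  obtain d where "\<forall>f\<in>M'.C. v f = frechet_derivative (f \<circ> inv_into V \<psi>) (at (\<psi> y)) d"
    using M'.tangent_eq_frechet_derivative[OF V v] by blast
  note d = this[rule_format]
  define E where "E = F \<circ> inv_into (U \<times> V) (map_prod \<phi> \<psi>)"
  note E = chart_expression[OF F U(1) V(1), folded E_def]
  have oU: "open (\<phi> ` U)" and oV: "open (\<psi> ` V)"
    by (rule M.chart_image_open[OF U(1)] M'.chart_image_open[OF V(1)])+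
  have "frechet_derivative ((\<lambda>x. v (\<lambda>y. F (x, y))) \<circ> inv_into U \<phi>) (at (\<phi> x)) =
      frechet_derivative (\<lambda>s. frechet_derivative E (at (s, \<psi> y)) (0, d)) (at (\<phi> x))"
  proof (rule frechet_derivative_transform_within_open[OF _ oU])
    show "(\<lambda>x. v (\<lambda>y. F (x, y))) \<circ> inv_into U \<phi> differentiable at (\<phi> x)"
      using smooth_on_has_derivative[OF oU M.smooth_functions_chart[OF tangent_parameter_snd[OF F v y] U(1)]] U(2)
      by (auto simp: differentiable_def)
    fix s assume "s \<in> \<phi> ` U"
    then obtain x' where x': "x' \<in> U" "s = \<phi> x'" by blast
    show "((\<lambda>x. v (\<lambda>y. F (x, y))) \<circ> inv_into U \<phi>) s = frechet_derivative E (at (s, \<psi> y)) (0, d)"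
      using frechet_derivative_chart_slice(2)[OF F U(1) V(1) x'(1) V(2), folded E_def] d[OF slice_snd[OF F]] U x'
      by simp
  qed (use U in auto)
  then have 1: "u (\<lambda>x. v (\<lambda>y. F (x, y))) =
      frechet_derivative (\<lambda>q. frechet_derivative E (at q) (0, d)) (at (\<phi> x, \<psi> y)) (c, 0)"
    using c[OF tangent_parameter_snd[OF F v y]]
      frechet_derivative_slice(1)[OF E(1) smooth_on_frechet[OF E(2)], of "\<phi> x" "\<psi> y"] U(2) V(2) by simp
  have "frechet_derivative ((\<lambda>y. u (\<lambda>x. F (x, y))) \<circ> inv_into V \<psi>) (at (\<psi> y)) =
      frechet_derivative (\<lambda>t. frechet_derivative E (at (\<phi> x, t)) (c, 0)) (at (\<psi> y))"
  proof (rule frechet_derivative_transform_within_open[OF _ oV])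
    show "(\<lambda>y. u (\<lambda>x. F (x, y))) \<circ> inv_into V \<psi> differentiable at (\<psi> y)"
      using smooth_on_has_derivative[OF oV M'.smooth_functions_chart[OF tangent_parameter_fst[OF F u x] V(1)]] V(2)
      by (auto simp: differentiable_def)
    fix t assume "t \<in> \<psi> ` V"
    then obtain y' where y': "y' \<in> V" "t = \<psi> y'" by blast
    show "((\<lambda>y. u (\<lambda>x. F (x, y))) \<circ> inv_into V \<psi>) t = frechet_derivative E (at (\<phi> x, t)) (c, 0)"
      using frechet_derivative_chart_slice(1)[OF F U(1) V(1) U(2) y'(1), folded E_def] c[OF slice_fst[OF F]] V y'
      by simp
  qed (use V in auto)
  then have 2: "v (\<lambda>y. u (\<lambda>x. F (x, y))) =
      frechet_derivative (\<lambda>q. frechet_derivative E (at q) (c, 0)) (at (\<phi> x, \<psi> y)) (0, d)"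
    using d[OF tangent_parameter_fst[OF F u x]]
      frechet_derivative_slice(2)[OF E(1) smooth_on_frechet[OF E(2)], of "\<phi> x" "\<psi> y"] U(2) V(2) by simp
  show ?thesis
    unfolding 1 2 by (rule frechet_derivative_symmetric[OF E(1,2)]) (use U V in auto)
qed

lemma tangent_product_rule:
  assumes F: "F \<in> P.C" and xy: "x \<in> topspace T" "y \<in> topspace T'" and u: "u \<in> tangent_space P.C (x, y)"
  shows "u F = tangent_map (topspace T \<times> topspace T') M.C fst u (\<lambda>x. F (x, y))
             + tangent_map (topspace T \<times> topspace T') M'.C snd u (\<lambda>y. F (x, y))"
proof -
  obtain U \<phi> where U: "(U, \<phi>) \<in> A" "x \<in> U" using M.chart_cover[OF xy(1)] by blast
  obtain V \<psi> where V: "(V, \<psi>) \<in> A'" "y \<in> V" using M'.chart_cover[OF xy(2)] by blast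
  note W = prod_atlasI[OF U(1) V(1)]
  let ?i = "inv_into (U \<times> V) (map_prod \<phi> \<psi>)"
  obtain c d where "\<forall>f\<in>P.C. u f = frechet_derivative (f \<circ> ?i) (at (\<phi> x, \<psi> y)) (c, d)"
    using P.tangent_eq_frechet_derivative[OF W _ u] U(2) V(2) by auto
  note q = this[rule_format]
  have split: "u K = frechet_derivative ((\<lambda>x. K (x, y)) \<circ> inv_into U \<phi>) (at (\<phi> x)) c
                 + frechet_derivative ((\<lambda>y. K (x, y)) \<circ> inv_into V \<psi>) (at (\<psi> y)) d" if K: "K \<in> P.C" for K
  proof -
    note E = chart_expression[OF K U(1) V(1)]
    have "((K \<circ> ?i) has_derivative frechet_derivative (K \<circ> ?i) (at (\<phi> x, \<psi> y))) (at (\<phi> x, \<psi> y))"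
      by (rule smooth_on_has_derivative[OF E(1,2)]) (use U V in auto)
    note lin = has_derivative_linear[OF this]
    have "u K = frechet_derivative (K \<circ> ?i) (at (\<phi> x, \<psi> y)) ((c, 0) + (0, d))"
      using q[OF K] by simp
    then show ?thesis
      unfolding linear_add[OF lin] frechet_derivative_chart_slice[OF K U(1) V(1) U(2) V(2)] .
  qed
  let ?F1 = "\<lambda>p. if p \<in> topspace T \<times> topspace T' then F (fst p, y) else 0"
  let ?F2 = "\<lambda>p. if p \<in> topspace T \<times> topspace T' then F (x, snd p) else 0"
  have F1: "?F1 \<in> P.C"
    using smooth_map_pullback_function[OF P.smooth_atlas_axioms M.smooth_atlas_axioms
        smooth_map_fst[OF M.smooth_atlas_axioms M'.smooth_atlas_axioms] slice_fst[OF F, of y]] by simp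
  have F2: "?F2 \<in> P.C"
    using smooth_map_pullback_function[OF P.smooth_atlas_axioms M'.smooth_atlas_axioms
        smooth_map_snd[OF M.smooth_atlas_axioms M'.smooth_atlas_axioms] slice_snd[OF F, of x]] by simp
  have out: "F (a, y) = 0" if "a \<notin> topspace T" for a using P.smooth_functions_outside[OF F] that by auto
  have out': "F (x, b) = 0" if "b \<notin> topspace T'" for b using P.smooth_functions_outside[OF F] that by auto
  have c0: "frechet_derivative ((\<lambda>y. ?F1 (x, y)) \<circ> inv_into V \<psi>) (at (\<psi> y)) d = 0"
  proof -
    have "frechet_derivative (\<lambda>t. F (x, y)) (at (\<psi> y)) = frechet_derivative ((\<lambda>y. ?F1 (x, y)) \<circ> inv_into V \<psi>) (at (\<psi> y))"
      by (rule frechet_derivative_transform_within_open[OF _ M'.chart_image_open[OF V(1)]])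
         (use V M'.chart_subset[OF V(1)] xy in auto)
    then show ?thesis by (metis frechet_derivative_const)
  qed
  have d0: "frechet_derivative ((\<lambda>x. ?F2 (x, y)) \<circ> inv_into U \<phi>) (at (\<phi> x)) c = 0"
  proof -
    have "frechet_derivative (\<lambda>t. F (x, y)) (at (\<phi> x)) = frechet_derivative ((\<lambda>x. ?F2 (x, y)) \<circ> inv_into U \<phi>) (at (\<phi> x))"
      by (rule frechet_derivative_transform_within_open[OF _ M.chart_image_open[OF U(1)]])
         (use U M.chart_subset[OF U(1)] xy in auto)
    then show ?thesis by (metis frechet_derivative_const)
  qed
  have e1: "(\<lambda>x. ?F1 (x, y)) = (\<lambda>x. F (x, y))" using out xy by auto
  have e2: "(\<lambda>y. ?F2 (x, y)) = (\<lambda>y. F (x, y))" using out' xy by auto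
  have "u F = u ?F1 + u ?F2"
    using split[OF F] split[OF F1] split[OF F2] c0 d0 unfolding e1 e2 by simp
  then show ?thesis
    using slice_fst[OF F, of y] slice_snd[OF F, of x] by (simp add: tangent_map_def)
qed

end

section \<open>Traces and invariant inner products\<close>

text \<open>The Lie bracket is linear only on the Lie algebra, not on the ambient function space.\<close>
definition endo_on :: "'v::real_vector set \<Rightarrow> ('v \<Rightarrow> 'v) \<Rightarrow> bool" where
  "endo_on V L \<longleftrightarrow> (\<forall>x\<in>V. L x \<in> V) \<and> (\<forall>x\<in>V. \<forall>y\<in>V. L (x + y) = L x + L y) \<and> (\<forall>x\<in>V. \<forall>c. L (c *\<^sub>R x) = c *\<^sub>R L x)"

lemma endo_on_0: "endo_on V L \<Longrightarrow> subspace V \<Longrightarrow> L 0 = 0"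
  using subspace_0[of V] by (metis endo_on_def scaleR_zero_left)

lemma endo_on_sum:
  assumes "endo_on V L" "subspace V" "\<And>i. i \<in> I \<Longrightarrow> f i \<in> V"
  shows "L (\<Sum>i\<in>I. c i *\<^sub>R f i) = (\<Sum>i\<in>I. c i *\<^sub>R L (f i))"
  using assms(3)
proof (induction I rule: infinite_finite_induct)
  case (infinite I)
  then show ?case using endo_on_0[OF assms(1,2)] by simp
next
  case empty
  then show ?case using endo_on_0[OF assms(1,2)] by simp
next
  case (insert i I)
  have "c i *\<^sub>R f i \<in> V" "(\<Sum>i\<in>I. c i *\<^sub>R f i) \<in> V" "f i \<in> V"
    using insert.prems assms(2) by (auto intro!: subspace_scale subspace_sum)
  then have "L (c i *\<^sub>R f i + (\<Sum>i\<in>I. c i *\<^sub>R f i)) = c i *\<^sub>R L (f i) + L (\<Sum>i\<in>I. c i *\<^sub>R f i)"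
    using assms(1) unfolding endo_on_def by simp
  then show ?case using insert by simp
qed

lemma endo_on_compose: "endo_on V L \<Longrightarrow> endo_on V K \<Longrightarrow> endo_on V (\<lambda>x. L (K x))"
  unfolding endo_on_def by simp

lemma independent_finite_if_spanned:
  assumes "independent b" "finite B" "span b = span B"
  shows "finite b"
  using assms independent_span_bound[of B b] span_superset by blast

lemma sum_representation:
  assumes "independent B" "finite B" "v \<in> span B"
  shows "(\<Sum>b\<in>B. representation B v b *\<^sub>R b) = v"
  using assms sum_representation_eq[of B v B] by simp

lemma representation_lincomb:
  assumes "independent B" "finite I" "\<And>i. i \<in> I \<Longrightarrow> f i \<in> span B"
  shows "representation B (\<Sum>i\<in>I. c i *\<^sub>R f i) b = (\<Sum>i\<in>I. c i * representation B (f i) b)"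
  using assms(2,3)
proof (induction I rule: finite_induct)
  case empty
  then show ?case by (simp add: representation_zero)
next
  case (insert i I)
  then show ?case
    using assms(1) by (simp add: representation_add representation_scale span_scale span_sum)
qed

lemma trace_change_basis:
  assumes B: "independent B" "finite B" "span B = V" and b: "independent b" "finite b" "span b = V"
    and L: "endo_on V L"
  shows "(\<Sum>x\<in>b. representation b (L x) x) = (\<Sum>e\<in>B. representation B (L e) e)"
proof -
  let ?r = "representation b" and ?R = "representation B"
  have sV: "subspace V" using B(3) by auto
  have inV: "x \<in> b \<Longrightarrow> x \<in> V" "e \<in> B \<Longrightarrow> e \<in> V" for x e
    using B(3) b(3) span_base by auto
  have LV: "x \<in> V \<Longrightarrow> L x \<in> V" for x using L by (simp add: endo_on_def)
  have Lx: "L x = (\<Sum>e\<in>B. ?R x e *\<^sub>R L e)" if "x \<in> V" for x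
    using endo_on_sum[OF L sV, of B "\<lambda>e. e" "?R x"] inV(2) sum_representation[OF B(1,2)] that B(3) by simp
  have Le: "?r v x = (\<Sum>e'\<in>B. ?R v e' * ?r e' x)" if "v \<in> V" for v x
    using representation_lincomb[OF b(1) B(2), of "\<lambda>e. e" "?R v" x] inV(2) b(3)
      sum_representation[OF B(1,2)] that B(3) by simp
  \<comment> \<open>The two base change matrices are inverse to each other; after reordering the
    triple sum this collapses the sum over \<open>b\<close>.\<close>
  have dual: "(\<Sum>x\<in>b. ?R x e * ?r e' x) = (if e = e' then 1 else 0)" if "e' \<in> B" for e e'
  proof -
    have "?R (\<Sum>x\<in>b. ?r e' x *\<^sub>R x) e = (\<Sum>x\<in>b. ?r e' x * ?R x e)"
      by (rule representation_lincomb[OF B(1) b(2)]) (use inV B(3) in auto)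
    moreover have "(\<Sum>x\<in>b. ?r e' x *\<^sub>R x) = e'"
      using sum_representation[OF b(1,2)] inV(2)[OF that] b(3) by simp
    ultimately show ?thesis
      using representation_basis[OF B(1) that] by (auto simp: mult.commute)
  qed
  have "(\<Sum>x\<in>b. ?r (L x) x) = (\<Sum>x\<in>b. \<Sum>e\<in>B. ?R x e * ?r (L e) x)"
  proof (rule sum.cong[OF refl])
    fix x assume "x \<in> b"
    then have "x \<in> V" by (rule inV)
    show "?r (L x) x = (\<Sum>e\<in>B. ?R x e * ?r (L e) x)"
      unfolding Lx[OF \<open>x \<in> V\<close>]
      by (rule representation_lincomb[OF b(1) B(2)]) (use LV inV b(3) in auto)
  qed
  also have "\<dots> = (\<Sum>x\<in>b. \<Sum>e\<in>B. \<Sum>e'\<in>B. ?R (L e) e' * (?R x e * ?r e' x))"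
    by (intro sum.cong refl) (simp add: Le[OF LV[OF inV(2)]] sum_distrib_left algebra_simps)
  also have "\<dots> = (\<Sum>e\<in>B. \<Sum>e'\<in>B. \<Sum>x\<in>b. ?R (L e) e' * (?R x e * ?r e' x))"
    by (subst sum.swap, rule sum.cong[OF refl], rule sum.swap)
  also have "\<dots> = (\<Sum>e\<in>B. \<Sum>e'\<in>B. ?R (L e) e' * (if e = e' then 1 else 0))"
    by (intro sum.cong refl) (simp add: sum_distrib_left[symmetric] dual)
  also have "\<dots> = (\<Sum>e\<in>B. ?R (L e) e)"
    by (intro sum.cong refl) (simp add: if_distrib B(2) cong: if_cong)
  finally show ?thesis .
qed

lemma trace_on_basis:
  assumes B: "independent B" "finite B" "span B = V" and L: "endo_on V L"
  shows "trace_on V L = (\<Sum>e\<in>B. representation B (L e) e)"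
proof -
  define b where "b = (SOME b. independent b \<and> span b = V)"
  have "independent b \<and> span b = V"
    unfolding b_def by (rule someI[of _ B]) (use B in auto)
  then have b: "independent b" "span b = V" by auto
  \<comment> \<open>The basis picked by \<open>SOME\<close> is not chosen to be finite; it is finite
    because an independent set cannot outgrow a finite spanning set.\<close>
  then have "finite b" using independent_finite_if_spanned B by blast
  have "trace_on V L = (\<Sum>x\<in>b. representation b (L x) x)"
    by (simp add: trace_on_def b_def Let_def)
  then show ?thesis
    using trace_change_basis[OF B b(1) \<open>finite b\<close> b(2) L] by simp
qed

lemma trace_on_commute:
  assumes B: "independent B" "finite B" "span B = V" and L: "endo_on V L" and K: "endo_on V K"
  shows "trace_on V (\<lambda>x. L (K x)) = trace_on V (\<lambda>x. K (L x))"
proof -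
  let ?R = "representation B"
  have sV: "subspace V" using B(3) by auto
  have inV: "e \<in> B \<Longrightarrow> e \<in> V" for e using B(3) span_base by auto
  have *: "?R (L (K e)) e = (\<Sum>e'\<in>B. ?R (K e) e' * ?R (L e') e)"
    if L: "endo_on V L" and K: "endo_on V K" and e: "e \<in> B" for L K e
  proof -
    have "K e \<in> V" using K inV[OF e] by (simp add: endo_on_def)
    then have "L (K e) = (\<Sum>e'\<in>B. ?R (K e) e' *\<^sub>R L e')"
      using endo_on_sum[OF L sV, of B "\<lambda>e. e" "?R (K e)"] inV sum_representation[OF B(1,2)] B(3) by simp
    then show ?thesis
      using representation_lincomb[OF B(1,2), of L "?R (K e)" e] L inV B(3) by (simp add: endo_on_def)
  qed
  have "trace_on V (\<lambda>x. L (K x)) = (\<Sum>e\<in>B. \<Sum>e'\<in>B. ?R (K e) e' * ?R (L e') e)"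
    using trace_on_basis[OF B endo_on_compose[OF L K]] *[OF L K] by simp
  also have "\<dots> = (\<Sum>e\<in>B. \<Sum>e'\<in>B. ?R (L e) e' * ?R (K e') e)"
    by (subst sum.swap) (simp add: mult.commute)
  also have "\<dots> = trace_on V (\<lambda>x. K (L x))"
    using trace_on_basis[OF B endo_on_compose[OF K L]] *[OF K L] by simp
  finally show ?thesis .
qed

lemma trace_on_lincomb:
  assumes B: "independent B" "finite B" "span B = V" and L: "endo_on V L" and K: "endo_on V K"
    and S: "\<And>x. x \<in> V \<Longrightarrow> S x = c *\<^sub>R L x + d *\<^sub>R K x"
  shows "trace_on V S = c * trace_on V L + d * trace_on V K"
proof -
  have sV: "subspace V" using B(3) by auto
  have inV: "e \<in> B \<Longrightarrow> e \<in> V" for e using B(3) span_base by auto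
  have LK: "x \<in> V \<Longrightarrow> L x \<in> V" "x \<in> V \<Longrightarrow> K x \<in> V" for x using L K by (auto simp: endo_on_def)
  have "endo_on V S"
    unfolding endo_on_def
  proof (intro conjI ballI allI)
    fix x y r assume "x \<in> V" "y \<in> V"
    then have "x + y \<in> V" "r *\<^sub>R x \<in> V" using sV by (auto intro: subspace_add subspace_scale)
    then show "S x \<in> V" "S (x + y) = S x + S y" "S (r *\<^sub>R x) = r *\<^sub>R S x"
      using S LK L K \<open>x \<in> V\<close> \<open>y \<in> V\<close> sV
      by (auto simp: endo_on_def algebra_simps intro!: subspace_add subspace_scale)
  qed
  moreover have "representation B (S e) e = c * representation B (L e) e + d * representation B (K e) e"
    if "e \<in> B" for e
  proof -
    have "L e \<in> span B" "K e \<in> span B" using LK inV[OF that] B(3) by auto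
    then show ?thesis
      using S[OF inV[OF that]] B(1) by (simp add: representation_add representation_scale span_scale)
  qed
  ultimately show ?thesis
    using trace_on_basis[OF B] L K by (simp add: sum.distrib sum_distrib_left)
qed

section \<open>Inner products on a subspace and orthonormal bases\<close>

definition inner_on :: "'v::real_vector set \<Rightarrow> ('v \<Rightarrow> 'v \<Rightarrow> real) \<Rightarrow> bool" where
  "inner_on V Q \<longleftrightarrow> (\<forall>x\<in>V. \<forall>y\<in>V. \<forall>z\<in>V. \<forall>c. Q (x + y) z = Q x z + Q y z \<and> Q (c *\<^sub>R x) z = c * Q x z) \<and>
     (\<forall>x\<in>V. \<forall>y\<in>V. Q x y = Q y x) \<and> (\<forall>x\<in>V. x \<noteq> 0 \<longrightarrow> Q x x > 0)"

lemma inner_on_add: "inner_on V Q \<Longrightarrow> x \<in> V \<Longrightarrow> y \<in> V \<Longrightarrow> z \<in> V \<Longrightarrow> Q (x + y) z = Q x z + Q y z"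
  and inner_on_scale: "inner_on V Q \<Longrightarrow> x \<in> V \<Longrightarrow> z \<in> V \<Longrightarrow> Q (c *\<^sub>R x) z = c * Q x z"
  and inner_on_sym: "inner_on V Q \<Longrightarrow> x \<in> V \<Longrightarrow> y \<in> V \<Longrightarrow> Q x y = Q y x"
  and inner_on_pos: "inner_on V Q \<Longrightarrow> x \<in> V \<Longrightarrow> x \<noteq> 0 \<Longrightarrow> Q x x > 0"
  by (simp_all add: inner_on_def)

lemma inner_on_0: "inner_on V Q \<Longrightarrow> subspace V \<Longrightarrow> z \<in> V \<Longrightarrow> Q 0 z = 0"
  using inner_on_scale[of V Q 0 z 0] by (simp add: subspace_0)

lemma inner_on_nonneg: "inner_on V Q \<Longrightarrow> subspace V \<Longrightarrow> x \<in> V \<Longrightarrow> Q x x \<ge> 0"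
  using inner_on_0[of V Q 0] inner_on_pos[of V Q x] by (cases "x = 0") (auto simp: subspace_0)

lemma inner_on_sum:
  assumes "inner_on V Q" "subspace V" "finite I" "\<And>i. i \<in> I \<Longrightarrow> f i \<in> V" "z \<in> V"
  shows "Q (\<Sum>i\<in>I. c i *\<^sub>R f i) z = (\<Sum>i\<in>I. c i * Q (f i) z)"
  using assms(3,4)
proof (induction I rule: finite_induct)
  case empty
  show ?case using inner_on_0[OF assms(1,2,5)] by simp
next
  case (insert i I)
  have "c i *\<^sub>R f i \<in> V" "(\<Sum>i\<in>I. c i *\<^sub>R f i) \<in> V" "f i \<in> V"
    using insert.prems assms(2) by (auto intro!: subspace_scale subspace_sum)
  then have "Q (c i *\<^sub>R f i + (\<Sum>i\<in>I. c i *\<^sub>R f i)) z = c i * Q (f i) z + Q (\<Sum>i\<in>I. c i *\<^sub>R f i) z"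
    by (simp add: inner_on_add[OF assms(1) _ _ assms(5)] inner_on_scale[OF assms(1) _ assms(5)])
  then show ?case using insert by simp
qed

text \<open>Gram-Schmidt, with one vector per induction step. If the remainder \<open>w\<close> is
  zero, the new vector already lies in the span and nothing is added.\<close>

lemma exists_orthonormal_basis:
  assumes Q: "inner_on V Q" and sV: "subspace V" and S: "finite S" "S \<subseteq> V"
  shows "\<exists>b. finite b \<and> b \<subseteq> V \<and> span b = span S \<and> (\<forall>x\<in>b. \<forall>y\<in>b. Q x y = (if x = y then 1 else 0))"
  using S
proof (induction S rule: finite_induct)
  case empty
  then show ?case by (intro exI[of _ "{}"]) auto
next
  case (insert v S)
  then obtain b where b: "finite b" "b \<subseteq> V" "span b = span S" "\<forall>x\<in>b. \<forall>y\<in>b. Q x y = (if x = y then 1 else 0)"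
    by auto
  have v: "v \<in> V" using insert by auto
  define s where "s = (\<Sum>x\<in>b. Q v x *\<^sub>R x)"
  define w where "w = v - s"
  have s: "s \<in> span b" unfolding s_def by (intro span_sum span_scale span_base)
  have sV': "s \<in> V" using b(2) sV by (auto simp: s_def intro!: subspace_sum subspace_scale)
  have wV: "w \<in> V" using v sV' sV by (simp add: w_def subspace_diff)
  have spw: "span (insert w b) = span (insert v S)"
  proof -
    have "span (insert w b) = span (insert v b)"
      using s unfolding w_def by (metis eq_span_insert_eq minus_diff_eq span_neg add_diff_cancel_left' diff_diff_eq2)
    also have "\<dots> = span (insert v S)" using b(3) by (simp add: span_insert)
    finally show ?thesis .
  qed
  show ?case
  proof (cases "w = 0")
    case True
    then have "span b = span (insert v S)" using spw by simp
    then show ?thesis using b by blast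
  next
    case False
    then have pos: "Q w w > 0" by (rule inner_on_pos[OF Q wV])
    have sym: "x \<in> V \<Longrightarrow> y \<in> V \<Longrightarrow> Q x y = Q y x" for x y by (rule inner_on_sym[OF Q])
    have scl: "x \<in> V \<Longrightarrow> y \<in> V \<Longrightarrow> Q (c *\<^sub>R x) y = c * Q x y" for x y c
      by (rule inner_on_scale[OF Q])
    have orth: "Q w y = 0" if y: "y \<in> b" for y
    proof -
      have yV: "y \<in> V" using y b(2) by auto
      have "Q s y = (\<Sum>x\<in>b. Q v x * Q x y)"
        unfolding s_def by (rule inner_on_sum[OF Q sV b(1) _ yV]) (use b(2) in auto)
      also have "\<dots> = (\<Sum>x\<in>b. if x = y then Q v x else 0)"
        by (rule sum.cong) (use b(4) y in auto)
      also have "\<dots> = Q v y" using b(1) y by simp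
      finally have "Q s y = Q v y" .
      moreover have "Q (w + s) y = Q w y + Q s y"
        by (rule inner_on_add[OF Q wV sV' yV])
      ultimately show ?thesis by (simp add: w_def)
    qed
    let ?c = "1 / sqrt (Q w w)"
    let ?u = "?c *\<^sub>R w"
    have uV: "?u \<in> V" using wV sV by (simp add: subspace_scale)
    have uu: "Q ?u ?u = 1"
    proof -
      have "Q ?u ?u = ?c * (?c * Q w w)" using scl sym wV uV by metis
      then show ?thesis using pos by (simp add: field_simps)
    qed
    have uy: "Q ?u y = 0 \<and> Q y ?u = 0" if "y \<in> b" for y
      using scl[OF wV, of y ?c] orth[OF that] sym[OF uV, of y] that b(2) by auto
    have "span (insert ?u b) = span (insert w b)"
    proof -
      have "?u \<in> span (insert w b)" by (intro span_scale span_base) simp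
      moreover have "w = sqrt (Q w w) *\<^sub>R ?u" using pos by simp
      then have "w \<in> span (insert ?u b)" by (metis insertI1 span_base span_scale)
      ultimately show ?thesis
        by (intro subset_antisym span_minimal) (auto intro: span_base)
    qed
    then have "span (insert ?u b) = span (insert v S)" using spw by simp
    then show ?thesis
      using b uV uu uy by (intro exI[of _ "insert ?u b"]) auto
  qed
qed

lemma orthonormal_imp_independent:
  assumes Q: "inner_on V Q" and sV: "subspace V" and b: "finite b" "b \<subseteq> V"
    "\<forall>x\<in>b. \<forall>y\<in>b. Q x y = (if x = y then 1 else 0)"
  shows "independent b" "v \<in> span b \<Longrightarrow> x \<in> b \<Longrightarrow> representation b v x = Q v x"
proof -
  have *: "Q (\<Sum>y\<in>b. c y *\<^sub>R y) x = c x" if "x \<in> b" for c x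
  proof -
    have "Q (\<Sum>y\<in>b. c y *\<^sub>R y) x = (\<Sum>y\<in>b. c y * Q y x)"
      by (rule inner_on_sum[OF Q sV b(1)]) (use b(2) that in auto)
    also have "\<dots> = (\<Sum>y\<in>b. if y = x then c y else 0)"
      by (rule sum.cong) (use b(3) that in auto)
    finally show ?thesis using b(1) that by simp
  qed
  have Q0: "Q 0 x = 0" if "x \<in> V" for x
    using inner_on_sum[OF Q sV finite.emptyI, of id x] that by simp
  show ind: "independent b"
  proof
    assume "dependent b"
    then obtain c x where c: "x \<in> b" "c x \<noteq> 0" "(\<Sum>y\<in>b. c y *\<^sub>R y) = 0"
      using dependent_finite[OF b(1)] by auto
    then show False using *[OF c(1), of c] Q0[of x] b(2) by auto
  qed
  assume "v \<in> span b" "x \<in> b"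
  then show "representation b v x = Q v x"
    using *[of x "representation b v"] sum_representation[OF ind b(1)] by simp
qed

text \<open>
  The square of an endomorphism that is skew with respect to an inner product has trace
  \<open>- \<Sum> |L b|\<^sup>2\<close> over an orthonormal basis \<open>b\<close>.
\<close>
lemma trace_skew_square_neg:
  assumes Q: "inner_on V Q" and S: "finite S" "span S = V" and L: "endo_on V L"
    and skew: "\<And>x y. x \<in> V \<Longrightarrow> y \<in> V \<Longrightarrow> Q (L x) y = - Q x (L y)"
    and nz: "x \<in> V" "L x \<noteq> 0"
  shows "trace_on V (\<lambda>x. L (L x)) < 0"
proof -
  have sV: "subspace V" using S(2) by auto
  have "S \<subseteq> V" using S(2) span_superset by auto
  from exists_orthonormal_basis[OF Q sV S(1) this]
  obtain b where b: "finite b" "b \<subseteq> V" "span b = V" "\<forall>x\<in>b. \<forall>y\<in>b. Q x y = (if x = y then 1 else 0)"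
    using S(2) by auto
  note on = orthonormal_imp_independent[OF Q sV b(1,2,4)]
  have LV: "x \<in> V \<Longrightarrow> L x \<in> V" for x using L by (simp add: endo_on_def)
  have "trace_on V (\<lambda>x. L (L x)) = (\<Sum>e\<in>b. representation b (L (L e)) e)"
    by (rule trace_on_basis[OF on(1) b(1,3) endo_on_compose[OF L L]])
  also have "\<dots> = (\<Sum>e\<in>b. - Q (L e) (L e))"
    by (rule sum.cong[OF refl]) (use on(2) skew LV b(2,3) in auto)
  finally have tr: "trace_on V (\<lambda>x. L (L x)) = - (\<Sum>e\<in>b. Q (L e) (L e))" by (simp add: sum_negf)
  have "\<exists>e\<in>b. L e \<noteq> 0"
  proof (rule ccontr)
    assume "\<not> ?thesis"
    then have "L (\<Sum>e\<in>b. representation b x e *\<^sub>R e) = 0"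
      using endo_on_sum[OF L sV, of b "\<lambda>e. e" "representation b x"] b(2) by auto
    then show False using nz sum_representation[OF on(1) b(1)] b(3) by simp
  qed
  then obtain e where e: "e \<in> b" "L e \<noteq> 0" by blast
  have "(\<Sum>e\<in>b. Q (L e) (L e)) > 0"
  proof (rule sum_pos2[OF b(1) e(1)])
    show "0 < Q (L e) (L e)" using inner_on_pos[OF Q LV e(2)] e(1) b(2) by blast
    show "0 \<le> Q (L i) (L i)" if "i \<in> b" for i using inner_on_nonneg[OF Q sV LV] that b(2) by blast
  qed
  then show ?thesis using tr by simp
qed

subsection \<open>Bounded groups of linear maps\<close>

text \<open>
  Among the forms that are uniformly positive on the orbits of the group, the one with the least
  supremum of Hilbert-Schmidt norms over its orbit exists by compactness, is unique by strict
  convexity, and is therefore invariant.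
\<close>
lemma invariant_inner_product:
  fixes \<Gamma> :: "('e::euclidean_space \<Rightarrow> 'e) set"
  assumes lin: "\<And>g. g \<in> \<Gamma> \<Longrightarrow> linear g"
    and one: "id \<in> \<Gamma>"
    and comp: "\<And>g h. g \<in> \<Gamma> \<Longrightarrow> h \<in> \<Gamma> \<Longrightarrow> g \<circ> h \<in> \<Gamma>"
    and inv: "\<And>g. g \<in> \<Gamma> \<Longrightarrow> \<exists>h\<in>\<Gamma>. g \<circ> h = id \<and> h \<circ> g = id"
    and bdd: "\<And>g x. g \<in> \<Gamma> \<Longrightarrow> norm (g x) \<le> K * norm x"
  obtains S :: "'e \<Rightarrow>\<^sub>L 'e" where "\<And>x y. x \<bullet> S y = y \<bullet> S x" "\<And>x. x \<noteq> 0 \<Longrightarrow> x \<bullet> S x > 0"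
    "\<And>g x y. g \<in> \<Gamma> \<Longrightarrow> g x \<bullet> S (g y) = x \<bullet> S y"
proof -
  have K: "K > 0"
  proof -
    obtain i :: 'e where "i \<in> Basis" using nonempty_Basis by blast
    then show ?thesis using bdd[OF one, of i] by simp
  qed
  let ?B = "Basis :: 'e set"
  define n where "n = real (card ?B)"
  have n: "n > 0" by (simp add: n_def)
  \<comment> \<open>The squared Hilbert-Schmidt norm of the form \<open>S\<close> transported by
    \<open>g\<close>, in the standard basis. Its supremum over the group is the quantity to be
    minimised.\<close>
  define N where "N g S = (\<Sum>i\<in>?B. \<Sum>j\<in>?B. (g i \<bullet> blinfun_apply S (g j))\<^sup>2)" for g and S :: "'e \<Rightarrow>\<^sub>L 'e"
  have N_entry: "(g i \<bullet> S (g j))\<^sup>2 \<le> N g S" if "i \<in> ?B" "j \<in> ?B" for g i j and S :: "'e \<Rightarrow>\<^sub>L 'e"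
  proof -
    have "(g i \<bullet> S (g j))\<^sup>2 \<le> (\<Sum>j\<in>?B. (g i \<bullet> S (g j))\<^sup>2)"
      by (rule member_le_sum) (use that in auto)
    also have "\<dots> \<le> N g S"
      unfolding N_def by (rule member_le_sum[where f = "\<lambda>i. \<Sum>j\<in>?B. (g i \<bullet> S (g j))\<^sup>2"]) (use that in \<open>auto intro: sum_nonneg\<close>)
    finally show ?thesis .
  qed
  have N_nonneg: "0 \<le> N g S" for g S by (auto simp: N_def intro!: sum_nonneg)
  have rep: "g x = (\<Sum>i\<in>?B. (x \<bullet> i) *\<^sub>R g i)" if "g \<in> \<Gamma>" for g x
  proof -
    have "g x = g (\<Sum>i\<in>?B. (x \<bullet> i) *\<^sub>R i)" by (simp only: euclidean_representation)
    then show ?thesis by (simp only: linear_sum[OF lin[OF that]] linear_scale[OF lin[OF that]])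
  qed
  have form: "\<bar>g x \<bullet> S (g y)\<bar> \<le> n\<^sup>2 * norm x * norm y * sqrt (N g S)" if g: "g \<in> \<Gamma>" for g x y and S :: "'e \<Rightarrow>\<^sub>L 'e"
  proof -
    have "g x \<bullet> S (g y) = (\<Sum>i\<in>?B. \<Sum>j\<in>?B. (x \<bullet> i) * (y \<bullet> j) * (g i \<bullet> S (g j)))"
      unfolding rep[OF g, of x] rep[OF g, of y]
      by (simp add: blinfun.sum_right blinfun.scaleR_right inner_sum_left inner_sum_right
          sum_distrib_left mult.assoc)
         (simp add: mult.left_commute mult.assoc, rule sum.swap)
    also have "\<bar>\<dots>\<bar> \<le> (\<Sum>i\<in>?B. \<Sum>j\<in>?B. \<bar>(x \<bullet> i) * (y \<bullet> j) * (g i \<bullet> S (g j))\<bar>)"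
      by (rule order_trans[OF sum_abs]) (intro sum_mono sum_abs)
    also have "\<dots> \<le> (\<Sum>i\<in>?B. \<Sum>j\<in>?B. norm x * norm y * sqrt (N g S))"
    proof (intro sum_mono)
      fix i j assume ij: "i \<in> ?B" "j \<in> ?B"
      have "\<bar>g i \<bullet> S (g j)\<bar> \<le> sqrt (N g S)"
        using N_entry[OF ij, of g S] by (metis real_sqrt_abs real_sqrt_le_mono)
      then show "\<bar>(x \<bullet> i) * (y \<bullet> j) * (g i \<bullet> S (g j))\<bar> \<le> norm x * norm y * sqrt (N g S)"
        unfolding abs_mult by (intro mult_mono Basis_le_norm ij) auto
    qed
    also have "\<dots> = n\<^sup>2 * norm x * norm y * sqrt (N g S)"
      by (simp add: n_def power2_eq_square)
    finally show ?thesis .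
  qed
  \<comment> \<open>The price of undoing a transport: by \<open>form\<close>, each squared entry of
    a form is at most (n^2 K^2)^2 times the norm of its transport, and there are n^2 entries. The
    bound must be uniform in \<open>g\<close> because the supremum over the group need not be
    attained.\<close>
  define \<delta> where "\<delta> = 1 / (n\<^sup>2 * (n\<^sup>2 * K * K)\<^sup>2)"
  have \<delta>: "\<delta> > 0" using n K by (simp add: \<delta>_def)
  have N_lower: "\<delta> * N id R \<le> N g R" if g: "g \<in> \<Gamma>" for g R
  proof -
    obtain h where h: "h \<in> \<Gamma>" "g \<circ> h = id" using inv[OF g] by blast
    have "(i \<bullet> R j)\<^sup>2 \<le> (n\<^sup>2 * K * K)\<^sup>2 * N g R" if ij: "i \<in> ?B" "j \<in> ?B" for i j
    proof -
      have gh: "g (h x) = x" for x using h(2) by (metis comp_apply id_apply)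
      have nh: "norm (h i) \<le> K" "norm (h j) \<le> K" using bdd[OF h(1)] ij by (metis mult.right_neutral norm_Basis)+
      have "\<bar>i \<bullet> R j\<bar> \<le> n\<^sup>2 * norm (h i) * norm (h j) * sqrt (N g R)"
        using form[OF g, of "h i" R "h j"] by (simp add: gh)
      also have "\<dots> \<le> n\<^sup>2 * K * K * sqrt (N g R)"
        using nh K by (intro mult_mono) (auto simp: N_nonneg)
      finally have "\<bar>i \<bullet> R j\<bar>\<^sup>2 \<le> (n\<^sup>2 * K * K * sqrt (N g R))\<^sup>2"
        by (intro power_mono) auto
      then show ?thesis by (simp add: power_mult_distrib N_nonneg)
    qed
    then have "N id R \<le> (\<Sum>i\<in>?B. \<Sum>j\<in>?B. (n\<^sup>2 * K * K)\<^sup>2 * N g R)"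
      unfolding N_def id_apply by (intro sum_mono) auto
    also have "\<dots> = n\<^sup>2 * (n\<^sup>2 * K * K)\<^sup>2 * N g R" by (simp add: n_def power2_eq_square)
    finally show ?thesis
      using n K by (simp add: \<delta>_def field_simps)
  qed
  \<comment> \<open>The identity form satisfies the lower bound because the inverse of
    \<open>g\<close> is bounded by \<open>K\<close>. Unlike bare positivity, this bound survives
    limits, so the minimiser is still positive definite.\<close>
  define P where "P S \<longleftrightarrow> (\<forall>x y. x \<bullet> blinfun_apply S y = y \<bullet> blinfun_apply S x) \<and>
      (\<forall>g\<in>\<Gamma>. \<forall>x. norm x ^ 2 / K ^ 2 \<le> g x \<bullet> blinfun_apply S (g x))" for S :: "'e \<Rightarrow>\<^sub>L 'e"
  define F where "F t = {S. P S \<and> (\<forall>g\<in>\<Gamma>. N g S \<le> t)}" for t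
  define \<T> where "\<T> = {t. F t \<noteq> {}}"
  define m where "m = Inf \<T>"
  have bb: "bdd_below \<T>"
    unfolding \<T>_def F_def using N_nonneg[of id] one order_trans by (intro bdd_belowI[of _ 0]) blast
  have "id_blinfun \<in> F (\<Sum>i\<in>?B. \<Sum>j\<in>?B. (K * K)\<^sup>2)"
    unfolding F_def P_def
  proof (intro CollectI conjI allI ballI)
    show "x \<bullet> id_blinfun y = y \<bullet> id_blinfun x" for x y :: 'e by (simp add: inner_commute)
    fix g assume g: "g \<in> \<Gamma>"
    show "norm x ^ 2 / K ^ 2 \<le> g x \<bullet> id_blinfun (g x)" for x
    proof -
      obtain h where h: "h \<in> \<Gamma>" "h \<circ> g = id" using inv[OF g] by blast
      have "norm x \<le> K * norm (g x)" using bdd[OF h(1), of "g x"] h(2) by (metis comp_apply id_apply)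
      then have "norm x ^ 2 \<le> (K * norm (g x)) ^ 2" by (intro power_mono) auto
      then show ?thesis using K by (simp add: power_mult_distrib pos_divide_le_eq mult.commute power2_norm_eq_inner)
    qed
    show "N g id_blinfun \<le> (\<Sum>i\<in>?B. \<Sum>j\<in>?B. (K * K)\<^sup>2)"
      unfolding N_def
    proof (intro sum_mono)
      fix i j assume ij: "i \<in> ?B" "j \<in> ?B"
      have "\<bar>g i \<bullet> id_blinfun (g j)\<bar> \<le> norm (g i) * norm (g j)" by (simp add: Cauchy_Schwarz_ineq2)
      also have "\<dots> \<le> K * K"
        using bdd[OF g, of i] bdd[OF g, of j] ij K by (intro mult_mono) auto
      finally have "\<bar>g i \<bullet> id_blinfun (g j)\<bar>\<^sup>2 \<le> (K * K)\<^sup>2" by (intro power_mono) auto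
      then show "(g i \<bullet> id_blinfun (g j))\<^sup>2 \<le> (K * K)\<^sup>2" by simp
    qed
  qed
  then have ne: "\<T> \<noteq> {}" by (auto simp: \<T>_def)
  have "\<exists>S. S \<in> F (m + 1 / real (Suc k))" for k
  proof -
    have "m < m + 1 / real (Suc k)" by simp
    then obtain t where "t \<in> \<T>" "t < m + 1 / real (Suc k)"
      using cInf_lessD[OF ne] unfolding m_def by blast
    then show ?thesis unfolding \<T>_def F_def by force
  qed
  then obtain s where s: "\<And>k. s k \<in> F (m + 1 / real (Suc k))" by metis
  \<comment> \<open>The norm at the identity of the group already controls the operator norm, so a
    minimising sequence is bounded and has a convergent subsequence.\<close>
  have "norm (s k) \<le> n\<^sup>2 * sqrt (m + 1)" for k
  proof (rule norm_blinfun_bound)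
    have "N id (s k) \<le> m + 1 / real (Suc k)" using s[of k] one by (auto simp: F_def)
    also have "\<dots> \<le> m + 1" by (simp add: divide_le_eq)
    finally have Nle: "N id (s k) \<le> m + 1" .
    then have m1: "0 \<le> m + 1" using N_nonneg order_trans by blast
    then show "0 \<le> n\<^sup>2 * sqrt (m + 1)" by simp
    fix x
    have "norm (s k x) ^ 2 = s k x \<bullet> s k x" by (simp add: power2_norm_eq_inner)
    also have "\<dots> \<le> n\<^sup>2 * norm (s k x) * norm x * sqrt (N id (s k))"
      using form[OF one, of "s k x" "s k" x] by simp
    also have "\<dots> \<le> n\<^sup>2 * norm (s k x) * norm x * sqrt (m + 1)"
      using Nle by (intro mult_left_mono) auto
    finally have "norm (s k x) * norm (s k x) \<le> norm (s k x) * (n\<^sup>2 * sqrt (m + 1) * norm x)"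
      by (simp add: power2_eq_square mult_ac)
    then show "norm (s k x) \<le> n\<^sup>2 * sqrt (m + 1) * norm x"
      using m1 by (cases "norm (s k x) = 0") auto
  qed
  then have "bounded (range s)" by (auto simp: bounded_iff)
  then obtain S r where r: "strict_mono r" and lim: "(s \<circ> r) \<longlonglongrightarrow> S"
    using bounded_imp_convergent_subsequence[of s] by (auto simp: o_def)
  have limx: "(\<lambda>k. s (r k) x) \<longlonglongrightarrow> S x" for x
    using blinfun.tendsto[OF lim tendsto_const] by (simp add: o_def)
  have SF: "S \<in> F m"
    unfolding F_def P_def
  proof (intro CollectI conjI allI ballI)
    have sP: "P (s k)" for k using s[of k] by (simp add: F_def)
    show "x \<bullet> S y = y \<bullet> S x" for x y
    proof (rule LIMSEQ_unique)
      show "(\<lambda>k. x \<bullet> s (r k) y) \<longlonglongrightarrow> x \<bullet> S y" by (intro tendsto_intros limx)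
      have "(\<lambda>k. y \<bullet> s (r k) x) \<longlonglongrightarrow> y \<bullet> S x" by (intro tendsto_intros limx)
      then show "(\<lambda>k. x \<bullet> s (r k) y) \<longlonglongrightarrow> y \<bullet> S x" using sP by (simp add: P_def)
    qed
    fix g assume g: "g \<in> \<Gamma>"
    show "norm x ^ 2 / K ^ 2 \<le> g x \<bullet> S (g x)" for x
    proof (rule LIMSEQ_le_const)
      show "(\<lambda>k. g x \<bullet> s (r k) (g x)) \<longlonglongrightarrow> g x \<bullet> S (g x)" by (intro tendsto_intros limx)
      show "\<exists>N. \<forall>k\<ge>N. (norm x)\<^sup>2 / K\<^sup>2 \<le> g x \<bullet> s (r k) (g x)" using sP g by (simp add: P_def)
    qed
    show "N g S \<le> m"
    proof (rule LIMSEQ_le)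
      show "(\<lambda>k. N g (s (r k))) \<longlonglongrightarrow> N g S"
        unfolding N_def by (intro tendsto_intros limx)
      have "(\<lambda>k. m + 1 / real (Suc k)) \<longlonglongrightarrow> m + 0"
        by (intro tendsto_intros LIMSEQ_Suc[OF lim_1_over_n])
      then show "(\<lambda>k. m + 1 / real (Suc (r k))) \<longlonglongrightarrow> m"
        using LIMSEQ_subseq_LIMSEQ[OF _ r] by (fastforce simp: o_def)
      show "\<exists>N0. \<forall>k\<ge>N0. N g (s (r k)) \<le> m + 1 / real (Suc (r k))"
        using s g by (auto simp: F_def)
    qed
  qed
  \<comment> \<open>By the parallelogram identity, the midpoint of two minimisers has all its norms
    below \<open>m\<close> by at least \<open>\<delta> * N id (S - S') / 4\<close>. This contradicts
    the infimum unless the two agree.\<close>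
  have uniq: "S = S'" if S': "S' \<in> F m" for S'
  proof -
    let ?M = "(1 / 2) *\<^sub>R (S + S')"
    have ap: "x \<bullet> ?M y = (x \<bullet> S y + x \<bullet> S' y) / 2" for x y
      by (simp add: blinfun.add_left blinfun.scaleR_left inner_add_right)
    have sq: "((a + b) / 2)\<^sup>2 = a\<^sup>2 / 2 + b\<^sup>2 / 2 - (a - b)\<^sup>2 / 4" for a b :: real
      by (simp add: power2_eq_square field_simps)
    have NM: "N g ?M = N g S / 2 + N g S' / 2 - N g (S - S') / 4" for g
      unfolding N_def ap sq
      by (simp add: sum.distrib sum_subtractf sum_divide_distrib blinfun.diff_left inner_diff_right)
    have "?M \<in> F (m - \<delta> * N id (S - S') / 4)"
      unfolding F_def P_def
    proof (intro CollectI conjI allI ballI)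
      show "x \<bullet> ?M y = y \<bullet> ?M x" for x y
        unfolding ap using SF S' by (simp add: F_def P_def)
      fix g assume g: "g \<in> \<Gamma>"
      have "N g S \<le> m" "N g S' \<le> m" using SF S' g by (auto simp: F_def)
      then show "N g ?M \<le> m - \<delta> * N id (S - S') / 4"
        unfolding NM using N_lower[OF g, of "S - S'"] by simp
      show "norm x ^ 2 / K ^ 2 \<le> g x \<bullet> ?M (g x)" for x
      proof -
        have "norm x ^ 2 / K ^ 2 \<le> g x \<bullet> S (g x)" "norm x ^ 2 / K ^ 2 \<le> g x \<bullet> S' (g x)"
          using SF S' g by (auto simp: F_def P_def)
        moreover have "c \<le> (a + b) / 2" if "c \<le> a" "c \<le> b" for a b c :: real
          using that by simp
        ultimately show ?thesis unfolding ap by blast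
      qed
    qed
    then have "m \<le> m - \<delta> * N id (S - S') / 4"
      unfolding m_def by (intro cInf_lower bb) (auto simp: \<T>_def)
    then have "\<delta> * N id (S - S') \<le> 0" by simp
    then have N0: "N id (S - S') = 0" using \<delta> N_nonneg[of id "S - S'"] by (simp add: mult_le_0_iff)
    have "(S - S') x = 0" for x
      using form[OF one, of "(S - S') x" "S - S'" x]
      by (simp add: N0) (metis inner_eq_zero_iff inner_ge_zero order_antisym)
    then show "S = S'"
      by (metis blinfun.diff_left blinfun_eqI right_minus_eq)
  qed
  show thesis
  proof
    show "x \<bullet> S y = y \<bullet> S x" for x y using SF by (simp add: F_def P_def)
    show "x \<bullet> S x > 0" if "x \<noteq> 0" for x
    proof -
      have "norm x ^ 2 / K ^ 2 \<le> id x \<bullet> S (id x)" using SF one unfolding F_def P_def by blast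
      moreover have "norm x ^ 2 / K ^ 2 > 0" using that K by simp
      ultimately show ?thesis by simp
    qed
    fix h x y assume h: "h \<in> \<Gamma>"
    have bl: "bounded_linear h" using lin[OF h] by (simp add: linear_conv_bounded_linear)
    have bl': "bounded_linear (adjoint h)" using adjoint_linear[OF lin[OF h]] by (simp add: linear_conv_bounded_linear)
    \<comment> \<open>The pull-back of the form \<open>S\<close> by \<open>h\<close>. Its norm at
      \<open>g\<close> is that of \<open>S\<close> at the composite of \<open>h\<close> and
      \<open>g\<close>, so it is again a minimiser and equals \<open>S\<close> by
      uniqueness.\<close>
    define R where "R = Blinfun (adjoint h) o\<^sub>L S o\<^sub>L Blinfun h"
    have R: "x \<bullet> R y = h x \<bullet> S (h y)" for x y
      by (simp add: R_def bounded_linear_Blinfun_apply[OF bl] bounded_linear_Blinfun_apply[OF bl']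
          adjoint_works[OF lin[OF h]])
    have "R \<in> F m"
      unfolding F_def P_def
    proof (intro CollectI conjI allI ballI)
      show "x \<bullet> R y = y \<bullet> R x" for x y
        unfolding R using SF by (simp add: F_def P_def)
      fix g assume g: "g \<in> \<Gamma>"
      have "h \<circ> g \<in> \<Gamma>" by (rule comp[OF h g])
      then have *: "N (h \<circ> g) S \<le> m" "\<And>x. norm x ^ 2 / K ^ 2 \<le> (h \<circ> g) x \<bullet> S ((h \<circ> g) x)"
        using SF by (auto simp: F_def P_def)
      show "N g R \<le> m" using *(1) by (simp add: N_def R)
      show "norm x ^ 2 / K ^ 2 \<le> g x \<bullet> R (g x)" for x using *(2)[of x] by (simp add: R)
    qed
    then show "h x \<bullet> S (h y) = x \<bullet> S y" using uniq R by metis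
  qed
qed

section \<open>The Lie algebra of a Lie group\<close>

text \<open>Group operations on arguments outside the carrier are unspecified, while members of the
  function algebras vanish there. Formulas are therefore cut off before a derivation is applied to
  them.\<close>

definition ext0 :: "'a set \<Rightarrow> ('a \<Rightarrow> real) \<Rightarrow> 'a \<Rightarrow> real" where
  "ext0 S h = (\<lambda>x. if x \<in> S then h x else 0)"

lemma ext0_apply [simp]: "x \<in> S \<Longrightarrow> ext0 S h x = h x" "x \<notin> S \<Longrightarrow> ext0 S h x = 0"
  by (auto simp: ext0_def)

lemma ext0_cong: "(\<And>x. x \<in> S \<Longrightarrow> f x = h x) \<Longrightarrow> ext0 S f = ext0 S h"
  by (auto simp: ext0_def)

lemma ext0_eqI: "(\<And>x. x \<in> S \<Longrightarrow> f x = h x) \<Longrightarrow> (\<And>x. x \<notin> S \<Longrightarrow> h x = 0) \<Longrightarrow> ext0 S f = h"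
  by (auto simp: ext0_def)

lemma tangent_map_ext0: "tangent_map S C' F v = (\<lambda>f. if f \<in> C' then v (ext0 S (\<lambda>x. f (F x))) else 0)"
  unfolding tangent_map_def ext0_def ..

lemma (in smooth_atlas) smooth_functions_continuous:
  assumes "f \<in> C"
  shows "continuous_map T euclideanreal f"
  unfolding continuous_map_def
proof (intro conjI allI impI)
  fix S :: "real set" assume "openin euclideanreal S"
  then have S: "open S" by simp
  show "openin T {x \<in> topspace T. f x \<in> S}"
  proof (subst openin_subopen, intro ballI)
    fix p assume "p \<in> {x \<in> topspace T. f x \<in> S}"
    then have p: "p \<in> topspace T" "f p \<in> S" by auto
    obtain U \<phi> where U: "(U, \<phi>) \<in> A" "p \<in> U" using chart_cover[OF p(1)] by blast
    let ?R = "(f \<circ> inv_into U \<phi>) -` S \<inter> \<phi> ` U"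
    have R: "open ?R"
      using continuous_on_open_vimage[OF chart_image_open[OF U(1)]]
        smooth_on_imp_continuous_on[OF smooth_functions_chart[OF assms U(1)]] S by blast
    have "{x \<in> U. \<phi> x \<in> ?R} \<subseteq> {x \<in> topspace T. f x \<in> S}"
    proof
      fix x assume "x \<in> {x \<in> U. \<phi> x \<in> ?R}"
      then obtain y where "x \<in> U" "y \<in> U" "\<phi> x = \<phi> y" "(f \<circ> inv_into U \<phi>) (\<phi> y) \<in> S" by auto
      then show "x \<in> {x \<in> topspace T. f x \<in> S}"
        using U(1) chart_subset[OF U(1)] inj_onD[OF chart_inj[OF U(1)], of x y] by simp
    qed
    moreover have "p \<in> {x \<in> U. \<phi> x \<in> ?R}" using U p by simp
    ultimately show "\<exists>W. openin T W \<and> p \<in> W \<and> W \<subseteq> {x \<in> topspace T. f x \<in> S}"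
      using chart_preimage_open[OF U(1) R] by blast
  qed
qed simp

lemma (in smooth_atlas) smooth_functions_bounded:
  assumes "compact_space T" "f \<in> C"
  obtains K where "K > 0" "\<And>x. \<bar>f x\<bar> \<le> K"
proof -
  have "compactin euclideanreal (f ` topspace T)"
    using assms(1) by (intro image_compactin[OF _ smooth_functions_continuous[OF assms(2)]])
      (simp add: compact_space_def)
  then have "bounded (f ` topspace T)" by (simp add: compact_imp_bounded)
  then obtain K where K: "\<And>x. x \<in> topspace T \<Longrightarrow> \<bar>f x\<bar> \<le> K" by (auto simp: bounded_iff)
  show thesis
  proof
    show "max K 1 > 0" by simp
    show "\<bar>f x\<bar> \<le> max K 1" for x
      using K[of x] smooth_functions_outside[OF assms(2), of x] by (cases "x \<in> topspace T") auto
  qed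
qed

text \<open>On chart balls a function with zero derivative is constant, so level sets are open, and
  then also closed. The hypothesis is phrased with derivations, the form in which it is later
  checked for the commutator map with \<open>z\<close>.\<close>

lemma (in smooth_atlas) locally_constant:
  assumes conn: "connected_space T" and h: "h \<in> C"
    and D: "\<And>x v. x \<in> topspace T \<Longrightarrow> v \<in> tangent_space C x \<Longrightarrow> v h = 0"
    and xy: "x \<in> topspace T" "y \<in> topspace T"
  shows "h x = h y"
proof -
  have loc: "\<exists>W. openin T W \<and> p \<in> W \<and> W \<subseteq> {q \<in> topspace T. h q = h p}" if p: "p \<in> topspace T" for p
  proof -
    obtain U \<phi> where U: "(U, \<phi>) \<in> A" "p \<in> U" using chart_cover[OF p] by blast
    obtain r where r: "r > 0" "ball (\<phi> p) r \<subseteq> \<phi> ` U"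
      using chart_image_open[OF U(1)] U(2) open_contains_ball by blast
    have der: "((h \<circ> inv_into U \<phi>) has_derivative (\<lambda>c. 0)) (at s within ball (\<phi> p) r)"
      if s: "s \<in> ball (\<phi> p) r" for s
    proof -
      obtain q where q: "q \<in> U" "s = \<phi> q" using s r(2) by blast
      have "frechet_derivative (h \<circ> inv_into U \<phi>) (at s) c = 0" for c
        using D[OF chart_subset[OF U(1) q(1)] coordinate_derivation[OF U(1) q(1), of c]] h q by simp
      then have "frechet_derivative (h \<circ> inv_into U \<phi>) (at s) = (\<lambda>c. 0)" by blast
      then have "((h \<circ> inv_into U \<phi>) has_derivative (\<lambda>c. 0)) (at s)"
        using smooth_on_has_derivative[OF chart_image_open[OF U(1)] smooth_functions_chart[OF h U(1)], of s] s r(2)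
        by auto
      then show ?thesis by (rule has_derivative_at_withinI)
    qed
    have const: "(h \<circ> inv_into U \<phi>) s = (h \<circ> inv_into U \<phi>) (\<phi> p)" if "s \<in> ball (\<phi> p) r" for s
      using has_derivative_zero_unique[OF convex_ball der that] r(1) by simp
    have "{q \<in> U. \<phi> q \<in> ball (\<phi> p) r} \<subseteq> {q \<in> topspace T. h q = h p}"
      using const chart_subset[OF U(1)] U by fastforce
    then show ?thesis
      using chart_preimage_open[OF U(1) open_ball, of "\<phi> p" r] U r(1) by fastforce
  qed
  let ?E = "{q \<in> topspace T. h q = h x}"
  have "openin T ?E"
  proof (subst openin_subopen, intro ballI)
    fix p assume "p \<in> ?E"
    then show "\<exists>W. openin T W \<and> p \<in> W \<and> W \<subseteq> ?E" using loc[of p] by simp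
  qed
  moreover have "openin T (topspace T - ?E)"
  proof (subst openin_subopen, intro ballI)
    fix p assume p: "p \<in> topspace T - ?E"
    then obtain W where "openin T W" "p \<in> W" "W \<subseteq> {q \<in> topspace T. h q = h p}" using loc[of p] by auto
    moreover from this have "W \<subseteq> topspace T - ?E" using p by auto
    ultimately show "\<exists>W. openin T W \<and> p \<in> W \<and> W \<subseteq> topspace T - ?E" by blast
  qed
  then have "closedin T ?E" by (simp add: closedin_def)
  ultimately have "?E = {} \<or> ?E = topspace T"
    using conn connected_space_clopen_in by blast
  then have "y \<in> ?E" using xy by blast
  then show ?thesis by simp
qed

section \<open>Vector fields and their Lie brackets\<close>

lemma vector_fields_in: "X \<in> vector_fields S C \<Longrightarrow> p \<in> S \<Longrightarrow> X p \<in> tangent_space C p"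
  and vector_fields_outside: "X \<in> vector_fields S C \<Longrightarrow> p \<notin> S \<Longrightarrow> X p = 0"
  and vector_fields_smooth: "X \<in> vector_fields S C \<Longrightarrow> f \<in> C \<Longrightarrow> (\<lambda>p. X p f) \<in> C"
  by (simp_all add: vector_fields_def)

lemma vector_fields_outside': "X \<in> vector_fields S C \<Longrightarrow> p \<notin> S \<Longrightarrow> X p f = 0"
  by (simp add: vector_fields_outside)

lemma lie_bracket_apply: "lie_bracket X Y p f = X p (\<lambda>q. Y q f) - Y p (\<lambda>q. X q f)"
  by (simp add: lie_bracket_def)

lemma (in smooth_atlas) lie_bracket_vector_field:
  assumes X: "X \<in> vector_fields (topspace T) C" and Y: "Y \<in> vector_fields (topspace T) C"
  shows "lie_bracket X Y \<in> vector_fields (topspace T) C"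
  unfolding vector_fields_def mem_Collect_eq
proof (intro conjI ballI allI impI)
  note Xs = vector_fields_smooth[OF X] and Ys = vector_fields_smooth[OF Y]
  note Xo = vector_fields_outside'[OF X] and Yo = vector_fields_outside'[OF Y]
  show "lie_bracket X Y p = 0" if "p \<notin> topspace T" for p
    using that X Y by (auto simp: lie_bracket_def vector_fields_outside fun_eq_iff)
  show "(\<lambda>p. lie_bracket X Y p f) \<in> C" if "f \<in> C" for f
    unfolding lie_bracket_apply by (intro smooth_functions_diff Xs Ys that)
  fix p assume p: "p \<in> topspace T"
  note Xp = vector_fields_in[OF X p] and Yp = vector_fields_in[OF Y p]
  show "lie_bracket X Y p \<in> tangent_space C p"
    unfolding tangent_space_def mem_Collect_eq
  proof (intro conjI ballI allI impI)
    fix f assume "f \<notin> C"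
    then have "(\<lambda>q. Y q f) = (\<lambda>q. 0)" "(\<lambda>q. X q f) = (\<lambda>q. 0)"
      using vector_fields_in[OF X] vector_fields_in[OF Y] Xo Yo tangent_outside by fast+
    then show "lie_bracket X Y p f = 0"
      unfolding lie_bracket_apply using tangent_0[OF Xp] tangent_0[OF Yp] by simp
  next
    fix f h a b assume fh: "f \<in> C" "h \<in> C"
    have 1: "(\<lambda>q. Z q (\<lambda>x. a * f x + b * h x)) = (\<lambda>q. a * Z q f + b * Z q h)"
      if Z: "Z \<in> vector_fields (topspace T) C" for Z
      using tangent_lincomb[OF vector_fields_in[OF Z] fh, of _ a b] vector_fields_outside'[OF Z]
      by (metis add.right_neutral mult_zero_right)
    show "lie_bracket X Y p (\<lambda>x. a * f x + b * h x) = a * lie_bracket X Y p f + b * lie_bracket X Y p h"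
      unfolding lie_bracket_apply 1[OF X] 1[OF Y]
      by (simp add: tangent_lincomb[OF Xp Ys Ys] tangent_lincomb[OF Yp Xs Xs] fh algebra_simps)
  next
    fix f h assume fh: "f \<in> C" "h \<in> C"
    have 1: "(\<lambda>q. Z q (\<lambda>x. f x * h x)) = (\<lambda>q. Z q f * h q + f q * Z q h)"
      if Z: "Z \<in> vector_fields (topspace T) C" for Z
      using tangent_mult[OF vector_fields_in[OF Z] fh] vector_fields_outside'[OF Z]
      by (metis add.right_neutral mult_zero_right mult_zero_left)
    \<comment> \<open>The cross terms are symmetric in the two fields, so they cancel in the
      commutator and leave the Leibniz rule.\<close>
    have 2: "W (\<lambda>q. Z q (\<lambda>x. f x * h x)) =
       W (\<lambda>q. Z q f) * h p + Z p f * W h + (W f * Z p h + f p * W (\<lambda>q. Z q h))"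
      if Z: "Z \<in> vector_fields (topspace T) C" and W: "W \<in> tangent_space C p" for Z W
      unfolding 1[OF Z] using fh vector_fields_smooth[OF Z]
      by (simp add: tangent_add[OF W smooth_functions_mult smooth_functions_mult] tangent_mult[OF W])
    show "lie_bracket X Y p (\<lambda>x. f x * h x) = lie_bracket X Y p f * h p + f p * lie_bracket X Y p h"
      unfolding lie_bracket_apply 2[OF X Yp] 2[OF Y Xp] by (simp add: algebra_simps)
  qed
qed

section \<open>Lie groups and left-invariant fields\<close>

locale lie_grp =
  fixes G :: "('g, 'm) monoid_scheme" (structure) and T :: "'g topology" and A :: "('g, 'e::euclidean_space) atlas"
  assumes lie: "lie_group G T A"
begin

sublocale group G
  using lie by (simp add: lie_group_def)

sublocale smooth_atlas_pair T A T A
  using lie by (intro smooth_atlas_pair.intro smooth_manifold_smooth_atlas) (simp_all add: lie_group_def)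

abbreviation "CG \<equiv> smooth_functions T A"
abbreviation "TN \<equiv> prod_topology T T"
abbreviation "AN \<equiv> prod_atlas A A"
abbreviation "CN \<equiv> smooth_functions TN AN"
abbreviation "\<gg> \<equiv> lie_algebra G CG"
abbreviation "res \<equiv> ext0 (carrier G)"

lemma topspace_T [simp]: "topspace T = carrier G"
  using lie by (simp add: lie_group_def)

lemmas atlasG = M.smooth_atlas_axioms
lemmas atlasN = P.smooth_atlas_axioms
lemmas atlasGN = smooth_atlas_prod[OF atlasG atlasN]

lemma smooth_mult:
  assumes "smooth_atlas T' A'" "smooth_map T' A' T A F" "smooth_map T' A' T A K"
  shows "smooth_map T' A' T A (\<lambda>x. F x \<otimes> K x)"
proof -
  have m: "smooth_map TN AN T A (\<lambda>(x, y). x \<otimes> y)" using lie by (simp add: lie_group_def)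
  show ?thesis
    using smooth_map_compose[OF assms(1) atlasN atlasG smooth_map_Pair[OF assms(1) atlasG atlasG assms(2,3)] m]
    by simp
qed

lemma smooth_inv:
  assumes "smooth_atlas T' A'" "smooth_map T' A' T A F"
  shows "smooth_map T' A' T A (\<lambda>x. inv (F x))"
proof -
  have m: "smooth_map T A T A (\<lambda>x. inv x)" using lie by (simp add: lie_group_def)
  show ?thesis by (rule smooth_map_compose[OF assms(1) atlasG atlasG assms(2) m])
qed

lemma smooth_const: "smooth_atlas T' A' \<Longrightarrow> c \<in> carrier G \<Longrightarrow> smooth_map T' A' T A (\<lambda>x. c)"
  by (rule smooth_map_const[OF _ atlasG]) simp_all

lemmas smooth_idG = smooth_map_id[OF atlasG]
lemmas smooth_fstN = smooth_map_fst[OF atlasG atlasG]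
lemmas smooth_sndN = smooth_map_snd[OF atlasG atlasG]
lemmas smooth_fstGN = smooth_map_fst[OF atlasG atlasN]
lemmas smooth_fst_sndGN = smooth_map_compose[OF atlasGN atlasN atlasG smooth_map_snd[OF atlasG atlasN] smooth_fstN]
lemmas smooth_snd_sndGN = smooth_map_compose[OF atlasGN atlasN atlasG smooth_map_snd[OF atlasG atlasN] smooth_sndN]

lemmas smooth_rules = smooth_mult[OF atlasG] smooth_inv[OF atlasG] smooth_const[OF atlasG] smooth_idG
  smooth_mult[OF atlasN] smooth_inv[OF atlasN] smooth_const[OF atlasN] smooth_fstN smooth_sndN
  smooth_mult[OF atlasGN] smooth_inv[OF atlasGN] smooth_const[OF atlasGN] smooth_fstGN
  smooth_fst_sndGN smooth_snd_sndGN

lemma res_pullback: "f \<in> CG \<Longrightarrow> smooth_map T A T A F \<Longrightarrow> res (\<lambda>x. f (F x)) \<in> CG"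
  using smooth_map_pullback_function[OF atlasG atlasG, of F f] by (simp add: ext0_def)

lemma res_pullback_N: "f \<in> CG \<Longrightarrow> smooth_map TN AN T A F \<Longrightarrow> ext0 (carrier G \<times> carrier G) (\<lambda>x. f (F x)) \<in> CN"
  using smooth_map_pullback_function[OF atlasN atlasG, of F f] by (simp add: ext0_def)

lemma CG_outside: "f \<in> CG \<Longrightarrow> x \<notin> carrier G \<Longrightarrow> f x = 0"
  using M.smooth_functions_outside by simp

lemma tangent_res_const: "v \<in> tangent_space CG p \<Longrightarrow> p \<in> carrier G \<Longrightarrow> v (res (\<lambda>x. c)) = 0"
  using M.tangent_const[of v p c] by (simp add: ext0_def)

text \<open>Push \<open>v\<close> forward along the diagonal map and split the result by
  \<open>tangent_product_rule\<close>. A word in which a group variable occurs several times is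
  differentiated through this rule, one occurrence at a time.\<close>

lemma diagonal_rule:
  assumes F: "F \<in> CN" and p: "p \<in> carrier G" and v: "v \<in> tangent_space CG p"
  shows "res (\<lambda>x. F (x, x)) \<in> CG" "v (res (\<lambda>x. F (x, x))) = v (\<lambda>x. F (x, p)) + v (\<lambda>x. F (p, x))"
proof -
  have d: "smooth_map T A TN AN (\<lambda>x. (x, x))"
    by (rule smooth_map_Pair[OF atlasG atlasG atlasG smooth_idG smooth_idG])
  show "res (\<lambda>x. F (x, x)) \<in> CG"
    using smooth_map_pullback_function[OF atlasG atlasN d F] by (simp add: ext0_def)
  define u where "u = tangent_map (carrier G) CN (\<lambda>x. (x, x)) v"
  have u: "u \<in> tangent_space CN (p, p)"
    using tangent_map_in[OF atlasG atlasN d _ v] p by (simp add: u_def)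
  have uf: "tangent_map (carrier G \<times> carrier G) CG fst u f = v f"
    and us: "tangent_map (carrier G \<times> carrier G) CG snd u f = v f" if f: "f \<in> CG" for f
  proof -
    have "ext0 (carrier G \<times> carrier G) (\<lambda>x. f (fst x)) \<in> CN" "ext0 (carrier G \<times> carrier G) (\<lambda>x. f (snd x)) \<in> CN"
      by (rule res_pullback_N[OF f smooth_fstN] res_pullback_N[OF f smooth_sndN])+
    moreover have "res (\<lambda>x. ext0 (carrier G \<times> carrier G) (\<lambda>x. f (fst x)) (x, x)) = f"
       "res (\<lambda>x. ext0 (carrier G \<times> carrier G) (\<lambda>x. f (snd x)) (x, x)) = f"
      by (rule ext0_eqI; simp add: CG_outside[OF f])+
    ultimately show "tangent_map (carrier G \<times> carrier G) CG fst u f = v f"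
      "tangent_map (carrier G \<times> carrier G) CG snd u f = v f"
      using f by (simp_all add: u_def tangent_map_ext0)
  qed
  have "u F = v (\<lambda>x. F (x, p)) + v (\<lambda>x. F (p, x))"
    using tangent_product_rule[OF F _ _ u] p uf[OF slice_fst[OF F]] us[OF slice_snd[OF F]] by simp
  then show "v (res (\<lambda>x. F (x, x))) = v (\<lambda>x. F (x, p)) + v (\<lambda>x. F (p, x))"
    using F by (simp add: u_def tangent_map_ext0)
qed

text \<open>The product of inv x and x is constant, so the two contributions in the diagonal rule
  cancel.\<close>

lemma inverse_rule:
  assumes f: "f \<in> CG" and v: "v \<in> tangent_space CG \<one>"
  shows "v (res (\<lambda>x. f (inv x))) = - v f"
proof -
  let ?F = "ext0 (carrier G \<times> carrier G) (\<lambda>p. f (inv (fst p) \<otimes> snd p))"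
  have F: "?F \<in> CN" by (rule res_pullback_N[OF f]) (intro smooth_rules)
  have "res (\<lambda>x. ?F (x, x)) = res (\<lambda>x. f \<one>)" by (rule ext0_cong) simp
  moreover have "(\<lambda>x. ?F (x, \<one>)) = res (\<lambda>x. f (inv x))" by (auto simp: ext0_def)
  moreover have "(\<lambda>x. ?F (\<one>, x)) = f" using CG_outside[OF f] by (auto simp: ext0_def)
  ultimately show ?thesis
    using diagonal_rule(2)[OF F _ v] tangent_res_const[OF v] by simp
qed

lemma lie_vector_field: "X \<in> \<gg> \<Longrightarrow> X \<in> vector_fields (carrier G) CG"
  by (simp add: lie_algebra_def)

lemma lie_tangent: "X \<in> \<gg> \<Longrightarrow> x \<in> carrier G \<Longrightarrow> X x \<in> tangent_space CG x"
  by (rule vector_fields_in[OF lie_vector_field])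

lemma lie_smooth: "X \<in> \<gg> \<Longrightarrow> f \<in> CG \<Longrightarrow> (\<lambda>x. X x f) \<in> CG"
  by (rule vector_fields_smooth[OF lie_vector_field])

lemma lie_outside: "X \<in> \<gg> \<Longrightarrow> x \<notin> carrier G \<Longrightarrow> X x f = 0"
  by (rule vector_fields_outside'[OF lie_vector_field])

lemma lie_left_invariant:
  assumes "X \<in> \<gg>" "a \<in> carrier G" "x \<in> carrier G" "f \<in> CG"
  shows "X (a \<otimes> x) f = X x (res (\<lambda>y. f (a \<otimes> y)))"
proof -
  have "tangent_map (carrier G) CG (\<lambda>y. a \<otimes> y) (X x) f = X (a \<otimes> x) f"
    using assms by (simp add: lie_algebra_def)
  then show ?thesis using assms(4) by (simp add: tangent_map_ext0)
qed

lemma lie_at: "X \<in> \<gg> \<Longrightarrow> x \<in> carrier G \<Longrightarrow> f \<in> CG \<Longrightarrow> X x f = X \<one> (res (\<lambda>y. f (x \<otimes> y)))"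
  using lie_left_invariant[of X x \<one> f] by simp

lemma lie_algebraI:
  assumes "X \<in> vector_fields (carrier G) CG"
    and "\<And>a x f. a \<in> carrier G \<Longrightarrow> x \<in> carrier G \<Longrightarrow> f \<in> CG \<Longrightarrow> X (a \<otimes> x) f = X x (res (\<lambda>y. f (a \<otimes> y)))"
  shows "X \<in> \<gg>"
  unfolding lie_algebra_def mem_Collect_eq
proof (intro conjI ballI assms(1) ext)
  fix a x f assume ax: "a \<in> carrier G" "x \<in> carrier G"
  show "tangent_map (carrier G) CG (\<lambda>y. a \<otimes> y) (X x) f = X (a \<otimes> x) f"
    using assms(2)[OF ax, of f] tangent_outside[OF vector_fields_in[OF assms(1), of "a \<otimes> x"], of f] ax
    by (simp add: tangent_map_ext0)
qed

lemma lie_eqI: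
  assumes X: "X \<in> \<gg>" and Y: "Y \<in> \<gg>" and eq: "\<And>f. f \<in> CG \<Longrightarrow> X \<one> f = Y \<one> f"
  shows "X = Y"
proof (intro ext)
  fix x f
  show "X x f = Y x f"
  proof (cases "x \<in> carrier G \<and> f \<in> CG")
    case True
    then have "res (\<lambda>y. f (x \<otimes> y)) \<in> CG"
      by (intro res_pullback smooth_rules) auto
    then show ?thesis using True lie_at[OF X, of x f] lie_at[OF Y, of x f] eq by simp
  next
    case False
    then show ?thesis
      using lie_outside[OF X, of x f] lie_outside[OF Y, of x f] tangent_outside[OF lie_tangent[OF X], of x f]
        tangent_outside[OF lie_tangent[OF Y], of x f] by (cases "x \<in> carrier G") auto
  qed
qed

definition left_field :: "'g tvec \<Rightarrow> 'g vfield" where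
  "left_field u x = (if x \<in> carrier G then tangent_map (carrier G) CG (\<lambda>y. x \<otimes> y) u else 0)"

lemma left_field:
  assumes u: "u \<in> tangent_space CG \<one>"
  shows "left_field u \<in> \<gg>" "left_field u \<one> = u"
proof -
  have at: "left_field u x f = u (res (\<lambda>y. f (x \<otimes> y)))" if "x \<in> carrier G" "f \<in> CG" for x f
    using that by (simp add: left_field_def tangent_map_ext0)
  show "left_field u \<in> \<gg>"
  proof (rule lie_algebraI)
    show "left_field u \<in> vector_fields (carrier G) CG"
      unfolding vector_fields_def mem_Collect_eq
    proof (intro conjI ballI allI impI)
      fix x assume x: "x \<in> carrier G"
      have "smooth_map T A T A (\<lambda>y. x \<otimes> y)" using x by (intro smooth_rules)
      from tangent_map_in[OF atlasG atlasG this _ u]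
      show "left_field u x \<in> tangent_space CG x" using x by (simp add: left_field_def)
    next
      show "x \<notin> carrier G \<Longrightarrow> left_field u x = 0" for x by (simp add: left_field_def)
      fix f assume f: "f \<in> CG"
      \<comment> \<open>The differentiated variable comes first and the base point second, so
        smoothness in the base point is an instance of \<open>tangent_parameter_fst\<close>.\<close>
      let ?F = "ext0 (carrier G \<times> carrier G) (\<lambda>p. f (snd p \<otimes> fst p))"
      have F: "?F \<in> CN" by (rule res_pullback_N[OF f]) (intro smooth_rules)
      have "(\<lambda>x. u (\<lambda>y. ?F (y, x))) \<in> CG"
        by (rule tangent_parameter_fst[OF F u]) simp
      moreover have "u (\<lambda>y. ?F (y, x)) = left_field u x f" for x
      proof (cases "x \<in> carrier G")
        case True
        then have "(\<lambda>y. ?F (y, x)) = res (\<lambda>y. f (x \<otimes> y))" by (auto simp: ext0_def)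
        then show ?thesis using at[OF True f] by simp
      next
        case False
        then have "(\<lambda>y. ?F (y, x)) = (\<lambda>y. 0)" by auto
        then show ?thesis using False M.tangent_0[OF u] by (simp add: left_field_def)
      qed
      ultimately show "(\<lambda>x. left_field u x f) \<in> CG" by simp
    qed
    fix a x f assume ax: "a \<in> carrier G" "x \<in> carrier G" and f: "f \<in> CG"
    have "res (\<lambda>y. f (a \<otimes> y)) \<in> CG" using ax f by (intro res_pullback smooth_rules)
    moreover have "res (\<lambda>y. f (a \<otimes> x \<otimes> y)) = res (\<lambda>y. res (\<lambda>y. f (a \<otimes> y)) (x \<otimes> y))"
      by (rule ext0_cong) (use ax in \<open>simp add: m_assoc\<close>)
    ultimately show "left_field u (a \<otimes> x) f = left_field u x (res (\<lambda>y. f (a \<otimes> y)))"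
      using ax f by (simp add: at)
  qed
  show "left_field u \<one> = u"
  proof (rule ext)
    fix f
    have "f \<in> CG \<Longrightarrow> res (\<lambda>y. f (\<one> \<otimes> y)) = f" by (rule ext0_eqI) (auto simp: CG_outside)
    then show "left_field u \<one> f = u f"
      using at[of \<one> f] tangent_outside[OF u, of f] by (auto simp: left_field_def tangent_map_ext0)
  qed
qed

lemma lie_algebra_transitive:
  assumes w: "w \<in> tangent_space CG x" and x: "x \<in> carrier G"
  shows "\<exists>X\<in>\<gg>. X x = w"
proof -
  define u where "u = tangent_map (carrier G) CG (\<lambda>y. inv x \<otimes> y) w"
  have "smooth_map T A T A (\<lambda>y. inv x \<otimes> y)" using x by (intro smooth_rules) simp
  from tangent_map_in[OF atlasG atlasG this _ w]
  have u: "u \<in> tangent_space CG \<one>" using x by (simp add: u_def)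
  note X = left_field[OF u]
  have "left_field u x = w"
  proof (rule tangent_eqI[OF lie_tangent[OF X(1) x] w])
    fix f assume f: "f \<in> CG"
    have c: "res (\<lambda>y. f (x \<otimes> y)) \<in> CG" using x f by (intro res_pullback smooth_rules)
    have "res (\<lambda>y. res (\<lambda>y. f (x \<otimes> y)) (inv x \<otimes> y)) = f"
      by (rule ext0_eqI) (use x CG_outside[OF f] in \<open>auto simp: m_assoc[symmetric]\<close>)
    then have "u (res (\<lambda>y. f (x \<otimes> y))) = w f" using c by (simp add: u_def tangent_map_ext0)
    then show "left_field u x f = w f" using lie_at[OF X(1) x f] X(2) by simp
  qed
  then show ?thesis using X by blast
qed

lemma lie_eq_at:
  assumes X: "X \<in> \<gg>" and Y: "Y \<in> \<gg>" and x: "x \<in> carrier G" and eq: "X x = Y x"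
  shows "X = Y"
proof (rule lie_eqI[OF X Y])
  fix f assume f: "f \<in> CG"
  show "X \<one> f = Y \<one> f"
    using lie_left_invariant[OF X _ x f, of "inv x"] lie_left_invariant[OF Y _ x f, of "inv x"] x eq by simp
qed

lemma left_invariant_extension_eq:
  assumes "X \<in> \<gg>" "x \<in> carrier G"
  shows "left_invariant_extension G CG x (X x) = X"
  unfolding left_invariant_extension_def
  by (rule the_equality) (use assms lie_eq_at in auto)

lemma left_invariant_extension_in:
  assumes "w \<in> tangent_space CG x" "x \<in> carrier G"
  shows "left_invariant_extension G CG x w \<in> \<gg>" "left_invariant_extension G CG x w x = w"
  using lie_algebra_transitive[OF assms] left_invariant_extension_eq assms(2) by auto

lemma subspace_lie_algebra: "subspace \<gg>"
proof (rule subspaceI)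
  have 0: "(0 :: 'g vfield) \<in> vector_fields (carrier G) CG"
    unfolding vector_fields_def mem_Collect_eq
  proof (intro conjI ballI allI impI)
    show "(0 :: 'g vfield) x \<in> tangent_space CG x" for x
      using subspace_0[OF subspace_tangent_space, of CG x] by (simp only: zero_fun_apply)
    show "(0 :: 'g vfield) x = 0" for x by (rule zero_fun_apply)
    show "(\<lambda>x. (0 :: 'g vfield) x f) \<in> CG" for f
      using M.smooth_functions_0 by (simp only: zero_fun_apply)
  qed
  show "(0 :: 'g vfield) \<in> \<gg>"
    by (rule lie_algebraI[OF 0]) (simp only: zero_fun_apply)
next
  fix X Y assume X: "X \<in> \<gg>" and Y: "Y \<in> \<gg>"
  have XY: "X + Y \<in> vector_fields (carrier G) CG"
    unfolding vector_fields_def mem_Collect_eq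
  proof (intro conjI ballI allI impI)
    show "(X + Y) x \<in> tangent_space CG x" if "x \<in> carrier G" for x
      using subspace_add[OF subspace_tangent_space lie_tangent[OF X that] lie_tangent[OF Y that]]
      by (simp only: plus_fun_apply)
    show "(X + Y) x = 0" if "x \<notin> carrier G" for x
      using lie_outside[OF X that] lie_outside[OF Y that] by (simp add: fun_eq_iff)
    show "(\<lambda>x. (X + Y) x f) \<in> CG" if "f \<in> CG" for f
      using M.smooth_functions_add[OF lie_smooth[OF X that] lie_smooth[OF Y that]]
      by (simp only: plus_fun_apply)
  qed
  show "X + Y \<in> \<gg>"
    by (rule lie_algebraI[OF XY]) (simp only: plus_fun_apply lie_left_invariant[OF X] lie_left_invariant[OF Y])
next
  fix X c assume X: "X \<in> \<gg>"
  show "c *\<^sub>R X \<in> \<gg>"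
  proof (rule lie_algebraI)
    show "c *\<^sub>R X \<in> vector_fields (carrier G) CG"
      unfolding vector_fields_def mem_Collect_eq
    proof (intro conjI ballI allI impI)
      show "(c *\<^sub>R X) x \<in> tangent_space CG x" if "x \<in> carrier G" for x
        using subspace_scale[OF subspace_tangent_space lie_tangent[OF X that], of c]
        by (simp add: scaleR_fun_def)
      show "(c *\<^sub>R X) x = 0" if "x \<notin> carrier G" for x
        using lie_outside[OF X that] by (simp add: scaleR_fun_def fun_eq_iff)
      show "(\<lambda>x. (c *\<^sub>R X) x f) \<in> CG" if "f \<in> CG" for f
        using M.smooth_functions_scale[OF lie_smooth[OF X that], of c] by (simp add: scaleR_fun_def)
    qed
  qed (simp add: lie_left_invariant[OF X] scaleR_fun_def)
qed

lemma lie_bracket_in: 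
  assumes X: "X \<in> \<gg>" and Y: "Y \<in> \<gg>"
  shows "lie_bracket X Y \<in> \<gg>"
proof (rule lie_algebraI)
  show "lie_bracket X Y \<in> vector_fields (carrier G) CG"
    using M.lie_bracket_vector_field[of X Y] lie_vector_field[OF X] lie_vector_field[OF Y] by simp
  fix a x f assume ax: "a \<in> carrier G" "x \<in> carrier G" and f: "f \<in> CG"
  have e: "res (\<lambda>y. Z (a \<otimes> y) f) = (\<lambda>y. Z y (res (\<lambda>y. f (a \<otimes> y))))" if Z: "Z \<in> \<gg>" for Z
    by (rule ext0_eqI) (use ax f Z in \<open>simp_all add: lie_left_invariant lie_outside\<close>)
  show "lie_bracket X Y (a \<otimes> x) f = lie_bracket X Y x (res (\<lambda>y. f (a \<otimes> y)))"
    unfolding lie_bracket_apply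
    by (simp add: lie_left_invariant[OF X ax lie_smooth[OF Y f]] lie_left_invariant[OF Y ax lie_smooth[OF X f]] e X Y)
qed

lemma lie_bracket_skew: "lie_bracket X Y = - lie_bracket Y X"
  by (simp add: lie_bracket_def fun_eq_iff)

lemma lie_bracket_add_right:
  assumes X: "X \<in> \<gg>" and Y: "Y \<in> \<gg>" and Z: "Z \<in> \<gg>"
  shows "lie_bracket X (Y + Z) = lie_bracket X Y + lie_bracket X Z"
proof (rule lie_eqI)
  show "lie_bracket X (Y + Z) \<in> \<gg>" "lie_bracket X Y + lie_bracket X Z \<in> \<gg>"
    by (intro lie_bracket_in subspace_add[OF subspace_lie_algebra] X Y Z)+
  fix f assume "f \<in> CG"
  then show "lie_bracket X (Y + Z) \<one> f = (lie_bracket X Y + lie_bracket X Z) \<one> f"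
    using tangent_add[OF lie_tangent[OF X one_closed] lie_smooth[OF Y] lie_smooth[OF Z], of f f]
    by (simp add: lie_bracket_apply)
qed

lemma lie_bracket_scale_right:
  assumes X: "X \<in> \<gg>" and Y: "Y \<in> \<gg>"
  shows "lie_bracket X (c *\<^sub>R Y) = c *\<^sub>R lie_bracket X Y"
proof (rule lie_eqI)
  show "lie_bracket X (c *\<^sub>R Y) \<in> \<gg>" "c *\<^sub>R lie_bracket X Y \<in> \<gg>"
    by (intro lie_bracket_in subspace_scale[OF subspace_lie_algebra] X Y)+
  fix f assume "f \<in> CG"
  then show "lie_bracket X (c *\<^sub>R Y) \<one> f = (c *\<^sub>R lie_bracket X Y) \<one> f"
    using tangent_scale[OF lie_tangent[OF X one_closed] lie_smooth[OF Y], of f c]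
    by (simp add: lie_bracket_apply scaleR_fun_def algebra_simps)
qed

lemma lie_bracket_add_left:
  "X \<in> \<gg> \<Longrightarrow> Y \<in> \<gg> \<Longrightarrow> Z \<in> \<gg> \<Longrightarrow> lie_bracket (X + Y) Z = lie_bracket X Z + lie_bracket Y Z"
  using lie_bracket_add_right[of Z X Y] lie_bracket_skew[of "X + Y" Z] lie_bracket_skew[of X Z]
    lie_bracket_skew[of Y Z] by (simp only: minus_add_distrib)

lemma lie_bracket_scale_left:
  "X \<in> \<gg> \<Longrightarrow> Y \<in> \<gg> \<Longrightarrow> lie_bracket (c *\<^sub>R X) Y = c *\<^sub>R lie_bracket X Y"
  using lie_bracket_scale_right[of Y X c] lie_bracket_skew[of "c *\<^sub>R X" Y] lie_bracket_skew[of X Y]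
  by (simp only: scaleR_minus_right)

lemma lie_bracket_jacobi:
  assumes X: "X \<in> \<gg>" and Y: "Y \<in> \<gg>" and Z: "Z \<in> \<gg>"
  shows "lie_bracket X (lie_bracket Y Z) = lie_bracket (lie_bracket X Y) Z + lie_bracket Y (lie_bracket X Z)"
proof (rule lie_eqI)
  show "lie_bracket X (lie_bracket Y Z) \<in> \<gg>"
    "lie_bracket (lie_bracket X Y) Z + lie_bracket Y (lie_bracket X Z) \<in> \<gg>"
    by (intro lie_bracket_in subspace_add[OF subspace_lie_algebra] X Y Z)+
  fix f assume f: "f \<in> CG"
  have d: "W \<one> (\<lambda>q. U q (\<lambda>q. V q f) - V q (\<lambda>q. U q f)) = W \<one> (\<lambda>q. U q (\<lambda>q. V q f)) - W \<one> (\<lambda>q. V q (\<lambda>q. U q f))"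
    if "W \<in> \<gg>" "U \<in> \<gg>" "V \<in> \<gg>" for U V W
    by (rule tangent_diff[OF lie_tangent[OF that(1) one_closed] lie_smooth[OF that(2) lie_smooth[OF that(3) f]]
          lie_smooth[OF that(3) lie_smooth[OF that(2) f]]])
  show "lie_bracket X (lie_bracket Y Z) \<one> f =
      (lie_bracket (lie_bracket X Y) Z + lie_bracket Y (lie_bracket X Z)) \<one> f"
    by (simp add: lie_bracket_apply d X Y Z)
qed

lemma endo_on_ad: "X \<in> \<gg> \<Longrightarrow> endo_on \<gg> (lie_bracket X)"
  by (simp add: endo_on_def lie_bracket_in lie_bracket_add_right lie_bracket_scale_right)

end

context lie_grp
begin

subsection \<open>The adjoint representation\<close>

text \<open>\<open>adj x\<close> is \<open>Ad (x\<^sup>-\<^sup>1)\<close>: the left-invariant field that agrees at \<open>x\<close> with the right-invariant field given by \<open>X\<close>.\<close>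
definition adj :: "'g \<Rightarrow> 'g vfield \<Rightarrow> 'g vfield" where
  "adj x X = left_field (tangent_map (carrier G) CG (\<lambda>w. inv x \<otimes> w \<otimes> x) (X \<one>))"

lemma adj_in: 
  assumes X: "X \<in> \<gg>" and x: "x \<in> carrier G"
  shows "adj x X \<in> \<gg>"
proof -
  have "smooth_map T A T A (\<lambda>w. inv x \<otimes> w \<otimes> x)" using x by (intro smooth_rules) simp_all
  from tangent_map_in[OF atlasG atlasG this _ lie_tangent[OF X one_closed]]
  have "tangent_map (carrier G) CG (\<lambda>w. inv x \<otimes> w \<otimes> x) (X \<one>) \<in> tangent_space CG \<one>"
    using x by simp
  then show ?thesis unfolding adj_def by (rule left_field)
qed

lemma adj_at_one:
  assumes X: "X \<in> \<gg>" and x: "x \<in> carrier G" and f: "f \<in> CG"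
  shows "adj x X \<one> f = X \<one> (res (\<lambda>w. f (inv x \<otimes> w \<otimes> x)))"
proof -
  have "smooth_map T A T A (\<lambda>w. inv x \<otimes> w \<otimes> x)" using x by (intro smooth_rules) simp_all
  from tangent_map_in[OF atlasG atlasG this _ lie_tangent[OF X one_closed]]
  have "tangent_map (carrier G) CG (\<lambda>w. inv x \<otimes> w \<otimes> x) (X \<one>) \<in> tangent_space CG \<one>"
    using x by simp
  from left_field(2)[OF this] show ?thesis
    using f by (simp add: adj_def tangent_map_ext0)
qed

lemma conj_in: "f \<in> CG \<Longrightarrow> x \<in> carrier G \<Longrightarrow> res (\<lambda>w. f (inv x \<otimes> w \<otimes> x)) \<in> CG"
  by (intro res_pullback smooth_rules) simp_all

lemma left_translate_in: "f \<in> CG \<Longrightarrow> x \<in> carrier G \<Longrightarrow> res (\<lambda>w. f (x \<otimes> w)) \<in> CG"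
  by (intro res_pullback smooth_rules)

lemma right_translate_in: "f \<in> CG \<Longrightarrow> x \<in> carrier G \<Longrightarrow> res (\<lambda>w. f (w \<otimes> x)) \<in> CG"
  by (intro res_pullback smooth_rules)

lemma adj_at:
  assumes X: "X \<in> \<gg>" and x: "x \<in> carrier G" and y: "y \<in> carrier G" and f: "f \<in> CG"
  shows "adj x X y f = X (y \<otimes> inv x) (res (\<lambda>v. f (v \<otimes> x)))"
proof -
  have c: "y \<otimes> inv x \<in> carrier G" using x y by simp
  have "adj x X y f = X \<one> (res (\<lambda>w. res (\<lambda>v. f (y \<otimes> v)) (inv x \<otimes> w \<otimes> x)))"
    using lie_at[OF adj_in[OF X x] y f] adj_at_one[OF X x left_translate_in[OF f y]] by simp
  also have "res (\<lambda>w. res (\<lambda>v. f (y \<otimes> v)) (inv x \<otimes> w \<otimes> x)) = res (\<lambda>w. res (\<lambda>v. f (v \<otimes> x)) (y \<otimes> inv x \<otimes> w))"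
    by (rule ext0_cong) (use x y in \<open>simp add: m_assoc\<close>)
  also have "X \<one> \<dots> = X (y \<otimes> inv x) (res (\<lambda>v. f (v \<otimes> x)))"
    using lie_at[OF X c right_translate_in[OF f x]] by simp
  finally show ?thesis .
qed

lemma adj_at_self:
  assumes X: "X \<in> \<gg>" and x: "x \<in> carrier G" and f: "f \<in> CG"
  shows "adj x X x f = X \<one> (res (\<lambda>v. f (v \<otimes> x)))"
  using adj_at[OF X x x f] x by simp

lemma adj_add:
  assumes "X \<in> \<gg>" "Y \<in> \<gg>" "x \<in> carrier G"
  shows "adj x (X + Y) = adj x X + adj x Y"
proof (rule lie_eqI)
  show "adj x (X + Y) \<in> \<gg>" "adj x X + adj x Y \<in> \<gg>"
    by (intro adj_in subspace_add[OF subspace_lie_algebra] assms)+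
  show "adj x (X + Y) \<one> f = (adj x X + adj x Y) \<one> f" if "f \<in> CG" for f
    using assms that by (simp add: adj_at_one subspace_add[OF subspace_lie_algebra])
qed

lemma adj_scale:
  assumes "X \<in> \<gg>" "x \<in> carrier G"
  shows "adj x (c *\<^sub>R X) = c *\<^sub>R adj x X"
proof (rule lie_eqI)
  show "adj x (c *\<^sub>R X) \<in> \<gg>" "c *\<^sub>R adj x X \<in> \<gg>"
    by (intro adj_in subspace_scale[OF subspace_lie_algebra] assms)+
  show "adj x (c *\<^sub>R X) \<one> f = (c *\<^sub>R adj x X) \<one> f" if "f \<in> CG" for f
    using adj_at_one[OF subspace_scale[OF subspace_lie_algebra assms(1)] assms(2) that, of c]
      adj_at_one[OF assms that] by (simp add: scaleR_fun_def)
qed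

lemma endo_on_adj: "x \<in> carrier G \<Longrightarrow> endo_on \<gg> (adj x)"
  by (simp add: endo_on_def adj_in adj_add adj_scale)

lemma adj_one: "X \<in> \<gg> \<Longrightarrow> adj \<one> X = X"
proof (rule lie_eqI)
  assume X: "X \<in> \<gg>"
  show "adj \<one> X \<in> \<gg>" using X by (simp add: adj_in)
  fix f assume f: "f \<in> CG"
  have "res (\<lambda>w. f (inv \<one> \<otimes> w \<otimes> \<one>)) = f" by (rule ext0_eqI) (auto simp: CG_outside[OF f])
  then show "adj \<one> X \<one> f = X \<one> f" using adj_at_one[OF X one_closed f] by simp
qed

text \<open>The order reverses because \<open>adj\<close> is Ad of the inverse, a right action of
  the group.\<close>

lemma adj_mult:
  assumes X: "X \<in> \<gg>" and x: "x \<in> carrier G" and y: "y \<in> carrier G"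
  shows "adj (x \<otimes> y) X = adj y (adj x X)"
proof (rule lie_eqI)
  show "adj (x \<otimes> y) X \<in> \<gg>" "adj y (adj x X) \<in> \<gg>" using assms by (auto intro!: adj_in)
  fix f assume f: "f \<in> CG"
  have "res (\<lambda>w. res (\<lambda>w. f (inv y \<otimes> w \<otimes> y)) (inv x \<otimes> w \<otimes> x)) = res (\<lambda>w. f (inv (x \<otimes> y) \<otimes> w \<otimes> (x \<otimes> y)))"
    by (rule ext0_cong) (use x y in \<open>simp add: m_assoc inv_mult_group\<close>)
  then show "adj (x \<otimes> y) X \<one> f = adj y (adj x X) \<one> f"
    using adj_at_one[OF X _ f, of "x \<otimes> y"] adj_at_one[OF adj_in[OF X x] y f] adj_at_one[OF X x conj_in[OF f y]] x y
    by simp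
qed

lemma adj_inverse:
  assumes "X \<in> \<gg>" "x \<in> carrier G"
  shows "adj x (adj (inv x) X) = X" "adj (inv x) (adj x X) = X"
  using adj_mult[of X "inv x" x] adj_mult[of X x "inv x"] assms adj_one by simp_all

text \<open>By \<open>adj_at\<close>, \<open>adj x X\<close> is the push-forward of \<open>X\<close>
  under right translation by \<open>x\<close>, and push-forwards respect brackets. Left invariance
  reduces the check to \<open>\<one>\<close>.\<close>

lemma adj_bracket:
  assumes X: "X \<in> \<gg>" and Y: "Y \<in> \<gg>" and x: "x \<in> carrier G"
  shows "adj x (lie_bracket X Y) = lie_bracket (adj x X) (adj x Y)"
proof (rule lie_eqI)
  show "adj x (lie_bracket X Y) \<in> \<gg>" "lie_bracket (adj x X) (adj x Y) \<in> \<gg>"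
    by (intro adj_in lie_bracket_in assms)+
  fix f assume f: "f \<in> CG"
  note fx = right_translate_in[OF f x]
  have *: "adj x X \<one> (\<lambda>q. adj x Y q f) = X (inv x) (\<lambda>q. Y q (res (\<lambda>v. f (v \<otimes> x))))"
    if X: "X \<in> \<gg>" and Y: "Y \<in> \<gg>" for X Y
  proof -
    have "res (\<lambda>v. adj x Y (v \<otimes> x) f) = (\<lambda>q. Y q (res (\<lambda>v. f (v \<otimes> x))))"
    proof (rule ext0_eqI)
      fix v assume v: "v \<in> carrier G"
      then show "adj x Y (v \<otimes> x) f = Y v (res (\<lambda>v. f (v \<otimes> x)))"
        using adj_at[OF Y x _ f, of "v \<otimes> x"] x by (simp add: m_assoc)
    qed (rule lie_outside[OF Y])
    then show ?thesis
      using adj_at[OF X x one_closed lie_smooth[OF adj_in[OF Y x] f]] x by simp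
  qed
  show "adj x (lie_bracket X Y) \<one> f = lie_bracket (adj x X) (adj x Y) \<one> f"
    using adj_at[OF lie_bracket_in[OF X Y] x one_closed f] x
    by (simp add: lie_bracket_apply *[OF X Y] *[OF Y X])
qed

lemma adj_smooth:
  assumes X: "X \<in> \<gg>" and f: "f \<in> CG"
  shows "res (\<lambda>x. adj x X \<one> f) \<in> CG"
proof -
  let ?F = "ext0 (carrier G \<times> carrier G) (\<lambda>p. f (inv (fst p) \<otimes> snd p \<otimes> fst p))"
  have F: "?F \<in> CN" by (rule res_pullback_N[OF f]) (intro smooth_rules)
  have u: "X \<one> \<in> tangent_space CG \<one>" by (rule lie_tangent[OF X one_closed])
  have "(\<lambda>x. X \<one> (\<lambda>w. ?F (x, w))) \<in> CG"
    by (rule tangent_parameter_snd[OF F u]) simp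
  moreover have "res (\<lambda>x. adj x X \<one> f) = (\<lambda>x. X \<one> (\<lambda>w. ?F (x, w)))"
  proof (rule ext0_eqI)
    fix x assume x: "x \<in> carrier G"
    have "(\<lambda>w. ?F (x, w)) = res (\<lambda>w. f (inv x \<otimes> w \<otimes> x))" using x by (auto simp: ext0_def)
    then show "adj x X \<one> f = X \<one> (\<lambda>w. ?F (x, w))" using adj_at_one[OF X x f] by simp
  next
    fix x assume "x \<notin> carrier G"
    then have "(\<lambda>w. ?F (x, w)) = (\<lambda>w. 0)" by auto
    then show "X \<one> (\<lambda>w. ?F (x, w)) = 0" using M.tangent_0[OF u] by simp
  qed
  ultimately show ?thesis by simp
qed

text \<open>Conjugation contains \<open>x\<close> twice. The diagonal rule splits its derivative
  into that of w x, which gives \<open>Z w f\<close>, and that of inv x w, which gives a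
  right-invariant derivative with a minus sign. Interchanging the latter with \<open>X\<close>
  produces the bracket, with the sign that belongs to Ad of the inverse.\<close>

lemma adj_derivative:
  assumes X: "X \<in> \<gg>" and Z: "Z \<in> \<gg>" and f: "f \<in> CG"
  shows "Z \<one> (res (\<lambda>x. adj x X \<one> f)) = lie_bracket X Z \<one> f"
proof -
  note u = lie_tangent[OF X one_closed] and v = lie_tangent[OF Z one_closed]
  let ?F = "ext0 (carrier G \<times> carrier G) (\<lambda>p. f (inv (fst p) \<otimes> snd p \<otimes> fst p))"
  have F: "?F \<in> CN" by (rule res_pullback_N[OF f]) (intro smooth_rules)
  let ?K = "ext0 (carrier G \<times> carrier G) (\<lambda>p. f (fst p \<otimes> snd p))"
  have K: "?K \<in> CN" by (rule res_pullback_N[OF f]) (intro smooth_rules)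
  have "res (\<lambda>x. adj x X \<one> f) = (\<lambda>x. X \<one> (\<lambda>w. ?F (x, w)))"
  proof (rule ext0_eqI)
    fix x assume x: "x \<in> carrier G"
    have "(\<lambda>w. ?F (x, w)) = res (\<lambda>w. f (inv x \<otimes> w \<otimes> x))" using x by (auto simp: ext0_def)
    then show "adj x X \<one> f = X \<one> (\<lambda>w. ?F (x, w))" using adj_at_one[OF X x f] by simp
  next
    fix x assume "x \<notin> carrier G"
    then have "(\<lambda>w. ?F (x, w)) = (\<lambda>w. 0)" by auto
    then show "X \<one> (\<lambda>w. ?F (x, w)) = 0" using M.tangent_0[OF u] by simp
  qed
  then have "Z \<one> (res (\<lambda>x. adj x X \<one> f)) = X \<one> (\<lambda>w. Z \<one> (\<lambda>x. ?F (x, w)))"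
    using tangent_interchange[OF F _ _ v u] by simp
  also have "(\<lambda>w. Z \<one> (\<lambda>x. ?F (x, w))) = (\<lambda>w. Z w f - Z \<one> (\<lambda>x. ?K (x, w)))"
  proof
    fix w
    show "Z \<one> (\<lambda>x. ?F (x, w)) = Z w f - Z \<one> (\<lambda>x. ?K (x, w))"
    proof (cases "w \<in> carrier G")
      case True
      \<comment> \<open>One variable for each occurrence of \<open>x\<close>; on the diagonal the
        conjugate of \<open>w\<close> returns.\<close>
      let ?P = "ext0 (carrier G \<times> carrier G) (\<lambda>p. f (inv (fst p) \<otimes> w \<otimes> snd p))"
      have P: "?P \<in> CN" using True by (intro res_pullback_N[OF f] smooth_rules)
      have "(\<lambda>x. ?F (x, w)) = res (\<lambda>x. ?P (x, x))" using True by (auto simp: ext0_def)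
      moreover have "(\<lambda>x. ?P (x, \<one>)) = res (\<lambda>x. res (\<lambda>x. f (x \<otimes> w)) (inv x))" using True by (auto simp: ext0_def)
      moreover have "(\<lambda>x. ?P (\<one>, x)) = res (\<lambda>x. f (w \<otimes> x))" using True by (auto simp: ext0_def)
      moreover have "(\<lambda>x. ?K (x, w)) = res (\<lambda>x. f (x \<otimes> w))" using True by (auto simp: ext0_def)
      ultimately show ?thesis
        using diagonal_rule(2)[OF P one_closed v] inverse_rule[OF right_translate_in[OF f True] v] lie_at[OF Z True f]
        by simp
    next
      case False
      then have "(\<lambda>x. ?F (x, w)) = (\<lambda>w. 0)" "(\<lambda>x. ?K (x, w)) = (\<lambda>x. 0)" by auto
      then show ?thesis using False M.tangent_0[OF v] lie_outside[OF Z] by simp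
    qed
  qed
  also have "X \<one> \<dots> = X \<one> (\<lambda>w. Z w f) - X \<one> (\<lambda>w. Z \<one> (\<lambda>x. ?K (x, w)))"
    by (rule tangent_diff[OF u lie_smooth[OF Z f] tangent_parameter_fst[OF K v]]) simp
  also have "X \<one> (\<lambda>w. Z \<one> (\<lambda>x. ?K (x, w))) = Z \<one> (\<lambda>x. X \<one> (\<lambda>w. ?K (x, w)))"
    using tangent_interchange[OF K _ _ v u] by simp
  also have "(\<lambda>x. X \<one> (\<lambda>w. ?K (x, w))) = (\<lambda>x. X x f)"
  proof
    fix x
    show "X \<one> (\<lambda>w. ?K (x, w)) = X x f"
    proof (cases "x \<in> carrier G")
      case True
      then have "(\<lambda>w. ?K (x, w)) = res (\<lambda>w. f (x \<otimes> w))" by (auto simp: ext0_def)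
      then show ?thesis using lie_at[OF X True f] by simp
    next
      case False
      then have "(\<lambda>w. ?K (x, w)) = (\<lambda>w. 0)" by auto
      then show ?thesis using False M.tangent_0[OF u] lie_outside[OF X] by simp
    qed
  qed
  finally show ?thesis by (simp add: lie_bracket_apply)
qed

subsection \<open>A basis of the Lie algebra\<close>

text \<open>The functions \<open>x i\<close> accompany the frame so that the coefficients of a
  left-invariant field are derivatives at \<open>\<one>\<close>. Smooth dependence of a field on a
  parameter can then be tested on functions.\<close>

definition lie_frame :: "('e \<Rightarrow> 'g \<Rightarrow> real) \<Rightarrow> ('e \<Rightarrow> 'g vfield) \<Rightarrow> bool" where
  "lie_frame x E \<longleftrightarrow> (\<forall>i\<in>Basis. x i \<in> CG) \<and> (\<forall>i\<in>Basis. E i \<in> \<gg>) \<and>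
     (\<forall>i\<in>Basis. \<forall>j\<in>Basis. E i \<one> (x j) = (if i = j then 1 else 0)) \<and>
     (\<forall>X\<in>\<gg>. X = (\<Sum>i\<in>Basis. X \<one> (x i) *\<^sub>R E i))"

lemma lie_frameD:
  assumes "lie_frame x E"
  shows "\<And>i. i \<in> Basis \<Longrightarrow> x i \<in> CG" "\<And>i. i \<in> Basis \<Longrightarrow> E i \<in> \<gg>"
    "\<And>i j. i \<in> Basis \<Longrightarrow> j \<in> Basis \<Longrightarrow> E i \<one> (x j) = (if i = j then 1 else 0)"
    "\<And>X. X \<in> \<gg> \<Longrightarrow> X = (\<Sum>i\<in>Basis. X \<one> (x i) *\<^sub>R E i)"
  using assms unfolding lie_frame_def by blast+

lemma exists_lie_frame: "\<exists>x E. lie_frame x E"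
proof -
  have "\<one> \<in> topspace T" by simp
  then show ?thesis
  proof (rule M.tangent_basis, goal_cases)
    case (1 x e)
    note x = 1(1) and e = 1(2) and d = 1(3) and r = 1(4)
    have ap: "(\<Sum>i\<in>I. c i *\<^sub>R left_field (e i)) \<one> = (\<Sum>i\<in>I. c i *\<^sub>R e i)" if "I \<subseteq> Basis" for I c
      using that
      by (induction I rule: infinite_finite_induct) (auto simp: scaleR_fun_def left_field(2)[OF e])
    have "lie_frame x (\<lambda>i. left_field (e i))"
      unfolding lie_frame_def
    proof (intro conjI ballI)
      show "x i \<in> CG" "left_field (e i) \<in> \<gg>" if "i \<in> Basis" for i
        using x[OF that] left_field(1)[OF e[OF that]] .
      show "left_field (e i) \<one> (x j) = (if i = j then 1 else 0)" if "i \<in> Basis" "j \<in> Basis" for i j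
        using d[OF that] left_field(2)[OF e[OF that(1)]] by simp
      fix X assume X: "X \<in> \<gg>"
      show "X = (\<Sum>i\<in>Basis. X \<one> (x i) *\<^sub>R left_field (e i))"
      proof (rule lie_eq_at[OF X _ one_closed])
        show "(\<Sum>i\<in>Basis. X \<one> (x i) *\<^sub>R left_field (e i)) \<in> \<gg>"
          by (intro subspace_sum subspace_scale subspace_lie_algebra left_field(1) e)
        show "X \<one> = (\<Sum>i\<in>Basis. X \<one> (x i) *\<^sub>R left_field (e i)) \<one>"
          using r[OF lie_tangent[OF X one_closed]] ap[OF subset_refl, of "\<lambda>i. X \<one> (x i)"] by simp
      qed
    qed
    then show ?thesis by blast
  qed
qed

lemma lie_finite_basis: "\<exists>B. independent B \<and> finite B \<and> span B = \<gg>"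
proof -
  obtain x E where xE: "lie_frame x E" using exists_lie_frame by blast
  note E = lie_frameD(2)[OF xE] and r = lie_frameD(4)[OF xE]
  let ?S = "E ` Basis"
  have "X \<in> span ?S" if "X \<in> \<gg>" for X
    by (subst r[OF that]) (intro span_sum span_scale span_base imageI)
  moreover have "?S \<subseteq> \<gg>" using E by auto
  ultimately have sp: "span ?S = \<gg>"
    using span_minimal[OF _ subspace_lie_algebra] by blast
  obtain B where B: "B \<subseteq> ?S" "independent B" "?S \<subseteq> span B"
    using maximal_independent_subset[of ?S] by blast
  have "span B = \<gg>"
    using B(1,3) sp by (metis span_mono span_span subset_antisym)
  then show ?thesis using B finite_subset[OF B(1)] by auto
qed

text \<open>In a frame, \<open>l\<close> is a finite combination of the coordinates of
  \<open>adj w X\<close>, to which \<open>adj_smooth\<close> and \<open>adj_derivative\<close>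
  apply. Linearity is asked for on \<open>\<gg>\<close> only, so that the Killing form and invariant
  inner products qualify.\<close>

lemma smooth_lin_adj:
  assumes X: "X \<in> \<gg>" and add: "\<And>Y Z. Y \<in> \<gg> \<Longrightarrow> Z \<in> \<gg> \<Longrightarrow> l (Y + Z) = l Y + l Z"
    and scale: "\<And>Y c. Y \<in> \<gg> \<Longrightarrow> l (c *\<^sub>R Y) = c * (l Y :: real)"
  shows "res (\<lambda>w. l (adj w X)) \<in> CG"
    and "Z \<in> \<gg> \<Longrightarrow> Z \<one> (res (\<lambda>w. l (adj w X))) = l (lie_bracket X Z)"
proof -
  obtain x E where xE: "lie_frame x E" using exists_lie_frame by blast
  note x = lie_frameD(1)[OF xE] and E = lie_frameD(2)[OF xE] and r = lie_frameD(4)[OF xE]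
  have l0: "l 0 = 0" using scale[of 0 0] subspace_0[OF subspace_lie_algebra] by simp
  have sum: "l (\<Sum>i\<in>I. c i *\<^sub>R E i) = (\<Sum>i\<in>I. c i * l (E i))" if "I \<subseteq> Basis" for I c
    using that
  proof (induction I rule: infinite_finite_induct)
    case (insert i I)
    have "c i *\<^sub>R E i \<in> \<gg>" "(\<Sum>i\<in>I. c i *\<^sub>R E i) \<in> \<gg>"
      using insert.prems by (auto intro!: subspace_scale subspace_sum subspace_lie_algebra E)
    from add[OF this] scale[OF E, of i "c i"]
    have H: "l (\<Sum>i\<in>insert i I. c i *\<^sub>R E i) = c i * l (E i) + l (\<Sum>i\<in>I. c i *\<^sub>R E i)"
      using insert.prems by (simp only: sum.insert[OF insert.hyps]) simp
    have "l (\<Sum>i\<in>I. c i *\<^sub>R E i) = (\<Sum>i\<in>I. c i * l (E i))"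
      using insert.IH insert.prems by simp
    with H show ?case
      by (simp only: sum.insert[OF insert.hyps, of "\<lambda>i. c i * l (E i)"])
  next
    case (infinite I)
    then show ?case by (simp only: sum.infinite l0 not_False_eq_True)
  next
    case empty
    show ?case by (simp only: sum.empty l0)
  qed
  have l: "l Y = (\<Sum>i\<in>Basis. l (E i) * Y \<one> (x i))" if "Y \<in> \<gg>" for Y
    by (subst r[OF that]) (simp add: sum mult.commute)
  have e: "res (\<lambda>w. l (adj w X)) = (\<lambda>w. \<Sum>i\<in>Basis. l (E i) * res (\<lambda>w. adj w X \<one> (x i)) w)"
    by (rule ext0_eqI) (auto simp: l[OF adj_in[OF X]])
  have sm: "(\<lambda>w. l (E i) * res (\<lambda>w. adj w X \<one> (x i)) w) \<in> CG" if "i \<in> Basis" for i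
    by (rule M.smooth_functions_scale[OF adj_smooth[OF X x[OF that]]])
  show "res (\<lambda>w. l (adj w X)) \<in> CG"
    unfolding e by (rule M.smooth_functions_sum[OF sm])
  assume Z: "Z \<in> \<gg>"
  note v = lie_tangent[OF Z one_closed]
  have "Z \<one> (res (\<lambda>w. l (adj w X))) = (\<Sum>i\<in>Basis. Z \<one> (\<lambda>w. l (E i) * res (\<lambda>w. adj w X \<one> (x i)) w))"
    unfolding e by (rule M.tangent_sum[OF v sm])
  also have "\<dots> = (\<Sum>i\<in>Basis. l (E i) * lie_bracket X Z \<one> (x i))"
    by (rule sum.cong[OF refl])
      (simp add: tangent_scale[OF v adj_smooth[OF X x]] adj_derivative[OF X Z x])
  also have "\<dots> = l (lie_bracket X Z)" using l[OF lie_bracket_in[OF X Z]] by simp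
  finally show "Z \<one> (res (\<lambda>w. l (adj w X))) = l (lie_bracket X Z)" .
qed

subsection \<open>The Killing form\<close>

abbreviation "\<kappa> \<equiv> killing_form G CG"

lemma endo_on_ad_ad: "X \<in> \<gg> \<Longrightarrow> Y \<in> \<gg> \<Longrightarrow> endo_on \<gg> (\<lambda>Z. lie_bracket X (lie_bracket Y Z))"
  by (rule endo_on_compose[OF endo_on_ad endo_on_ad])

lemma killing_sym: "X \<in> \<gg> \<Longrightarrow> Y \<in> \<gg> \<Longrightarrow> \<kappa> X Y = \<kappa> Y X"
  unfolding killing_form_def using lie_finite_basis trace_on_commute[OF _ _ _ endo_on_ad endo_on_ad] by metis

lemma killing_lincomb:
  assumes "X \<in> \<gg>" "Y \<in> \<gg>" "Z \<in> \<gg>"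
  shows "\<kappa> (c *\<^sub>R X + d *\<^sub>R Y) Z = c * \<kappa> X Z + d * \<kappa> Y Z"
proof -
  obtain B where B: "independent B" "finite B" "span B = \<gg>" using lie_finite_basis by blast
  show ?thesis
    unfolding killing_form_def
    by (rule trace_on_lincomb[OF B endo_on_ad_ad endo_on_ad_ad])
       (use assms in \<open>simp_all add: lie_bracket_add_left lie_bracket_scale_left lie_bracket_in
          subspace_scale[OF subspace_lie_algebra]\<close>)
qed

lemma killing_add: "X \<in> \<gg> \<Longrightarrow> Y \<in> \<gg> \<Longrightarrow> Z \<in> \<gg> \<Longrightarrow> \<kappa> (X + Y) Z = \<kappa> X Z + \<kappa> Y Z"
  using killing_lincomb[of X Y Z 1 1] by simp

lemma killing_scale: "X \<in> \<gg> \<Longrightarrow> Z \<in> \<gg> \<Longrightarrow> \<kappa> (c *\<^sub>R X) Z = c * \<kappa> X Z"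
  using killing_lincomb[of X X Z c 0] by simp

lemma killing_diff: "X \<in> \<gg> \<Longrightarrow> Y \<in> \<gg> \<Longrightarrow> Z \<in> \<gg> \<Longrightarrow> \<kappa> (X - Y) Z = \<kappa> X Z - \<kappa> Y Z"
  using killing_lincomb[of X Y Z 1 "-1"] by simp

lemma killing_uminus: "X \<in> \<gg> \<Longrightarrow> Z \<in> \<gg> \<Longrightarrow> \<kappa> (- X) Z = - \<kappa> X Z"
  using killing_scale[of X Z "-1"] by simp

lemma killing_add_right: "X \<in> \<gg> \<Longrightarrow> Y \<in> \<gg> \<Longrightarrow> Z \<in> \<gg> \<Longrightarrow> \<kappa> Z (X + Y) = \<kappa> Z X + \<kappa> Z Y"
  using killing_add[of X Y Z] killing_sym[of Z] subspace_add[OF subspace_lie_algebra, of X Y] by simp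

lemma killing_scale_right: "X \<in> \<gg> \<Longrightarrow> Z \<in> \<gg> \<Longrightarrow> \<kappa> Z (c *\<^sub>R X) = c * \<kappa> Z X"
  using killing_scale[of X Z c] killing_sym[of Z] subspace_scale[OF subspace_lie_algebra, of X c] by simp

lemma killing_uminus_right: "X \<in> \<gg> \<Longrightarrow> Z \<in> \<gg> \<Longrightarrow> \<kappa> Z (- X) = - \<kappa> Z X"
  using killing_scale_right[of X Z "-1"] by simp

text \<open>By Jacobi both sides are traces of products with a commutator of ad maps. One term is
  common, and the other two agree because traces of products commute.\<close>

lemma killing_invariant:
  assumes X: "X \<in> \<gg>" and Y: "Y \<in> \<gg>" and Z: "Z \<in> \<gg>"
  shows "\<kappa> (lie_bracket X Y) Z = \<kappa> X (lie_bracket Y Z)"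
proof -
  obtain B where B: "independent B" "finite B" "span B = \<gg>" using lie_finite_basis by blast
  let ?tr = "trace_on \<gg>"
  have e3: "endo_on \<gg> (\<lambda>W. lie_bracket P (lie_bracket Q (lie_bracket R W)))"
    if "P \<in> \<gg>" "Q \<in> \<gg>" "R \<in> \<gg>" for P Q R
    by (rule endo_on_compose[OF endo_on_ad endo_on_ad_ad]) (use that in auto)
  have br: "lie_bracket (lie_bracket P Q) W = lie_bracket P (lie_bracket Q W) - lie_bracket Q (lie_bracket P W)"
    if "P \<in> \<gg>" "Q \<in> \<gg>" "W \<in> \<gg>" for P Q W
    using lie_bracket_jacobi[OF that] by simp
  have "\<kappa> (lie_bracket X Y) Z = 1 * ?tr (\<lambda>W. lie_bracket X (lie_bracket Y (lie_bracket Z W)))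
      + (-1) * ?tr (\<lambda>W. lie_bracket Y (lie_bracket X (lie_bracket Z W)))"
    unfolding killing_form_def
    by (rule trace_on_lincomb[OF B e3[OF X Y Z] e3[OF Y X Z]])
       (use assms in \<open>simp add: br lie_bracket_in\<close>)
  moreover have "\<kappa> X (lie_bracket Y Z) = 1 * ?tr (\<lambda>W. lie_bracket X (lie_bracket Y (lie_bracket Z W)))
      + (-1) * ?tr (\<lambda>W. lie_bracket X (lie_bracket Z (lie_bracket Y W)))"
    unfolding killing_form_def
  proof (rule trace_on_lincomb[OF B e3[OF X Y Z] e3[OF X Z Y]])
    fix W assume W: "W \<in> \<gg>"
    have "lie_bracket X (lie_bracket (lie_bracket Y Z) W) =
        lie_bracket X (lie_bracket Y (lie_bracket Z W) + (-1) *\<^sub>R lie_bracket Z (lie_bracket Y W))"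
      using br[OF Y Z W] by simp
    also have "\<dots> = lie_bracket X (lie_bracket Y (lie_bracket Z W)) + (-1) *\<^sub>R lie_bracket X (lie_bracket Z (lie_bracket Y W))"
    proof -
      have a: "lie_bracket Y (lie_bracket Z W) \<in> \<gg>" "lie_bracket Z (lie_bracket Y W) \<in> \<gg>"
        by (intro lie_bracket_in assms W)+
      show ?thesis
        unfolding lie_bracket_add_right[OF X a(1) subspace_scale[OF subspace_lie_algebra a(2)]]
          lie_bracket_scale_right[OF X a(2)] ..
    qed
    finally show "lie_bracket X (lie_bracket (lie_bracket Y Z) W) =
       1 *\<^sub>R lie_bracket X (lie_bracket Y (lie_bracket Z W)) + (-1) *\<^sub>R lie_bracket X (lie_bracket Z (lie_bracket Y W))"
      by simp
  qed
  moreover have "?tr (\<lambda>W. lie_bracket Y (lie_bracket X (lie_bracket Z W))) = ?tr (\<lambda>W. lie_bracket X (lie_bracket Z (lie_bracket Y W)))"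
    by (rule trace_on_commute[OF B endo_on_ad[OF Y] endo_on_ad_ad[OF X Z]])
  ultimately show ?thesis by simp
qed

lemma killing_cyclic:
  "X \<in> \<gg> \<Longrightarrow> Y \<in> \<gg> \<Longrightarrow> Z \<in> \<gg> \<Longrightarrow> \<kappa> (lie_bracket X Y) Z = \<kappa> (lie_bracket Y Z) X"
  using killing_invariant[of X Y Z] killing_sym[of X "lie_bracket Y Z"] lie_bracket_in[of Y Z] by simp

lemma killing_skew: "X \<in> \<gg> \<Longrightarrow> Y \<in> \<gg> \<Longrightarrow> Z \<in> \<gg> \<Longrightarrow> \<kappa> (lie_bracket X Y) Z = - \<kappa> (lie_bracket Y X) Z"
  using killing_uminus[of "lie_bracket Y X" Z] lie_bracket_in[of Y X] lie_bracket_skew[of X Y] by simp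

lemma killing_adj:
  assumes X: "X \<in> \<gg>" and Y: "Y \<in> \<gg>" and x: "x \<in> carrier G"
  shows "\<kappa> (adj x X) (adj x Y) = \<kappa> X Y"
proof -
  obtain B where B: "independent B" "finite B" "span B = \<gg>" using lie_finite_basis by blast
  let ?L = "\<lambda>W. adj x (lie_bracket X (lie_bracket Y W))" and ?K = "adj (inv x)"
  have ix: "inv x \<in> carrier G" using x by simp
  have L: "endo_on \<gg> ?L" by (rule endo_on_compose[OF endo_on_adj[OF x] endo_on_ad_ad[OF X Y]])
  have K: "endo_on \<gg> ?K" by (rule endo_on_adj[OF ix])
  \<comment> \<open>The coefficients 1 and 0 turn \<open>trace_on_lincomb\<close> into a congruence
    for maps that agree on \<open>\<gg>\<close>, where \<open>adj x\<close> conjugates the one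
    product of ad maps into the other.\<close>
  have "\<kappa> (adj x X) (adj x Y) = 1 * trace_on \<gg> (\<lambda>W. ?L (?K W)) + 0 * trace_on \<gg> (\<lambda>W. ?L (?K W))"
    unfolding killing_form_def
  proof (rule trace_on_lincomb[OF B endo_on_compose[OF L K] endo_on_compose[OF L K]])
    fix W assume W: "W \<in> \<gg>"
    have kW: "?K W \<in> \<gg>" by (rule adj_in[OF W ix])
    have "?L (?K W) = lie_bracket (adj x X) (lie_bracket (adj x Y) (adj x (?K W)))"
      by (simp add: adj_bracket[OF X lie_bracket_in[OF Y kW] x] adj_bracket[OF Y kW x])
    then show "lie_bracket (adj x X) (lie_bracket (adj x Y) W) = 1 *\<^sub>R ?L (?K W) + 0 *\<^sub>R ?L (?K W)"
      by (simp add: adj_inverse[OF W x])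
  qed
  also have "\<dots> = trace_on \<gg> (\<lambda>W. ?K (?L W))"
    using trace_on_commute[OF B L K] by simp
  also have "\<dots> = 1 * \<kappa> X Y + 0 * \<kappa> X Y"
    unfolding killing_form_def
    by (rule trace_on_lincomb[OF B endo_on_ad_ad endo_on_ad_ad])
       (use X Y x in \<open>simp_all add: adj_inverse lie_bracket_in\<close>)
  finally show ?thesis by simp
qed

text \<open>In a frame the maps \<open>adj w\<close> become a group of matrices on the model space.
  Their entries are smooth functions on a compact space, hence bounded, and
  \<open>invariant_inner_product\<close> applies.\<close>

lemma invariant_inner_on:
  assumes "compact_space T"
  obtains Q where "inner_on \<gg> Q"
    "\<And>X Y x. X \<in> \<gg> \<Longrightarrow> Y \<in> \<gg> \<Longrightarrow> x \<in> carrier G \<Longrightarrow> Q (adj x X) (adj x Y) = Q X Y"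
proof -
  obtain x E where xE: "lie_frame x E" using exists_lie_frame by blast
  note x = lie_frameD(1)[OF xE] and E = lie_frameD(2)[OF xE] and d = lie_frameD(3)[OF xE] and r = lie_frameD(4)[OF xE]
  define \<rho> where "\<rho> s = (\<Sum>i\<in>Basis. (s \<bullet> i) *\<^sub>R E i)" for s
  define c where "c X = (\<Sum>i\<in>Basis. X \<one> (x i) *\<^sub>R i)" for X
  have \<rho>: "\<rho> s \<in> \<gg>" for s
    unfolding \<rho>_def by (intro subspace_sum subspace_scale subspace_lie_algebra E)
  have ci: "c X \<bullet> i = X \<one> (x i)" if "i \<in> Basis" for X i
    using that by (simp add: c_def inner_sum_left inner_Basis if_distrib cong: if_cong)
  have \<rho>c: "\<rho> (c X) = X" if "X \<in> \<gg>" for X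
    by (subst (2) r[OF that]) (simp add: \<rho>_def ci)
  have cadd: "c (X + Y) = c X + c Y" and cscale: "c (k *\<^sub>R X) = k *\<^sub>R c X" for X Y k
    by (simp_all add: c_def scaleR_left_distrib sum.distrib scaleR_fun_def scaleR_sum_right)
  have csum: "c (\<Sum>i\<in>I. k i *\<^sub>R F i) = (\<Sum>i\<in>I. k i *\<^sub>R c (F i))" for k F and I :: "'e set"
  proof -
    have c0: "c 0 = 0" using cscale[of 0 0] by simp
    show ?thesis
    proof (induction I rule: infinite_finite_induct)
      case (infinite I)
      then show ?case by (simp only: sum.infinite c0 not_False_eq_True)
    next
      case empty
      show ?case by (simp only: sum.empty c0)
    next
      case (insert i I)
      show ?case by (simp only: sum.insert[OF insert.hyps] cadd cscale insert.IH)
    qed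
  qed
  have cE: "c (E i) = i" if "i \<in> Basis" for i
    by (rule euclidean_eqI) (use that in \<open>simp add: ci d inner_Basis\<close>)
  have c\<rho>: "c (\<rho> s) = s" for s
    unfolding \<rho>_def csum by (simp add: cE euclidean_representation)
  define g where "g w s = c (adj w (\<rho> s))" for w s
  have \<rho>add: "\<rho> (s + t) = \<rho> s + \<rho> t" and \<rho>scale: "\<rho> (k *\<^sub>R s) = k *\<^sub>R \<rho> s" for s t k
    by (simp_all add: \<rho>_def inner_add_left scaleR_left_distrib sum.distrib scaleR_sum_right)
  have lin: "linear (g w)" if "w \<in> carrier G" for w
    by (rule linearI) (simp_all add: g_def \<rho>add \<rho>scale adj_add[OF \<rho> \<rho> that] adj_scale[OF \<rho> that] cadd cscale)
  have gg: "g w (g w' s) = g (w' \<otimes> w) s" if "w \<in> carrier G" "w' \<in> carrier G" for w w' s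
    using that by (simp add: g_def \<rho>c adj_in \<rho> adj_mult)
  have g1: "g \<one> = id" by (auto simp: g_def adj_one[OF \<rho>] c\<rho>)
  have "\<forall>i\<in>Basis. \<forall>j\<in>Basis. \<exists>K>0. \<forall>w. \<bar>res (\<lambda>w. adj w (E j) \<one> (x i)) w\<bar> \<le> K"
  proof (intro ballI)
    fix i j :: 'e assume "i \<in> Basis" "j \<in> Basis"
    then show "\<exists>K>0. \<forall>w. \<bar>res (\<lambda>w. adj w (E j) \<one> (x i)) w\<bar> \<le> K"
      using M.smooth_functions_bounded[OF assms adj_smooth[OF E[of j] x[of i]]] by metis
  qed
  then obtain k where k: "\<forall>i\<in>Basis. \<forall>j\<in>Basis. k i j > 0 \<and> (\<forall>w. \<bar>res (\<lambda>w. adj w (E j) \<one> (x i)) w\<bar> \<le> k i j)"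
    by metis
  have g_le: "norm (g w s) \<le> (\<Sum>i\<in>Basis. \<Sum>j\<in>Basis. k i j) * norm s" if w: "w \<in> carrier G" for w s
  proof -
    have *: "\<bar>g w j \<bullet> i\<bar> \<le> k i j" if "i \<in> Basis" "j \<in> Basis" for i j
    proof -
      have "\<rho> j = (\<Sum>i\<in>Basis. if i = j then E i else 0)"
        unfolding \<rho>_def by (rule sum.cong) (use that(2) in \<open>auto simp: inner_Basis\<close>)
      then have "\<rho> j = E j" using that(2) by (simp only: sum.delta[OF finite_Basis] if_True)
      then have "g w j \<bullet> i = res (\<lambda>w. adj w (E j) \<one> (x i)) w"
        using that w by (simp add: g_def ci)
      then show ?thesis using k that by auto
    qed
    have gs: "g w s = (\<Sum>j\<in>Basis. (s \<bullet> j) *\<^sub>R g w j)"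
    proof -
      have "g w s = g w (\<Sum>j\<in>Basis. (s \<bullet> j) *\<^sub>R j)" by (simp only: euclidean_representation)
      then show ?thesis by (simp only: linear_sum[OF lin[OF w]] linear_scale[OF lin[OF w]])
    qed
    have "norm (g w s) \<le> (\<Sum>i\<in>Basis. \<bar>g w s \<bullet> i\<bar>)" by (rule norm_le_l1)
    also have "\<dots> \<le> (\<Sum>i\<in>Basis. \<Sum>j\<in>Basis. k i j * norm s)"
    proof (rule sum_mono)
      fix i :: 'e assume i: "i \<in> Basis"
      have "\<bar>g w s \<bullet> i\<bar> = \<bar>\<Sum>j\<in>Basis. (s \<bullet> j) * (g w j \<bullet> i)\<bar>"
        by (subst gs) (simp add: inner_sum_left)
      also have "\<dots> \<le> (\<Sum>j\<in>Basis. \<bar>(s \<bullet> j) * (g w j \<bullet> i)\<bar>)" by (rule sum_abs)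
      also have "\<dots> \<le> (\<Sum>j\<in>Basis. k i j * norm s)"
      proof (rule sum_mono)
        fix j :: 'e assume j: "j \<in> Basis"
        have "\<bar>s \<bullet> j\<bar> * \<bar>g w j \<bullet> i\<bar> \<le> norm s * k i j"
          by (intro mult_mono Basis_le_norm *[OF i j] j) auto
        then show "\<bar>(s \<bullet> j) * (g w j \<bullet> i)\<bar> \<le> k i j * norm s" by (simp add: abs_mult mult.commute)
      qed
      finally show "\<bar>g w s \<bullet> i\<bar> \<le> (\<Sum>j\<in>Basis. k i j * norm s)" .
    qed
    finally show ?thesis by (simp add: sum_distrib_right)
  qed
  let ?\<Gamma> = "g ` carrier G"
  have "\<exists>S :: 'e \<Rightarrow>\<^sub>L 'e. (\<forall>s t. s \<bullet> S t = t \<bullet> S s) \<and> (\<forall>s. s \<noteq> 0 \<longrightarrow> s \<bullet> S s > 0) \<and>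
      (\<forall>h\<in>?\<Gamma>. \<forall>s t. h s \<bullet> S (h t) = s \<bullet> S t)"
  proof (rule invariant_inner_product[of ?\<Gamma> "\<Sum>i\<in>Basis. \<Sum>j\<in>Basis. k i j"], goal_cases)
    case (1 h) then show ?case using lin by auto
  next
    case 2 then show ?case using g1 by (metis image_eqI one_closed)
  next
    case (3 h h')
    then obtain w w' where w: "w \<in> carrier G" "w' \<in> carrier G" "h = g w" "h' = g w'" by blast
    then have "h \<circ> h' = g (w' \<otimes> w)" using gg[OF w(1,2)] by auto
    then show ?case using w by auto
  next
    case (4 h)
    then obtain w where w: "w \<in> carrier G" "h = g w" by blast
    then have "h \<circ> g (inv w) = id" "g (inv w) \<circ> h = id"
      using gg[of w "inv w"] gg[of "inv w" w] g1 by (auto simp: fun_eq_iff)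
    then show ?case using w by blast
  next
    case (5 h s) then show ?case using g_le by blast
  next
    case (6 S) then show ?case by blast
  qed
  then obtain S :: "'e \<Rightarrow>\<^sub>L 'e" where S0: "(\<forall>s t. s \<bullet> S t = t \<bullet> S s) \<and> (\<forall>s. s \<noteq> 0 \<longrightarrow> s \<bullet> S s > 0) \<and>
      (\<forall>h\<in>?\<Gamma>. \<forall>s t. h s \<bullet> S (h t) = s \<bullet> S t)" ..
  have S: "s \<bullet> S t = t \<bullet> S s" "s \<noteq> 0 \<Longrightarrow> s \<bullet> S s > 0"
      "w \<in> carrier G \<Longrightarrow> g w s \<bullet> S (g w t) = s \<bullet> S t" for w s t
    using S0 by auto
  show thesis
  proof (rule that[of "\<lambda>X Y. c X \<bullet> S (c Y)"])
    show "inner_on \<gg> (\<lambda>X Y. c X \<bullet> S (c Y))"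
      unfolding inner_on_def
    proof (intro conjI ballI allI impI)
      show "c X \<bullet> S (c Y) = c Y \<bullet> S (c X)" for X Y by (rule S(1))
      show "0 < c X \<bullet> S (c X)" if "X \<in> \<gg>" "X \<noteq> 0" for X
      proof -
        have "\<rho> 0 = 0" by (simp add: \<rho>_def)
        then have "c X \<noteq> 0" using \<rho>c[OF that(1)] that(2) by auto
        then show ?thesis by (rule S(2))
      qed
    qed (simp_all add: cadd cscale inner_add_left)
    show "c (adj w X) \<bullet> S (c (adj w Y)) = c X \<bullet> S (c Y)"
      if "X \<in> \<gg>" "Y \<in> \<gg>" "w \<in> carrier G" for X Y w
      using S(3)[OF that(3), of "c X" "c Y"] \<rho>c that(1,2) by (simp add: g_def)
  qed
qed

end

section \<open>Negative definiteness of the Killing form\<close>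

context lie_grp
begin

text \<open>Differentiate the constant function Q (adj w X) (adj w Y) of \<open>w\<close> at
  \<open>\<one>\<close> along \<open>Z\<close>. Expanding the second argument in a frame reduces the
  product rule for \<open>Q\<close> to the one for products of functions.\<close>

lemma adj_skew:
  assumes Q: "inner_on \<gg> Q"
    and inv: "\<And>X Y x. X \<in> \<gg> \<Longrightarrow> Y \<in> \<gg> \<Longrightarrow> x \<in> carrier G \<Longrightarrow> Q (adj x X) (adj x Y) = Q X Y"
    and X: "X \<in> \<gg>" and Y: "Y \<in> \<gg>" and Z: "Z \<in> \<gg>"
  shows "Q (lie_bracket Z X) Y = - Q X (lie_bracket Z Y)"
proof -
  note v = lie_tangent[OF Z one_closed]
  obtain x E where xE: "lie_frame x E" using exists_lie_frame by blast
  note x = lie_frameD(1)[OF xE] and E = lie_frameD(2)[OF xE] and r = lie_frameD(4)[OF xE]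
  have lr: "Q W (\<Sum>i\<in>Basis. c i *\<^sub>R E i) = (\<Sum>i\<in>Basis. c i * Q W (E i))" if "W \<in> \<gg>" for W c
  proof -
    have s: "(\<Sum>i\<in>Basis. c i *\<^sub>R E i) \<in> \<gg>" by (intro subspace_sum subspace_scale subspace_lie_algebra E)
    show ?thesis
      using inner_on_sum[OF Q subspace_lie_algebra finite_Basis E that, of "\<lambda>i. i" c]
        inner_on_sym[OF Q that s] inner_on_sym[OF Q that E] by simp
  qed
  define a where "a W i = res (\<lambda>w. Q (adj w W) (E i))" for W i
  define b where "b W i = res (\<lambda>w. adj w W \<one> (x i))" for W i
  have a: "a X i \<in> CG" "Z \<one> (a X i) = Q (lie_bracket X Z) (E i)" if i: "i \<in> Basis" for i
    using smooth_lin_adj[OF X, of "\<lambda>W. Q W (E i)"] inner_on_add[OF Q _ _ E[OF i]] inner_on_scale[OF Q _ E[OF i]] Z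
    by (auto simp: a_def)
  have b: "b Y i \<in> CG" "Z \<one> (b Y i) = lie_bracket Y Z \<one> (x i)" if i: "i \<in> Basis" for i
    using adj_smooth[OF Y x[OF i]] adj_derivative[OF Y Z x[OF i]] by (auto simp: b_def)
  have ab: "(\<lambda>w. b Y i w * a X i w) \<in> CG" if "i \<in> Basis" for i
    by (rule M.smooth_functions_mult[OF b(1) a(1)]) (use that in auto)
  have "res (\<lambda>w. Q X Y) = (\<lambda>w. \<Sum>i\<in>Basis. b Y i w * a X i w)"
  proof (rule ext0_eqI)
    fix w assume w: "w \<in> carrier G"
    have "Q X Y = Q (adj w X) (adj w Y)" using inv[OF X Y w] by simp
    also have "\<dots> = (\<Sum>i\<in>Basis. adj w Y \<one> (x i) * Q (adj w X) (E i))"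
      using lr[OF adj_in[OF X w], of "\<lambda>i. adj w Y \<one> (x i)"] r[OF adj_in[OF Y w]] by simp
    finally show "Q X Y = (\<Sum>i\<in>Basis. b Y i w * a X i w)" using w by (simp add: a_def b_def)
  qed (simp add: a_def)
  then have "0 = Z \<one> (\<lambda>w. \<Sum>i\<in>Basis. b Y i w * a X i w)"
    using tangent_res_const[OF v one_closed, of "Q X Y"] by simp
  also have "\<dots> = (\<Sum>i\<in>Basis. Z \<one> (\<lambda>w. b Y i w * a X i w))" by (rule M.tangent_sum[OF v ab])
  also have "\<dots> = (\<Sum>i\<in>Basis. lie_bracket Y Z \<one> (x i) * Q X (E i) + Y \<one> (x i) * Q (lie_bracket X Z) (E i))"
  proof (rule sum.cong[OF refl])
    fix i :: 'e assume i: "i \<in> Basis"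
    have "a X i \<one> = Q X (E i)" "b Y i \<one> = Y \<one> (x i)"
      using adj_one[OF X] adj_one[OF Y] by (simp_all add: a_def b_def)
    then show "Z \<one> (\<lambda>w. b Y i w * a X i w) = lie_bracket Y Z \<one> (x i) * Q X (E i) + Y \<one> (x i) * Q (lie_bracket X Z) (E i)"
      using tangent_mult[OF v b(1)[OF i] a(1)[OF i]] a(2)[OF i] b(2)[OF i] by simp
  qed
  also have "\<dots> = Q X (lie_bracket Y Z) + Q (lie_bracket X Z) Y"
    using lr[OF X, of "\<lambda>i. lie_bracket Y Z \<one> (x i)"] r[OF lie_bracket_in[OF Y Z]]
      lr[OF lie_bracket_in[OF X Z], of "\<lambda>i. Y \<one> (x i)"] r[OF Y] by (simp add: sum.distrib)
  finally have 0: "Q X (lie_bracket Y Z) + Q (lie_bracket X Z) Y = 0" by simp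
  have neg: "Q (- U) W = - Q U W" "Q W (- U) = - Q W U" if "U \<in> \<gg>" "W \<in> \<gg>" for U W
  proof -
    have m: "- U \<in> \<gg>" by (rule subspace_neg[OF subspace_lie_algebra that(1)])
    show "Q (- U) W = - Q U W" using inner_on_scale[OF Q that, of "-1"] by simp
    then show "Q W (- U) = - Q W U" using inner_on_sym[OF Q that(2) m] inner_on_sym[OF Q that(2,1)] by simp
  qed
  show ?thesis
    using 0 neg(1)[OF lie_bracket_in[OF X Z] Y] neg(2)[OF lie_bracket_in[OF Y Z] X]
      lie_bracket_skew[of Z X] lie_bracket_skew[of Z Y] by simp
qed

text \<open>The derived series of an abelian ideal reaches zero after one step, so the ideal is
  solvable.\<close>

lemma abelian_ideal_trivial:
  assumes ss: "semisimple_lie_group G CG" and I: "subspace I" "I \<subseteq> \<gg>"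
    and ideal: "\<And>X Y. X \<in> \<gg> \<Longrightarrow> Y \<in> I \<Longrightarrow> lie_bracket X Y \<in> I"
    and abelian: "\<And>X Y. X \<in> I \<Longrightarrow> Y \<in> I \<Longrightarrow> lie_bracket X Y = 0"
  shows "I = {0}"
proof -
  let ?S = "{lie_bracket X Y | X Y. X \<in> I \<and> Y \<in> I}"
  have "?S \<subseteq> {0}" using abelian by auto
  then have "span ?S \<subseteq> {0}" by (rule span_minimal) (rule subspace_single_0)
  then have "span ?S = {0}" using span_0[of ?S] by auto
  then have "derived_series I (Suc 0) = {0}" by simp
  then have "\<exists>k. derived_series I k = {0}" by (rule exI)
  then have "subspace I \<and> I \<subseteq> \<gg> \<and> (\<forall>X\<in>\<gg>. \<forall>Y\<in>I. lie_bracket X Y \<in> I) \<and> (\<exists>k. derived_series I k = {0})"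
    using I ideal by simp
  then show ?thesis
    by (rule ss[unfolded semisimple_lie_group_def, THEN spec, THEN mp])
qed

text \<open>For an invariant inner product every ad map is skew, so its square has negative trace
  unless the map is zero. It is nonzero for nonzero \<open>X\<close> because the centre is an
  abelian ideal and therefore trivial.\<close>

lemma killing_negative_definite:
  assumes "compact_space T" and ss: "semisimple_lie_group G CG" and X: "X \<in> \<gg>" "X \<noteq> 0"
  shows "\<kappa> X X < 0"
proof -
  have "\<exists>Q. inner_on \<gg> Q \<and> (\<forall>X\<in>\<gg>. \<forall>Y\<in>\<gg>. \<forall>x\<in>carrier G. Q (adj x X) (adj x Y) = Q X Y)"
    by (rule invariant_inner_on[OF assms(1)]) blast
  then obtain Q where Q: "inner_on \<gg> Q"
    and inv: "\<forall>X\<in>\<gg>. \<forall>Y\<in>\<gg>. \<forall>x\<in>carrier G. Q (adj x X) (adj x Y) = Q X Y" by blast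
  let ?I = "{X \<in> \<gg>. \<forall>Y\<in>\<gg>. lie_bracket X Y = 0}"
  have "?I = {0}"
  proof (rule abelian_ideal_trivial[OF ss])
    have z: "lie_bracket 0 Y = 0" if "Y \<in> \<gg>" for Y
      using lie_bracket_scale_left[OF subspace_0[OF subspace_lie_algebra] that, of 0] by simp
    show "subspace ?I"
      by (rule subspaceI)
         (auto simp: z subspace_0[OF subspace_lie_algebra] subspace_add[OF subspace_lie_algebra]
            subspace_scale[OF subspace_lie_algebra] lie_bracket_add_left lie_bracket_scale_left)
    fix X Y assume X: "X \<in> \<gg>" and Y: "Y \<in> ?I"
    have "lie_bracket X Y = 0" using lie_bracket_skew[of X Y] X Y by simp
    then show "lie_bracket X Y \<in> ?I" using z subspace_0[OF subspace_lie_algebra] by simp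
  qed auto
  then obtain Y where Y: "Y \<in> \<gg>" "lie_bracket X Y \<noteq> 0" using X by blast
  obtain B where B: "independent B" "finite B" "span B = \<gg>" using lie_finite_basis by blast
  have skew: "Q (lie_bracket X U) W = - Q U (lie_bracket X W)" if "U \<in> \<gg>" "W \<in> \<gg>" for U W
    by (rule adj_skew[OF Q inv[rule_format] that X(1)])
  have "trace_on \<gg> (\<lambda>U. lie_bracket X (lie_bracket X U)) < 0"
  proof (rule trace_skew_square_neg[where L = "lie_bracket X" and x = Y])
    show "inner_on \<gg> Q" "finite B" "span B = \<gg>" "Y \<in> \<gg>" "lie_bracket X Y \<noteq> 0"
      by (fact Q B Y)+
    show "endo_on \<gg> (lie_bracket X)" by (rule endo_on_ad[OF X(1)])
  qed (rule skew)
  then show ?thesis by (simp only: killing_form_def)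
qed

lemma killing_nondegenerate:
  assumes "compact_space T" "semisimple_lie_group G CG" "X \<in> \<gg>" "\<And>Y. Y \<in> \<gg> \<Longrightarrow> \<kappa> X Y = 0"
  shows "X = 0"
  using killing_negative_definite[OF assms(1-3)] assms(4)[OF assms(3)] by force

subsection \<open>Inner automorphisms with trivial differential\<close>

text \<open>The commutator map with \<open>z\<close> has zero derivative everywhere when Ad z is
  trivial. Composed with any smooth function it is therefore constant on the connected group, and
  smooth functions separate points.\<close>

lemma central_if_adj_trivial:
  assumes conn: "connected_space T" and z: "z \<in> carrier G" and triv: "\<And>X. X \<in> \<gg> \<Longrightarrow> adj z X = X"
    and x: "x \<in> carrier G"
  shows "z \<otimes> x \<otimes> inv z = x"
proof -
  define \<psi> where "\<psi> x = z \<otimes> x \<otimes> inv z \<otimes> inv x" for x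
  have \<psi>_in: "\<psi> x \<in> carrier G" if "x \<in> carrier G" for x using z that by (simp add: \<psi>_def)
  have sm: "smooth_map T A T A \<psi>"
    unfolding \<psi>_def by (intro smooth_rules z) (use z in simp)
  have const: "f (\<psi> x) = f \<one>" if f: "f \<in> CG" for f
  proof -
    have h: "res (\<lambda>x. f (\<psi> x)) \<in> CG" by (rule res_pullback[OF f sm])
    have "res (\<lambda>x. f (\<psi> x)) x = res (\<lambda>x. f (\<psi> x)) \<one>"
    proof (rule M.locally_constant[OF conn h])
      fix y v assume "y \<in> topspace T" and v: "v \<in> tangent_space CG y"
      then have y: "y \<in> carrier G" by simp
      obtain X where X: "X \<in> \<gg>" "X y = v" using lie_algebra_transitive[OF v y] by blast
      note u = lie_tangent[OF X(1) one_closed]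
      \<comment> \<open>All factors that depend only on the base point \<open>y\<close> are absorbed
        into \<open>?k\<close>. What varies with \<open>w\<close> is z w inv z inv w, whose
        derivative at \<open>\<one>\<close> is that of a conjugation minus that of the
        identity.\<close>
      let ?k = "res (\<lambda>v. f (z \<otimes> y \<otimes> inv z \<otimes> v \<otimes> inv y))"
      have k: "?k \<in> CG" using z y by (intro res_pullback[OF f] smooth_rules) simp_all
      let ?F = "ext0 (carrier G \<times> carrier G) (\<lambda>p. ?k ((z \<otimes> fst p \<otimes> inv z) \<otimes> inv (snd p)))"
      have F: "?F \<in> CN" using z by (intro res_pullback_N[OF k] smooth_rules) simp_all
      have "v (res (\<lambda>x. f (\<psi> x))) = X \<one> (res (\<lambda>w. res (\<lambda>x. f (\<psi> x)) (y \<otimes> w)))"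
        using lie_at[OF X(1) y h] X(2) by simp
      also have "res (\<lambda>w. res (\<lambda>x. f (\<psi> x)) (y \<otimes> w)) = res (\<lambda>w. ?F (w, w))"
      proof (rule ext0_cong)
        fix w assume w: "w \<in> carrier G"
        have "\<psi> (y \<otimes> w) = z \<otimes> y \<otimes> inv z \<otimes> ((z \<otimes> w \<otimes> inv z) \<otimes> inv w) \<otimes> inv y"
        proof -
          have "inv z \<otimes> (z \<otimes> (w \<otimes> (inv z \<otimes> (inv w \<otimes> inv y)))) = w \<otimes> (inv z \<otimes> (inv w \<otimes> inv y))"
            using z y w by (simp add: m_assoc[symmetric])
          then show ?thesis using z y w by (simp add: \<psi>_def m_assoc inv_mult_group)
        qed
        then show "res (\<lambda>x. f (\<psi> x)) (y \<otimes> w) = ?F (w, w)" using z y w by simp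
      qed
      also have "X \<one> \<dots> = X \<one> (\<lambda>w. ?F (w, \<one>)) + X \<one> (\<lambda>w. ?F (\<one>, w))"
        by (rule diagonal_rule(2)[OF F one_closed u])
      also have "(\<lambda>w. ?F (w, \<one>)) = res (\<lambda>w. ?k (inv (inv z) \<otimes> w \<otimes> inv z))"
        using z by (auto simp: ext0_def)
      also have "X \<one> \<dots> = adj (inv z) X \<one> ?k"
        using adj_at_one[OF X(1) _ k, of "inv z"] z by simp
      also have "adj (inv z) X = X" using adj_inverse(2)[OF X(1) z] triv[OF X(1)] by simp
      also have "(\<lambda>w. ?F (\<one>, w)) = res (\<lambda>w. ?k (inv w))"
        using z by (auto simp: ext0_def)
      also have "X \<one> \<dots> = - X \<one> ?k" by (rule inverse_rule[OF k u])
      finally show "v (res (\<lambda>x. f (\<psi> x))) = 0" by simp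
    qed (use x in simp_all)
    then show ?thesis using x z by (simp add: \<psi>_def)
  qed
  have "\<psi> x = \<one>"
  proof (rule ccontr)
    assume "\<psi> x \<noteq> \<one>"
    then obtain W where W: "openin T W" "\<one> \<in> W" "\<psi> x \<notin> W"
      using M.hausdorff \<psi>_in[OF x] unfolding Hausdorff_space_def
      by (metis disjnt_iff one_closed topspace_T)
    have "\<exists>\<beta>\<in>CG. \<beta> \<one> = 1 \<and> \<beta> (\<psi> x) = 0"
      by (rule M.exists_smooth_bump[OF W(1,2)]) (use W(3) in blast)
    then show False using const by (metis zero_neq_one)
  qed
  then have "z \<otimes> x \<otimes> inv z \<otimes> inv x \<otimes> x = x" using x by (simp add: \<psi>_def)
  then show ?thesis using x z by (simp add: m_assoc)
qed

end

section \<open>The orbit of \<open>(1, z)\<close> in \<open>G \<times> G\<close>\<close>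

locale involution_orbit = lie_grp G T A
  for G :: "('g, 'm) monoid_scheme" (structure) and T :: "'g topology"
    and A :: "('g, 'e::euclidean_space) atlas" +
  fixes z :: 'g
  assumes z [simp]: "z \<in> carrier G"
    and involutive: "a \<in> carrier G \<Longrightarrow> z \<otimes> (z \<otimes> a \<otimes> inv z) \<otimes> inv z = a"
begin

abbreviation "N \<equiv> carrier G \<times> carrier G"
abbreviation "M \<equiv> orbit (G \<times>\<times> G) (two_sided_action G) (\<one>, z)"
abbreviation "CM \<equiv> submanifold_functions TN CN M"
abbreviation "p\<^sub>0 \<equiv> (\<one>, z)"

lemma zz_central: "a \<in> carrier G \<Longrightarrow> z \<otimes> z \<otimes> a = a \<otimes> (z \<otimes> z)"
proof -
  assume a: "a \<in> carrier G"
  have "z \<otimes> (z \<otimes> a \<otimes> inv z) \<otimes> inv z \<otimes> (z \<otimes> z) = z \<otimes> z \<otimes> a"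
  proof -
    have "z \<otimes> (z \<otimes> a \<otimes> inv z) \<otimes> inv z \<otimes> (z \<otimes> z) = z \<otimes> (z \<otimes> (a \<otimes> (inv z \<otimes> (inv z \<otimes> (z \<otimes> z)))))"
      using a by (simp add: m_assoc)
    also have "inv z \<otimes> (inv z \<otimes> (z \<otimes> z)) = \<one>" by (simp add: m_assoc[symmetric])
    finally show ?thesis using a by (simp add: m_assoc)
  qed
  then show ?thesis using involutive[OF a] by simp
qed

lemma orbit_iff: "q \<in> M \<longleftrightarrow> (\<exists>g\<in>carrier G. \<exists>h\<in>carrier G. q = (g \<otimes> inv h, g \<otimes> z \<otimes> inv h))"
proof -
  have "q \<in> M \<longleftrightarrow> (\<exists>p\<in>carrier G \<times> carrier G. q = two_sided_action G p (\<one>, z))"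
    by (auto simp: orbit_def)
  also have "\<dots> \<longleftrightarrow> (\<exists>g\<in>carrier G. \<exists>h\<in>carrier G. q = (g \<otimes> inv h, g \<otimes> z \<otimes> inv h))"
    by (auto simp: two_sided_action_def)
  finally show ?thesis .
qed

lemma orbit_subset: "q \<in> M \<Longrightarrow> fst q \<in> carrier G" "q \<in> M \<Longrightarrow> snd q \<in> carrier G"
  by (auto simp: orbit_iff)

lemma orbit_subset': "q \<in> M \<Longrightarrow> q \<in> N"
  using orbit_subset by (cases q) auto

lemma base_in_orbit: "p\<^sub>0 \<in> M"
  unfolding orbit_iff by (rule bexI[of _ \<one>], rule bexI[of _ \<one>]) simp_all

lemma orbit_left: "q \<in> M \<Longrightarrow> w \<in> carrier G \<Longrightarrow> (w \<otimes> fst q, w \<otimes> snd q) \<in> M"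
proof -
  assume q: "q \<in> M" and w: "w \<in> carrier G"
  then obtain g h where gh: "g \<in> carrier G" "h \<in> carrier G" "q = (g \<otimes> inv h, g \<otimes> z \<otimes> inv h)"
    unfolding orbit_iff by blast
  have "(w \<otimes> fst q, w \<otimes> snd q) = (w \<otimes> g \<otimes> inv h, w \<otimes> g \<otimes> z \<otimes> inv h)"
    using gh w by (simp add: m_assoc)
  then show ?thesis using gh w unfolding orbit_iff by blast
qed

lemma orbit_right: "q \<in> M \<Longrightarrow> w \<in> carrier G \<Longrightarrow> (fst q \<otimes> w, snd q \<otimes> w) \<in> M"
proof -
  assume q: "q \<in> M" and w: "w \<in> carrier G"
  then obtain g h where gh: "g \<in> carrier G" "h \<in> carrier G" "q = (g \<otimes> inv h, g \<otimes> z \<otimes> inv h)"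
    unfolding orbit_iff by blast
  have "(fst q \<otimes> w, snd q \<otimes> w) = (g \<otimes> inv (inv w \<otimes> h), g \<otimes> z \<otimes> inv (inv w \<otimes> h))"
    using gh w by (simp add: m_assoc inv_mult_group)
  moreover have "inv w \<otimes> h \<in> carrier G" using gh w by simp
  ultimately show ?thesis using gh(1) unfolding orbit_iff by blast
qed

text \<open>The quotient of the two components of a point of \<open>M\<close> is a conjugate of
  \<open>z\<close>, so its square is a conjugate of a central element.\<close>

lemma orbit_square:
  assumes "q \<in> M"
  shows "(snd q \<otimes> inv (fst q)) \<otimes> (snd q \<otimes> inv (fst q)) = z \<otimes> z"
proof -
  obtain g h where gh: "g \<in> carrier G" "h \<in> carrier G" "q = (g \<otimes> inv h, g \<otimes> z \<otimes> inv h)"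
    using assms unfolding orbit_iff by blast
  have "inv h \<otimes> (h \<otimes> inv g) = inv g" using gh by (simp add: m_assoc[symmetric])
  then have "snd q \<otimes> inv (fst q) = g \<otimes> z \<otimes> inv g"
    using gh by (simp add: m_assoc inv_mult_group)
  moreover have "inv g \<otimes> (g \<otimes> (z \<otimes> inv g)) = z \<otimes> inv g" using gh by (simp add: m_assoc[symmetric])
  then have "g \<otimes> z \<otimes> inv g \<otimes> (g \<otimes> z \<otimes> inv g) = g \<otimes> (z \<otimes> z) \<otimes> inv g"
    using gh by (simp add: m_assoc)
  moreover have "\<dots> = z \<otimes> z" 
    unfolding zz_central[OF gh(1), symmetric] using gh(1) by (simp add: m_assoc)
  ultimately show ?thesis by simp
qed

subsection \<open>Smooth functions and tangent vectors on the orbit\<close>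

lemma CM_outside: "f \<in> CM \<Longrightarrow> q \<notin> M \<Longrightarrow> f q = 0"
  unfolding submanifold_functions_def by blast

lemma CM_local: "f \<in> CM \<Longrightarrow> q \<in> M \<Longrightarrow> \<exists>U F. openin TN U \<and> q \<in> U \<and> F \<in> CN \<and> (\<forall>p\<in>U \<inter> M. f p = F p)"
  by (simp add: submanifold_functions_def)

lemma CM_I:
  assumes "\<And>q. q \<notin> M \<Longrightarrow> f q = 0"
    and "\<And>q. q \<in> M \<Longrightarrow> \<exists>U F. openin TN U \<and> q \<in> U \<and> F \<in> CN \<and> (\<forall>p\<in>U \<inter> M. f p = F p)"
  shows "f \<in> CM"
  using assms by (simp add: submanifold_functions_def)

lemma CM_restrict: "F \<in> CN \<Longrightarrow> ext0 M F \<in> CM"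
proof (rule CM_I)
  fix q assume F: "F \<in> CN" and q: "q \<in> M"
  have "openin TN N" using openin_topspace[of TN] by simp
  then show "\<exists>U K. openin TN U \<and> q \<in> U \<and> K \<in> CN \<and> (\<forall>p\<in>U \<inter> M. ext0 M F p = K p)"
    using F orbit_subset'[OF q] by (intro exI[of _ N] exI[of _ F]) simp
qed simp

lemma CM_const: "ext0 M (\<lambda>q. c) \<in> CM"
proof -
  have "ext0 M (\<lambda>q. if q \<in> topspace TN then c else 0) = ext0 M (\<lambda>q. c)"
    by (rule ext0_cong) (use orbit_subset in force)
  then show ?thesis using CM_restrict[OF P.smooth_functions_const[of c]] by simp
qed

lemma CM_binary:
  assumes "f \<in> CM" "h \<in> CM" and op: "\<And>F K. F \<in> CN \<Longrightarrow> K \<in> CN \<Longrightarrow> (\<lambda>x. op (F x) (K x)) \<in> CN" and "op 0 0 = 0"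
  shows "(\<lambda>x. op (f x) (h x)) \<in> CM"
proof (rule CM_I)
  show "op (f q) (h q) = 0" if "q \<notin> M" for q
    by (simp add: CM_outside[OF assms(1) that] CM_outside[OF assms(2) that] assms(4))
  fix q assume q: "q \<in> M"
  obtain U F where U: "openin TN U" "q \<in> U" "F \<in> CN" "\<forall>p\<in>U \<inter> M. f p = F p"
    using CM_local[OF assms(1) q] by blast
  obtain V K where V: "openin TN V" "q \<in> V" "K \<in> CN" "\<forall>p\<in>V \<inter> M. h p = K p"
    using CM_local[OF assms(2) q] by blast
  show "\<exists>U F. openin TN U \<and> q \<in> U \<and> F \<in> CN \<and> (\<forall>p\<in>U \<inter> M. op (f p) (h p) = F p)"
    using U V op[OF U(3) V(3)] by (intro exI[of _ "U \<inter> V"] exI[of _ "\<lambda>x. op (F x) (K x)"]) auto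
qed

lemma CM_mult: "f \<in> CM \<Longrightarrow> h \<in> CM \<Longrightarrow> (\<lambda>x. f x * h x) \<in> CM"
  by (rule CM_binary[where op = "(*)"]) (auto intro: P.smooth_functions_mult)

lemma CM_lincomb: "f \<in> CM \<Longrightarrow> h \<in> CM \<Longrightarrow> (\<lambda>x. a * f x + b * h x) \<in> CM"
  by (rule CM_binary[where op = "\<lambda>x y. a * x + b * y"])
     (auto intro: P.smooth_functions_add P.smooth_functions_scale)

lemma CM_pullback:
  assumes "smooth_atlas T' A'" "smooth_map T' A' TN AN K" "f \<in> CM" "\<And>x. x \<in> topspace T' \<Longrightarrow> K x \<in> M"
  shows "ext0 (topspace T') (\<lambda>x. f (K x)) \<in> smooth_functions T' A'"
proof -
  interpret D: smooth_atlas T' A' by fact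
  show ?thesis
  proof (rule D.smooth_functions_eq_localI)
    fix x assume x: "x \<in> topspace T'"
    obtain U F where U: "openin TN U" "K x \<in> U" "F \<in> CN" "\<forall>p\<in>U \<inter> M. f p = F p"
      using CM_local[OF assms(3) assms(4)[OF x]] by blast
    have "openin T' {y \<in> topspace T'. K y \<in> U}"
      using openin_continuous_map_preimage[OF smooth_map_continuous[OF assms(2)] U(1)] .
    moreover have "ext0 (topspace T') (\<lambda>x. F (K x)) \<in> D.C"
      using smooth_map_pullback_function[OF assms(1) atlasN assms(2) U(3)] by (simp add: ext0_def)
    ultimately show "\<exists>W F. openin T' W \<and> x \<in> W \<and> F \<in> D.C \<and> (\<forall>y\<in>W. ext0 (topspace T') (\<lambda>x. f (K x)) y = F y)"
      using U x assms(4)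
      by (intro exI[of _ "{y \<in> topspace T'. K y \<in> U}"] exI[of _ "ext0 (topspace T') (\<lambda>x. F (K x))"]) auto
  qed simp
qed

lemma tangent_CM_const:
  assumes v: "v \<in> tangent_space CM q" and q: "q \<in> M"
  shows "v (ext0 M (\<lambda>q. c)) = 0"
proof -
  have "ext0 M (\<lambda>q. 1) = (\<lambda>x. ext0 M (\<lambda>q. 1) x * ext0 M (\<lambda>q. 1) x)" by (auto simp: ext0_def)
  then have "v (ext0 M (\<lambda>q. 1)) = v (ext0 M (\<lambda>q. 1)) + v (ext0 M (\<lambda>q. 1))"
    using tangent_mult[OF v CM_const[of 1] CM_const[of 1]] q by simp
  moreover have "ext0 M (\<lambda>q. c) = (\<lambda>x. c * ext0 M (\<lambda>q. 1) x)" by (auto simp: ext0_def)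
  ultimately show ?thesis using tangent_scale[OF v CM_const[of 1], of c] by simp
qed

lemma tangent_inclusion:
  assumes v: "v \<in> tangent_space CM q" and q: "q \<in> M"
  shows "tangent_map M CN (\<lambda>x. x) v \<in> tangent_space CN q"
proof -
  have e: "ext0 M (\<lambda>x. a * f x + b * h x) = (\<lambda>x. a * ext0 M f x + b * ext0 M h x)"
    "ext0 M (\<lambda>x. f x * h x) = (\<lambda>x. ext0 M f x * ext0 M h x)" for f h a b
    by (auto simp: ext0_def)
  show ?thesis
    unfolding tangent_space_def mem_Collect_eq tangent_map_ext0
  proof (intro conjI ballI allI impI)
    fix f h a b assume fh: "f \<in> CN" "h \<in> CN"
    have "(\<lambda>x. a * f x + b * h x) \<in> CN"
      by (intro P.smooth_functions_add P.smooth_functions_scale fh)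
    then show "(if (\<lambda>x. a * f x + b * h x) \<in> CN then v (ext0 M (\<lambda>x. a * f x + b * h x)) else 0) =
       a * (if f \<in> CN then v (ext0 M (\<lambda>x. f x)) else 0) + b * (if h \<in> CN then v (ext0 M (\<lambda>x. h x)) else 0)"
      using fh by (simp add: e(1) tangent_lincomb[OF v CM_restrict[OF fh(1)] CM_restrict[OF fh(2)]])
  next
    fix f h assume fh: "f \<in> CN" "h \<in> CN"
    then show "(if (\<lambda>x. f x * h x) \<in> CN then v (ext0 M (\<lambda>x. f x * h x)) else 0) =
       (if f \<in> CN then v (ext0 M (\<lambda>x. f x)) else 0) * h q + f q * (if h \<in> CN then v (ext0 M (\<lambda>x. h x)) else 0)"
      using q P.smooth_functions_mult[OF fh]
      by (simp add: e(2) tangent_mult[OF v CM_restrict[OF fh(1)] CM_restrict[OF fh(2)]])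
  qed simp
qed

text \<open>The inclusion carries a tangent vector of \<open>M\<close> into the product, and a
  projection carries it on to a factor. The two resulting components are all that
  \<open>gbar\<close> and \<open>Hbar\<close> see of the vector.\<close>

definition push :: "('g \<times> 'g \<Rightarrow> 'g) \<Rightarrow> ('g \<times> 'g) tvec \<Rightarrow> 'g tvec" where
  "push \<pi> v = tangent_map N CG \<pi> (tangent_map M CN (\<lambda>x. x) v)"

lemma push_in:
  assumes v: "v \<in> tangent_space CM q" and q: "q \<in> M"
  shows "push fst v \<in> tangent_space CG (fst q)" "push snd v \<in> tangent_space CG (snd q)"
  using tangent_map_in[OF atlasN atlasG smooth_fstN _ tangent_inclusion[OF assms]]
    tangent_map_in[OF atlasN atlasG smooth_sndN _ tangent_inclusion[OF assms]] orbit_subset'[OF q]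
  by (simp_all add: push_def)

lemma push_apply:
  assumes f: "f \<in> CG" and \<pi>: "smooth_map TN AN T A \<pi>"
  shows "push \<pi> v f = v (ext0 M (\<lambda>q. f (\<pi> q)))"
proof -
  have "ext0 M (ext0 N (\<lambda>q. f (\<pi> q))) = ext0 M (\<lambda>q. f (\<pi> q))"
    by (rule ext0_cong) (use orbit_subset' in force)
  then show ?thesis
    using f res_pullback_N[OF f \<pi>] by (simp add: push_def tangent_map_ext0)
qed

lemma push_outside: "f \<notin> CG \<Longrightarrow> push \<pi> v f = 0"
  by (simp add: push_def tangent_map_def)

lemma push_add: "push \<pi> (u + v) = push \<pi> u + push \<pi> v"
  by (rule ext) (simp add: push_def tangent_map_def)

text \<open>The components of a tangent vector of \<open>M\<close> in the left trivialisation.\<close>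
definition triv :: "('g \<times> 'g \<Rightarrow> 'g) \<Rightarrow> 'g \<times> 'g \<Rightarrow> ('g \<times> 'g) tvec \<Rightarrow> 'g vfield" where
  "triv \<pi> q v = left_invariant_extension G CG (\<pi> q) (push \<pi> v)"

lemma triv_in:
  assumes "v \<in> tangent_space CM q" "q \<in> M"
  shows "triv fst q v \<in> \<gg>" "triv snd q v \<in> \<gg>"
    "triv fst q v (fst q) = push fst v" "triv snd q v (snd q) = push snd v"
  using left_invariant_extension_in push_in[OF assms] orbit_subset[OF assms(2)] by (simp_all add: triv_def)

lemma triv_eqI:
  assumes "X \<in> \<gg>" "\<pi> q \<in> carrier G" "push \<pi> v = X (\<pi> q)"
  shows "triv \<pi> q v = X"
  using left_invariant_extension_eq[OF assms(1,2)] assms(3) by (simp add: triv_def)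

lemma triv_add:
  assumes u: "u \<in> tangent_space CM q" and v: "v \<in> tangent_space CM q" and q: "q \<in> M"
  shows "triv fst q (u + v) = triv fst q u + triv fst q v" "triv snd q (u + v) = triv snd q u + triv snd q v"
  by (rule triv_eqI; simp add: triv_in[OF u q] triv_in[OF v q] push_add orbit_subset[OF q]
      subspace_add[OF subspace_lie_algebra])+

text \<open>The squared quotient of the components is constant on \<open>M\<close>, so
  \<open>v\<close> annihilates every function of it; the two partial derivatives yield the two
  sides. The equation serves to exclude tangent directions (U, -U) with nonzero U fixed by
  \<open>adj z\<close>.\<close>

lemma tangency:
  assumes v: "v \<in> tangent_space CM p\<^sub>0"
  defines "U \<equiv> triv fst p\<^sub>0 v" and "V \<equiv> triv snd p\<^sub>0 v"
  shows "V + adj z V = U + adj z U"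
proof (rule lie_eqI)
  note q = base_in_orbit
  have U: "U \<in> \<gg>" "U \<one> = push fst v" and V: "V \<in> \<gg>" "V z = push snd v"
    using triv_in[OF v q] by (simp_all add: U_def V_def)
  show "V + adj z V \<in> \<gg>" "U + adj z U \<in> \<gg>"
    by (intro subspace_add[OF subspace_lie_algebra] adj_in U V z)+
  fix k assume k: "k \<in> CG"
  \<comment> \<open>Translating by the inverse of \<open>z \<otimes> z\<close> moves the constant
    value to \<open>\<one>\<close>. The function \<open>?m\<close> then sends w to k (inv z w z w),
    and its derivative along W is \<open>adj z W + W\<close>.\<close>
  let ?f = "res (\<lambda>v. k (inv (z \<otimes> z) \<otimes> v))"
  have f: "?f \<in> CG" by (rule left_translate_in[OF k]) simp
  let ?m = "res (\<lambda>w. ?f ((z \<otimes> w) \<otimes> (z \<otimes> w)))"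
  have m: "?m \<in> CG" by (intro res_pullback[OF f] smooth_rules z)
  have D: "W \<one> ?m = adj z W \<one> k + W \<one> k" if W: "W \<in> \<gg>" for W
  proof -
    let ?F = "ext0 N (\<lambda>p. k ((inv z \<otimes> fst p \<otimes> z) \<otimes> snd p))"
    have F: "?F \<in> CN" by (intro res_pullback_N[OF k] smooth_rules) simp_all
    have "?m = res (\<lambda>w. ?F (w, w))"
    proof (rule ext0_cong)
      fix w assume w: "w \<in> carrier G"
      have "inv (z \<otimes> z) \<otimes> ((z \<otimes> w) \<otimes> (z \<otimes> w)) = (inv z \<otimes> w \<otimes> z) \<otimes> w"
      proof -
        have "inv z \<otimes> (z \<otimes> (w \<otimes> (z \<otimes> w))) = w \<otimes> (z \<otimes> w)" using w by (simp add: m_assoc[symmetric])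
        then show ?thesis using w by (simp add: m_assoc inv_mult_group)
      qed
      then show "?f ((z \<otimes> w) \<otimes> (z \<otimes> w)) = ?F (w, w)" using w by simp
    qed
    moreover have "(\<lambda>w. ?F (w, \<one>)) = res (\<lambda>w. k (inv z \<otimes> w \<otimes> z))" by (auto simp: ext0_def)
    moreover have "(\<lambda>w. ?F (\<one>, w)) = k" by (auto simp: ext0_def CG_outside[OF k])
    ultimately show ?thesis
      using diagonal_rule(2)[OF F one_closed lie_tangent[OF W one_closed]] adj_at_one[OF W z k] by simp
  qed
  let ?F = "ext0 N (\<lambda>p. ?f ((snd p \<otimes> inv (fst p)) \<otimes> (snd p \<otimes> inv (fst p))))"
  have F: "?F \<in> CN" by (intro res_pullback_N[OF f] smooth_rules)
  let ?u = "tangent_map M CN (\<lambda>x. x) v"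
  have u: "?u \<in> tangent_space CN p\<^sub>0" by (rule tangent_inclusion[OF v q])
  have "ext0 M ?F = ext0 M (\<lambda>q. ?f (z \<otimes> z))"
    by (rule ext0_cong) (use orbit_square orbit_subset' in auto)
  then have "?u ?F = 0"
    using tangent_CM_const[OF v q] F by (simp add: tangent_map_ext0)
  then have "0 = push fst v (\<lambda>x. ?F (x, z)) + push snd v (\<lambda>y. ?F (\<one>, y))"
    using tangent_product_rule[OF F _ _ u] by (simp add: push_def)
  also have "(\<lambda>x. ?F (x, z)) = res (\<lambda>x. ?m (inv x))" by (auto simp: ext0_def)
  also have "push fst v \<dots> = - U \<one> ?m"
    using inverse_rule[OF m lie_tangent[OF U(1) one_closed]] U(2) by simp
  also have "(\<lambda>y. ?F (\<one>, y)) = res (\<lambda>y. ?f (y \<otimes> y))" by (auto simp: ext0_def)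
  also have "push snd v \<dots> = V \<one> ?m"
  proof -
    have c: "res (\<lambda>y. ?f (y \<otimes> y)) \<in> CG" by (intro res_pullback[OF f] smooth_rules)
    have "res (\<lambda>w. res (\<lambda>y. ?f (y \<otimes> y)) (z \<otimes> w)) = ?m" by (rule ext0_cong) simp
    then show ?thesis using lie_at[OF V(1) z c] V(2) by simp
  qed
  finally show "(V + adj z V) \<one> k = (U + adj z U) \<one> k"
    using D[OF U(1)] D[OF V(1)] by simp
qed

subsection \<open>Fundamental vector fields\<close>

text \<open>The action is a parameter so that left and right translations are treated together.
  Differentiating in the group variable produces tangent vectors of \<open>M\<close> without any
  description of its tangent spaces.\<close>

definition fundamental :: "('g \<Rightarrow> 'g \<times> 'g \<Rightarrow> 'g \<times> 'g) \<Rightarrow> 'g vfield \<Rightarrow> ('g \<times> 'g) vfield" where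
  "fundamental \<mu> Y q = (\<lambda>f. if q \<in> M \<and> f \<in> CM then Y \<one> (res (\<lambda>w. f (\<mu> w q))) else 0)"

definition act_left :: "'g \<Rightarrow> 'g \<times> 'g \<Rightarrow> 'g \<times> 'g" where
  "act_left w q = (w \<otimes> fst q, w \<otimes> snd q)"

definition act_right :: "'g \<Rightarrow> 'g \<times> 'g \<Rightarrow> 'g \<times> 'g" where
  "act_right w q = (fst q \<otimes> w, snd q \<otimes> w)"

definition action :: "('g \<Rightarrow> 'g \<times> 'g \<Rightarrow> 'g \<times> 'g) \<Rightarrow> bool" where
  "action \<mu> \<longleftrightarrow> smooth_map (prod_topology T TN) (prod_atlas A AN) TN AN (\<lambda>p. \<mu> (fst p) (snd p)) \<and>
     (\<forall>w\<in>carrier G. \<forall>q\<in>M. \<mu> w q \<in> M) \<and> (\<forall>q\<in>M. \<mu> \<one> q = q)"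

lemma action_left: "action act_left"
  unfolding action_def act_left_def
proof (intro conjI ballI)
  show "smooth_map (prod_topology T TN) (prod_atlas A AN) TN AN (\<lambda>p. (fst p \<otimes> fst (snd p), fst p \<otimes> snd (snd p)))"
    by (rule smooth_map_Pair[OF atlasGN atlasG atlasG]; intro smooth_rules)
qed (use orbit_left orbit_subset in auto)

lemma action_right: "action act_right"
  unfolding action_def act_right_def
proof (intro conjI ballI)
  show "smooth_map (prod_topology T TN) (prod_atlas A AN) TN AN (\<lambda>p. (fst (snd p) \<otimes> fst p, snd (snd p) \<otimes> fst p))"
    by (rule smooth_map_Pair[OF atlasGN atlasG atlasG]; intro smooth_rules)
qed (use orbit_right orbit_subset in auto)

lemma action_curve:
  assumes \<mu>: "action \<mu>" and f: "f \<in> CM" and q: "q \<in> M"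
  shows "res (\<lambda>w. f (\<mu> w q)) \<in> CG"
proof -
  have "smooth_map T A (prod_topology T TN) (prod_atlas A AN) (\<lambda>w. (w, q))"
    by (rule smooth_map_Pair[OF atlasG atlasG atlasN smooth_idG smooth_map_const[OF atlasG atlasN]])
       (use orbit_subset'[OF q] in simp)
  from smooth_map_compose[OF atlasG atlasGN atlasN this] \<mu>
  have "smooth_map T A TN AN (\<lambda>w. \<mu> w q)" by (fastforce simp: action_def)
  from CM_pullback[OF atlasG this f] \<mu> q show ?thesis by (simp add: action_def)
qed

lemma fundamental_apply: "q \<in> M \<Longrightarrow> f \<in> CM \<Longrightarrow> fundamental \<mu> Y q f = Y \<one> (res (\<lambda>w. f (\<mu> w q)))"
  by (simp add: fundamental_def)

lemma fundamental_vector_field: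
  assumes \<mu>: "action \<mu>" and Y: "Y \<in> \<gg>"
  shows "fundamental \<mu> Y \<in> vector_fields M CM"
  unfolding vector_fields_def mem_Collect_eq
proof (intro conjI ballI allI impI)
  note v = lie_tangent[OF Y one_closed]
  show "fundamental \<mu> Y q = 0" if "q \<notin> M" for q
    using that by (simp add: fundamental_def fun_eq_iff)
  show "fundamental \<mu> Y q \<in> tangent_space CM q" if q: "q \<in> M" for q
    unfolding tangent_space_def mem_Collect_eq
  proof (intro conjI ballI allI impI)
    fix f h a b assume fh: "f \<in> CM" "h \<in> CM"
    have "res (\<lambda>w. a * f (\<mu> w q) + b * h (\<mu> w q)) =
        (\<lambda>w. a * res (\<lambda>w. f (\<mu> w q)) w + b * res (\<lambda>w. h (\<mu> w q)) w)" by (auto simp: ext0_def)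
    then show "fundamental \<mu> Y q (\<lambda>x. a * f x + b * h x) = a * fundamental \<mu> Y q f + b * fundamental \<mu> Y q h"
      using tangent_lincomb[OF v action_curve[OF \<mu> fh(1) q] action_curve[OF \<mu> fh(2) q], of a b]
        fh CM_lincomb[OF fh] q by (simp add: fundamental_apply)
  next
    fix f h assume fh: "f \<in> CM" "h \<in> CM"
    have "res (\<lambda>w. f (\<mu> w q) * h (\<mu> w q)) =
        (\<lambda>w. res (\<lambda>w. f (\<mu> w q)) w * res (\<lambda>w. h (\<mu> w q)) w)" by (auto simp: ext0_def)
    then show "fundamental \<mu> Y q (\<lambda>x. f x * h x) = fundamental \<mu> Y q f * h q + f q * fundamental \<mu> Y q h"
      using tangent_mult[OF v action_curve[OF \<mu> fh(1) q] action_curve[OF \<mu> fh(2) q]]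
        fh CM_mult[OF fh] q \<mu> by (simp add: fundamental_apply action_def)
  qed (simp add: fundamental_def)
  fix f assume f: "f \<in> CM"
  show "(\<lambda>q. fundamental \<mu> Y q f) \<in> CM"
  proof (rule CM_I)
    show "fundamental \<mu> Y q f = 0" if "q \<notin> M" for q using that by (simp add: fundamental_def)
    fix p assume p: "p \<in> M"
    obtain U0 F0 where U0: "openin TN U0" "p \<in> U0" "F0 \<in> CN" "\<forall>p\<in>U0 \<inter> M. f p = F0 p"
      using CM_local[OF f p] by blast
    interpret GN: smooth_atlas_pair T A TN AN
      by (rule smooth_atlas_pair.intro[OF atlasG atlasN])
    have sm: "smooth_map (prod_topology T TN) (prod_atlas A AN) TN AN (\<lambda>p. \<mu> (fst p) (snd p))"
      using \<mu> by (simp add: action_def)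
    let ?\<Phi> = "ext0 (carrier G \<times> N) (\<lambda>p. F0 (\<mu> (fst p) (snd p)))"
    have \<Phi>: "?\<Phi> \<in> GN.P.C"
      using smooth_map_pullback_function[OF atlasGN atlasN sm U0(3)] by (simp add: ext0_def)
    have F: "(\<lambda>q. Y \<one> (\<lambda>w. ?\<Phi> (w, q))) \<in> CN"
      by (rule GN.tangent_parameter_fst[OF \<Phi> v]) simp
    \<comment> \<open>\<open>f\<close> has a smooth extension only near \<open>p\<close>, and
      \<open>R\<close> collects the pairs that are moved into that region. A product neighbourhood
      inside \<open>R\<close> yields one extension valid for all base points near \<open>p\<close>,
      since \<open>tangent_local\<close> ignores group elements away from
      \<open>\<one>\<close>.\<close>
    define R where "R = {p \<in> topspace (prod_topology T TN). \<mu> (fst p) (snd p) \<in> U0}"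
    have R: "openin (prod_topology T TN) R"
      unfolding R_def using openin_continuous_map_preimage[OF smooth_map_continuous[OF sm] U0(1)] .
    have "(\<one>, p) \<in> R" using p orbit_subset'[OF p] U0(2) \<mu> by (simp add: action_def R_def)
    with R obtain W U where W: "openin T W" "openin TN U" "\<one> \<in> W" "p \<in> U" "W \<times> U \<subseteq> R"
      by (metis openin_prod_topology_alt)
    have "fundamental \<mu> Y q f = Y \<one> (\<lambda>w. ?\<Phi> (w, q))" if q: "q \<in> U \<inter> M" for q
    proof -
      have qM: "q \<in> M" using q by simp
      have "Y \<one> (res (\<lambda>w. f (\<mu> w q))) = Y \<one> (\<lambda>w. ?\<Phi> (w, q))"
      proof (rule M.tangent_local[OF v W(1,3) action_curve[OF \<mu> f qM] GN.slice_fst[OF \<Phi>]])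
        fix w assume w: "w \<in> W"
        then have "(w, q) \<in> R" using W(5) q by blast
        then have "w \<in> carrier G" "\<mu> w q \<in> U0" by (simp_all add: R_def)
        moreover have "\<mu> w q \<in> M" using \<mu> qM \<open>w \<in> carrier G\<close> by (simp add: action_def)
        ultimately show "res (\<lambda>w. f (\<mu> w q)) w = ?\<Phi> (w, q)"
          using U0(4) orbit_subset'[OF qM] by simp
      qed
      then show ?thesis using fundamental_apply[OF qM f] by simp
    qed
    then show "\<exists>U F. openin TN U \<and> p \<in> U \<and> F \<in> CN \<and> (\<forall>q\<in>U \<inter> M. fundamental \<mu> Y q f = F q)"
      using W(2,4) F by blast
  qed
qed

text \<open>
  Right translations generate the fields that are left-invariant in both factors, and left
  translations those that are right-invariant; hence the names.
\<close>
abbreviation "LL \<equiv> fundamental act_right"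
abbreviation "RR \<equiv> fundamental act_left"

lemmas LL_field = fundamental_vector_field[OF action_right]
lemmas RR_field = fundamental_vector_field[OF action_left]

lemma push_fundamental:
  assumes "action \<mu>" "q \<in> M" "f \<in> CG" "smooth_map TN AN T A \<pi>"
  shows "push \<pi> (fundamental \<mu> Y q) f = Y \<one> (res (\<lambda>w. f (\<pi> (\<mu> w q))))"
proof -
  have "ext0 M (ext0 N (\<lambda>q. f (\<pi> q))) = ext0 M (\<lambda>q. f (\<pi> q))"
    by (rule ext0_cong) (use orbit_subset' in force)
  then have "ext0 M (\<lambda>q. f (\<pi> q)) \<in> CM"
    using CM_restrict[OF res_pullback_N[OF assms(3,4)]] by simp
  moreover have "res (\<lambda>w. ext0 M (\<lambda>q. f (\<pi> q)) (\<mu> w q)) = res (\<lambda>w. f (\<pi> (\<mu> w q)))"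
    by (rule ext0_cong) (use assms(1,2) in \<open>simp add: action_def\<close>)
  ultimately show ?thesis
    using push_apply[OF assms(3,4)] fundamental_apply[OF assms(2)] by simp
qed

lemma triv_LL:
  assumes Y: "Y \<in> \<gg>" and q: "q \<in> M"
  shows "triv fst q (LL Y q) = Y" "triv snd q (LL Y q) = Y"
proof -
  note x = orbit_subset[OF q]
  have "push fst (LL Y q) f = Y (fst q) f" "push snd (LL Y q) f = Y (snd q) f" for f
    using push_fundamental[OF action_right q, of f fst Y] push_fundamental[OF action_right q, of f snd Y]
      smooth_fstN smooth_sndN lie_at[OF Y x(1), of f] lie_at[OF Y x(2), of f] push_outside[of f]
      tangent_outside[OF lie_tangent[OF Y x(1)], of f] tangent_outside[OF lie_tangent[OF Y x(2)], of f]
    by (cases "f \<in> CG"; simp add: act_right_def)+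
  then show "triv fst q (LL Y q) = Y" "triv snd q (LL Y q) = Y"
    by (auto intro!: triv_eqI Y x)
qed

lemma triv_RR:
  assumes X: "X \<in> \<gg>" and q: "q \<in> M"
  shows "triv fst q (RR X q) = adj (fst q) X" "triv snd q (RR X q) = adj (snd q) X"
proof -
  note x = orbit_subset[OF q]
  note a = adj_in[OF X x(1)] adj_in[OF X x(2)]
  have "push fst (RR X q) f = adj (fst q) X (fst q) f" "push snd (RR X q) f = adj (snd q) X (snd q) f" for f
    using push_fundamental[OF action_left q, of f fst X] push_fundamental[OF action_left q, of f snd X]
      smooth_fstN smooth_sndN adj_at_self[OF X x(1), of f] adj_at_self[OF X x(2), of f] push_outside[of f]
      tangent_outside[OF lie_tangent[OF a(1) x(1)], of f] tangent_outside[OF lie_tangent[OF a(2) x(2)], of f]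
    by (cases "f \<in> CG"; simp add: act_left_def)+
  then show "triv fst q (RR X q) = adj (fst q) X" "triv snd q (RR X q) = adj (snd q) X"
    by (auto intro!: triv_eqI a x)
qed

section \<open>Brackets of the fundamental fields\<close>

lemma bracket_outside: "f \<notin> CM \<Longrightarrow> action \<mu> \<Longrightarrow> action \<nu> \<Longrightarrow> X \<in> \<gg> \<Longrightarrow> Y \<in> \<gg> \<Longrightarrow>
   lie_bracket (fundamental \<mu> X) (fundamental \<nu> Y) q f = 0"
proof -
  assume f: "f \<notin> CM" and XY: "X \<in> \<gg>" "Y \<in> \<gg>"
  have "(\<lambda>q. fundamental \<mu> W q f) = (\<lambda>q. 0)" for \<mu> W using f by (simp add: fundamental_def)
  moreover have "fundamental \<mu> W q (\<lambda>q. 0) = 0" if "W \<in> \<gg>" for \<mu> W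
    using M.tangent_0[OF lie_tangent[OF that one_closed]] by (simp add: fundamental_def ext0_def)
  ultimately show ?thesis using XY by (simp add: lie_bracket_apply)
qed

lemma bracket_LL_LL:
  assumes X: "X \<in> \<gg>" and Y: "Y \<in> \<gg>" and q: "q \<in> M"
  shows "lie_bracket (LL X) (LL Y) q = LL (lie_bracket X Y) q"
proof
  fix f
  show "lie_bracket (LL X) (LL Y) q f = LL (lie_bracket X Y) q f"
  proof (cases "f \<in> CM")
    case True
    let ?h = "res (\<lambda>w. f (act_right w q))"
    have h: "?h \<in> CG" by (rule action_curve[OF action_right True q])
    have *: "LL X q (\<lambda>q. LL Y q f) = X \<one> (\<lambda>w. Y w ?h)" if X: "X \<in> \<gg>" and Y: "Y \<in> \<gg>" for X Y
    proof -
      have "res (\<lambda>w. LL Y (act_right w q) f) = (\<lambda>w. Y w ?h)"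
      proof (rule ext0_eqI)
        fix w assume w: "w \<in> carrier G"
        have wq: "act_right w q \<in> M" using orbit_right[OF q w] by (simp add: act_right_def)
        have "res (\<lambda>v. f (act_right v (act_right w q))) = res (\<lambda>v. ?h (w \<otimes> v))"
          by (rule ext0_cong) (use w orbit_subset[OF q] in \<open>simp add: act_right_def m_assoc\<close>)
        then show "LL Y (act_right w q) f = Y w ?h"
          using fundamental_apply[OF wq True, of act_right Y] lie_at[OF Y w h] by simp
      qed (rule lie_outside[OF Y])
      then show ?thesis
        using fundamental_apply[OF q vector_fields_smooth[OF LL_field[OF Y] True], of act_right X] by simp
    qed
    show ?thesis
      using fundamental_apply[OF q True, of act_right "lie_bracket X Y"]
      by (simp add: lie_bracket_apply *[OF X Y] *[OF Y X])
  next
    case False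
    then show ?thesis
      using bracket_outside[OF False action_right action_right X Y] by (simp add: fundamental_def)
  qed
qed

text \<open>Successive left translations put the later factor on the left. Interchanging the two
  derivatives restores the order of a left-invariant bracket, with the roles of \<open>X\<close> and
  \<open>Y\<close> exchanged.\<close>

lemma bracket_RR_RR:
  assumes X: "X \<in> \<gg>" and Y: "Y \<in> \<gg>" and q: "q \<in> M"
  shows "lie_bracket (RR X) (RR Y) q = RR (lie_bracket Y X) q"
proof
  fix f
  show "lie_bracket (RR X) (RR Y) q f = RR (lie_bracket Y X) q f"
  proof (cases "f \<in> CM")
    case True
    let ?h = "res (\<lambda>w. f (act_left w q))"
    have h: "?h \<in> CG" by (rule action_curve[OF action_left True q])
    let ?K = "ext0 N (\<lambda>p. ?h (fst p \<otimes> snd p))"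
    have K: "?K \<in> CN" by (intro res_pullback_N[OF h] smooth_rules)
    have *: "RR X q (\<lambda>q. RR Y q f) = Y \<one> (\<lambda>w. X w ?h)" if X: "X \<in> \<gg>" and Y: "Y \<in> \<gg>" for X Y
    proof -
      note u = lie_tangent[OF X one_closed] and v = lie_tangent[OF Y one_closed]
      have "res (\<lambda>w. RR Y (act_left w q) f) = (\<lambda>w. Y \<one> (\<lambda>w'. ?K (w', w)))"
      proof (rule ext0_eqI)
        fix w assume w: "w \<in> carrier G"
        have wq: "act_left w q \<in> M" using orbit_left[OF q w] by (simp add: act_left_def)
        have "res (\<lambda>v. f (act_left v (act_left w q))) = (\<lambda>w'. ?K (w', w))"
          by (rule ext0_eqI) (use w orbit_subset[OF q] in \<open>simp_all add: act_left_def m_assoc\<close>)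
        then show "RR Y (act_left w q) f = Y \<one> (\<lambda>w'. ?K (w', w))"
          using fundamental_apply[OF wq True, of act_left Y] by simp
      next
        fix w assume "w \<notin> carrier G"
        then have "(\<lambda>w'. ?K (w', w)) = (\<lambda>w'. 0)" by auto
        then show "Y \<one> (\<lambda>w'. ?K (w', w)) = 0" using M.tangent_0[OF v] by simp
      qed
      then have "RR X q (\<lambda>q. RR Y q f) = X \<one> (\<lambda>w. Y \<one> (\<lambda>w'. ?K (w', w)))"
        using fundamental_apply[OF q vector_fields_smooth[OF RR_field[OF Y] True], of act_left X] by simp
      also have "\<dots> = Y \<one> (\<lambda>w'. X \<one> (\<lambda>w. ?K (w', w)))"
        using tangent_interchange[OF K _ _ v u] by simp
      also have "(\<lambda>w'. X \<one> (\<lambda>w. ?K (w', w))) = (\<lambda>w'. X w' ?h)"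
      proof
        fix w'
        show "X \<one> (\<lambda>w. ?K (w', w)) = X w' ?h"
        proof (cases "w' \<in> carrier G")
          case True
          then have "(\<lambda>w. ?K (w', w)) = res (\<lambda>w. ?h (w' \<otimes> w))" by (auto simp: ext0_def)
          then show ?thesis using lie_at[OF X True h] by simp
        next
          case False
          then have "(\<lambda>w. ?K (w', w)) = (\<lambda>w. 0)" by auto
          then show ?thesis using False M.tangent_0[OF u] lie_outside[OF X] by simp
        qed
      qed
      finally show ?thesis .
    qed
    show ?thesis
      using fundamental_apply[OF q True, of act_left "lie_bracket Y X"]
      by (simp add: lie_bracket_apply *[OF X Y] *[OF Y X])
  next
    case False
    then show ?thesis
      using bracket_outside[OF False action_left action_left X Y] by (simp add: fundamental_def)
  qed
qed

text \<open>Left and right translations commute, so both iterated derivatives are taken of one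
  function of two group variables and agree by \<open>tangent_interchange\<close>.\<close>

lemma bracket_RR_LL:
  assumes X: "X \<in> \<gg>" and Y: "Y \<in> \<gg>" and q: "q \<in> M"
  shows "lie_bracket (RR X) (LL Y) q = 0" "lie_bracket (LL Y) (RR X) q = 0"
proof -
  note x = orbit_subset[OF q]
  have "RR X q (\<lambda>q. LL Y q f) = LL Y q (\<lambda>q. RR X q f)" if f: "f \<in> CM" for f
  proof -
    note u = lie_tangent[OF X one_closed] and v = lie_tangent[OF Y one_closed]
    let ?K = "ext0 (topspace TN) (\<lambda>p. f (act_right (snd p) (act_left (fst p) q)))"
    have K: "?K \<in> CN"
    proof (rule CM_pullback[OF atlasN _ f])
      show "smooth_map TN AN TN AN (\<lambda>p. act_right (snd p) (act_left (fst p) q))"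
        unfolding act_left_def act_right_def fst_conv snd_conv
        by (rule smooth_map_Pair[OF atlasN atlasG atlasG]; intro smooth_rules x)
      show "act_right (snd p) (act_left (fst p) q) \<in> M" if "p \<in> topspace TN" for p
        using that orbit_right[OF orbit_left[OF q, of "fst p"], of "snd p"]
        by (auto simp: act_left_def act_right_def)
    qed
    have "res (\<lambda>w. LL Y (act_left w q) f) = (\<lambda>w. Y \<one> (\<lambda>w'. ?K (w, w')))"
    proof (rule ext0_eqI)
      fix w assume w: "w \<in> carrier G"
      have wq: "act_left w q \<in> M" using orbit_left[OF q w] by (simp add: act_left_def)
      have "res (\<lambda>v. f (act_right v (act_left w q))) = (\<lambda>w'. ?K (w, w'))"
        by (rule ext0_eqI) (use w in simp_all)
      then show "LL Y (act_left w q) f = Y \<one> (\<lambda>w'. ?K (w, w'))"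
        using fundamental_apply[OF wq f, of act_right Y] by simp
    next
      fix w assume "w \<notin> carrier G"
      then have "(\<lambda>w'. ?K (w, w')) = (\<lambda>w'. 0)" by auto
      then show "Y \<one> (\<lambda>w'. ?K (w, w')) = 0" using M.tangent_0[OF v] by simp
    qed
    then have 1: "RR X q (\<lambda>q. LL Y q f) = X \<one> (\<lambda>w. Y \<one> (\<lambda>w'. ?K (w, w')))"
      using fundamental_apply[OF q vector_fields_smooth[OF LL_field[OF Y] f], of act_left X] by simp
    have "res (\<lambda>w'. RR X (act_right w' q) f) = (\<lambda>w'. X \<one> (\<lambda>w. ?K (w, w')))"
    proof (rule ext0_eqI)
      fix w assume w: "w \<in> carrier G"
      have wq: "act_right w q \<in> M" using orbit_right[OF q w] by (simp add: act_right_def)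
      have "res (\<lambda>v. f (act_left v (act_right w q))) = (\<lambda>v. ?K (v, w))"
        by (rule ext0_eqI) (use w x in \<open>simp_all add: act_left_def act_right_def m_assoc\<close>)
      then show "RR X (act_right w q) f = X \<one> (\<lambda>v. ?K (v, w))"
        using fundamental_apply[OF wq f, of act_left X] by simp
    next
      fix w assume "w \<notin> carrier G"
      then have "(\<lambda>v. ?K (v, w)) = (\<lambda>v. 0)" by auto
      then show "X \<one> (\<lambda>v. ?K (v, w)) = 0" using M.tangent_0[OF u] by simp
    qed
    then have 2: "LL Y q (\<lambda>q. RR X q f) = Y \<one> (\<lambda>w'. X \<one> (\<lambda>w. ?K (w, w')))"
      using fundamental_apply[OF q vector_fields_smooth[OF RR_field[OF X] f], of act_right Y] by simp
    show ?thesis unfolding 1 2 using tangent_interchange[OF K _ _ u v] by simp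
  qed
  then have "lie_bracket (RR X) (LL Y) q f = 0 \<and> lie_bracket (LL Y) (RR X) q f = 0" for f
    using bracket_outside[of f act_left act_right X Y] bracket_outside[of f act_right act_left Y X]
      action_left action_right X Y
    by (cases "f \<in> CM") (simp_all add: lie_bracket_apply)
  then show "lie_bracket (RR X) (LL Y) q = 0" "lie_bracket (LL Y) (RR X) q = 0"
    by (auto simp: fun_eq_iff)
qed

end

subsection \<open>The Koszul formula for the Bismut connection\<close>

lemma affine_connection_in:
  "affine_connection S C D \<Longrightarrow> X \<in> vector_fields S C \<Longrightarrow> Y \<in> vector_fields S C \<Longrightarrow> D X Y \<in> vector_fields S C"
  by (simp add: affine_connection_def)

lemma metric_connectionD:
  "metric_connection S C g D \<Longrightarrow> X \<in> vector_fields S C \<Longrightarrow> Y \<in> vector_fields S C \<Longrightarrow> Z \<in> vector_fields S C \<Longrightarrow>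
    p \<in> S \<Longrightarrow> X p (eval2 S g Y Z) = eval2 S g (D X Y) Z p + eval2 S g Y (D X Z) p"
  by (simp add: metric_connection_def)

lemma eval2_at: "p \<in> S \<Longrightarrow> eval2 S g Y Z p = g p (Y p) (Z p)"
  and eval3_at: "p \<in> S \<Longrightarrow> eval3 S H X Y Z p = H p (X p) (Y p) (Z p)"
  by (simp_all add: eval2_def eval3_def)

text \<open>This is the Koszul identity for the Levi-Civita connection with half the torsion added
  and everything doubled. Additivity and symmetry of \<open>g\<close> are asked for on tangent
  vectors at \<open>p\<close> only, which is where they can be verified for
  \<open>gbar\<close>.\<close>

lemma koszul_bismut:
  assumes bis: "bismut_connection S C g H D"
    and X: "X \<in> vector_fields S C" and Y: "Y \<in> vector_fields S C" and Z: "Z \<in> vector_fields S C" and p: "p \<in> S"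
    and add: "\<And>u v w. u \<in> tangent_space C p \<Longrightarrow> v \<in> tangent_space C p \<Longrightarrow> w \<in> tangent_space C p \<Longrightarrow>
       g p (u + v) w = g p u w + g p v w"
    and sym: "\<And>u v. u \<in> tangent_space C p \<Longrightarrow> v \<in> tangent_space C p \<Longrightarrow> g p u v = g p v u"
  shows "2 * g p (D X Y p) (Z p) = X p (eval2 S g Y Z) + Y p (eval2 S g X Z) - Z p (eval2 S g X Y)
     + g p (lie_bracket X Y p) (Z p) - g p (lie_bracket X Z p) (Y p) - g p (lie_bracket Y Z p) (X p)
     + H p (X p) (Y p) (Z p)"
proof -
  obtain L where L: "levi_civita_connection S C g L"
    and D: "\<forall>X\<in>vector_fields S C. \<forall>Y\<in>vector_fields S C. \<forall>Z\<in>vector_fields S C. \<forall>p\<in>S.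
           eval2 S g (D X Y) Z p = eval2 S g (L X Y) Z p + 1 / 2 * eval3 S H X Y Z p"
    using bis by (auto simp: bismut_connection_def)
  have m: "metric_connection S C g L" and tf: "\<And>X Y. X \<in> vector_fields S C \<Longrightarrow> Y \<in> vector_fields S C \<Longrightarrow> L X Y - L Y X = lie_bracket X Y"
    using L by (simp_all add: levi_civita_connection_def)
  have aff: "affine_connection S C L" using m by (simp add: metric_connection_def)
  have Lin: "L X Y p \<in> tangent_space C p" if "X \<in> vector_fields S C" "Y \<in> vector_fields S C" for X Y
    by (rule vector_fields_in[OF affine_connection_in[OF aff that] p])
  have br: "g p (L X Y p) w = g p (L Y X p) w + g p (lie_bracket X Y p) w"
    if "X \<in> vector_fields S C" "Y \<in> vector_fields S C" "w \<in> tangent_space C p" for X Y w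
  proof -
    have e: "lie_bracket X Y p = L X Y p - L Y X p" using tf[OF that(1,2)] by (metis minus_apply)
    have "lie_bracket X Y p \<in> tangent_space C p"
      unfolding e by (rule subspace_diff[OF subspace_tangent_space Lin[OF that(1,2)] Lin[OF that(2,1)]])
    from add[OF Lin[OF that(2,1)] this that(3)] show ?thesis unfolding e by simp
  qed
  have mc: "X p (eval2 S g Y Z) = g p (L X Y p) (Z p) + g p (L X Z p) (Y p)"
    if "X \<in> vector_fields S C" "Y \<in> vector_fields S C" "Z \<in> vector_fields S C" for X Y Z
    using metric_connectionD[OF m that p] sym[OF vector_fields_in[OF that(2) p] Lin[OF that(1,3)]]
    by (simp add: eval2_at[OF p])
  note t = vector_fields_in[OF X p] vector_fields_in[OF Y p] vector_fields_in[OF Z p]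
  have "g p (D X Y p) (Z p) = g p (L X Y p) (Z p) + 1 / 2 * H p (X p) (Y p) (Z p)"
    using D X Y Z p by (simp add: eval2_at eval3_at)
  then show ?thesis
    using mc[OF X Y Z] mc[OF Y X Z] mc[OF Z X Y] br[OF X Y t(3)] br[OF X Z t(2)] br[OF Y Z t(1)] by simp
qed

context involution_orbit
begin

subsection \<open>Metric and torsion on the orbit\<close>

definition gbar :: "('g \<times> 'g) form2" where
  "gbar = pullback2 M CN (\<lambda>x. x)
     (pullback2 N CG fst (killing_metric G CG) + pullback2 N CG snd (killing_metric G CG))"

definition Hbar :: "('g \<times> 'g) form3" where
  "Hbar = pullback3 M CN (\<lambda>x. x)
     (pullback3 N CG fst (cartan_3form G CG) + pullback3 N CG snd (cartan_3form G CG))"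

lemma gbar_eq: "gbar q u v = - \<kappa> (triv fst q u) (triv fst q v) - \<kappa> (triv snd q u) (triv snd q v)"
  by (simp add: gbar_def pullback2_def killing_metric_def triv_def push_def)

lemma Hbar_eq:
  assumes "u \<in> tangent_space CM q" "v \<in> tangent_space CM q" "w \<in> tangent_space CM q" "q \<in> M"
  shows "Hbar q u v w = - \<kappa> (lie_bracket (triv fst q u) (triv fst q v)) (triv fst q w)
                        - \<kappa> (lie_bracket (triv snd q u) (triv snd q v)) (triv snd q w)"
proof -
  note in1 = triv_in[OF assms(1,4)] and in2 = triv_in[OF assms(2,4)]
  note x = orbit_subset[OF assms(4)]
  have "left_invariant_extension G CG (fst q) (lie_bracket (triv fst q u) (triv fst q v) (fst q)) =
      lie_bracket (triv fst q u) (triv fst q v)"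
    "left_invariant_extension G CG (snd q) (lie_bracket (triv snd q u) (triv snd q v) (snd q)) =
      lie_bracket (triv snd q u) (triv snd q v)"
    by (intro left_invariant_extension_eq lie_bracket_in in1 in2 x)+
  then show ?thesis
    by (simp add: Hbar_def pullback3_def cartan_3form_def killing_metric_def triv_def push_def)
qed

lemma gbar_add:
  assumes "u \<in> tangent_space CM q" "v \<in> tangent_space CM q" "w \<in> tangent_space CM q" "q \<in> M"
  shows "gbar q (u + v) w = gbar q u w + gbar q v w"
  by (simp add: gbar_eq triv_add[OF assms(1,2,4)] killing_add triv_in[OF _ assms(4)] assms(1-3))

lemma gbar_sym:
  assumes "u \<in> tangent_space CM q" "v \<in> tangent_space CM q" "q \<in> M"
  shows "gbar q u v = gbar q v u"
  by (simp add: gbar_eq killing_sym[of "triv fst q u"] killing_sym[of "triv snd q u"] triv_in[OF _ assms(3)] assms(1,2))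

text \<open>Up to sign, the inner product of an \<open>LL\<close> field with an \<open>RR\<close>
  field: the only inner product among these fields that varies over \<open>M\<close>. The torsion on
  such fields reduces to it or to constants.\<close>

definition mixed :: "'g vfield \<Rightarrow> 'g vfield \<Rightarrow> 'g \<times> 'g \<Rightarrow> real" where
  "mixed Y X q = \<kappa> Y (adj (fst q) X) + \<kappa> Y (adj (snd q) X)"

lemma mixed_uminus:
  assumes "X \<in> \<gg>" "Y \<in> \<gg>" "q \<in> M"
  shows "mixed Y (- X) q = - mixed Y X q" "mixed (- Y) X q = - mixed Y X q"
proof -
  have "adj x (- X) = - adj x X" if "x \<in> carrier G" for x using adj_scale[OF assms(1) that, of "-1"] by simp
  then show "mixed Y (- X) q = - mixed Y X q"
    using assms orbit_subset[OF assms(3)] by (simp add: mixed_def killing_uminus_right adj_in)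
  show "mixed (- Y) X q = - mixed Y X q"
    using assms orbit_subset[OF assms(3)] by (simp add: mixed_def killing_uminus adj_in)
qed

lemma mixed_swap:
  assumes "X \<in> \<gg>" "X' \<in> \<gg>" "Y \<in> \<gg>" "q \<in> M"
  shows "mixed Y (lie_bracket X' X) q = - mixed Y (lie_bracket X X') q"
    "mixed (lie_bracket X' X) Y q = - mixed (lie_bracket X X') Y q"
  using mixed_uminus[OF lie_bracket_in[OF assms(1,2)] assms(3,4)] mixed_uminus[OF assms(3) lie_bracket_in[OF assms(1,2)] assms(4)]
    lie_bracket_skew[of X' X] by simp_all

lemma eval2_LL_LL: "Y \<in> \<gg> \<Longrightarrow> Y' \<in> \<gg> \<Longrightarrow> eval2 M gbar (LL Y) (LL Y') = ext0 M (\<lambda>q. - 2 * \<kappa> Y Y')"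
  by (auto simp: eval2_def ext0_def gbar_eq triv_LL fun_eq_iff)

lemma eval2_RR_RR: "X \<in> \<gg> \<Longrightarrow> X' \<in> \<gg> \<Longrightarrow> eval2 M gbar (RR X) (RR X') = ext0 M (\<lambda>q. - 2 * \<kappa> X X')"
  using orbit_subset by (force simp: eval2_def ext0_def gbar_eq triv_RR fun_eq_iff killing_adj)

lemma eval2_LL_RR: "Y \<in> \<gg> \<Longrightarrow> X \<in> \<gg> \<Longrightarrow> eval2 M gbar (LL Y) (RR X) = ext0 M (\<lambda>q. - mixed Y X q)"
  by (auto simp: eval2_def ext0_def gbar_eq triv_LL triv_RR fun_eq_iff mixed_def)

lemma eval2_sym:
  assumes "X \<in> vector_fields M CM" "Y \<in> vector_fields M CM"
  shows "eval2 M gbar X Y = eval2 M gbar Y X"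
  using gbar_sym vector_fields_in[OF assms(1)] vector_fields_in[OF assms(2)] by (auto simp: eval2_def fun_eq_iff)

lemma mixed_in: 
  assumes Y: "Y \<in> \<gg>" and X: "X \<in> \<gg>"
  shows "ext0 M (\<lambda>q. mixed Y X q) \<in> CM"
proof -
  have l: "res (\<lambda>x. \<kappa> Y (adj x X)) \<in> CG"
    by (rule smooth_lin_adj(1)[OF X, of "\<lambda>W. \<kappa> Y W"]) (simp_all add: killing_add_right killing_scale_right Y)
  let ?f = "\<lambda>x. ext0 N (\<lambda>q. res (\<lambda>x. \<kappa> Y (adj x X)) (fst q)) x + ext0 N (\<lambda>q. res (\<lambda>x. \<kappa> Y (adj x X)) (snd q)) x"
  have "?f \<in> CN"
    by (intro P.smooth_functions_add res_pullback_N[OF l] smooth_fstN smooth_sndN)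
  then have "ext0 M ?f \<in> CM" by (rule CM_restrict)
  moreover have "ext0 M ?f = ext0 M (\<lambda>q. mixed Y X q)"
  proof (rule ext0_cong)
    fix q assume "q \<in> M"
    then show "?f q = mixed Y X q" using orbit_subset[of q] orbit_subset'[of q] by (simp add: mixed_def)
  qed
  ultimately show ?thesis by simp
qed

lemma neg_mixed_in:
  assumes Y: "Y \<in> \<gg>" and X: "X \<in> \<gg>"
  shows "ext0 M (\<lambda>q. - mixed Y X q) \<in> CM"
proof -
  have "ext0 M (\<lambda>q. - mixed Y X q) = (\<lambda>q. (-1) * ext0 M (\<lambda>q. mixed Y X q) q + 0 * ext0 M (\<lambda>q. mixed Y X q) q)"
    by (auto simp: ext0_def)
  then show ?thesis using CM_lincomb[OF mixed_in[OF assms] mixed_in[OF assms], of "-1" 0] by simp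
qed

text \<open>Left translation by \<open>w\<close> replaces \<open>adj x X\<close> by
  \<open>adj x (adj w X)\<close>, so the derivative acts on \<open>X\<close> inside
  \<open>adj x\<close>.\<close>

lemma RR_mixed:
  assumes Y: "Y \<in> \<gg>" and X: "X \<in> \<gg>" and Z: "Z \<in> \<gg>" and q: "q \<in> M"
  shows "RR Z q (ext0 M (\<lambda>q. - mixed Y X q)) = - mixed Y (lie_bracket X Z) q"
proof -
  note x = orbit_subset[OF q]
  define l where "l W = - \<kappa> Y (adj (fst q) W) - \<kappa> Y (adj (snd q) W)" for W
  have ladd: "l (V + W) = l V + l W" if "V \<in> \<gg>" "W \<in> \<gg>" for V W
    using that x Y by (simp add: l_def adj_add killing_add_right adj_in)
  have lscale: "l (c *\<^sub>R W) = c * l W" if "W \<in> \<gg>" for c W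
    using that x Y by (simp add: l_def adj_scale killing_scale_right adj_in algebra_simps)
  have "res (\<lambda>w. ext0 M (\<lambda>q. - mixed Y X q) (act_left w q)) = res (\<lambda>w. l (adj w X))"
  proof (rule ext0_cong)
    fix w assume w: "w \<in> carrier G"
    then have "act_left w q \<in> M" using orbit_left[OF q] by (simp add: act_left_def)
    then show "ext0 M (\<lambda>q. - mixed Y X q) (act_left w q) = l (adj w X)"
      using adj_mult[OF X w x(1)] adj_mult[OF X w x(2)] by (simp add: mixed_def l_def act_left_def)
  qed
  then have "RR Z q (ext0 M (\<lambda>q. - mixed Y X q)) = Z \<one> (res (\<lambda>w. l (adj w X)))"
    using fundamental_apply[OF q neg_mixed_in[OF Y X]] by simp
  also have "\<dots> = l (lie_bracket X Z)" by (rule smooth_lin_adj(2)[OF X ladd lscale Z])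
  finally show ?thesis by (simp add: l_def mixed_def)
qed

text \<open>Right translation by \<open>w\<close> applies \<open>adj w\<close> outside
  \<open>adj x X\<close>. Invariance of the Killing form then shifts the bracket with
  \<open>Z\<close> onto \<open>Y\<close>.\<close>

lemma LL_mixed:
  assumes Y: "Y \<in> \<gg>" and X: "X \<in> \<gg>" and Z: "Z \<in> \<gg>" and q: "q \<in> M"
  shows "LL Z q (ext0 M (\<lambda>q. - mixed Y X q)) = - mixed (lie_bracket Z Y) X q"
proof -
  note x = orbit_subset[OF q] and v = lie_tangent[OF Z one_closed]
  have D: "res (\<lambda>w. \<kappa> Y (adj w W)) \<in> CG \<and> Z \<one> (res (\<lambda>w. \<kappa> Y (adj w W))) = \<kappa> (lie_bracket Z Y) W" if W: "W \<in> \<gg>" for W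
  proof
    show "res (\<lambda>w. \<kappa> Y (adj w W)) \<in> CG"
      by (rule smooth_lin_adj(1)[OF W, of "\<kappa> Y"]) (simp_all add: killing_add_right killing_scale_right Y)
    have "Z \<one> (res (\<lambda>w. \<kappa> Y (adj w W))) = \<kappa> Y (lie_bracket W Z)"
      by (rule smooth_lin_adj(2)[OF W, of "\<kappa> Y"]) (simp_all add: killing_add_right killing_scale_right Y Z)
    also have "\<dots> = \<kappa> (lie_bracket Z Y) W"
      using killing_sym[OF Y lie_bracket_in[OF W Z]] killing_cyclic[OF W Z Y] by simp
    finally show "Z \<one> (res (\<lambda>w. \<kappa> Y (adj w W))) = \<kappa> (lie_bracket Z Y) W" .
  qed
  note D1 = D[OF adj_in[OF X x(1)]] and D2 = D[OF adj_in[OF X x(2)]]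
  let ?a = "res (\<lambda>w. \<kappa> Y (adj w (adj (fst q) X)))" and ?b = "res (\<lambda>w. \<kappa> Y (adj w (adj (snd q) X)))"
  have "res (\<lambda>w. ext0 M (\<lambda>q. - mixed Y X q) (act_right w q)) = (\<lambda>w. (-1) * ?a w + (-1) * ?b w)"
  proof (rule ext0_eqI)
    fix w assume w: "w \<in> carrier G"
    then have "act_right w q \<in> M" using orbit_right[OF q] by (simp add: act_right_def)
    then show "ext0 M (\<lambda>q. - mixed Y X q) (act_right w q) = (-1) * ?a w + (-1) * ?b w"
      using adj_mult[OF X x(1) w] adj_mult[OF X x(2) w] w by (simp add: mixed_def act_right_def)
  qed simp
  then have "LL Z q (ext0 M (\<lambda>q. - mixed Y X q)) = Z \<one> (\<lambda>w. (-1) * ?a w + (-1) * ?b w)"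
    using fundamental_apply[OF q neg_mixed_in[OF Y X]] by simp
  also have "\<dots> = (-1) * Z \<one> ?a + (-1) * Z \<one> ?b"
    by (rule tangent_lincomb[OF v]) (use D1 D2 in auto)
  finally show ?thesis using D1 D2 by (simp add: mixed_def)
qed

lemma fundamental_const: 
  "action \<mu> \<Longrightarrow> Z \<in> \<gg> \<Longrightarrow> q \<in> M \<Longrightarrow> fundamental \<mu> Z q (ext0 M (\<lambda>q. c)) = 0"
  by (rule tangent_CM_const[OF vector_fields_in[OF fundamental_vector_field]])

text \<open>Each value collapses because \<open>adj\<close> preserves both the bracket and the
  Killing form, and because the associated trilinear form is cyclic.\<close>

lemma Hbar_fields:
  assumes "X \<in> \<gg>" "Y \<in> \<gg>" "Z \<in> \<gg>" "q \<in> M"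
  shows "Hbar q (RR X q) (LL Y q) (LL Z q) = - mixed (lie_bracket Y Z) X q"
    and "Hbar q (RR X q) (LL Y q) (RR Z q) = mixed Y (lie_bracket X Z) q"
    and "Hbar q (RR X q) (RR Y q) (LL Z q) = - mixed Z (lie_bracket X Y) q"
    and "Hbar q (RR X q) (RR Y q) (RR Z q) = - 2 * \<kappa> (lie_bracket X Y) Z"
    and "Hbar q (LL X q) (LL Y q) (RR Z q) = - mixed (lie_bracket X Y) Z q"
proof -
  note x = orbit_subset[OF assms(4)]
  note t = vector_fields_in[OF LL_field assms(4)] vector_fields_in[OF RR_field assms(4)]
  note s = Hbar_eq[OF _ _ _ assms(4)] t triv_LL[OF _ assms(4)] triv_RR[OF _ assms(4)] mixed_def assms(1-3)
  note a = adj_in[OF _ x(1)] adj_in[OF _ x(2)]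
  show "Hbar q (RR X q) (LL Y q) (LL Z q) = - mixed (lie_bracket Y Z) X q"
    using assms a by (simp add: s killing_cyclic[of "adj (fst q) X"] killing_cyclic[of "adj (snd q) X"])
  have "- \<kappa> (lie_bracket (adj w X) Y) (adj w Z) = \<kappa> Y (adj w (lie_bracket X Z))" if w: "w \<in> carrier G" for w
  proof -
    have A: "adj w X \<in> \<gg>" "adj w Z \<in> \<gg>" using adj_in w assms by auto
    have "- \<kappa> (lie_bracket (adj w X) Y) (adj w Z) = \<kappa> (lie_bracket Y (adj w X)) (adj w Z)"
      using killing_skew[OF A(1) assms(2) A(2)] by simp
    also have "\<dots> = \<kappa> Y (lie_bracket (adj w X) (adj w Z))" by (rule killing_invariant[OF assms(2) A])
    finally show ?thesis using adj_bracket[OF assms(1,3) w] by simp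
  qed
  then show "Hbar q (RR X q) (LL Y q) (RR Z q) = mixed Y (lie_bracket X Z) q"
    using x by (simp add: s)
  have sy: "\<kappa> (lie_bracket (adj w X) (adj w Y)) Z = \<kappa> Z (adj w (lie_bracket X Y))" if w: "w \<in> carrier G" for w
    using killing_sym[OF assms(3) adj_in[OF lie_bracket_in[OF assms(1,2)] w]] adj_bracket[OF assms(1,2) w] by simp
  show "Hbar q (RR X q) (RR Y q) (LL Z q) = - mixed Z (lie_bracket X Y) q"
    using x by (simp add: s sy)
  have kk: "\<kappa> (lie_bracket (adj w X) (adj w Y)) (adj w Z) = \<kappa> (lie_bracket X Y) Z" if w: "w \<in> carrier G" for w
    using killing_adj[OF lie_bracket_in[OF assms(1,2)] assms(3) w] adj_bracket[OF assms(1,2) w] by simp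
  show "Hbar q (RR X q) (RR Y q) (RR Z q) = - 2 * \<kappa> (lie_bracket X Y) Z"
    using x by (simp add: s kk)
  show "Hbar q (LL X q) (LL Y q) (RR Z q) = - mixed (lie_bracket X Y) Z q"
    by (simp add: s)
qed

lemma gbar_fields:
  assumes "X \<in> \<gg>" "Y \<in> \<gg>" "q \<in> M"
  shows "gbar q (LL X q) (LL Y q) = - 2 * \<kappa> X Y" "gbar q (RR X q) (RR Y q) = - 2 * \<kappa> X Y"
    "gbar q (LL X q) (RR Y q) = - mixed X Y q" "gbar q (RR Y q) (LL X q) = - mixed X Y q"
  using fun_cong[OF eval2_LL_LL[OF assms(1,2)], of q] fun_cong[OF eval2_RR_RR[OF assms(1,2)], of q]
    fun_cong[OF eval2_LL_RR[OF assms(1,2)], of q]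
    gbar_sym[OF vector_fields_in[OF LL_field[OF assms(1)] assms(3)] vector_fields_in[OF RR_field[OF assms(2)] assms(3)] assms(3)]
    assms(3) by (simp_all add: eval2_at)

subsection \<open>The anti-invariant part of the Lie algebra\<close>

text \<open>\<open>adj z\<close> is Ad of the inverse of \<open>z\<close>; being its own inverse on
  \<open>\<gg>\<close>, it has the same eigenspace for -1 as Ad z.\<close>

definition anti :: "'g vfield set" where "anti = {X \<in> \<gg>. adj z X = - X}"

lemma anti_in: "X \<in> anti \<Longrightarrow> X \<in> \<gg>"
  by (simp add: anti_def)

lemma adj_z_twice: "X \<in> \<gg> \<Longrightarrow> adj z (adj z X) = X"
proof (rule lie_eqI)
  assume X: "X \<in> \<gg>"
  show "adj z (adj z X) \<in> \<gg>" using X by (simp add: adj_in)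
  fix f assume f: "f \<in> CG"
  have "res (\<lambda>w. f (inv (z \<otimes> z) \<otimes> w \<otimes> (z \<otimes> z))) = f"
  proof (rule ext0_eqI)
    fix w assume w: "w \<in> carrier G"
    have "inv a \<otimes> (a \<otimes> w) = w" if "a \<in> carrier G" for a
      using that w by (simp add: m_assoc[symmetric])
    moreover have "inv (z \<otimes> z) \<otimes> w \<otimes> (z \<otimes> z) = inv (z \<otimes> z) \<otimes> (z \<otimes> z \<otimes> w)"
      using w zz_central[OF w] m_assoc[of "inv (z \<otimes> z)" w "z \<otimes> z"] by simp
    ultimately have "inv (z \<otimes> z) \<otimes> w \<otimes> (z \<otimes> z) = w" by simp
    then show "f (inv (z \<otimes> z) \<otimes> w \<otimes> (z \<otimes> z)) = f w" by simp
  qed (simp add: CG_outside[OF f])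
  then show "adj z (adj z X) \<one> f = X \<one> f"
    using adj_mult[OF X z z] adj_at_one[OF X _ f, of "z \<otimes> z"] by simp
qed

lemma killing_adj_z: "X \<in> \<gg> \<Longrightarrow> Y \<in> \<gg> \<Longrightarrow> \<kappa> X (adj z Y) = \<kappa> (adj z X) Y"
  using killing_adj[of "adj z X" Y z] adj_z_twice[of X] by (simp add: adj_in)

text \<open>At the base point \<open>mixed\<close> pairs \<open>Y\<close> with
  \<open>X + adj z X\<close>. As \<open>adj z\<close> is self-adjoint for the Killing form, the
  cancellation can come from either argument.\<close>

lemma mixed_anti:
  assumes "X \<in> \<gg>" "Y \<in> \<gg>" "X \<in> anti \<or> Y \<in> anti"
  shows "mixed Y X p\<^sub>0 = 0"
  using assms(3)
proof
  assume "X \<in> anti"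
  then show ?thesis using assms by (simp add: mixed_def anti_def adj_one killing_uminus_right)
next
  assume "Y \<in> anti"
  then have "adj z Y = - Y" by (simp add: anti_def)
  then show ?thesis using assms killing_adj_z[OF assms(2,1)] by (simp add: mixed_def adj_one killing_uminus)
qed

text \<open>Testing against \<open>LL\<close> fields gives V = -U, and against \<open>RR\<close>
  fields U = \<open>adj z U\<close>. These fields are not known to span the tangent space, so
  \<open>tangency\<close> has to finish: it becomes -2 U = 2 U.\<close>

lemma nondegenerate_at_base:
  assumes nd: "\<And>X. X \<in> \<gg> \<Longrightarrow> (\<And>Y. Y \<in> \<gg> \<Longrightarrow> \<kappa> X Y = 0) \<Longrightarrow> X = 0"
    and v: "v \<in> tangent_space CM p\<^sub>0"
    and L: "\<And>Z. Z \<in> \<gg> \<Longrightarrow> gbar p\<^sub>0 v (LL Z p\<^sub>0) = 0" and R: "\<And>Z. Z \<in> \<gg> \<Longrightarrow> gbar p\<^sub>0 v (RR Z p\<^sub>0) = 0"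
  shows "triv fst p\<^sub>0 v = 0" "triv snd p\<^sub>0 v = 0"
proof -
  note q = base_in_orbit
  define U where "U = triv fst p\<^sub>0 v"
  define V where "V = triv snd p\<^sub>0 v"
  have U: "U \<in> \<gg>" and V: "V \<in> \<gg>" using triv_in[OF v q] by (simp_all add: U_def V_def)
  note sub = subspace_add[OF subspace_lie_algebra] subspace_diff[OF subspace_lie_algebra]
  have "U + V = 0"
  proof (rule nd)
    show "U + V \<in> \<gg>" by (rule sub[OF U V])
    show "\<kappa> (U + V) Z = 0" if Z: "Z \<in> \<gg>" for Z
      unfolding killing_add[OF U V Z]
      using L[OF Z] triv_LL[OF Z q] by (simp add: gbar_eq U_def V_def)
  qed
  then have VU: "V = - U" by (metis add.commute add_eq_0_iff)
  have zU: "adj z U \<in> \<gg>" by (rule adj_in[OF U z])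
  have "U - adj z U = 0"
  proof (rule nd)
    show "U - adj z U \<in> \<gg>" by (rule sub(2)[OF U zU])
    show "\<kappa> (U - adj z U) Z = 0" if Z: "Z \<in> \<gg>" for Z
    proof -
      have "gbar p\<^sub>0 v (RR Z p\<^sub>0) = - \<kappa> U Z - \<kappa> V (adj z Z)"
        using triv_RR[OF Z q] adj_one[OF Z] by (simp add: gbar_eq U_def V_def)
      also have "\<dots> = - \<kappa> U Z + \<kappa> (adj z U) Z"
        unfolding VU using killing_uminus[OF U adj_in[OF Z z]] killing_adj_z[OF U Z] by simp
      finally show ?thesis using R[OF Z] killing_diff[OF U zU Z] by simp
    qed
  qed
  then have zU': "adj z U = U" by simp
  have "adj z V = - U" using adj_scale[OF U z, of "-1"] VU zU' by simp
  moreover have "V + adj z V = U + adj z U"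
    using tangency[OF v] by (simp add: U_def V_def)
  ultimately have eq: "- U + - U = U + U" using VU zU' by simp
  have "U x f = 0" for x f
    using fun_cong[OF fun_cong[OF eq, of x], of f] by simp
  then have "U = 0" by (simp add: fun_eq_iff)
  then show "triv fst p\<^sub>0 v = 0" "triv snd p\<^sub>0 v = 0" using VU by (simp_all add: U_def[symmetric] V_def[symmetric])
qed

lemma triv_zero: "q \<in> M \<Longrightarrow> triv fst q 0 = 0" "q \<in> M \<Longrightarrow> triv snd q 0 = 0"
  by (rule triv_eqI[OF subspace_0[OF subspace_lie_algebra]];
      simp add: orbit_subset push_def tangent_map_def fun_eq_iff)+

lemma killing_zero: "Z \<in> \<gg> \<Longrightarrow> \<kappa> 0 Z = 0"
  using killing_scale[of 0 Z 0] subspace_0[OF subspace_lie_algebra] by simp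

lemma gbar_zero: "q \<in> M \<Longrightarrow> w \<in> tangent_space CM q \<Longrightarrow> gbar q 0 w = 0"
  by (simp add: gbar_eq triv_zero killing_zero triv_in)

section \<open>Covariant derivatives of fundamental fields at the base point\<close>

context
  fixes D
  assumes bis: "bismut_connection M CM gbar Hbar D"
    and nd: "\<And>X. X \<in> \<gg> \<Longrightarrow> (\<And>Y. Y \<in> \<gg> \<Longrightarrow> \<kappa> X Y = 0) \<Longrightarrow> X = 0"
begin

lemma D_in:
  assumes "X \<in> vector_fields M CM" "Y \<in> vector_fields M CM"
  shows "D X Y \<in> vector_fields M CM"
proof -
  have "metric_connection M CM gbar D" using bis by (simp only: bismut_connection_def)
  then have "affine_connection M CM D" by (simp only: metric_connection_def)
  from affine_connection_in[OF this assms] show ?thesis .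
qed

lemma koszul_orbit:
  assumes X: "X \<in> vector_fields M CM" and Y: "Y \<in> vector_fields M CM" and Z: "Z \<in> vector_fields M CM" and q: "q \<in> M"
  shows "2 * gbar q (D X Y q) (Z q) = X q (eval2 M gbar Y Z) + Y q (eval2 M gbar X Z) - Z q (eval2 M gbar X Y)
     + gbar q (lie_bracket X Y q) (Z q) - gbar q (lie_bracket X Z q) (Y q) - gbar q (lie_bracket Y Z q) (X q)
     + Hbar q (X q) (Y q) (Z q)"
  by (rule koszul_bismut[OF bis X Y Z q gbar_add[OF _ _ _ q] gbar_sym[OF _ _ q]])

lemma eval2_RR_LL: "Y \<in> \<gg> \<Longrightarrow> X \<in> \<gg> \<Longrightarrow> eval2 M gbar (RR X) (LL Y) = ext0 M (\<lambda>q. - mixed Y X q)"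
  using eval2_sym[OF RR_field LL_field, of X Y] eval2_LL_RR by simp

lemmas field_at = vector_fields_in[OF LL_field base_in_orbit] vector_fields_in[OF RR_field base_in_orbit]

lemmas field_rules = LL_field RR_field base_in_orbit eval2_LL_LL eval2_RR_RR eval2_LL_RR eval2_RR_LL
  fundamental_const[OF action_left] fundamental_const[OF action_right] RR_mixed LL_mixed
  bracket_LL_LL bracket_RR_RR bracket_RR_LL gbar_fields gbar_zero field_at Hbar_fields lie_bracket_in

text \<open>Every term left in the Koszul formula is a value of \<open>mixed\<close> at the base
  point. Against \<open>LL Z\<close> one of its arguments is \<open>X\<close>, against
  \<open>RR Z\<close> it is \<open>Y\<close>, and both are anti-invariant.\<close>

lemma nabla_RR_LL:
  assumes X: "X \<in> anti" and Y: "Y \<in> anti"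
  shows "triv fst p\<^sub>0 (D (RR X) (LL Y) p\<^sub>0) = 0" "triv snd p\<^sub>0 (D (RR X) (LL Y) p\<^sub>0) = 0"
proof -
  note X' = anti_in[OF X] and Y' = anti_in[OF Y]
  have v: "D (RR X) (LL Y) p\<^sub>0 \<in> tangent_space CM p\<^sub>0"
    by (rule vector_fields_in[OF D_in[OF RR_field[OF X'] LL_field[OF Y']] base_in_orbit])
  have L: "gbar p\<^sub>0 (D (RR X) (LL Y) p\<^sub>0) (LL Z p\<^sub>0) = 0" if Z: "Z \<in> \<gg>" for Z
  proof -
    have "2 * gbar p\<^sub>0 (D (RR X) (LL Y) p\<^sub>0) (LL Z p\<^sub>0) = 0"
      unfolding koszul_orbit[OF RR_field[OF X'] LL_field[OF Y'] LL_field[OF Z] base_in_orbit]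
      by (simp add: field_rules X' Y' Z mixed_anti X Y)
    then show ?thesis by simp
  qed
  have R: "gbar p\<^sub>0 (D (RR X) (LL Y) p\<^sub>0) (RR Z p\<^sub>0) = 0" if Z: "Z \<in> \<gg>" for Z
  proof -
    have "2 * gbar p\<^sub>0 (D (RR X) (LL Y) p\<^sub>0) (RR Z p\<^sub>0) = 0"
      unfolding koszul_orbit[OF RR_field[OF X'] LL_field[OF Y'] RR_field[OF Z] base_in_orbit]
      by (simp add: field_rules X' Y' Z mixed_anti X Y)
    then show ?thesis by simp
  qed
  show "triv fst p\<^sub>0 (D (RR X) (LL Y) p\<^sub>0) = 0" "triv snd p\<^sub>0 (D (RR X) (LL Y) p\<^sub>0) = 0"
    by (rule nondegenerate_at_base[OF nd v L R]; assumption)+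
qed

text \<open>Against \<open>LL Z\<close> the two derivative terms cancel each other and the bracket
  term cancels the torsion; against \<open>RR Z\<close> the Killing terms cancel by cyclicity. This
  reflects that right-invariant fields are parallel on the product, and they are tangent to
  \<open>M\<close>.\<close>

lemma nabla_RR_RR:
  assumes X: "X \<in> \<gg>" and S: "S \<in> \<gg>"
  shows "triv fst p\<^sub>0 (D (RR X) (RR S) p\<^sub>0) = 0" "triv snd p\<^sub>0 (D (RR X) (RR S) p\<^sub>0) = 0"
proof -
  have v: "D (RR X) (RR S) p\<^sub>0 \<in> tangent_space CM p\<^sub>0"
    by (rule vector_fields_in[OF D_in[OF RR_field[OF X] RR_field[OF S]] base_in_orbit])
  have L: "gbar p\<^sub>0 (D (RR X) (RR S) p\<^sub>0) (LL Z p\<^sub>0) = 0" if Z: "Z \<in> \<gg>" for Z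
  proof -
    have "2 * gbar p\<^sub>0 (D (RR X) (RR S) p\<^sub>0) (LL Z p\<^sub>0) = 0"
      unfolding koszul_orbit[OF RR_field[OF X] RR_field[OF S] LL_field[OF Z] base_in_orbit]
      by (simp add: field_rules X S Z mixed_swap[OF X S Z base_in_orbit])
    then show ?thesis by simp
  qed
  have R: "gbar p\<^sub>0 (D (RR X) (RR S) p\<^sub>0) (RR Z p\<^sub>0) = 0" if Z: "Z \<in> \<gg>" for Z
  proof -
    have "2 * gbar p\<^sub>0 (D (RR X) (RR S) p\<^sub>0) (RR Z p\<^sub>0) =
       - 2 * \<kappa> (lie_bracket S X) Z + 2 * \<kappa> (lie_bracket Z X) S + 2 * \<kappa> (lie_bracket Z S) X - 2 * \<kappa> (lie_bracket X S) Z"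
      unfolding koszul_orbit[OF RR_field[OF X] RR_field[OF S] RR_field[OF Z] base_in_orbit]
      by (simp add: field_rules X S Z)
    also have "\<dots> = 0"
      using killing_skew[OF S X Z] killing_cyclic[OF Z X S] killing_cyclic[OF Z S X] by simp
    finally show ?thesis by simp
  qed
  show "triv fst p\<^sub>0 (D (RR X) (RR S) p\<^sub>0) = 0" "triv snd p\<^sub>0 (D (RR X) (RR S) p\<^sub>0) = 0"
    by (rule nondegenerate_at_base[OF nd v L R]; assumption)+
qed

text \<open>The torsion vanishes once one slot has trivial components, so only the derivative along
  \<open>RR X\<close> of its value on \<open>LL Y1\<close>, \<open>LL Y2\<close>,
  \<open>RR S\<close> remains. That value is a \<open>mixed\<close> function, and the derivative
  puts [S, X] into its second argument.\<close>

lemma parallel_imp_commute: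
  assumes par: "parallel3 M CM D Hbar"
    and X: "X \<in> anti" and S: "S \<in> anti" and Y1: "Y1 \<in> anti" and Y2: "Y2 \<in> anti"
  shows "\<kappa> (lie_bracket Y1 Y2) (lie_bracket S X) = 0"
proof -
  note g = anti_in[OF X] anti_in[OF S] anti_in[OF Y1] anti_in[OF Y2]
  note q = base_in_orbit
  have zl: "lie_bracket 0 W = 0" "lie_bracket W 0 = 0" if "W \<in> \<gg>" for W
    using lie_bracket_scale_left[OF subspace_0[OF subspace_lie_algebra] that, of 0]
      lie_bracket_scale_right[OF that subspace_0[OF subspace_lie_algebra], of 0] by simp_all
  have zr: "\<kappa> W 0 = 0" if "W \<in> \<gg>" for W
    using killing_scale_right[OF subspace_0[OF subspace_lie_algebra] that, of 0] by simp
  note Din = vector_fields_in[OF D_in q]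
  have "covariant_derivative3 M D Hbar (RR X) (LL Y1) (LL Y2) (RR S) p\<^sub>0 = 0"
    using par RR_field[OF g(1)] LL_field[OF g(3)] LL_field[OF g(4)] RR_field[OF g(2)] q
    unfolding parallel3_def by blast
  moreover have "Hbar p\<^sub>0 (D (RR X) (LL Y1) p\<^sub>0) (LL Y2 p\<^sub>0) (RR S p\<^sub>0) = 0"
    by (simp add: Hbar_eq[OF Din _ _ q] field_rules g nabla_RR_LL[OF X Y1] triv_LL triv_RR zl killing_zero adj_in)
  moreover have "Hbar p\<^sub>0 (LL Y1 p\<^sub>0) (D (RR X) (LL Y2) p\<^sub>0) (RR S p\<^sub>0) = 0"
    by (simp add: Hbar_eq[OF _ Din _ q] field_rules g nabla_RR_LL[OF X Y2] triv_LL triv_RR zl killing_zero adj_in)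
  moreover have "Hbar p\<^sub>0 (LL Y1 p\<^sub>0) (LL Y2 p\<^sub>0) (D (RR X) (RR S) p\<^sub>0) = 0"
    by (simp add: Hbar_eq[OF _ _ Din q] field_rules g nabla_RR_RR[OF g(1,2)] triv_LL triv_RR zr)
  ultimately have "RR X p\<^sub>0 (eval3 M Hbar (LL Y1) (LL Y2) (RR S)) = 0"
    by (simp add: covariant_derivative3_def eval3_at[OF q])
  moreover have "eval3 M Hbar (LL Y1) (LL Y2) (RR S) = ext0 M (\<lambda>q. - mixed (lie_bracket Y1 Y2) S q)"
    using Hbar_fields(5)[OF g(3,4,2)] by (auto simp: eval3_def ext0_def fun_eq_iff)
  ultimately have "mixed (lie_bracket Y1 Y2) (lie_bracket S X) p\<^sub>0 = 0"
    using RR_mixed[OF lie_bracket_in[OF g(3,4)] g(2) g(1) q] by simp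
  \<comment> \<open>A bracket of two anti-invariant fields is fixed by \<open>adj z\<close>, so the
    two summands of \<open>mixed\<close> agree here instead of cancelling.\<close>
  moreover have "adj z (lie_bracket S X) = lie_bracket S X"
  proof -
    have "adj z S = (-1) *\<^sub>R S" "adj z X = (-1) *\<^sub>R X" using X S by (simp_all add: anti_def)
    then show ?thesis
      using adj_bracket[OF g(2,1) z] lie_bracket_scale_left[OF g(2) subspace_scale[OF subspace_lie_algebra g(1)], of "-1" "-1"]
        lie_bracket_scale_right[OF g(2,1), of "-1"] by simp
  qed
  ultimately show ?thesis
    using adj_one[OF lie_bracket_in[OF g(2,1)]] by (simp add: mixed_def)
qed

end

theorem torsion_not_parallel:
  assumes compact: "compact_space T" and conn: "connected_space T" and ss: "semisimple_lie_group G CG"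
    and nontriv: "a \<in> carrier G" "z \<otimes> a \<otimes> inv z \<noteq> a"
    and bis: "bismut_connection M CM gbar Hbar D"
  shows "\<not> parallel3 M CM D Hbar"
proof
  assume par: "parallel3 M CM D Hbar"
  note nd = killing_nondegenerate[OF compact ss]
  have comm: "lie_bracket X Y = 0" if X: "X \<in> anti" and Y: "Y \<in> anti" for X Y
  proof (rule ccontr)
    assume "lie_bracket X Y \<noteq> 0"
    then have "\<kappa> (lie_bracket X Y) (lie_bracket X Y) < 0"
      using killing_negative_definite[OF compact ss lie_bracket_in[OF anti_in[OF X] anti_in[OF Y]]] by simp
    \<comment> \<open>Differentiating along \<open>RR Y\<close> with \<open>RR X\<close> as third
      argument makes the two brackets of the lemma equal, so that definiteness can be used.\<close>
    moreover have "\<kappa> (lie_bracket X Y) (lie_bracket X Y) = 0"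
      by (rule parallel_imp_commute[OF bis nd par Y X X Y])
    ultimately show False by simp
  qed
  \<comment> \<open>This is twice the projection onto the eigenspace for -1; its vanishing on all of
    \<open>\<gg>\<close> is what triviality of Ad z amounts to.\<close>
  have diff_anti: "X - adj z X \<in> anti" if X: "X \<in> \<gg>" for X
  proof -
    have zX: "adj z X \<in> \<gg>" by (rule adj_in[OF X z])
    have m: "(-1) *\<^sub>R adj z X \<in> \<gg>" by (rule subspace_scale[OF subspace_lie_algebra zX])
    have "X - adj z X = X + (-1) *\<^sub>R adj z X" by simp
    then have "adj z (X - adj z X) = adj z X + (-1) *\<^sub>R adj z (adj z X)"
      using adj_add[OF X m z] adj_scale[OF zX z] by (simp only:)
    then show ?thesis
      using adj_z_twice[OF X] subspace_diff[OF subspace_lie_algebra X zX] by (simp add: anti_def)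
  qed
  have "anti = {0}"
  proof (rule abelian_ideal_trivial[OF ss])
    show "subspace anti"
    proof (rule subspaceI)
      show "0 \<in> anti"
        using adj_scale[OF subspace_0[OF subspace_lie_algebra] z, of 0] subspace_0[OF subspace_lie_algebra]
        by (simp add: anti_def)
      show "X + Y \<in> anti" if "X \<in> anti" "Y \<in> anti" for X Y
        using that adj_add[of X Y z] subspace_add[OF subspace_lie_algebra, of X Y] by (simp add: anti_def)
      show "c *\<^sub>R X \<in> anti" if "X \<in> anti" for c X
        using that adj_scale[of X z c] subspace_scale[OF subspace_lie_algebra, of X c] by (simp add: anti_def)
    qed
    show "anti \<subseteq> \<gg>" using anti_in by blast
    show "lie_bracket X Y = 0" if "X \<in> anti" "Y \<in> anti" for X Y by (rule comm[OF that])
    fix X Y assume X: "X \<in> \<gg>" and Y: "Y \<in> anti"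
    have zX: "adj z X \<in> \<gg>" by (rule adj_in[OF X z])
    have m: "(-1) *\<^sub>R adj z X \<in> \<gg>" by (rule subspace_scale[OF subspace_lie_algebra zX])
    have "X - adj z X = X + (-1) *\<^sub>R adj z X" by simp
    then have "lie_bracket (X - adj z X) Y = lie_bracket X Y + (-1) *\<^sub>R lie_bracket (adj z X) Y"
      using lie_bracket_add_left[OF X m anti_in[OF Y]] lie_bracket_scale_left[OF zX anti_in[OF Y]] by (simp only:)
    \<comment> \<open>\<open>X\<close> and \<open>adj z X\<close> differ by an anti-invariant field,
      which commutes with \<open>Y\<close>. Hence \<open>adj z\<close> merely changes the sign of
      [X, Y], and \<open>anti\<close> is stable under brackets with every element of
      \<open>\<gg>\<close>.\<close>
    then have e: "lie_bracket (adj z X) Y = lie_bracket X Y" using comm[OF diff_anti[OF X] Y] by simp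
    have "adj z Y = (-1) *\<^sub>R Y" using Y by (simp add: anti_def)
    then have "adj z (lie_bracket X Y) = (-1) *\<^sub>R lie_bracket (adj z X) Y"
      using adj_bracket[OF X anti_in[OF Y] z] lie_bracket_scale_right[OF zX anti_in[OF Y], of "-1"] by (simp only:)
    then show "lie_bracket X Y \<in> anti"
      using e lie_bracket_in[OF X anti_in[OF Y]] by (simp add: anti_def)
  qed
  then have "adj z X = X" if "X \<in> \<gg>" for X
    using diff_anti[OF that] by simp
  then show False
    using central_if_adj_trivial[OF conn z _ nontriv(1)] nontriv(2) by blast
qed

end

theorem proposition2p11:
  fixes G :: "('g, 'm) monoid_scheme"
    and T :: "'g topology"
    and A :: "('g, 'e::euclidean_space) atlas"
    and \<sigma> :: "'g \<Rightarrow> 'g"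
    and z :: 'g
    and CG :: "('g \<Rightarrow> real) set"
    and N M :: "('g \<times> 'g) set"
    and CN CM :: "('g \<times> 'g \<Rightarrow> real) set"
    and g gbar :: "('g \<times> 'g) form2"
    and H Hbar :: "('g \<times> 'g) form3"
    and D :: "('g \<times> 'g) connection"
  assumes "lie_group G T A"
    and "compact_space T"
    and "connected_space T"
    and "CG = smooth_functions T A"
    and "semisimple_lie_group G CG"
    and "involutive_automorphism G T A \<sigma>"
    and "z \<in> carrier G"
    and "\<forall>a\<in>carrier G. \<sigma> a = z \<otimes>\<^bsub>G\<^esub> a \<otimes>\<^bsub>G\<^esub> inv\<^bsub>G\<^esub> z"
    and "N = carrier G \<times> carrier G"
    and "CN = smooth_functions (prod_topology T T) (prod_atlas A A)"
    and "g = pullback2 N CG fst (killing_metric G CG) + pullback2 N CG snd (killing_metric G CG)"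
    and "H = pullback3 N CG fst (cartan_3form G CG) + pullback3 N CG snd (cartan_3form G CG)"
    and "M = orbit (G \<times>\<times> G) (two_sided_action G) (\<one>\<^bsub>G\<^esub>, z)"
    and "CM = submanifold_functions (prod_topology T T) CN M"
    and "gbar = pullback2 M CN (\<lambda>x. x) g"
    and "Hbar = pullback3 M CN (\<lambda>x. x) H"
    and "bismut_connection M CM gbar Hbar D"
  shows "\<not> parallel3 M CM D Hbar"
proof -
  interpret L: lie_grp G T A by unfold_locales fact
  interpret involution_orbit G T A z
  proof
    show "z \<in> carrier G" by fact
    fix a assume a: "a \<in> carrier G"
    then have "z \<otimes>\<^bsub>G\<^esub> a \<otimes>\<^bsub>G\<^esub> inv\<^bsub>G\<^esub> z \<in> carrier G" using assms(7) by simp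
    then have "z \<otimes>\<^bsub>G\<^esub> (z \<otimes>\<^bsub>G\<^esub> a \<otimes>\<^bsub>G\<^esub> inv\<^bsub>G\<^esub> z) \<otimes>\<^bsub>G\<^esub> inv\<^bsub>G\<^esub> z = \<sigma> (\<sigma> a)"
      using assms(8) a by simp
    then show "z \<otimes>\<^bsub>G\<^esub> (z \<otimes>\<^bsub>G\<^esub> a \<otimes>\<^bsub>G\<^esub> inv\<^bsub>G\<^esub> z) \<otimes>\<^bsub>G\<^esub> inv\<^bsub>G\<^esub> z = a"
      using assms(6) a by (simp add: involutive_automorphism_def)
  qed
  obtain a where a: "a \<in> carrier G" "\<sigma> a \<noteq> a"
    using assms(6) by (auto simp: involutive_automorphism_def)
  have gb: "gbar = involution_orbit.gbar G T A z"
    unfolding gbar_def assms(4,9-11,13-15) ..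
  have Hb: "Hbar = involution_orbit.Hbar G T A z"
    unfolding Hbar_def assms(4,9,10,12-14,16) ..
  show ?thesis
    using torsion_not_parallel[OF assms(2,3) _ a(1), of D] assms(5,8,17) a
    unfolding gb Hb assms(4,10,13,14) by simp
qed

end
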